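(* The following are equivalent: 1. For every finitely generated abelian group $A$ and every finitely generated Hopfian group $\Gamma$, the wreath product $A \wr \Gamma$ is Hopfian. 2. Kaplansky's direct finiteness conjecture holds, that is, for every group $\Gamma$ and every field $\mathbb{F}$, the group ring $\mathbb{F}[\Gamma]$ is directly finite.
   Context: The (standard, restricted) wreath product is $A \wr \Gamma := \left(\bigoplus_\Gamma A\right) \rtimes \Gamma$, where $\bigoplus_\Gamma A$ is the group of finitely supported functions $f\colon\Gamma \to A$ and $\Gamma$ acts by $({}_\gamma f)(x) = f(\gamma^{-1}x)$. A group is Hopfian if every surjective endomorphism of it is an automorphism. A ring $R$ with identity is directly finite if for all $x,y\in R$, $xy=1$ implies $yx=1$. *)

theory Defs
  imports "HOL-Algebra.Algebra"
begin

text \<open>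
  Groups, rings and fields are the carrier-based structures of HOL-Algebra. HOL cannot quantify over
  types inside a formula, so ``every group'' is read as ``every group whose carrier is a subset of
  a given type'', where the types are arbitrary but infinite. Every finitely generated group is
  countable, hence has an isomorphic copy in every infinite type.
\<close>

definition fin_gen_group :: "('a, 'm) monoid_scheme \<Rightarrow> bool" where
  "fin_gen_group G \<longleftrightarrow> group G \<and> (\<exists>S \<subseteq> carrier G. finite S \<and> generate G S = carrier G)"

definition hopfian :: "('a, 'm) monoid_scheme \<Rightarrow> bool" where
  "hopfian G \<longleftrightarrow> group G \<and> epi G G \<subseteq> iso G G"

definition semidirect_product ::
  "('n, 'm) monoid_scheme \<Rightarrow> ('h, 'k) monoid_scheme \<Rightarrow> ('h \<Rightarrow> 'n \<Rightarrow> 'n) \<Rightarrow> ('n \<times> 'h) monoid" where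
  "semidirect_product N H \<alpha> =
    \<lparr>carrier = carrier N \<times> carrier H,
     monoid.mult = (\<lambda>(n, h) (n', h'). (n \<otimes>\<^bsub>N\<^esub> \<alpha> h n', h \<otimes>\<^bsub>H\<^esub> h')),
     one = (\<one>\<^bsub>N\<^esub>, \<one>\<^bsub>H\<^esub>)\<rparr>"

definition shift :: "('g, 'm) monoid_scheme \<Rightarrow> 'g \<Rightarrow> ('g \<Rightarrow> 'a) \<Rightarrow> 'g \<Rightarrow> 'a" where
  "shift \<Gamma> \<gamma> f = (\<lambda>x\<in>carrier \<Gamma>. f (inv\<^bsub>\<Gamma>\<^esub> \<gamma> \<otimes>\<^bsub>\<Gamma>\<^esub> x))"

text \<open>
  The library's \<^const>\<open>sum_group\<close> consists of the finitely supported functions (extensional, that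
  is, \<^const>\<open>undefined\<close> off the index set) with the pointwise product.
\<close>

definition wreath_product ::
  "('a, 'm) monoid_scheme \<Rightarrow> ('g, 'k) monoid_scheme \<Rightarrow> (('g \<Rightarrow> 'a) \<times> 'g) monoid" where
  "wreath_product A \<Gamma> = semidirect_product (sum_group (carrier \<Gamma>) (\<lambda>_. A)) \<Gamma> (shift \<Gamma>)"

text \<open>
  A formal sum of group elements is its coefficient function. The convolution is summed over the
  support of the first factor, because \<^const>\<open>finsum\<close> over an infinite index set is zero.
\<close>

definition group_ring ::
  "('f, 'm) ring_scheme \<Rightarrow> ('g, 'k) monoid_scheme \<Rightarrow> ('g \<Rightarrow> 'f) ring" where
  "group_ring F \<Gamma> =
    \<lparr>carrier = {f \<in> carrier \<Gamma> \<rightarrow>\<^sub>E carrier F. finite {x \<in> carrier \<Gamma>. f x \<noteq> \<zero>\<^bsub>F\<^esub>}},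
     monoid.mult = (\<lambda>f g. \<lambda>x\<in>carrier \<Gamma>.
       \<Oplus>\<^bsub>F\<^esub>y\<in>{y \<in> carrier \<Gamma>. f y \<noteq> \<zero>\<^bsub>F\<^esub>}. f y \<otimes>\<^bsub>F\<^esub> g (inv\<^bsub>\<Gamma>\<^esub> y \<otimes>\<^bsub>\<Gamma>\<^esub> x)),
     one = (\<lambda>x\<in>carrier \<Gamma>. if x = \<one>\<^bsub>\<Gamma>\<^esub> then \<one>\<^bsub>F\<^esub> else \<zero>\<^bsub>F\<^esub>),
     ring.zero = (\<lambda>x\<in>carrier \<Gamma>. \<zero>\<^bsub>F\<^esub>),
     add = (\<lambda>f g. \<lambda>x\<in>carrier \<Gamma>. f x \<oplus>\<^bsub>F\<^esub> g x)\<rparr>"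

definition directly_finite :: "('r, 'm) ring_scheme \<Rightarrow> bool" where
  "directly_finite R \<longleftrightarrow>
    (\<forall>x\<in>carrier R. \<forall>y\<in>carrier R. x \<otimes>\<^bsub>R\<^esub> y = \<one>\<^bsub>R\<^esub> \<longrightarrow> y \<otimes>\<^bsub>R\<^esub> x = \<one>\<^bsub>R\<^esub>)"

end

theory Submission
  imports Defs "HOL-Library.Countable_Set" "HOL-Number_Theory.Cong"
begin

text \<open>
  Write \<open>B\<close> for the group of finitely supported functions \<open>\<Gamma> \<Rightarrow> A\<close>, the base of the wreath product.

  \<^emph>\<open>Hopfian wreath products give direct finiteness.\<close> For a ring \<open>K\<close>, the base of the wreath product
  of \<open>(K, +)\<close> with \<open>\<Gamma>\<close> is the group ring \<open>K[\<Gamma>]\<close>. If \<open>xy = 1\<close> there, then \<open>(f, \<gamma>) \<mapsto> (fy, \<gamma>)\<close> is a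
  surjective endomorphism, because right multiplication commutes with the left shift; it is injective
  only if \<open>yx = 1\<close> (\<open>directly_finite_if_hopfian_wreath\<close>). To use this for a field \<open>F\<close> and a group \<open>\<Gamma>\<close>,
  \<open>(K, +)\<close> must be finitely generated and the top group finitely generated and Hopfian. Given \<open>xy = 1\<close>
  and \<open>yx \<noteq> 1\<close> in \<open>F[\<Gamma>]\<close>, only finitely many group elements and coefficients occur. The group that
  they generate embeds in a finitely generated Hopfian group (\<open>embeds_in_hopfian\<close>). The coefficients
  lie in a finitely generated domain, which has a finite quotient ring \<open>K\<close> in which a chosen nonzero
  coefficient of \<open>yx - 1\<close> survives (\<open>res_finite_finitely_generated\<close>).

  \<^emph>\<open>Direct finiteness gives Hopfian wreath products.\<close> Let \<open>\<phi>\<close> be a surjective endomorphism. The image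
  of \<open>B\<close> is an abelian normal subgroup. If it is not contained in \<open>B\<close>, then its projection to \<open>\<Gamma>\<close> consists
  of \<open>1\<close> and a central involution, and \<open>A\<close> has exponent two; as \<open>\<Gamma>\<close> is Hopfian this forces the wreath product to be
  finite (\<open>W_finite_off_base\<close>), so that \<open>\<phi>\<close> is injective by counting. Otherwise \<open>\<phi>\<close> induces a
  surjective endomorphism of \<open>\<Gamma>\<close>, an automorphism; reindexing along it turns the restriction of \<open>\<phi>\<close> to
  \<open>B\<close> into a shift-equivariant surjection \<open>T : B \<Rightarrow> B\<close>, and it remains to see that \<open>T\<close> is injective.

  For a prime \<open>p\<close>, modulo \<open>p\<close>-th powers \<open>B\<close> is a free module over the group ring of \<open>\<Gamma>\<close> with \<open>p\<close>
  elements as coefficients, and \<open>T\<close> is a matrix over it with a one-sided inverse. Such a matrix is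
  invertible: the \<open>n \<times> n\<close> matrices over the group ring of \<open>\<Gamma>\<close> embed in the group ring of \<open>\<Gamma> \<times> H\<close> for a
  suitable finite Heisenberg group \<open>H\<close>, where direct finiteness applies (\<open>stable_finite_mod\<close>). So the
  kernel of \<open>T\<close> consists of functions whose values are \<open>p\<close>-th powers, and repeating the argument inside
  the subgroup of \<open>M\<close>-th powers shows that the values are \<open>N\<close>-th powers for every \<open>N\<close>. In a finitely
  generated abelian group only the identity is an \<open>N\<close>-th power for every \<open>N\<close>
  (\<open>fin_gen_not_divisible\<close>).
\<close>

section \<open>Embedding a finitely generated group in a Hopfian one\<close>

definition perm_group :: "('x \<Rightarrow> 'x) monoid" where
  "perm_group = \<lparr>carrier = {f. bij f}, monoid.mult = (\<circ>), one = id\<rparr>"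

lemma perm_group_simps [simp]:
  "carrier perm_group = {f. bij f}" "f \<otimes>\<^bsub>perm_group\<^esub> g = f \<circ> g" "\<one>\<^bsub>perm_group\<^esub> = id"
  by (auto simp: perm_group_def)

lemma perm_group_group: "group perm_group"
proof (rule groupI)
  fix f :: "'x \<Rightarrow> 'x" assume "f \<in> carrier perm_group"
  then have b: "bij f" by simp
  then have "bij (inv_into UNIV f)" "inv_into UNIV f \<circ> f = id" by (auto simp: bij_imp_bij_inv bij_is_inj)
  then show "\<exists>g\<in>carrier perm_group. g \<otimes>\<^bsub>perm_group\<^esub> f = \<one>\<^bsub>perm_group\<^esub>" by auto
qed (auto simp: bij_comp o_assoc)

text \<open>
  The kernel of a surjective endomorphism that is not injective would contain all commutators, so the
  image, which is the whole group, would be abelian.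
\<close>

lemma hopfian_if_commutator_monolith:
  assumes Q: "group Q" and ab: "a \<in> carrier Q" "b \<in> carrier Q" "a \<otimes>\<^bsub>Q\<^esub> b \<noteq> b \<otimes>\<^bsub>Q\<^esub> a"
    and mono: "\<And>K x y. K \<lhd> Q \<Longrightarrow> K \<noteq> {\<one>\<^bsub>Q\<^esub>} \<Longrightarrow> x \<in> carrier Q \<Longrightarrow> y \<in> carrier Q \<Longrightarrow>
        x \<otimes>\<^bsub>Q\<^esub> y \<otimes>\<^bsub>Q\<^esub> inv\<^bsub>Q\<^esub> (y \<otimes>\<^bsub>Q\<^esub> x) \<in> K"
  shows "hopfian Q"
proof -
  interpret Q: group Q by fact
  have "h \<in> iso Q Q" if h: "h \<in> epi Q Q" for h
  proof (rule ccontr)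
    assume ni: "h \<notin> iso Q Q"
    have hom: "h \<in> hom Q Q" and surj: "h ` carrier Q = carrier Q" using h by (auto simp: epi_def)
    interpret H: group_hom Q Q h by unfold_locales (rule hom)
    define K where "K = kernel Q Q h"
    have KN: "K \<lhd> Q" unfolding K_def by (rule H.normal_kernel)
    have K1: "K \<noteq> {\<one>\<^bsub>Q\<^esub>}"
    proof
      assume "K = {\<one>\<^bsub>Q\<^esub>}"
      then have "inj_on h (carrier Q)" unfolding K_def using H.inj_iff_trivial_ker by blast
      then have "h \<in> iso Q Q" using hom surj by (simp add: iso_def bij_betw_def)
      with ni show False by simp
    qed
    have comm: "h x \<otimes>\<^bsub>Q\<^esub> h y = h y \<otimes>\<^bsub>Q\<^esub> h x" if xy: "x \<in> carrier Q" "y \<in> carrier Q" for x y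
    proof -
      have "x \<otimes>\<^bsub>Q\<^esub> y \<otimes>\<^bsub>Q\<^esub> inv\<^bsub>Q\<^esub> (y \<otimes>\<^bsub>Q\<^esub> x) \<in> K" using mono[OF KN K1 xy] .
      then have "h (x \<otimes>\<^bsub>Q\<^esub> y \<otimes>\<^bsub>Q\<^esub> inv\<^bsub>Q\<^esub> (y \<otimes>\<^bsub>Q\<^esub> x)) = \<one>\<^bsub>Q\<^esub>" by (simp add: K_def kernel_def)
      then have "h x \<otimes>\<^bsub>Q\<^esub> h y \<otimes>\<^bsub>Q\<^esub> inv\<^bsub>Q\<^esub> (h y \<otimes>\<^bsub>Q\<^esub> h x) = \<one>\<^bsub>Q\<^esub>" using xy by simp
      then show ?thesis using xy Q.inv_equality by (metis H.hom_closed Q.inv_closed Q.inv_inv Q.m_closed)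
    qed
    obtain u v where "u \<in> carrier Q" "v \<in> carrier Q" "h u = a" "h v = b"
      using ab(1,2) surj by (metis imageE)
    with comm ab(3) show False by blast
  qed
  then show ?thesis using Q by (auto simp: hopfian_def)
qed

lemma generate_commute:
  assumes H: "group H" and S: "S \<subseteq> carrier H" 
    and comm: "\<And>x y. x \<in> S \<Longrightarrow> y \<in> S \<Longrightarrow> x \<otimes>\<^bsub>H\<^esub> y = y \<otimes>\<^bsub>H\<^esub> x"
    and x: "x \<in> generate H S" and y: "y \<in> generate H S"
  shows "x \<otimes>\<^bsub>H\<^esub> y = y \<otimes>\<^bsub>H\<^esub> x"
proof -
  interpret H: group H by fact
  have invc: "inv\<^bsub>H\<^esub> h \<otimes>\<^bsub>H\<^esub> y = y \<otimes>\<^bsub>H\<^esub> inv\<^bsub>H\<^esub> h"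
    if "h \<in> carrier H" "y \<in> carrier H" "h \<otimes>\<^bsub>H\<^esub> y = y \<otimes>\<^bsub>H\<^esub> h" for h y
    using that by (metis H.inv_closed H.inv_solve_left H.inv_solve_right' H.m_assoc H.m_closed)
  have mulc: "h \<otimes>\<^bsub>H\<^esub> k \<otimes>\<^bsub>H\<^esub> y = y \<otimes>\<^bsub>H\<^esub> (h \<otimes>\<^bsub>H\<^esub> k)"
    if "h \<in> carrier H" "k \<in> carrier H" "y \<in> carrier H" "h \<otimes>\<^bsub>H\<^esub> y = y \<otimes>\<^bsub>H\<^esub> h" "k \<otimes>\<^bsub>H\<^esub> y = y \<otimes>\<^bsub>H\<^esub> k" for h k y
    using that by (metis H.m_assoc)
  have 1: "x \<otimes>\<^bsub>H\<^esub> y = y \<otimes>\<^bsub>H\<^esub> x" if "x \<in> generate H S" "y \<in> S" for x y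
    using that(1)
  proof (induction rule: generate.induct)
    case one then show ?case using that S by auto
  next
    case (incl h) then show ?case using comm that by blast
  next
    case (inv h) then show ?case using invc comm that S by blast
  next
    case (eng h1 h2) then show ?case
      using mulc that S H.generate_in_carrier[OF S] by blast
  qed
  show ?thesis using y
  proof (induction rule: generate.induct)
    case one then show ?case using x H.generate_in_carrier[OF S] by auto
  next
    case (incl h) then show ?case using 1 x by blast
  next
    case (inv h) then show ?case using invc[of h x] 1[OF x inv] S H.generate_in_carrier[OF S x] by auto
  next
    case (eng h1 h2) then show ?case
      using mulc[of h1 h2 x] H.generate_in_carrier[OF S] x by metis
  qed
qed

text \<open>
  The Hopfian group is a quotient of a group of permutations of countably many sheets, indexed by the
  first component. Each sheet consists of points \<open>(g, i, j, m)\<close> with a group element, two bits, and an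
  infinite stack \<open>m\<close>. The group \<open>\<Gamma>\<close> acts on sheet 0. The stack is there to make sheet 1 as large as
  the part \<open>g = e, j = True\<close> of sheet 0: pushing \<open>(g, j)\<close> on the stack is a bijection between them, and
  \<open>link\<close> exchanges the two along it.
  
  So \<open>flip_z\<close>, \<open>link\<close>, \<open>swap12\<close>, \<open>swap01\<close> act like transpositions of which neighbours share a block,
  and satisfy braid relations. A homomorphism that kills one of two elements \<open>u\<close>, \<open>v\<close> with
  \<open>uvu = vuv\<close> kills the other. Hence a homomorphism that kills \<open>flip_z\<close> kills the three others; with
  \<open>flip_z\<close> gone, \<open>flip_a\<close> and \<open>flip_b\<close> commute; with \<open>swap01\<close> gone, the action of \<open>\<Gamma>\<close> on sheet 0 agrees with its conjugate on sheet 1, which commutes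
  with everything on sheet 0, and the image is abelian. On the other hand \<open>flip_z\<close> is the commutator of
  \<open>flip_a\<close> and \<open>flip_b\<close>.
\<close>

type_synonym 'g point = "nat \<times> 'g \<times> bool \<times> bool \<times> (nat \<Rightarrow> 'g \<times> bool)"

definition translate :: "('g, 'm) monoid_scheme \<Rightarrow> 'g \<Rightarrow> 'g point \<Rightarrow> 'g point" where
  "translate \<Gamma> w = (\<lambda>(n, g, i, j, m).
    (n, if n = 0 \<and> g \<in> carrier \<Gamma> then w \<otimes>\<^bsub>\<Gamma>\<^esub> g else g, i, j, m))"

definition swap01 :: "'g point \<Rightarrow> 'g point" where
  "swap01 = (\<lambda>(n, r). (if n = 0 then 1 else if n = 1 then 0 else n, r))"

definition swap12 :: "'g point \<Rightarrow> 'g point" where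
  "swap12 = (\<lambda>(n, r). (if n = 1 then 2 else if n = 2 then 1 else n, r))"

definition flip_a :: "'g \<Rightarrow> 'g point \<Rightarrow> 'g point" where
  "flip_a e = (\<lambda>(n, g, i, j, m). (n, g, i, if n = 0 \<and> g = e \<and> \<not> i then \<not> j else j, m))"

definition flip_b :: "'g \<Rightarrow> 'g point \<Rightarrow> 'g point" where
  "flip_b e = (\<lambda>(n, g, i, j, m). (n, g, if n = 0 \<and> g = e then \<not> i else i, j, m))"

definition flip_z :: "'g \<Rightarrow> 'g point \<Rightarrow> 'g point" where
  "flip_z e = (\<lambda>(n, g, i, j, m). (n, g, i, if n = 0 \<and> g = e then \<not> j else j, m))"

definition link :: "'g \<Rightarrow> 'g point \<Rightarrow> 'g point" where
  "link e = (\<lambda>(n, g, i, j, m).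
    if n = 0 \<and> g = e \<and> j then (1, fst (m 0), i, snd (m 0), m \<circ> Suc)
    else if n = 1 then (0, e, i, True, case_nat (g, j) m)
    else (n, g, i, j, m))"

lemma case_nat_o_Suc [simp]: "case_nat x m \<circ> Suc = m"
  by (simp add: fun_eq_iff)

lemma case_nat_head_tail [simp]: "case_nat (m 0) (m \<circ> Suc) = m" "case_nat (m 0) (\<lambda>k. m (Suc k)) = m"
  by (simp_all add: fun_eq_iff split: nat.split)

lemma involutions:
  "swap01 \<circ> swap01 = id" "swap12 \<circ> swap12 = id" "flip_a e \<circ> flip_a e = id"
  "flip_b e \<circ> flip_b e = id" "flip_z e \<circ> flip_z e = id" "link e \<circ> link e = id"
  by (rule ext, clarsimp simp: swap01_def swap12_def flip_a_def flip_b_def flip_z_def link_def)+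

lemma braids:
  "link e \<circ> flip_z e \<circ> link e = flip_z e \<circ> link e \<circ> flip_z e"
  "link e \<circ> swap12 \<circ> link e = swap12 \<circ> link e \<circ> swap12"
  "swap01 \<circ> swap12 \<circ> swap01 = swap12 \<circ> swap01 \<circ> swap12"
  by (rule ext, clarsimp simp: swap01_def swap12_def flip_z_def link_def)+

lemma flip_z_commutator: "flip_z e = flip_a e \<circ> flip_b e \<circ> flip_a e \<circ> flip_b e"
  by (rule ext, clarsimp simp: flip_a_def flip_b_def flip_z_def)

lemma flip_z_not_id: "flip_z e \<noteq> id"
proof
  assume "flip_z e = id"
  then have "flip_z e (0, e, True, True, m) = (0, e, True, True, m)" for m by simp
  then show False by (simp add: flip_z_def)
qed

context group begin

lemma translate_mult:
  "w \<in> carrier G \<Longrightarrow> v \<in> carrier G \<Longrightarrow> translate G w \<circ> translate G v = translate G (w \<otimes> v)"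
  by (auto simp: translate_def fun_eq_iff m_assoc)

lemma translate_one: "translate G \<one> = id"
  by (auto simp: translate_def fun_eq_iff)

lemma bij_translate: "w \<in> carrier G \<Longrightarrow> bij (translate G w)"
  by (rule o_bij[of "translate G (inv w)"]) (simp_all add: translate_mult translate_one)

text \<open>
  Conjugation by a translation moves the support of \<open>flip_a\<close> to another fibre. So a homomorphism that
  kills a nontrivial translation makes the images of \<open>flip_a\<close> and \<open>flip_b\<close> commute, and kills \<open>flip_z\<close>.
\<close>

lemma translate_disjoint:
  assumes "w \<in> carrier G" "w \<noteq> \<one>"
  shows "(translate G w \<circ> flip_a \<one> \<circ> translate G (inv w)) \<circ> flip_b \<one> =
         flip_b \<one> \<circ> (translate G w \<circ> flip_a \<one> \<circ> translate G (inv w))"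
proof -
  have *: "inv w \<otimes> g = \<one> \<longleftrightarrow> g = w" if "g \<in> carrier G" for g
    using that assms by (metis inv_closed inv_equality inv_inv l_inv)
  have "translate G w \<circ> flip_a \<one> \<circ> translate G (inv w) =
      (\<lambda>(n, g, i, j, m). (n, g, i, if n = 0 \<and> g = w \<and> \<not> i then \<not> j else j, m))"
    using assms by (auto simp: translate_def flip_a_def fun_eq_iff * m_assoc[symmetric])
  then show ?thesis using assms by (auto simp: flip_b_def fun_eq_iff)
qed

lemma translate_moved:
  assumes "w \<in> carrier G" 
  shows "(swap01 \<circ> translate G w \<circ> swap01) \<circ> flip_a \<one> = flip_a \<one> \<circ> (swap01 \<circ> translate G w \<circ> swap01)"
    "(swap01 \<circ> translate G w \<circ> swap01) \<circ> flip_b \<one> = flip_b \<one> \<circ> (swap01 \<circ> translate G w \<circ> swap01)"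
    "(swap01 \<circ> translate G w \<circ> swap01) \<circ> translate G v = translate G v \<circ> (swap01 \<circ> translate G w \<circ> swap01)"
  by (rule ext, clarsimp simp: translate_def swap01_def flip_a_def flip_b_def)+

end

text \<open>
  The union of a chain of normal subgroups that avoid \<open>z\<close> is such a subgroup, and Zorn's lemma applies.
\<close>

lemma max_normal_avoiding:
  assumes G: "group G" and z: "z \<in> carrier G" "z \<noteq> \<one>\<^bsub>G\<^esub>"
  obtains N where "N \<lhd> G" "z \<notin> N" "\<And>M. M \<lhd> G \<Longrightarrow> N \<subseteq> M \<Longrightarrow> M \<noteq> N \<Longrightarrow> z \<in> M"
proof -
  interpret G: group G by fact
  define \<A> where "\<A> = {N. N \<lhd> G \<and> z \<notin> N}"
  have "{\<one>\<^bsub>G\<^esub>} \<in> \<A>" using z G.one_is_normal by (auto simp: \<A>_def)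
  moreover have "\<Union>\<C> \<in> \<A>" if ne: "\<C> \<noteq> {}" and ch: "subset.chain \<A> \<C>" for \<C>
  proof -
    have sub: "N \<lhd> G \<and> z \<notin> N" if "N \<in> \<C>" for N
      using ch that by (auto simp: subset_chain_def \<A>_def)
    have sg: "subgroup N G" if "N \<in> \<C>" for N using sub[OF that] normal_imp_subgroup by blast
    have "subgroup (\<Union>\<C>) G"
    proof (rule G.subgroupI)
      show "\<Union>\<C> \<subseteq> carrier G" by (intro Union_least subgroup.subset sg)
      show "\<Union>\<C> \<noteq> {}" using ne subgroup.one_closed[OF sg] by blast
      show "inv\<^bsub>G\<^esub> a \<in> \<Union>\<C>" if "a \<in> \<Union>\<C>" for a
        using that subgroup.m_inv_closed[OF sg] by blast
      show "a \<otimes>\<^bsub>G\<^esub> b \<in> \<Union>\<C>" if ab: "a \<in> \<Union>\<C>" "b \<in> \<Union>\<C>" for a b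
      proof -
        from ab obtain V W where XY: "V \<in> \<C>" "a \<in> V" "W \<in> \<C>" "b \<in> W" by blast
        then have "V \<subseteq> W \<or> W \<subseteq> V" using ch by (auto simp: subset_chain_def)
        then show ?thesis
        proof
          assume "V \<subseteq> W"
          then have "a \<otimes>\<^bsub>G\<^esub> b \<in> W" using XY subgroup.m_closed[OF sg[OF XY(3)], of a b] by blast
          then show ?thesis using XY by blast
        next
          assume "W \<subseteq> V"
          then have "a \<otimes>\<^bsub>G\<^esub> b \<in> V" using XY subgroup.m_closed[OF sg[OF XY(1)], of a b] by blast
          then show ?thesis using XY by blast
        qed
      qed
    qed
    moreover have "x \<otimes>\<^bsub>G\<^esub> h \<otimes>\<^bsub>G\<^esub> inv\<^bsub>G\<^esub> x \<in> \<Union>\<C>" if "x \<in> carrier G" "h \<in> \<Union>\<C>" for x h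
    proof -
      obtain V where V: "V \<in> \<C>" "h \<in> V" using \<open>h \<in> \<Union>\<C>\<close> by blast
      then have "x \<otimes>\<^bsub>G\<^esub> h \<otimes>\<^bsub>G\<^esub> inv\<^bsub>G\<^esub> x \<in> V"
        using normal.inv_op_closed2[of V G x h] sub[OF V(1)] that by blast
      then show ?thesis using V by blast
    qed
    ultimately have "\<Union>\<C> \<lhd> G" by (simp add: G.normal_inv_iff)
    then show ?thesis using sub by (auto simp: \<A>_def)
  qed
  ultimately obtain N where N: "N \<in> \<A>" "\<And>V. V \<in> \<A> \<Longrightarrow> N \<subseteq> V \<Longrightarrow> V = N"
    using subset_Zorn_nonempty[of \<A>] by blast
  then show ?thesis using that[of N] by (auto simp: \<A>_def)
qed

text \<open>
  Divide the permutation group generated by \<open>\<Gamma>\<close> and the five permutations above by a normal subgroup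
  that is maximal among those without \<open>flip_z\<close>. Every nontrivial normal subgroup of the quotient
  contains \<open>flip_z\<close>, hence all commutators, while \<open>flip_z\<close> is a commutator and survives; so the quotient
  is Hopfian. No nontrivial element of \<open>\<Gamma>\<close> dies, since \<open>flip_z\<close> would die with it.
\<close>

theorem embeds_in_hopfian:
  fixes \<Gamma> :: "('g, 'm) monoid_scheme"
  assumes fg: "fin_gen_group \<Gamma>"
  obtains Q :: "('g point \<Rightarrow> 'g point) set monoid" and j
    where "fin_gen_group Q" "hopfian Q" "j \<in> hom \<Gamma> Q" "inj_on j (carrier \<Gamma>)"
proof -
  obtain S where S: "S \<subseteq> carrier \<Gamma>" "finite S" "generate \<Gamma> S = carrier \<Gamma>" and gr: "group \<Gamma>"
    using fg by (auto simp: fin_gen_group_def)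
  interpret \<Gamma>: group \<Gamma> by fact
  let ?e = "\<one>\<^bsub>\<Gamma>\<^esub>"
  let ?a = "flip_a ?e" and ?b = "flip_b ?e" and ?z = "flip_z ?e" and ?c = "link ?e" and ?s = "translate \<Gamma>"
  let ?d = "swap01 :: 'g point \<Rightarrow> 'g point" and ?d' = "swap12 :: 'g point \<Rightarrow> 'g point"
  interpret P: group "perm_group :: ('g point \<Rightarrow> 'g point) monoid" by (rule perm_group_group)
  define U where "U = {?a, ?b, ?c, ?d, ?d'} \<union> ?s ` S"
  have Ub: "U \<subseteq> carrier perm_group"
    using S(1) \<Gamma>.bij_translate by (auto simp: U_def intro: o_bij involutions)
  define G where "G = subgroup_generated perm_group U"
  have grG: "group G" by (simp add: G_def)
  interpret G: group G by fact
  have cG: "carrier G = generate perm_group U"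
    using Ub by (simp add: G_def carrier_subgroup_generated Int_absorb1)
  have multG: "x \<otimes>\<^bsub>G\<^esub> y = x \<circ> y" for x y by (simp add: G_def)
  have oneG: "\<one>\<^bsub>G\<^esub> = id" by (simp add: G_def)
  have UG: "U \<subseteq> carrier G" by (auto simp: cG intro: generate.incl)
  have gensG: "?a \<in> carrier G" "?b \<in> carrier G" "?c \<in> carrier G" "?d \<in> carrier G" "?d' \<in> carrier G"
    using UG by (auto simp: U_def)
  have genU: "carrier G \<subseteq> generate G U"
  proof
    fix x assume "x \<in> carrier G"
    then have "x \<in> generate perm_group U" by (simp add: cG)
    then show "x \<in> generate G U"
    proof (induction rule: generate.induct)
      case one then show ?case using generate.one[of G U] by (metis oneG perm_group_simps(3))
    next
      case (incl h) then show ?case by (rule generate.incl)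
    next
      case (inv h)
      have "inv\<^bsub>G\<^esub> h = inv\<^bsub>perm_group\<^esub> h"
        unfolding G_def by (rule P.inv_subgroup_generated) (use inv UG in \<open>auto simp: G_def\<close>)
      then show ?case using generate.inv[OF inv, of G] by simp
    next
      case (eng h1 h2) then show ?case using generate.eng[of h1 G U h2] by (metis multG perm_group_simps(2))
    qed
  qed
  have zG: "?z \<in> carrier G"
    unfolding flip_z_commutator by (intro G.m_closed[unfolded multG] gensG)
  have invT: "inv\<^bsub>perm_group\<^esub> (?s w) = ?s (inv\<^bsub>\<Gamma>\<^esub> w)" if "w \<in> carrier \<Gamma>" for w
    by (rule P.inv_equality) (use that \<Gamma>.bij_translate \<Gamma>.translate_mult \<Gamma>.translate_one in auto)
  have sG: "?s w \<in> carrier G" if "w \<in> carrier \<Gamma>" for w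
  proof -
    have "w \<in> generate \<Gamma> S" using that S by simp
    then show ?thesis
    proof (induction rule: generate.induct)
      case one then show ?case using G.one_closed by (simp only: \<Gamma>.translate_one oneG)
    next
      case (incl h) then show ?case using UG by (auto simp: U_def)
    next
      case (inv h) 
      then have "inv\<^bsub>perm_group\<^esub> (?s h) \<in> carrier G" 
        unfolding cG by (intro generate.inv) (auto simp: U_def)
      then show ?case using invT inv S by auto
    next
      case (eng h1 h2)
      then have "?s h1 \<circ> ?s h2 \<in> carrier G" using G.m_closed multG by metis
      then show ?case using eng \<Gamma>.translate_mult \<Gamma>.generate_in_carrier[OF S(1)] by metis
    qed
  qed
  have cl: "x \<circ> y \<in> carrier G" if "x \<in> carrier G" "y \<in> carrier G" for x y
    using G.m_closed[OF that] by (simp only: multG)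
  have zcomm: "f ?z = \<one>\<^bsub>H\<^esub>"
    if H: "group H" and f: "f \<in> hom G H" and ab: "f ?a \<otimes>\<^bsub>H\<^esub> f ?b = f ?b \<otimes>\<^bsub>H\<^esub> f ?a"
    for H :: "('h, 'k) monoid_scheme" and f
  proof -
    interpret H: group H by fact
    interpret f: group_hom G H f by (simp add: group_hom_def group_hom_axioms_def H f grG)
    have fm: "f (x \<circ> y) = f x \<otimes>\<^bsub>H\<^esub> f y" if "x \<in> carrier G" "y \<in> carrier G" for x y
      using f.hom_mult[OF that] by (simp only: multG)
    have fc: "f x \<in> carrier H" if "x \<in> carrier G" for x using f.hom_closed that .
    have f1: "f id = \<one>\<^bsub>H\<^esub>" using f.hom_one by (simp only: oneG)
    have fa: "f ?a \<otimes>\<^bsub>H\<^esub> f ?a = \<one>\<^bsub>H\<^esub>" "f ?b \<otimes>\<^bsub>H\<^esub> f ?b = \<one>\<^bsub>H\<^esub>"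
      using fm[OF gensG(1,1)] fm[OF gensG(2,2)] f1 by (simp_all only: involutions)
    have "f ?z = f ?a \<otimes>\<^bsub>H\<^esub> f ?b \<otimes>\<^bsub>H\<^esub> (f ?a \<otimes>\<^bsub>H\<^esub> f ?b)"
      using gensG cl fc by (simp add: flip_z_commutator fm H.m_assoc)
    also have "\<dots> = f ?a \<otimes>\<^bsub>H\<^esub> f ?b \<otimes>\<^bsub>H\<^esub> (f ?b \<otimes>\<^bsub>H\<^esub> f ?a)" by (simp only: ab)
    also have "\<dots> = f ?a \<otimes>\<^bsub>H\<^esub> (f ?b \<otimes>\<^bsub>H\<^esub> f ?b) \<otimes>\<^bsub>H\<^esub> f ?a" using gensG fc by (simp add: H.m_assoc)
    also have "\<dots> = \<one>\<^bsub>H\<^esub>" using fa fc gensG by simp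
    finally show ?thesis .
  qed
  have wkill: "f ?z = \<one>\<^bsub>H\<^esub>"
    if H: "group H" and f: "f \<in> hom G H" and w: "w \<in> carrier \<Gamma>" "w \<noteq> ?e" "f (?s w) = \<one>\<^bsub>H\<^esub>"
    for H :: "('h, 'k) monoid_scheme" and f w
  proof -
    interpret f: group_hom G H f by (simp add: group_hom_def group_hom_axioms_def H f grG)
    have fm: "f (x \<circ> y) = f x \<otimes>\<^bsub>H\<^esub> f y" if "x \<in> carrier G" "y \<in> carrier G" for x y
      using f.hom_mult[OF that] by (simp only: multG)
    have fc: "f x \<in> carrier H" if "x \<in> carrier G" for x using f.hom_closed that .
    have w': "inv\<^bsub>\<Gamma>\<^esub> w \<in> carrier \<Gamma>" using w by simp
    have "f (?s w \<circ> ?s (inv\<^bsub>\<Gamma>\<^esub> w)) = \<one>\<^bsub>H\<^esub>"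
      using w w' f.hom_one by (simp only: \<Gamma>.translate_mult \<Gamma>.r_inv \<Gamma>.translate_one oneG)
    then have si: "f (?s (inv\<^bsub>\<Gamma>\<^esub> w)) = \<one>\<^bsub>H\<^esub>"
      using w w' sG fc by (simp add: fm)
    let ?a' = "?s w \<circ> ?a \<circ> ?s (inv\<^bsub>\<Gamma>\<^esub> w)"
    have a': "?a' \<in> carrier G" using cl sG gensG w w' by simp
    have "f ?a' = f ?a" using cl sG gensG w w' si fc by (simp add: fm)
    then have "f ?a \<otimes>\<^bsub>H\<^esub> f ?b = f ?b \<otimes>\<^bsub>H\<^esub> f ?a"
      using fm[OF a' gensG(2)] fm[OF gensG(2) a'] \<Gamma>.translate_disjoint[OF w(1,2)] by simp
    then show ?thesis using zcomm[OF H f] by simp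
  qed
  \<comment> \<open>Killing \<open>flip_z\<close> makes all generators commute: the braid relations kill \<open>link\<close> and the swaps, and a
    translation may then be replaced by its conjugate on sheet 1.\<close>
  have zkill: "f x \<otimes>\<^bsub>H\<^esub> f y = f y \<otimes>\<^bsub>H\<^esub> f x"
    if H: "group H" and f: "f \<in> hom G H" and z: "f ?z = \<one>\<^bsub>H\<^esub>" and xy: "x \<in> carrier G" "y \<in> carrier G"
    for H :: "('h, 'k) monoid_scheme" and f x y
  proof -
    interpret H: group H by fact
    interpret f: group_hom G H f by (simp add: group_hom_def group_hom_axioms_def H f grG)
    have fm: "f (x \<circ> y) = f x \<otimes>\<^bsub>H\<^esub> f y" if "x \<in> carrier G" "y \<in> carrier G" for x y
      using f.hom_mult[OF that] by (simp only: multG)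
    have fc: "f x \<in> carrier H" if "x \<in> carrier G" for x using f.hom_closed that .
    have f1: "f id = \<one>\<^bsub>H\<^esub>" using f.hom_one by (simp only: oneG)
    have braid: "f v = \<one>\<^bsub>H\<^esub>" 
      if "u \<in> carrier G" "v \<in> carrier G" "u \<circ> v \<circ> u = v \<circ> u \<circ> v" "f u = \<one>\<^bsub>H\<^esub>" for u v
    proof -
      have "f (u \<circ> v \<circ> u) = f u \<otimes>\<^bsub>H\<^esub> f v \<otimes>\<^bsub>H\<^esub> f u" "f (v \<circ> u \<circ> v) = f v \<otimes>\<^bsub>H\<^esub> f u \<otimes>\<^bsub>H\<^esub> f v"
        using fm cl that(1,2) by metis+
      then have "f v \<otimes>\<^bsub>H\<^esub> f v = f v" using that(3,4) fc[OF that(2)] by simp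
      then show ?thesis using fc[OF that(2)] H.r_cancel_one by metis
    qed
    have c1: "f ?c = \<one>\<^bsub>H\<^esub>" using braid[OF zG gensG(3) _ z] braids(1) by metis
    have d'1: "f ?d' = \<one>\<^bsub>H\<^esub>" using braid[OF gensG(3,5) _ c1] braids(2) by metis
    have d1: "f ?d = \<one>\<^bsub>H\<^esub>" using braid[OF gensG(5,4) _ d'1] braids(3) by metis
    have moved: "f (?d \<circ> ?s w \<circ> ?d) = f (?s w)" "?d \<circ> ?s w \<circ> ?d \<in> carrier G" if "w \<in> S" for w
      using that S sG[of w] d1 gensG cl fc by (auto simp: fm)
    have comm: "f (?s w) \<otimes>\<^bsub>H\<^esub> f u = f u \<otimes>\<^bsub>H\<^esub> f (?s w)"
      if w: "w \<in> S" and u: "u \<in> carrier G" "(?d \<circ> ?s w \<circ> ?d) \<circ> u = u \<circ> (?d \<circ> ?s w \<circ> ?d)" for w u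
      using fm[OF moved(2)[OF w] u(1)] fm[OF u(1) moved(2)[OF w]] u(2) moved(1)[OF w] by simp
    have ab: "f ?a \<otimes>\<^bsub>H\<^esub> f ?b = f ?b \<otimes>\<^bsub>H\<^esub> f ?a"
    proof -
      have fa: "f ?a \<otimes>\<^bsub>H\<^esub> f ?a = \<one>\<^bsub>H\<^esub>" "f ?b \<otimes>\<^bsub>H\<^esub> f ?b = \<one>\<^bsub>H\<^esub>"
        using fm[OF gensG(1,1)] fm[OF gensG(2,2)] f1 by (simp_all add: involutions)
      have "f ?a \<otimes>\<^bsub>H\<^esub> f ?b \<otimes>\<^bsub>H\<^esub> (f ?a \<otimes>\<^bsub>H\<^esub> f ?b) = \<one>\<^bsub>H\<^esub>"
        using z gensG cl fc by (simp add: flip_z_commutator fm H.m_assoc)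
      then have "f ?a \<otimes>\<^bsub>H\<^esub> f ?b = inv\<^bsub>H\<^esub> (f ?a \<otimes>\<^bsub>H\<^esub> f ?b)"
        using fc gensG H.inv_equality by (metis H.m_closed)
      also have "\<dots> = f ?b \<otimes>\<^bsub>H\<^esub> f ?a"
        using fa fc gensG H.inv_mult_group H.inv_equality by metis
      finally show ?thesis .
    qed
    have UC: "f u \<otimes>\<^bsub>H\<^esub> f v = f v \<otimes>\<^bsub>H\<^esub> f u" if "u \<in> U" "v \<in> U" for u v
    proof -
      have S1: "f (?s w) \<otimes>\<^bsub>H\<^esub> f u = f u \<otimes>\<^bsub>H\<^esub> f (?s w)" if wS: "w \<in> S" and uU: "u \<in> U" for w u
      proof -
        have wG: "w \<in> carrier \<Gamma>" using wS S by blast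
        consider "u = ?a" | "u = ?b" | "u = ?c" | "u = ?d" | "u = ?d'" | v where "v \<in> S" "u = ?s v"
          using uU unfolding U_def by blast
        then show ?thesis
        proof cases
          case 1 then show ?thesis using comm[OF wS gensG(1)] \<Gamma>.translate_moved(1)[OF wG] by simp
        next
          case 2 then show ?thesis using comm[OF wS gensG(2)] \<Gamma>.translate_moved(2)[OF wG] by simp
        next
          case 3 then show ?thesis using c1 fc sG wG by simp
        next
          case 4 then show ?thesis using d1 fc sG wG by simp
        next
          case 5 then show ?thesis using d'1 fc sG wG by simp
        next
          case 6 then show ?thesis
            using comm[OF wS, of "?s v"] sG S(1) \<Gamma>.translate_moved(3)[OF wG] by blast
        qed
      qed
      have "u \<in> ?s ` S \<or> v \<in> ?s ` S \<or> (u \<in> {?a, ?b, ?c, ?d, ?d'} \<and> v \<in> {?a, ?b, ?c, ?d, ?d'})"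
        using that by (auto simp: U_def)
      then show ?thesis
        using S1 that ab c1 d1 d'1 fc gensG by (elim disjE imageE conjE insertE emptyE) simp_all
    qed
    have "f ` carrier G \<subseteq> generate H (f ` U)"
      using f.generate_img[OF UG] genU by auto
    then show ?thesis
      using generate_commute[OF H, of "f ` U" "f x" "f y"] UC UG fc xy by blast
  qed
  obtain N where N: "N \<lhd> G" "?z \<notin> N" "\<And>M. M \<lhd> G \<Longrightarrow> N \<subseteq> M \<Longrightarrow> M \<noteq> N \<Longrightarrow> ?z \<in> M"
    using max_normal_avoiding[OF grG zG] flip_z_not_id by (metis oneG)
  interpret N: normal N G by fact
  define Q where "Q = G Mod N"
  let ?r = "\<lambda>x. N #>\<^bsub>G\<^esub> x"
  have grQ: "group Q" unfolding Q_def by (rule N.factorgroup_is_group)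
  interpret Q: group Q by fact
  have rhom: "?r \<in> hom G Q" unfolding Q_def by (rule N.r_coset_hom_Mod)
  interpret r: group_hom G Q ?r by (simp add: group_hom_def group_hom_axioms_def grQ rhom grG)
  have rsurj: "carrier Q = ?r ` carrier G" by (auto simp: Q_def FactGroup_def RCOSETS_def)
  have r1: "?r x = \<one>\<^bsub>Q\<^esub> \<longleftrightarrow> x \<in> N" if "x \<in> carrier G" for x
    using that N.is_subgroup by (metis G.coset_join1 G.coset_join2 N.subset Q_def one_FactGroup)
  have "fin_gen_group Q"
  proof -
    have "carrier Q = generate Q (?r ` U)"
    proof
      show "carrier Q \<subseteq> generate Q (?r ` U)"
        unfolding rsurj using r.generate_img[OF UG] genU by auto
      show "generate Q (?r ` U) \<subseteq> carrier Q"
        using UG by (intro Q.generate_incl) auto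
    qed
    moreover have "finite (?r ` U)" using S(2) by (simp add: U_def)
    moreover have "?r ` U \<subseteq> carrier Q" unfolding rsurj using UG by (rule image_mono)
    ultimately show ?thesis using grQ unfolding fin_gen_group_def by metis
  qed
  moreover have "hopfian Q"
  proof (rule hopfian_if_commutator_monolith[OF grQ, of "?r ?a" "?r ?b"])
    show "?r ?a \<in> carrier Q" "?r ?b \<in> carrier Q" using gensG by auto
    show "?r ?a \<otimes>\<^bsub>Q\<^esub> ?r ?b \<noteq> ?r ?b \<otimes>\<^bsub>Q\<^esub> ?r ?a"
      using zcomm[OF grQ rhom] r1[OF zG] N(2) by blast
    fix K x y assume K: "K \<lhd> Q" "K \<noteq> {\<one>\<^bsub>Q\<^esub>}" and xy: "x \<in> carrier Q" "y \<in> carrier Q"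
    interpret K: normal K Q by fact
    let ?q = "\<lambda>x. K #>\<^bsub>Q\<^esub> x"
    let ?f = "?q \<circ> ?r"
    have grK: "group (Q Mod K)" by (rule K.factorgroup_is_group)
    interpret QK: group "Q Mod K" by fact
    have qhom: "?q \<in> hom Q (Q Mod K)" by (rule K.r_coset_hom_Mod)
    interpret q: group_hom Q "Q Mod K" ?q by (simp add: group_hom_def group_hom_axioms_def grQ qhom grK)
    have q1: "?q u = \<one>\<^bsub>Q Mod K\<^esub> \<longleftrightarrow> u \<in> K" if "u \<in> carrier Q" for u
      using that K.is_subgroup by (metis Q.coset_join1 Q.coset_join2 K.subset one_FactGroup)
    have fhom: "?f \<in> hom G (Q Mod K)" using hom_compose[OF rhom qhom] .
    interpret f: group_hom G "Q Mod K" ?f by (simp add: group_hom_def group_hom_axioms_def grG fhom grK del: comp_apply)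
    have "?z \<in> kernel G (Q Mod K) ?f"
    proof (rule N(3))
      show "kernel G (Q Mod K) ?f \<lhd> G" by (rule f.normal_kernel)
      show "N \<subseteq> kernel G (Q Mod K) ?f"
      proof
        fix t assume t: "t \<in> N"
        then have tG: "t \<in> carrier G" using N.subset by blast
        then have "?r t = \<one>\<^bsub>Q\<^esub>" using r1 t by blast
        then have "?f t = \<one>\<^bsub>Q Mod K\<^esub>" using q.hom_one by (simp only: comp_apply)
        then show "t \<in> kernel G (Q Mod K) ?f" using tG by (simp only: kernel_def mem_Collect_eq)
      qed
      obtain k where k: "k \<in> K" "k \<noteq> \<one>\<^bsub>Q\<^esub>" using K(2) K.one_closed by blast
      have kQ: "k \<in> carrier Q" using k(1) K.subset by blast
      then obtain x where x: "x \<in> carrier G" "k = ?r x" unfolding rsurj by blast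
      have "x \<notin> N" using r1[OF x(1)] k(2) x(2) by simp
      moreover have "?q (?r x) = \<one>\<^bsub>Q Mod K\<^esub>" using q1[OF kQ] k(1) unfolding x(2) by blast
      then have "x \<in> kernel G (Q Mod K) ?f" using x(1) by (simp only: kernel_def mem_Collect_eq comp_apply)
      ultimately show "kernel G (Q Mod K) ?f \<noteq> N" by blast
    qed
    then have fz: "?f ?z = \<one>\<^bsub>Q Mod K\<^esub>" by (simp only: kernel_def mem_Collect_eq)
    obtain x' y' where xy': "x' \<in> carrier G" "y' \<in> carrier G" "x = ?r x'" "y = ?r y'"
      using xy unfolding rsurj by (elim imageE) metis
    have comm: "?q x \<otimes>\<^bsub>Q Mod K\<^esub> ?q y = ?q y \<otimes>\<^bsub>Q Mod K\<^esub> ?q x"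
      using zkill[OF grK fhom fz xy'(1,2)] xy'(3,4) by (simp only: comp_apply)
    then have "?q (x \<otimes>\<^bsub>Q\<^esub> y \<otimes>\<^bsub>Q\<^esub> inv\<^bsub>Q\<^esub> (y \<otimes>\<^bsub>Q\<^esub> x)) = \<one>\<^bsub>Q Mod K\<^esub>"
    proof -
      have m: "?q (u \<otimes>\<^bsub>Q\<^esub> v) = ?q u \<otimes>\<^bsub>Q Mod K\<^esub> ?q v" if "u \<in> carrier Q" "v \<in> carrier Q" for u v
        using q.hom_mult[OF that] .
      have "?q (x \<otimes>\<^bsub>Q\<^esub> y) = ?q (y \<otimes>\<^bsub>Q\<^esub> x)" using comm m xy by metis
      then have "?q (x \<otimes>\<^bsub>Q\<^esub> y \<otimes>\<^bsub>Q\<^esub> inv\<^bsub>Q\<^esub> (y \<otimes>\<^bsub>Q\<^esub> x)) = ?q (y \<otimes>\<^bsub>Q\<^esub> x \<otimes>\<^bsub>Q\<^esub> inv\<^bsub>Q\<^esub> (y \<otimes>\<^bsub>Q\<^esub> x))"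
        using m xy by (metis Q.inv_closed Q.m_closed)
      then show ?thesis using q.hom_one xy by (metis Q.m_closed Q.r_inv)
    qed
    then show "x \<otimes>\<^bsub>Q\<^esub> y \<otimes>\<^bsub>Q\<^esub> inv\<^bsub>Q\<^esub> (y \<otimes>\<^bsub>Q\<^esub> x) \<in> K"
      using q1[of "x \<otimes>\<^bsub>Q\<^esub> y \<otimes>\<^bsub>Q\<^esub> inv\<^bsub>Q\<^esub> (y \<otimes>\<^bsub>Q\<^esub> x)"] xy by blast
  qed
  moreover have "(\<lambda>w. ?r (?s w)) \<in> hom \<Gamma> Q"
  proof (rule homI)
    show "?r (?s w) \<in> carrier Q" if "w \<in> carrier \<Gamma>" for w using sG[OF that] by simp
    show "?r (?s (w \<otimes>\<^bsub>\<Gamma>\<^esub> v)) = ?r (?s w) \<otimes>\<^bsub>Q\<^esub> ?r (?s v)" if "w \<in> carrier \<Gamma>" "v \<in> carrier \<Gamma>" for w v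
      using r.hom_mult[OF sG[OF that(1)] sG[OF that(2)]] \<Gamma>.translate_mult[OF that] by (simp only: multG)
  qed
  moreover have "inj_on (\<lambda>w. ?r (?s w)) (carrier \<Gamma>)"
  proof -
    interpret j: group_hom \<Gamma> Q "\<lambda>w. ?r (?s w)"
      by (simp add: group_hom_def group_hom_axioms_def grQ gr calculation(3))
    have "w = ?e" if "w \<in> carrier \<Gamma>" "?r (?s w) = \<one>\<^bsub>Q\<^esub>" for w
      using wkill[OF grQ rhom that(1) _ that(2)] r1[OF zG] N(2) by blast
    then show ?thesis using j.inj_on_one_iff by blast
  qed
  ultimately show ?thesis using that by blast
qed

section \<open>Finitely generated groups and their copies\<close>

lemma fin_gen_group_countable:
  assumes "fin_gen_group G" shows "countable (carrier G)"
proof -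
  obtain S where S: "S \<subseteq> carrier G" "finite S" "generate G S = carrier G" and gr: "group G"
    using assms by (auto simp: fin_gen_group_def)
  interpret group G by fact
  define ev where "ev = (\<lambda>xs. foldr (\<otimes>\<^bsub>G\<^esub>) xs \<one>\<^bsub>G\<^esub>)"
  have evc: "ev xs \<in> carrier G" if "set xs \<subseteq> carrier G" for xs
    using that by (induction xs) (auto simp: ev_def)
  have ev_app: "ev (xs @ ys) = ev xs \<otimes>\<^bsub>G\<^esub> ev ys" if "set xs \<subseteq> carrier G" "set ys \<subseteq> carrier G" for xs ys
    using that
  proof (induction xs)
    case Nil then show ?case using evc by (simp add: ev_def)
  next
    case (Cons a xs) then show ?case using evc[of xs] evc[of ys] by (simp add: ev_def m_assoc)
  qed
  let ?T = "S \<union> m_inv G ` S"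
  have T: "?T \<subseteq> carrier G" using S by auto
  have "carrier G \<subseteq> ev ` lists ?T"
  proof
    fix x assume "x \<in> carrier G"
    then have "x \<in> generate G S" using S by simp
    then show "x \<in> ev ` lists ?T"
    proof (induction rule: generate.induct)
      case one show ?case by (rule image_eqI[of _ _ "[]"]) (auto simp: ev_def)
    next
      case (incl h) then show ?case using S by (intro image_eqI[of _ _ "[h]"]) (auto simp: ev_def)
    next
      case (inv h) then show ?case using S by (intro image_eqI[of _ _ "[m_inv G h]"]) (auto simp: ev_def)
    next
      case (eng h1 h2)
      then obtain xs ys where "xs \<in> lists ?T" "ys \<in> lists ?T" "h1 = ev xs" "h2 = ev ys" by blast
      moreover from this have "ev (xs @ ys) = ev xs \<otimes>\<^bsub>G\<^esub> ev ys"
        by (intro ev_app subset_trans[OF _ T]) (simp_all add: lists_eq_set)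
      ultimately show ?case by (intro image_eqI[of _ _ "xs @ ys"]) auto
    qed
  qed
  moreover have "countable (ev ` lists ?T)" using S(2) by (intro countable_image countable_lists countable_finite) auto
  ultimately show ?thesis by (rule countable_subset)
qed

lemma countable_inj_into_infinite:
  assumes "countable C" "infinite (UNIV :: 'b set)"
  shows "\<exists>f :: 'a \<Rightarrow> 'b. inj_on f C"
proof -
  obtain e :: "nat \<Rightarrow> 'b" where "inj e" using infinite_countable_subset[OF assms(2)] by blast
  moreover obtain t :: "'a \<Rightarrow> nat" where "inj_on t C" using assms(1) by (auto simp: countable_def)
  ultimately have "inj_on (e \<circ> t) C" by (auto intro!: comp_inj_on intro: inj_on_subset)
  then show ?thesis by blast
qed

lemma fin_gen_group_iso:
  assumes G: "fin_gen_group G" and H: "group H" and f: "f \<in> iso G H"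
  shows "fin_gen_group H"
proof -
  obtain S where S: "S \<subseteq> carrier G" "finite S" "generate G S = carrier G" and gr: "group G"
    using G by (auto simp: fin_gen_group_def)
  interpret f: group_hom G H f using gr H f by (simp add: group_hom_def group_hom_axioms_def iso_def)
  have "generate H (f ` S) = carrier H"
    using f.generate_img[OF S(1)] S(3) f by (simp add: iso_def bij_betw_def)
  then show ?thesis using H S f.hom_closed unfolding fin_gen_group_def by (metis finite_imageI image_subset_iff subset_iff)
qed

lemma hopfian_iso:
  assumes G: "hopfian G" and H: "group H" and f: "f \<in> iso G H"
  shows "hopfian H"
proof -
  have gr: "group G" using G by (simp add: hopfian_def)
  interpret G: group G by fact
  define g where "g = inv_into (carrier G) f"
  have g: "g \<in> iso H G" using G.iso_set_sym[OF f] by (simp add: g_def)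
  have gf: "f (g y) = y" if "y \<in> carrier H" for y
    using that f by (simp add: g_def iso_def bij_betw_def f_inv_into_f)
  have fg: "g (f x) = x" if "x \<in> carrier G" for x
    using that f by (simp add: g_def iso_def bij_betw_def)
  have "h \<in> iso H H" if h: "h \<in> epi H H" for h
  proof -
    have ge: "g \<in> epi H G" "f \<in> epi G H" using g f by (simp_all add: iso_iff_mon_epi)
    have "g \<circ> (h \<circ> f) \<in> epi G G" by (intro epi_compose[OF _ ge(1)] epi_compose[OF ge(2) h])
    then have "g \<circ> (h \<circ> f) \<in> iso G G" using G by (auto simp: hopfian_def)
    then have "f \<circ> (g \<circ> (h \<circ> f)) \<circ> g \<in> iso H H" using f g by (blast intro: iso_set_trans)
    moreover have "(f \<circ> (g \<circ> (h \<circ> f)) \<circ> g) y = h y" if "y \<in> carrier H" for y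
      using that h gf by (auto simp: epi_def hom_def Pi_def)
    ultimately show ?thesis using h by (auto simp: iso_def epi_def bij_betw_def inj_on_def)
  qed
  then show ?thesis using H by (auto simp: hopfian_def)
qed

section \<open>Group rings\<close>

lemma (in abelian_monoid) finsum_swap:
  assumes "finite A" "finite B" "\<And>a b. a \<in> A \<Longrightarrow> b \<in> B \<Longrightarrow> f a b \<in> carrier G"
  shows "(\<Oplus>a\<in>A. \<Oplus>b\<in>B. f a b) = (\<Oplus>b\<in>B. \<Oplus>a\<in>A. f a b)"
  using assms(1,3)
proof (induction A rule: finite_induct)
  case empty then show ?case by simp
next
  case (insert a A)
  have "(\<Oplus>b\<in>B. \<Oplus>a\<in>insert a A. f a b) = (\<Oplus>b\<in>B. f a b \<oplus> (\<Oplus>a\<in>A. f a b))"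
    using insert by (intro finsum_cong') (auto simp: Pi_def)
  also have "\<dots> = (\<Oplus>b\<in>B. f a b) \<oplus> (\<Oplus>b\<in>B. \<Oplus>a\<in>A. f a b)"
    using insert by (intro finsum_addf) (auto simp: Pi_def)
  finally show ?case using insert by (simp add: Pi_def)
qed

locale grp_ring = R: ring R + \<Gamma>: group \<Gamma> for R :: "('f, 'm) ring_scheme" and \<Gamma> :: "('g, 'k) monoid_scheme"
begin

abbreviation "GR \<equiv> group_ring R \<Gamma>"
abbreviation "supp f \<equiv> {y \<in> carrier \<Gamma>. f y \<noteq> \<zero>\<^bsub>R\<^esub>}"

lemma GR_carrier: "f \<in> carrier GR \<longleftrightarrow> f \<in> carrier \<Gamma> \<rightarrow>\<^sub>E carrier R \<and> finite (supp f)"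
  by (simp add: group_ring_def)

lemma GR_closed: "f \<in> carrier GR \<Longrightarrow> x \<in> carrier \<Gamma> \<Longrightarrow> f x \<in> carrier R"
  by (auto simp: GR_carrier)

lemma GR_eqI: "f \<in> carrier GR \<Longrightarrow> g \<in> carrier GR \<Longrightarrow> (\<And>x. x \<in> carrier \<Gamma> \<Longrightarrow> f x = g x) \<Longrightarrow> f = g"
  unfolding GR_carrier by (elim conjE, rule PiE_ext)

lemma GR_mult_superset:
  assumes f: "f \<in> carrier GR" and g: "g \<in> carrier GR" and U: "finite U" "supp f \<subseteq> U" "U \<subseteq> carrier \<Gamma>"
    and x: "x \<in> carrier \<Gamma>"
  shows "(f \<otimes>\<^bsub>GR\<^esub> g) x = (\<Oplus>\<^bsub>R\<^esub>y\<in>U. f y \<otimes>\<^bsub>R\<^esub> g (inv\<^bsub>\<Gamma>\<^esub> y \<otimes>\<^bsub>\<Gamma>\<^esub> x))"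
proof -
  have "(f \<otimes>\<^bsub>GR\<^esub> g) x = (\<Oplus>\<^bsub>R\<^esub>y\<in>supp f. f y \<otimes>\<^bsub>R\<^esub> g (inv\<^bsub>\<Gamma>\<^esub> y \<otimes>\<^bsub>\<Gamma>\<^esub> x))"
    using x by (simp add: group_ring_def)
  also have "\<dots> = (\<Oplus>\<^bsub>R\<^esub>y\<in>U. f y \<otimes>\<^bsub>R\<^esub> g (inv\<^bsub>\<Gamma>\<^esub> y \<otimes>\<^bsub>\<Gamma>\<^esub> x))"
    using U x GR_closed[OF f] GR_closed[OF g]
    by (intro R.add.finprod_mono_neutral_cong_left) (auto simp: subset_iff)
  finally show ?thesis .
qed

lemma GR_mult_eq:
  assumes "f \<in> carrier GR" "g \<in> carrier GR" "x \<in> carrier \<Gamma>"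
  shows "(f \<otimes>\<^bsub>GR\<^esub> g) x = (\<Oplus>\<^bsub>R\<^esub>y\<in>supp f. f y \<otimes>\<^bsub>R\<^esub> g (inv\<^bsub>\<Gamma>\<^esub> y \<otimes>\<^bsub>\<Gamma>\<^esub> x))"
  using assms by (intro GR_mult_superset) (auto simp: GR_carrier)

lemma GR_mult_supp:
  assumes f: "f \<in> carrier GR" and g: "g \<in> carrier GR"
  shows "supp (f \<otimes>\<^bsub>GR\<^esub> g) \<subseteq> (\<lambda>(u, v). u \<otimes>\<^bsub>\<Gamma>\<^esub> v) ` (supp f \<times> supp g)"
proof
  fix x assume x: "x \<in> supp (f \<otimes>\<^bsub>GR\<^esub> g)"
  then have xc: "x \<in> carrier \<Gamma>" by simp
  have "\<exists>y\<in>supp f. g (inv\<^bsub>\<Gamma>\<^esub> y \<otimes>\<^bsub>\<Gamma>\<^esub> x) \<noteq> \<zero>\<^bsub>R\<^esub>"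
  proof (rule ccontr)
    assume "\<not> ?thesis"
    then have "(f \<otimes>\<^bsub>GR\<^esub> g) x = (\<Oplus>\<^bsub>R\<^esub>y\<in>supp f. \<zero>\<^bsub>R\<^esub>)"
      unfolding GR_mult_eq[OF f g xc] using GR_closed[OF f] by (intro R.finsum_cong') auto
    with x show False by simp
  qed
  then obtain y where y: "y \<in> supp f" "g (inv\<^bsub>\<Gamma>\<^esub> y \<otimes>\<^bsub>\<Gamma>\<^esub> x) \<noteq> \<zero>\<^bsub>R\<^esub>" by blast
  then have "x = y \<otimes>\<^bsub>\<Gamma>\<^esub> (inv\<^bsub>\<Gamma>\<^esub> y \<otimes>\<^bsub>\<Gamma>\<^esub> x)" using xc by (simp add: \<Gamma>.m_assoc[symmetric])
  then show "x \<in> (\<lambda>(u, v). u \<otimes>\<^bsub>\<Gamma>\<^esub> v) ` (supp f \<times> supp g)"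
    using y xc by (intro image_eqI[of _ _ "(y, inv\<^bsub>\<Gamma>\<^esub> y \<otimes>\<^bsub>\<Gamma>\<^esub> x)"]) auto
qed

lemma GR_mult_closed:
  assumes f: "f \<in> carrier GR" and g: "g \<in> carrier GR"
  shows "f \<otimes>\<^bsub>GR\<^esub> g \<in> carrier GR"
proof -
  have "finite (supp (f \<otimes>\<^bsub>GR\<^esub> g))"
    using f g by (intro finite_subset[OF GR_mult_supp[OF f g]]) (auto simp: GR_carrier)
  moreover have "(f \<otimes>\<^bsub>GR\<^esub> g) x \<in> carrier R" if "x \<in> carrier \<Gamma>" for x
    unfolding GR_mult_eq[OF f g that] using that GR_closed[OF f] GR_closed[OF g]
    by (intro R.finsum_closed) auto
  moreover have "f \<otimes>\<^bsub>GR\<^esub> g \<in> extensional (carrier \<Gamma>)" by (simp add: group_ring_def)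
  ultimately show ?thesis by (auto simp: GR_carrier PiE_def)
qed

lemma GR_one_eq: "x \<in> carrier \<Gamma> \<Longrightarrow> \<one>\<^bsub>GR\<^esub> x = (if x = \<one>\<^bsub>\<Gamma>\<^esub> then \<one>\<^bsub>R\<^esub> else \<zero>\<^bsub>R\<^esub>)"
  by (simp add: group_ring_def)

lemma GR_one_closed: "\<one>\<^bsub>GR\<^esub> \<in> carrier GR"
proof -
  have "supp \<one>\<^bsub>GR\<^esub> \<subseteq> {\<one>\<^bsub>\<Gamma>\<^esub>}" by (auto simp: group_ring_def)
  then have "finite (supp \<one>\<^bsub>GR\<^esub>)" using finite_subset by blast
  then show ?thesis by (auto simp: group_ring_def)
qed

lemma GR_l_one:
  assumes f: "f \<in> carrier GR" shows "\<one>\<^bsub>GR\<^esub> \<otimes>\<^bsub>GR\<^esub> f = f"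
proof (rule GR_eqI[OF GR_mult_closed[OF GR_one_closed f] f])
  fix x assume x: "x \<in> carrier \<Gamma>"
  have "(\<one>\<^bsub>GR\<^esub> \<otimes>\<^bsub>GR\<^esub> f) x = (\<Oplus>\<^bsub>R\<^esub>y\<in>{\<one>\<^bsub>\<Gamma>\<^esub>}. \<one>\<^bsub>GR\<^esub> y \<otimes>\<^bsub>R\<^esub> f (inv\<^bsub>\<Gamma>\<^esub> y \<otimes>\<^bsub>\<Gamma>\<^esub> x))"
    by (rule GR_mult_superset[OF GR_one_closed f _ _ _ x]) (auto simp: GR_one_eq split: if_splits)
  also have "\<dots> = f x" using GR_closed[OF f x] x by (simp add: GR_one_eq)
  finally show "(\<one>\<^bsub>GR\<^esub> \<otimes>\<^bsub>GR\<^esub> f) x = f x" .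
qed

lemma GR_r_one:
  assumes f: "f \<in> carrier GR" shows "f \<otimes>\<^bsub>GR\<^esub> \<one>\<^bsub>GR\<^esub> = f"
proof (rule GR_eqI[OF GR_mult_closed[OF f GR_one_closed] f])
  fix x assume x: "x \<in> carrier \<Gamma>"
  have *: "inv\<^bsub>\<Gamma>\<^esub> y \<otimes>\<^bsub>\<Gamma>\<^esub> x = \<one>\<^bsub>\<Gamma>\<^esub> \<longleftrightarrow> x = y" if "y \<in> carrier \<Gamma>" for y
    using that x by (metis \<Gamma>.inv_solve_left \<Gamma>.one_closed \<Gamma>.r_one)
  have "(f \<otimes>\<^bsub>GR\<^esub> \<one>\<^bsub>GR\<^esub>) x = (\<Oplus>\<^bsub>R\<^esub>y\<in>insert x (supp f). f y \<otimes>\<^bsub>R\<^esub> \<one>\<^bsub>GR\<^esub> (inv\<^bsub>\<Gamma>\<^esub> y \<otimes>\<^bsub>\<Gamma>\<^esub> x))"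
    using f x by (intro GR_mult_superset[OF f GR_one_closed]) (auto simp: GR_carrier)
  also have "\<dots> = (\<Oplus>\<^bsub>R\<^esub>y\<in>insert x (supp f). if x = y then f y else \<zero>\<^bsub>R\<^esub>)"
    using x GR_closed[OF f] by (intro R.finsum_cong') (auto simp: GR_one_eq *)
  also have "\<dots> = f x"
    using x f GR_closed[OF f] by (intro R.finsum_singleton) (auto simp: GR_carrier)
  finally show "(f \<otimes>\<^bsub>GR\<^esub> \<one>\<^bsub>GR\<^esub>) x = f x" .
qed

lemma GR_assoc:
  assumes f: "f \<in> carrier GR" and g: "g \<in> carrier GR" and h: "h \<in> carrier GR"
  shows "(f \<otimes>\<^bsub>GR\<^esub> g) \<otimes>\<^bsub>GR\<^esub> h = f \<otimes>\<^bsub>GR\<^esub> (g \<otimes>\<^bsub>GR\<^esub> h)"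
proof (rule GR_eqI)
  note fg = GR_mult_closed[OF f g] and gh = GR_mult_closed[OF g h]
  show "(f \<otimes>\<^bsub>GR\<^esub> g) \<otimes>\<^bsub>GR\<^esub> h \<in> carrier GR" "f \<otimes>\<^bsub>GR\<^esub> (g \<otimes>\<^bsub>GR\<^esub> h) \<in> carrier GR"
    using f g h GR_mult_closed by auto
  fix x assume x: "x \<in> carrier \<Gamma>"
  define U where "U = (\<lambda>(u, v). u \<otimes>\<^bsub>\<Gamma>\<^esub> v) ` (supp f \<times> supp g)"
  have U: "finite U" "U \<subseteq> carrier \<Gamma>" using f g by (auto simp: U_def GR_carrier)
  have ff: "finite (supp f)" "finite (supp g)" using f g by (auto simp: GR_carrier)
  note cl = GR_closed[OF f] GR_closed[OF g] GR_closed[OF h]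
  have "((f \<otimes>\<^bsub>GR\<^esub> g) \<otimes>\<^bsub>GR\<^esub> h) x = (\<Oplus>\<^bsub>R\<^esub>y\<in>U. (f \<otimes>\<^bsub>GR\<^esub> g) y \<otimes>\<^bsub>R\<^esub> h (inv\<^bsub>\<Gamma>\<^esub> y \<otimes>\<^bsub>\<Gamma>\<^esub> x))"
    using GR_mult_supp[OF f g] U x unfolding U_def[symmetric] by (intro GR_mult_superset[OF fg h]) auto
  also have "\<dots> = (\<Oplus>\<^bsub>R\<^esub>y\<in>U. \<Oplus>\<^bsub>R\<^esub>u\<in>supp f. f u \<otimes>\<^bsub>R\<^esub> (g (inv\<^bsub>\<Gamma>\<^esub> u \<otimes>\<^bsub>\<Gamma>\<^esub> y) \<otimes>\<^bsub>R\<^esub> h (inv\<^bsub>\<Gamma>\<^esub> y \<otimes>\<^bsub>\<Gamma>\<^esub> x)))"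
  proof (rule R.finsum_cong')
    show "(\<lambda>y. \<Oplus>\<^bsub>R\<^esub>u\<in>supp f. f u \<otimes>\<^bsub>R\<^esub> (g (inv\<^bsub>\<Gamma>\<^esub> u \<otimes>\<^bsub>\<Gamma>\<^esub> y) \<otimes>\<^bsub>R\<^esub> h (inv\<^bsub>\<Gamma>\<^esub> y \<otimes>\<^bsub>\<Gamma>\<^esub> x))) \<in> U \<rightarrow> carrier R"
      using U x cl by (intro Pi_I R.finsum_closed) (auto simp: subset_iff)
    fix y assume "y \<in> U"
    then have y: "y \<in> carrier \<Gamma>" using U by auto
    then show "(f \<otimes>\<^bsub>GR\<^esub> g) y \<otimes>\<^bsub>R\<^esub> h (inv\<^bsub>\<Gamma>\<^esub> y \<otimes>\<^bsub>\<Gamma>\<^esub> x) = 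
        (\<Oplus>\<^bsub>R\<^esub>u\<in>supp f. f u \<otimes>\<^bsub>R\<^esub> (g (inv\<^bsub>\<Gamma>\<^esub> u \<otimes>\<^bsub>\<Gamma>\<^esub> y) \<otimes>\<^bsub>R\<^esub> h (inv\<^bsub>\<Gamma>\<^esub> y \<otimes>\<^bsub>\<Gamma>\<^esub> x)))"
      unfolding GR_mult_eq[OF f g y] using x cl ff
      by (subst R.finsum_ldistr) (auto simp: R.m_assoc intro!: R.finsum_cong')
  qed simp
  also have "\<dots> = (\<Oplus>\<^bsub>R\<^esub>u\<in>supp f. \<Oplus>\<^bsub>R\<^esub>y\<in>U. f u \<otimes>\<^bsub>R\<^esub> (g (inv\<^bsub>\<Gamma>\<^esub> u \<otimes>\<^bsub>\<Gamma>\<^esub> y) \<otimes>\<^bsub>R\<^esub> h (inv\<^bsub>\<Gamma>\<^esub> y \<otimes>\<^bsub>\<Gamma>\<^esub> x)))"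
    using U x cl ff by (intro R.finsum_swap) (auto simp: subset_iff)
  also have "\<dots> = (\<Oplus>\<^bsub>R\<^esub>u\<in>supp f. f u \<otimes>\<^bsub>R\<^esub> (g \<otimes>\<^bsub>GR\<^esub> h) (inv\<^bsub>\<Gamma>\<^esub> u \<otimes>\<^bsub>\<Gamma>\<^esub> x))"
  proof (rule R.finsum_cong')
    show "(\<lambda>u. f u \<otimes>\<^bsub>R\<^esub> (g \<otimes>\<^bsub>GR\<^esub> h) (inv\<^bsub>\<Gamma>\<^esub> u \<otimes>\<^bsub>\<Gamma>\<^esub> x)) \<in> supp f \<rightarrow> carrier R"
      using x cl GR_closed[OF gh] by auto
    fix u assume u: "u \<in> supp f"
    then have uc: "u \<in> carrier \<Gamma>" by simp
    let ?k = "\<lambda>y. g (inv\<^bsub>\<Gamma>\<^esub> u \<otimes>\<^bsub>\<Gamma>\<^esub> y) \<otimes>\<^bsub>R\<^esub> h (inv\<^bsub>\<Gamma>\<^esub> y \<otimes>\<^bsub>\<Gamma>\<^esub> x)"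
    have "(\<Oplus>\<^bsub>R\<^esub>y\<in>U. f u \<otimes>\<^bsub>R\<^esub> ?k y) = f u \<otimes>\<^bsub>R\<^esub> (\<Oplus>\<^bsub>R\<^esub>y\<in>U. ?k y)"
      using U x cl uc by (subst R.finsum_rdistr) (auto simp: subset_iff)
    also have "(\<Oplus>\<^bsub>R\<^esub>y\<in>U. ?k y) = (\<Oplus>\<^bsub>R\<^esub>y\<in>(\<lambda>v. u \<otimes>\<^bsub>\<Gamma>\<^esub> v) ` supp g. ?k y)"
    proof (rule R.add.finprod_mono_neutral_cong_right)
      show "(\<lambda>v. u \<otimes>\<^bsub>\<Gamma>\<^esub> v) ` supp g \<subseteq> U" using u by (auto simp: U_def)
      show "?k i = \<zero>\<^bsub>R\<^esub>" if i: "i \<in> U - (\<lambda>v. u \<otimes>\<^bsub>\<Gamma>\<^esub> v) ` supp g" for i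
      proof -
        have ic: "i \<in> carrier \<Gamma>" using i U by auto
        have "i = u \<otimes>\<^bsub>\<Gamma>\<^esub> (inv\<^bsub>\<Gamma>\<^esub> u \<otimes>\<^bsub>\<Gamma>\<^esub> i)" using ic uc by (simp add: \<Gamma>.m_assoc[symmetric])
        then have "g (inv\<^bsub>\<Gamma>\<^esub> u \<otimes>\<^bsub>\<Gamma>\<^esub> i) = \<zero>\<^bsub>R\<^esub>" using i ic uc by blast
        then show ?thesis using ic x cl by simp
      qed
      show "?k \<in> U \<rightarrow> carrier R" using U x cl uc by (auto simp: subset_iff)
    qed (use U in auto)
    also have "\<dots> = (\<Oplus>\<^bsub>R\<^esub>v\<in>supp g. ?k (u \<otimes>\<^bsub>\<Gamma>\<^esub> v))"
      using x cl uc by (intro R.finsum_reindex) (auto simp: inj_on_def)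
    also have "\<dots> = (\<Oplus>\<^bsub>R\<^esub>v\<in>supp g. g v \<otimes>\<^bsub>R\<^esub> h (inv\<^bsub>\<Gamma>\<^esub> v \<otimes>\<^bsub>\<Gamma>\<^esub> (inv\<^bsub>\<Gamma>\<^esub> u \<otimes>\<^bsub>\<Gamma>\<^esub> x)))"
      using x cl uc by (intro R.finsum_cong') (auto simp: \<Gamma>.m_assoc[symmetric] \<Gamma>.inv_mult_group)
    also have "\<dots> = (g \<otimes>\<^bsub>GR\<^esub> h) (inv\<^bsub>\<Gamma>\<^esub> u \<otimes>\<^bsub>\<Gamma>\<^esub> x)"
      using uc x by (intro GR_mult_eq[symmetric, OF g h]) auto
    finally show "(\<Oplus>\<^bsub>R\<^esub>y\<in>U. f u \<otimes>\<^bsub>R\<^esub> ?k y) = f u \<otimes>\<^bsub>R\<^esub> (g \<otimes>\<^bsub>GR\<^esub> h) (inv\<^bsub>\<Gamma>\<^esub> u \<otimes>\<^bsub>\<Gamma>\<^esub> x)" .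
  qed simp
  also have "\<dots> = (f \<otimes>\<^bsub>GR\<^esub> (g \<otimes>\<^bsub>GR\<^esub> h)) x" by (rule GR_mult_eq[symmetric, OF f gh x])
  finally show "((f \<otimes>\<^bsub>GR\<^esub> g) \<otimes>\<^bsub>GR\<^esub> h) x = (f \<otimes>\<^bsub>GR\<^esub> (g \<otimes>\<^bsub>GR\<^esub> h)) x" .
qed

lemma GR_add_eq: "x \<in> carrier \<Gamma> \<Longrightarrow> (f \<oplus>\<^bsub>GR\<^esub> g) x = f x \<oplus>\<^bsub>R\<^esub> g x"
  by (simp add: group_ring_def)

lemma GR_add_closed:
  assumes f: "f \<in> carrier GR" and g: "g \<in> carrier GR" shows "f \<oplus>\<^bsub>GR\<^esub> g \<in> carrier GR"
proof -
  have "supp (f \<oplus>\<^bsub>GR\<^esub> g) \<subseteq> supp f \<union> supp g" by (auto simp: group_ring_def)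
  then have "finite (supp (f \<oplus>\<^bsub>GR\<^esub> g))"
    by (rule finite_subset) (use f g in \<open>auto simp: GR_carrier\<close>)
  moreover have "f \<oplus>\<^bsub>GR\<^esub> g \<in> carrier \<Gamma> \<rightarrow>\<^sub>E carrier R"
    using GR_closed[OF f] GR_closed[OF g] by (auto simp: group_ring_def)
  ultimately show ?thesis by (simp add: GR_carrier)
qed

lemma GR_distrib:
  assumes f: "f \<in> carrier GR" and g: "g \<in> carrier GR" and h: "h \<in> carrier GR"
  shows "(f \<oplus>\<^bsub>GR\<^esub> g) \<otimes>\<^bsub>GR\<^esub> h = (f \<otimes>\<^bsub>GR\<^esub> h) \<oplus>\<^bsub>GR\<^esub> (g \<otimes>\<^bsub>GR\<^esub> h)"
proof (rule GR_eqI)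
  show "(f \<oplus>\<^bsub>GR\<^esub> g) \<otimes>\<^bsub>GR\<^esub> h \<in> carrier GR" "(f \<otimes>\<^bsub>GR\<^esub> h) \<oplus>\<^bsub>GR\<^esub> (g \<otimes>\<^bsub>GR\<^esub> h) \<in> carrier GR"
    using f g h GR_mult_closed GR_add_closed by auto
  fix x assume x: "x \<in> carrier \<Gamma>"
  let ?U = "supp f \<union> supp g"
  have U: "finite ?U" "?U \<subseteq> carrier \<Gamma>" using f g by (auto simp: GR_carrier)
  note cl = GR_closed[OF f] GR_closed[OF g] GR_closed[OF h]
  have "((f \<oplus>\<^bsub>GR\<^esub> g) \<otimes>\<^bsub>GR\<^esub> h) x = (\<Oplus>\<^bsub>R\<^esub>y\<in>?U. (f \<oplus>\<^bsub>GR\<^esub> g) y \<otimes>\<^bsub>R\<^esub> h (inv\<^bsub>\<Gamma>\<^esub> y \<otimes>\<^bsub>\<Gamma>\<^esub> x))"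
    by (rule GR_mult_superset[OF GR_add_closed[OF f g] h U(1) _ U(2) x]) (auto simp: GR_add_eq)
  also have "\<dots> = (\<Oplus>\<^bsub>R\<^esub>y\<in>?U. f y \<otimes>\<^bsub>R\<^esub> h (inv\<^bsub>\<Gamma>\<^esub> y \<otimes>\<^bsub>\<Gamma>\<^esub> x) \<oplus>\<^bsub>R\<^esub> g y \<otimes>\<^bsub>R\<^esub> h (inv\<^bsub>\<Gamma>\<^esub> y \<otimes>\<^bsub>\<Gamma>\<^esub> x))"
    using x cl by (intro R.finsum_cong') (auto simp: GR_add_eq R.l_distr)
  also have "\<dots> = (\<Oplus>\<^bsub>R\<^esub>y\<in>?U. f y \<otimes>\<^bsub>R\<^esub> h (inv\<^bsub>\<Gamma>\<^esub> y \<otimes>\<^bsub>\<Gamma>\<^esub> x)) \<oplus>\<^bsub>R\<^esub> (\<Oplus>\<^bsub>R\<^esub>y\<in>?U. g y \<otimes>\<^bsub>R\<^esub> h (inv\<^bsub>\<Gamma>\<^esub> y \<otimes>\<^bsub>\<Gamma>\<^esub> x))"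
    using x cl by (intro R.finsum_addf) auto
  also have "\<dots> = ((f \<otimes>\<^bsub>GR\<^esub> h) \<oplus>\<^bsub>GR\<^esub> (g \<otimes>\<^bsub>GR\<^esub> h)) x"
    using GR_mult_superset[OF f h U(1) _ U(2) x] GR_mult_superset[OF g h U(1) _ U(2) x] x
    by (simp add: GR_add_eq)
  finally show "((f \<oplus>\<^bsub>GR\<^esub> g) \<otimes>\<^bsub>GR\<^esub> h) x = ((f \<otimes>\<^bsub>GR\<^esub> h) \<oplus>\<^bsub>GR\<^esub> (g \<otimes>\<^bsub>GR\<^esub> h)) x" .
qed

lemma shift_supp:
  assumes c: "\<gamma> \<in> carrier \<Gamma>"
  shows "{x \<in> carrier \<Gamma>. shift \<Gamma> \<gamma> f x \<noteq> z} = (\<lambda>x. \<gamma> \<otimes>\<^bsub>\<Gamma>\<^esub> x) ` {x \<in> carrier \<Gamma>. f x \<noteq> z}"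
proof (intro equalityI subsetI)
  fix x assume "x \<in> {x \<in> carrier \<Gamma>. shift \<Gamma> \<gamma> f x \<noteq> z}"
  then show "x \<in> (\<lambda>x. \<gamma> \<otimes>\<^bsub>\<Gamma>\<^esub> x) ` {x \<in> carrier \<Gamma>. f x \<noteq> z}"
    using c by (intro image_eqI[of _ _ "inv\<^bsub>\<Gamma>\<^esub> \<gamma> \<otimes>\<^bsub>\<Gamma>\<^esub> x"]) (auto simp: shift_def \<Gamma>.m_assoc[symmetric])
qed (use c in \<open>auto simp: shift_def \<Gamma>.m_assoc[symmetric]\<close>)

lemma shift_closed:
  assumes c: "\<gamma> \<in> carrier \<Gamma>" and f: "f \<in> carrier GR"
  shows "shift \<Gamma> \<gamma> f \<in> carrier GR"
proof -
  have "finite (supp (shift \<Gamma> \<gamma> f))" unfolding shift_supp[OF c] using f by (simp add: GR_carrier)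
  moreover have "shift \<Gamma> \<gamma> f \<in> carrier \<Gamma> \<rightarrow>\<^sub>E carrier R"
    using GR_closed[OF f] c by (auto simp: shift_def)
  ultimately show ?thesis by (simp add: GR_carrier)
qed

lemma shift_mult:
  assumes c: "\<gamma> \<in> carrier \<Gamma>" and f: "f \<in> carrier GR" and g: "g \<in> carrier GR"
  shows "shift \<Gamma> \<gamma> f \<otimes>\<^bsub>GR\<^esub> g = shift \<Gamma> \<gamma> (f \<otimes>\<^bsub>GR\<^esub> g)"
proof (rule GR_eqI)
  note sf = shift_closed[OF c f]
  show "shift \<Gamma> \<gamma> f \<otimes>\<^bsub>GR\<^esub> g \<in> carrier GR" "shift \<Gamma> \<gamma> (f \<otimes>\<^bsub>GR\<^esub> g) \<in> carrier GR"
    using assms shift_closed GR_mult_closed by auto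
  fix x assume x: "x \<in> carrier \<Gamma>"
  note cl = GR_closed[OF f] GR_closed[OF g] GR_closed[OF sf]
  have "(shift \<Gamma> \<gamma> f \<otimes>\<^bsub>GR\<^esub> g) x = 
      (\<Oplus>\<^bsub>R\<^esub>y\<in>(\<lambda>x. \<gamma> \<otimes>\<^bsub>\<Gamma>\<^esub> x) ` supp f. shift \<Gamma> \<gamma> f y \<otimes>\<^bsub>R\<^esub> g (inv\<^bsub>\<Gamma>\<^esub> y \<otimes>\<^bsub>\<Gamma>\<^esub> x))"
    using GR_mult_eq[OF sf g x] by (simp only: shift_supp[OF c])
  also have "\<dots> = (\<Oplus>\<^bsub>R\<^esub>y\<in>supp f. shift \<Gamma> \<gamma> f (\<gamma> \<otimes>\<^bsub>\<Gamma>\<^esub> y) \<otimes>\<^bsub>R\<^esub> g (inv\<^bsub>\<Gamma>\<^esub> (\<gamma> \<otimes>\<^bsub>\<Gamma>\<^esub> y) \<otimes>\<^bsub>\<Gamma>\<^esub> x))"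
    using c x cl by (intro R.finsum_reindex) (auto simp: inj_on_def)
  also have "\<dots> = (\<Oplus>\<^bsub>R\<^esub>y\<in>supp f. f y \<otimes>\<^bsub>R\<^esub> g (inv\<^bsub>\<Gamma>\<^esub> y \<otimes>\<^bsub>\<Gamma>\<^esub> (inv\<^bsub>\<Gamma>\<^esub> \<gamma> \<otimes>\<^bsub>\<Gamma>\<^esub> x)))"
    using c x cl by (intro R.finsum_cong') (auto simp: shift_def \<Gamma>.m_assoc[symmetric] \<Gamma>.inv_mult_group)
  also have "\<dots> = (f \<otimes>\<^bsub>GR\<^esub> g) (inv\<^bsub>\<Gamma>\<^esub> \<gamma> \<otimes>\<^bsub>\<Gamma>\<^esub> x)" using c x by (intro GR_mult_eq[symmetric, OF f g]) auto
  also have "\<dots> = shift \<Gamma> \<gamma> (f \<otimes>\<^bsub>GR\<^esub> g) x" using x by (simp add: shift_def)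
  finally show "(shift \<Gamma> \<gamma> f \<otimes>\<^bsub>GR\<^esub> g) x = shift \<Gamma> \<gamma> (f \<otimes>\<^bsub>GR\<^esub> g) x" .
qed

text \<open>
  Right multiplication by \<open>y\<close> commutes with the shift, so it extends to an endomorphism of the wreath
  product which is the identity on \<open>\<Gamma>\<close>. It is onto because \<open>fxy = f\<close>, and it sends \<open>yx\<close> and \<open>1\<close> to the
  same element.
\<close>

theorem directly_finite_if_hopfian_wreath:
  assumes hop: "hopfian (wreath_product (add_monoid R) \<Gamma>)"
  shows "directly_finite GR"
  unfolding directly_finite_def
proof (intro ballI impI)
  fix x y assume x: "x \<in> carrier GR" and y: "y \<in> carrier GR" and xy: "x \<otimes>\<^bsub>GR\<^esub> y = \<one>\<^bsub>GR\<^esub>"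
  let ?W = "wreath_product (add_monoid R) \<Gamma>"
  have grp: "group (add_monoid R)" by (rule R.add.is_group)
  have cW: "carrier ?W = carrier GR \<times> carrier \<Gamma>"
    using grp by (simp add: wreath_product_def semidirect_product_def carrier_sum_group group_ring_def)
  have mW: "(f, \<gamma>) \<otimes>\<^bsub>?W\<^esub> (g, \<delta>) = (f \<oplus>\<^bsub>GR\<^esub> shift \<Gamma> \<gamma> g, \<gamma> \<otimes>\<^bsub>\<Gamma>\<^esub> \<delta>)" for f g \<gamma> \<delta>
    by (simp add: wreath_product_def semidirect_product_def group_ring_def)
  define \<Phi> where "\<Phi> = (\<lambda>(f, \<gamma> :: 'g). (f \<otimes>\<^bsub>GR\<^esub> y, \<gamma>))"
  have "\<Phi> \<in> hom ?W ?W"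
    by (rule homI) (auto simp: cW \<Phi>_def mW GR_mult_closed y GR_distrib shift_closed shift_mult)
  moreover have "carrier ?W \<subseteq> \<Phi> ` carrier ?W"
  proof
    fix w assume "w \<in> carrier ?W"
    then obtain f \<gamma> where w: "w = (f, \<gamma>)" "f \<in> carrier GR" "\<gamma> \<in> carrier \<Gamma>" by (auto simp: cW)
    have "\<Phi> (f \<otimes>\<^bsub>GR\<^esub> x, \<gamma>) = w"
      using w x y xy by (simp add: \<Phi>_def GR_assoc GR_r_one)
    then show "w \<in> \<Phi> ` carrier ?W" using w x GR_mult_closed by (force simp: cW)
  qed
  ultimately have "\<Phi> \<in> epi ?W ?W" by (simp add: epi_iff_subset)
  then have inj: "inj_on \<Phi> (carrier ?W)" using hop by (auto simp: hopfian_def iso_def bij_betw_def)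
  have "\<Phi> (y \<otimes>\<^bsub>GR\<^esub> x, \<one>\<^bsub>\<Gamma>\<^esub>) = \<Phi> (\<one>\<^bsub>GR\<^esub>, \<one>\<^bsub>\<Gamma>\<^esub>)"
    using x y xy by (simp add: \<Phi>_def GR_assoc GR_r_one GR_l_one)
  then show "y \<otimes>\<^bsub>GR\<^esub> x = \<one>\<^bsub>GR\<^esub>"
    using inj_onD[OF inj] x y GR_mult_closed GR_one_closed by (fastforce simp: cW)
qed

end

section \<open>Change of coefficients and of groups\<close>

locale gr_push = A: grp_ring R \<Gamma> + B: grp_ring K \<Delta>
  for R :: "('f, 'm) ring_scheme" and \<Gamma> :: "('g, 'k) monoid_scheme"
  and K :: "('f', 'm') ring_scheme" and \<Delta> :: "('g', 'k') monoid_scheme" +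
  fixes \<theta> j
  assumes \<theta>: "\<theta> \<in> ring_hom R K" and j: "j \<in> hom \<Gamma> \<Delta>" and inj: "inj_on j (carrier \<Gamma>)"
begin

sublocale \<theta>: ring_hom_ring R K \<theta>
  using \<theta> A.R.ring_axioms B.R.ring_axioms by (intro ring_hom_ringI2)

sublocale j: group_hom \<Gamma> \<Delta> j
  using j by unfold_locales

definition push :: "('g \<Rightarrow> 'f) \<Rightarrow> 'g' \<Rightarrow> 'f'" where
  "push f = (\<lambda>g\<in>carrier \<Delta>. if g \<in> j ` carrier \<Gamma> then \<theta> (f (inv_into (carrier \<Gamma>) j g)) else \<zero>\<^bsub>K\<^esub>)"

lemma push_image: "x \<in> carrier \<Gamma> \<Longrightarrow> push f (j x) = \<theta> (f x)"
  using inj by (simp add: push_def)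

lemma push_off: "g \<in> carrier \<Delta> \<Longrightarrow> g \<notin> j ` carrier \<Gamma> \<Longrightarrow> push f g = \<zero>\<^bsub>K\<^esub>"
  by (simp add: push_def)

lemma push_supp: "B.supp (push f) \<subseteq> j ` A.supp f"
  using inj by (auto simp: push_def)

lemma push_closed:
  assumes f: "f \<in> carrier (group_ring R \<Gamma>)" shows "push f \<in> carrier (group_ring K \<Delta>)"
proof -
  have "finite (B.supp (push f))"
    using f by (intro finite_subset[OF push_supp]) (auto simp: A.GR_carrier)
  moreover have "push f \<in> carrier \<Delta> \<rightarrow>\<^sub>E carrier K"
    using A.GR_closed[OF f] inj by (auto simp: push_def)
  ultimately show ?thesis by (simp add: B.GR_carrier)
qed

lemma push_mult:
  assumes f: "f \<in> carrier (group_ring R \<Gamma>)" and g: "g \<in> carrier (group_ring R \<Gamma>)"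
  shows "push (f \<otimes>\<^bsub>group_ring R \<Gamma>\<^esub> g) = push f \<otimes>\<^bsub>group_ring K \<Delta>\<^esub> push g"
proof (rule B.GR_eqI)
  note pf = push_closed[OF f] and pg = push_closed[OF g]
  show "push (f \<otimes>\<^bsub>group_ring R \<Gamma>\<^esub> g) \<in> carrier (group_ring K \<Delta>)"
    "push f \<otimes>\<^bsub>group_ring K \<Delta>\<^esub> push g \<in> carrier (group_ring K \<Delta>)"
    using f g push_closed A.GR_mult_closed B.GR_mult_closed by auto
  fix y assume y: "y \<in> carrier \<Delta>"
  have fin: "finite (A.supp f)" using f by (simp add: A.GR_carrier)
  note cl = A.GR_closed[OF f] A.GR_closed[OF g] B.GR_closed[OF pf] B.GR_closed[OF pg]
  have "(push f \<otimes>\<^bsub>group_ring K \<Delta>\<^esub> push g) y = 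
      (\<Oplus>\<^bsub>K\<^esub>u\<in>j ` A.supp f. push f u \<otimes>\<^bsub>K\<^esub> push g (inv\<^bsub>\<Delta>\<^esub> u \<otimes>\<^bsub>\<Delta>\<^esub> y))"
    using fin y by (intro B.GR_mult_superset[OF pf pg _ push_supp]) auto
  also have "\<dots> = (\<Oplus>\<^bsub>K\<^esub>u\<in>A.supp f. push f (j u) \<otimes>\<^bsub>K\<^esub> push g (inv\<^bsub>\<Delta>\<^esub> j u \<otimes>\<^bsub>\<Delta>\<^esub> y))"
    using y cl inj by (intro B.R.finsum_reindex) (auto simp: inj_on_def)
  finally have *: "(push f \<otimes>\<^bsub>group_ring K \<Delta>\<^esub> push g) y =
     (\<Oplus>\<^bsub>K\<^esub>u\<in>A.supp f. push f (j u) \<otimes>\<^bsub>K\<^esub> push g (inv\<^bsub>\<Delta>\<^esub> j u \<otimes>\<^bsub>\<Delta>\<^esub> y))" .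
  show "push (f \<otimes>\<^bsub>group_ring R \<Gamma>\<^esub> g) y = (push f \<otimes>\<^bsub>group_ring K \<Delta>\<^esub> push g) y"
  proof (cases "y \<in> j ` carrier \<Gamma>")
    case True
    then obtain x where x: "x \<in> carrier \<Gamma>" "y = j x" by blast
    have "(push f \<otimes>\<^bsub>group_ring K \<Delta>\<^esub> push g) y =
        (\<Oplus>\<^bsub>K\<^esub>u\<in>A.supp f. \<theta> (f u \<otimes>\<^bsub>R\<^esub> g (inv\<^bsub>\<Gamma>\<^esub> u \<otimes>\<^bsub>\<Gamma>\<^esub> x)))"
      unfolding *
    proof (rule B.R.finsum_cong')
      show "(\<lambda>u. \<theta> (f u \<otimes>\<^bsub>R\<^esub> g (inv\<^bsub>\<Gamma>\<^esub> u \<otimes>\<^bsub>\<Gamma>\<^esub> x))) \<in> A.supp f \<rightarrow> carrier K" using cl x by auto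
      fix u assume u: "u \<in> A.supp f"
      then have "inv\<^bsub>\<Delta>\<^esub> j u \<otimes>\<^bsub>\<Delta>\<^esub> y = j (inv\<^bsub>\<Gamma>\<^esub> u \<otimes>\<^bsub>\<Gamma>\<^esub> x)" using x by simp
      then show "push f (j u) \<otimes>\<^bsub>K\<^esub> push g (inv\<^bsub>\<Delta>\<^esub> j u \<otimes>\<^bsub>\<Delta>\<^esub> y) = \<theta> (f u \<otimes>\<^bsub>R\<^esub> g (inv\<^bsub>\<Gamma>\<^esub> u \<otimes>\<^bsub>\<Gamma>\<^esub> x))"
        using u x cl by (simp del: j.hom_mult add: push_image)
    qed simp
    also have "\<dots> = \<theta> ((f \<otimes>\<^bsub>group_ring R \<Gamma>\<^esub> g) x)"
      unfolding A.GR_mult_eq[OF f g x(1)] using cl x by (subst \<theta>.hom_finsum) (auto simp: o_def)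
    finally show ?thesis using x by (simp add: push_image)
  next
    case False
    have "push g (inv\<^bsub>\<Delta>\<^esub> j u \<otimes>\<^bsub>\<Delta>\<^esub> y) = \<zero>\<^bsub>K\<^esub>" if u: "u \<in> A.supp f" for u
    proof (rule push_off)
      show "inv\<^bsub>\<Delta>\<^esub> j u \<otimes>\<^bsub>\<Delta>\<^esub> y \<in> carrier \<Delta>" using u y by simp
      show "inv\<^bsub>\<Delta>\<^esub> j u \<otimes>\<^bsub>\<Delta>\<^esub> y \<notin> j ` carrier \<Gamma>"
      proof
        assume "inv\<^bsub>\<Delta>\<^esub> j u \<otimes>\<^bsub>\<Delta>\<^esub> y \<in> j ` carrier \<Gamma>"
        then obtain v where v: "v \<in> carrier \<Gamma>" "inv\<^bsub>\<Delta>\<^esub> j u \<otimes>\<^bsub>\<Delta>\<^esub> y = j v" by blast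
        then have "y = j (u \<otimes>\<^bsub>\<Gamma>\<^esub> v)" using u y by (simp add: B.\<Gamma>.m_assoc[symmetric] flip: v(2))
        then show False using False u v by blast
      qed
    qed
    then have "(push f \<otimes>\<^bsub>group_ring K \<Delta>\<^esub> push g) y = (\<Oplus>\<^bsub>K\<^esub>u\<in>A.supp f. \<zero>\<^bsub>K\<^esub>)"
      unfolding * using cl by (intro B.R.finsum_cong') auto
    then show ?thesis using y False by (simp add: push_off)
  qed
qed

lemma push_one: "push \<one>\<^bsub>group_ring R \<Gamma>\<^esub> = \<one>\<^bsub>group_ring K \<Delta>\<^esub>"
proof (rule B.GR_eqI)
  show "push \<one>\<^bsub>group_ring R \<Gamma>\<^esub> \<in> carrier (group_ring K \<Delta>)" "\<one>\<^bsub>group_ring K \<Delta>\<^esub> \<in> carrier (group_ring K \<Delta>)"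
    using push_closed A.GR_one_closed B.GR_one_closed by auto
  fix y assume y: "y \<in> carrier \<Delta>"
  show "push \<one>\<^bsub>group_ring R \<Gamma>\<^esub> y = \<one>\<^bsub>group_ring K \<Delta>\<^esub> y"
  proof (cases "y \<in> j ` carrier \<Gamma>")
    case True
    then obtain x where x: "x \<in> carrier \<Gamma>" "y = j x" by blast
    have "j x = \<one>\<^bsub>\<Delta>\<^esub> \<longleftrightarrow> x = \<one>\<^bsub>\<Gamma>\<^esub>" using x(1) inj j.hom_one by (metis A.\<Gamma>.one_closed inj_onD)
    then show ?thesis using x y by (simp add: push_image A.GR_one_eq B.GR_one_eq)
  next
    case False
    then have "y \<noteq> \<one>\<^bsub>\<Delta>\<^esub>" using j.hom_one by (metis A.\<Gamma>.one_closed image_eqI)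
    then show ?thesis using False y by (simp add: push_off B.GR_one_eq)
  qed
qed

lemma push_eq_one_iff:
  assumes "f \<in> carrier (group_ring R \<Gamma>)"
  shows "push f = \<one>\<^bsub>group_ring K \<Delta>\<^esub> \<longleftrightarrow> (\<forall>x\<in>carrier \<Gamma>. \<theta> (f x) = \<theta> (\<one>\<^bsub>group_ring R \<Gamma>\<^esub> x))"
proof -
  have "push f = push \<one>\<^bsub>group_ring R \<Gamma>\<^esub> \<longleftrightarrow> (\<forall>x\<in>carrier \<Gamma>. \<theta> (f x) = \<theta> (\<one>\<^bsub>group_ring R \<Gamma>\<^esub> x))"
  proof
    show "\<forall>x\<in>carrier \<Gamma>. \<theta> (f x) = \<theta> (\<one>\<^bsub>group_ring R \<Gamma>\<^esub> x)" if "push f = push \<one>\<^bsub>group_ring R \<Gamma>\<^esub>"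
      using that push_image by metis
    show "push f = push \<one>\<^bsub>group_ring R \<Gamma>\<^esub>" if "\<forall>x\<in>carrier \<Gamma>. \<theta> (f x) = \<theta> (\<one>\<^bsub>group_ring R \<Gamma>\<^esub> x)"
      unfolding push_def using that inj by (intro restrict_ext) auto
  qed
  then show ?thesis by (simp add: push_one)
qed

text \<open>
  The hypothesis and the conclusion only concern coefficients after applying \<open>\<theta>\<close>: direct finiteness is
  pulled back along a ring homomorphism that may have a kernel.
\<close>

lemma directly_finite_pull:
  assumes df: "directly_finite (group_ring K \<Delta>)"
    and f: "f \<in> carrier (group_ring R \<Gamma>)" and g: "g \<in> carrier (group_ring R \<Gamma>)"
    and fg: "\<And>x. x \<in> carrier \<Gamma> \<Longrightarrow> \<theta> ((f \<otimes>\<^bsub>group_ring R \<Gamma>\<^esub> g) x) = \<theta> (\<one>\<^bsub>group_ring R \<Gamma>\<^esub> x)"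
    and x: "x \<in> carrier \<Gamma>"
  shows "\<theta> ((g \<otimes>\<^bsub>group_ring R \<Gamma>\<^esub> f) x) = \<theta> (\<one>\<^bsub>group_ring R \<Gamma>\<^esub> x)"
proof -
  have "push (f \<otimes>\<^bsub>group_ring R \<Gamma>\<^esub> g) = \<one>\<^bsub>group_ring K \<Delta>\<^esub>"
    using fg push_eq_one_iff A.GR_mult_closed[OF f g] by blast
  then have "push g \<otimes>\<^bsub>group_ring K \<Delta>\<^esub> push f = \<one>\<^bsub>group_ring K \<Delta>\<^esub>"
    using df push_closed f g unfolding directly_finite_def push_mult[OF f g] by blast
  then have "push (g \<otimes>\<^bsub>group_ring R \<Gamma>\<^esub> f) = \<one>\<^bsub>group_ring K \<Delta>\<^esub>" by (simp add: push_mult f g)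
  then show ?thesis using push_eq_one_iff[OF A.GR_mult_closed[OF g f]] x by blast
qed

end

section \<open>Residual finiteness of finitely generated domains\<close>

definition unit_mod :: "('a, 'm) ring_scheme \<Rightarrow> 'a set \<Rightarrow> 'a \<Rightarrow> bool" where
  "unit_mod R I a \<longleftrightarrow> a \<in> carrier R \<and> (\<exists>a'\<in>carrier R. a \<otimes>\<^bsub>R\<^esub> a' \<ominus>\<^bsub>R\<^esub> \<one>\<^bsub>R\<^esub> \<in> I)"

text \<open>
  This is residual finiteness in a strong form that is needed for an induction on generators: a
  nonzero element is required to become a unit, not just to be nonzero, in some finite quotient.
\<close>

definition res_finite :: "('a, 'm) ring_scheme \<Rightarrow> bool" where
  "res_finite R \<longleftrightarrow> (\<forall>a\<in>carrier R. a \<noteq> \<zero>\<^bsub>R\<^esub> \<longrightarrow>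
     (\<exists>I. ideal I R \<and> finite (carrier (R Quot I)) \<and> \<one>\<^bsub>R\<^esub> \<notin> I \<and> unit_mod R I a))"

lemma quot_carrierE:
  assumes "x \<in> carrier (S Quot J)" obtains y where "y \<in> carrier S" "x = J +>\<^bsub>S\<^esub> y"
  using assms by (auto simp: FactRing_def A_RCOSETS_def')

lemma (in cring) coset_eq_zero_iff:
  assumes I: "ideal I R" and x: "x \<in> carrier R"
  shows "I +> x = \<zero>\<^bsub>R Quot I\<^esub> \<longleftrightarrow> x \<in> I"
proof -
  interpret I: ideal I R by fact
  interpret q: ring_hom_cring R "R Quot I" "(+>) I" by (rule I.rcos_ring_hom_cring) (rule is_cring)
  have "I +> x = I +> \<zero> \<longleftrightarrow> x \<ominus> \<zero> \<in> I"
    using quotient_eq_iff_same_a_r_cos[OF I x zero_closed] by blast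
  moreover have "x \<ominus> \<zero> = x" using x by (simp add: a_minus_def)
  ultimately show ?thesis using q.hom_zero by simp
qed

lemma (in cring) unit_mod_pow:
  assumes I: "ideal I R" and u: "a \<in> carrier R" "a' \<in> carrier R" "a \<otimes> a' \<ominus> \<one> \<in> I"
  shows "(a [^] (n::nat)) \<otimes> (a' [^] n) \<ominus> \<one> \<in> I"
proof -
  interpret I: ideal I R by fact
  interpret q: ring_hom_cring R "R Quot I" "(+>) I" by (rule I.rcos_ring_hom_cring) (rule is_cring)
  have eq: "x \<ominus> y \<in> I \<longleftrightarrow> I +> x = I +> y" if "x \<in> carrier R" "y \<in> carrier R" for x y
    using quotient_eq_iff_same_a_r_cos[OF I that] .
  have "I +> (a \<otimes> a') = I +> \<one>" using u eq by simp
  then have "I +> ((a \<otimes> a') [^] n) = I +> \<one>" using u q.hom_pow[of "a \<otimes> a'" n] by (simp del: q.hom_mult)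
  then have "I +> ((a [^] n) \<otimes> (a' [^] n)) = I +> \<one>" using u by (simp only: nat_pow_distrib)
  then show ?thesis using eq u by simp
qed

lemma (in cring) unit_mod_mult:
  assumes I: "ideal I R" and "a \<in> carrier R" "b \<in> carrier R" "unit_mod R I (a \<otimes> b)"
  shows "unit_mod R I a"
proof -
  obtain c where "c \<in> carrier R" "a \<otimes> b \<otimes> c \<ominus> \<one> \<in> I" using assms by (auto simp: unit_mod_def)
  then show ?thesis using assms by (auto simp: unit_mod_def m_assoc intro!: bexI[of _ "b \<otimes> c"])
qed

definition (in UP) coeff_ideal :: "'a set \<Rightarrow> (nat \<Rightarrow> 'a) set" where
  "coeff_ideal I = {p \<in> carrier P. \<forall>n. up_ring.coeff P p n \<in> I}"

lemma (in UP_cring) coeff_ideal_ideal: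
  assumes I: "ideal I R" shows "ideal (coeff_ideal I) P"
proof -
  interpret I: ideal I R by fact
  interpret q: ring_hom_cring R "R Quot I" "(+>) I" by (rule I.rcos_ring_hom_cring) (rule R.is_cring)
  note q0 = R.coset_eq_zero_iff[OF I, symmetric]
  have mult: "p \<otimes>\<^bsub>P\<^esub> f \<in> coeff_ideal I" if p: "p \<in> coeff_ideal I" and f: "f \<in> carrier P" for p f
  proof -
    have pc: "p \<in> carrier P" "\<And>n. I +> up_ring.coeff P p n = \<zero>\<^bsub>R Quot I\<^esub>" using p q0 by (auto simp: coeff_ideal_def)
    have "I +> up_ring.coeff P (p \<otimes>\<^bsub>P\<^esub> f) n = \<zero>\<^bsub>R Quot I\<^esub>" for n
    proof -
      have "I +> up_ring.coeff P (p \<otimes>\<^bsub>P\<^esub> f) n = 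
          (\<Oplus>\<^bsub>R Quot I\<^esub>i\<in>{..n}. (I +> up_ring.coeff P p i) \<otimes>\<^bsub>R Quot I\<^esub> (I +> up_ring.coeff P f (n - i)))"
        using pc f by (simp add: q.ring.hom_finsum Pi_def o_def)
      also have "\<dots> = (\<Oplus>\<^bsub>R Quot I\<^esub>i\<in>{..n}. \<zero>\<^bsub>R Quot I\<^esub>)"
        using pc f by (intro q.S.finsum_cong') auto
      finally show ?thesis by simp
    qed
    then show ?thesis using pc f q0 by (auto simp: coeff_ideal_def simp del: coeff_mult)
  qed
  show ?thesis
  proof (rule idealI)
    show "ring P" by (rule UP_ring)
    show "subgroup (coeff_ideal I) (add_monoid P)"
    proof (rule P.add.subgroupI)
      show "coeff_ideal I \<subseteq> carrier P" by (auto simp: coeff_ideal_def)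
      show "coeff_ideal I \<noteq> {}" using I.zero_closed by (auto simp: coeff_ideal_def intro!: exI[of _ "\<zero>\<^bsub>P\<^esub>"])
      show "\<ominus>\<^bsub>P\<^esub> a \<in> coeff_ideal I" if "a \<in> coeff_ideal I" for a
        using that by (auto simp: coeff_ideal_def)
      show "a \<oplus>\<^bsub>P\<^esub> b \<in> coeff_ideal I" if "a \<in> coeff_ideal I" "b \<in> coeff_ideal I" for a b
        using that by (auto simp: coeff_ideal_def)
    qed
    show "a \<otimes>\<^bsub>P\<^esub> x \<in> coeff_ideal I" "x \<otimes>\<^bsub>P\<^esub> a \<in> coeff_ideal I" if "a \<in> coeff_ideal I" "x \<in> carrier P" for a x
      using mult[OF that] that UP_m_comm[of x a] by (auto simp: coeff_ideal_def)
  qed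
qed

text \<open>
  Modulo \<open>I\<close> the leading coefficient of \<open>m\<close> is a unit, so a product \<open>mh\<close> with \<open>h\<close> nonzero modulo \<open>I\<close>
  has degree at least that of \<open>m\<close>, which is positive; it cannot be the constant \<open>a\<close>.
\<close>

lemma (in UP_cring) const_in_ideal_sum:
  assumes I: "ideal I R" and m: "m \<in> carrier P" "deg R m > 0" "unit_mod R I (up_ring.coeff P m (deg R m))"
    and i: "i \<in> coeff_ideal I" and h: "h \<in> carrier P" and a: "a \<in> carrier R"
    and eq: "up_ring.monom P a 0 = i \<oplus>\<^bsub>P\<^esub> m \<otimes>\<^bsub>P\<^esub> h"
  shows "a \<in> I"
proof (rule ccontr)
  assume aI: "a \<notin> I"
  interpret I: ideal I R by fact
  let ?Q = "R Quot I" and ?d = "deg R m"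
  interpret q: ring_hom_cring R ?Q "(+>) I" by (rule I.rcos_ring_hom_cring) (rule R.is_cring)
  note q0 = R.coset_eq_zero_iff[OF I, symmetric]
  have ic: "i \<in> carrier P" "\<And>n. I +> up_ring.coeff P i n = \<zero>\<^bsub>?Q\<^esub>" using i q0 by (auto simp: coeff_ideal_def)
  have co: "I +> up_ring.coeff P (up_ring.monom P a 0) n = 
      (\<Oplus>\<^bsub>?Q\<^esub>k\<in>{..n}. (I +> up_ring.coeff P m k) \<otimes>\<^bsub>?Q\<^esub> (I +> up_ring.coeff P h (n - k)))" for n
  proof -
    have "I +> up_ring.coeff P (up_ring.monom P a 0) n = I +> up_ring.coeff P (m \<otimes>\<^bsub>P\<^esub> h) n"
      unfolding eq using ic m h by (simp del: coeff_mult)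
    then show ?thesis using m h by (simp add: q.ring.hom_finsum Pi_def o_def)
  qed
  let ?N = "{n. I +> up_ring.coeff P h n \<noteq> \<zero>\<^bsub>?Q\<^esub>}"
  have fin: "finite ?N"
  proof (rule finite_subset)
    show "?N \<subseteq> {..deg R h}"
    proof
      fix n assume "n \<in> ?N"
      then have "up_ring.coeff P h n \<noteq> \<zero>" by auto
      then show "n \<in> {..deg R h}" using deg_aboveD[OF _ h, of n] by (meson atMost_iff not_le)
    qed
  qed simp
  have "?N \<noteq> {}"
  proof
    assume "?N = {}"
    then have "I +> a = \<zero>\<^bsub>?Q\<^esub>" using co[of 0] a m h by simp
    then show False using aI q0 a by simp
  qed
  define n where "n = Max ?N"
  have n: "I +> up_ring.coeff P h n \<noteq> \<zero>\<^bsub>?Q\<^esub>" using Max_in[OF fin \<open>?N \<noteq> {}\<close>] by (simp add: n_def)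
  have above: "I +> up_ring.coeff P h k = \<zero>\<^bsub>?Q\<^esub>" if "k > n" for k
    using Max_ge[OF fin, of k] that unfolding n_def by auto
  have "\<zero>\<^bsub>?Q\<^esub> = I +> up_ring.coeff P (up_ring.monom P a 0) (n + ?d)" using a m(2) by simp
  also have "\<dots> = (\<Oplus>\<^bsub>?Q\<^esub>k\<in>{..n + ?d}. (I +> up_ring.coeff P m k) \<otimes>\<^bsub>?Q\<^esub> (I +> up_ring.coeff P h (n + ?d - k)))"
    by (rule co)
  also have "\<dots> = (\<Oplus>\<^bsub>?Q\<^esub>k\<in>{..n + ?d}. if ?d = k then (I +> up_ring.coeff P m k) \<otimes>\<^bsub>?Q\<^esub> (I +> up_ring.coeff P h n) else \<zero>\<^bsub>?Q\<^esub>)"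
  proof (rule q.S.finsum_cong')
    fix k assume "k \<in> {..n + ?d}"
    then consider "k < ?d" | "k = ?d" | "k > ?d" by linarith
    then show "(I +> up_ring.coeff P m k) \<otimes>\<^bsub>?Q\<^esub> (I +> up_ring.coeff P h (n + ?d - k)) = 
      (if ?d = k then (I +> up_ring.coeff P m k) \<otimes>\<^bsub>?Q\<^esub> (I +> up_ring.coeff P h n) else \<zero>\<^bsub>?Q\<^esub>)"
      by cases (use above m h deg_aboveD[OF _ m(1)] in auto)
  qed (use m h in auto)
  also have "\<dots> = (I +> up_ring.coeff P m ?d) \<otimes>\<^bsub>?Q\<^esub> (I +> up_ring.coeff P h n)"
    using m h by (intro q.S.finsum_singleton) auto
  finally have z: "(I +> up_ring.coeff P m ?d) \<otimes>\<^bsub>?Q\<^esub> (I +> up_ring.coeff P h n) = \<zero>\<^bsub>?Q\<^esub>" ..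
  obtain u where u: "u \<in> carrier R" "up_ring.coeff P m ?d \<otimes> u \<ominus> \<one> \<in> I" using m(3) by (auto simp: unit_mod_def)
  then have "I +> (up_ring.coeff P m ?d \<otimes> u) = I +> \<one>"
    using R.quotient_eq_iff_same_a_r_cos[OF I] m(1) by simp
  then have u1: "(I +> up_ring.coeff P m ?d) \<otimes>\<^bsub>?Q\<^esub> (I +> u) = \<one>\<^bsub>?Q\<^esub>" using u m(1) by simp
  have "I +> up_ring.coeff P h n = ((I +> up_ring.coeff P m ?d) \<otimes>\<^bsub>?Q\<^esub> (I +> u)) \<otimes>\<^bsub>?Q\<^esub> (I +> up_ring.coeff P h n)"
    using u1 h by simp
  also have "\<dots> = (I +> u) \<otimes>\<^bsub>?Q\<^esub> ((I +> up_ring.coeff P m ?d) \<otimes>\<^bsub>?Q\<^esub> (I +> up_ring.coeff P h n))"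
    using u m h by (simp add: q.S.m_ac)
  also have "\<dots> = \<zero>\<^bsub>?Q\<^esub>" using z u by simp
  finally show False using n by simp
qed

text \<open>
  \<open>S\<close> is generated by one element \<open>s\<close> over the subring \<open>h ` R\<close>, in the form of a surjective evaluation
  map from the polynomial ring.
\<close>

locale simple_ext = UP_univ_prop R S h P s Eval + UP_domain R P + SD: "domain" S
  for R (structure) and S (structure) and h and P (structure) and s and Eval +
  assumes h_inj: "inj_on h (carrier R)" and Eval_surj: "Eval ` carrier P = carrier S"
begin

text \<open>
  \<open>J\<close> is the image of the ideal generated by \<open>m\<close> and the polynomials with coefficients in \<open>I\<close>. Modulo
  \<open>J\<close>, division by \<open>m\<close> writes every element in terms of the powers of \<open>s\<close> below the degree of \<open>m\<close> with
  coefficients from the finite ring \<open>R / I\<close>, so the quotient is finite. It is not zero by the degree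
  argument above; the hypothesis on the kernel of the evaluation says that, up to powers of the leading
  coefficient, the kernel consists of multiples of \<open>m\<close> and so adds nothing to the ideal.
\<close>

lemma extend_ideal:
  assumes I: "ideal I R" "finite (carrier (R Quot I))" "\<one> \<notin> I"
    and m: "m \<in> carrier P" "deg R m > 0" "unit_mod R I (up_ring.coeff P m (deg R m))"
    and ker: "\<And>k. k \<in> carrier P \<Longrightarrow> Eval k = \<zero>\<^bsub>S\<^esub> \<Longrightarrow>
       \<exists>n t. t \<in> carrier P \<and> (up_ring.coeff P m (deg R m) [^] (n::nat)) \<odot>\<^bsub>P\<^esub> k = m \<otimes>\<^bsub>P\<^esub> t"
  shows "\<exists>J. ideal J S \<and> finite (carrier (S Quot J)) \<and> \<one>\<^bsub>S\<^esub> \<notin> J \<and> Eval m \<in> J \<and> h ` I \<subseteq> J"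
proof -
  interpret I: ideal I R by (rule I(1))
  interpret q: ring_hom_cring R "R Quot I" "(+>) I" by (rule I.rcos_ring_hom_cring) (rule R.is_cring)
  let ?l = "up_ring.coeff P m (deg R m)"
  \<comment> \<open>The ideal generated by \<open>I\<close> and \<open>m\<close> in the polynomial ring.\<close>
  define L where "L = {i \<oplus>\<^bsub>P\<^esub> m \<otimes>\<^bsub>P\<^esub> t | i t. i \<in> coeff_ideal I \<and> t \<in> carrier P}"
  define J where "J = Eval ` L"
  interpret IX: ideal "coeff_ideal I" P by (rule coeff_ideal_ideal[OF I(1)])
  have IXc: "i \<in> carrier P" if "i \<in> coeff_ideal I" for i using that unfolding coeff_ideal_def by blast
  have LI: "i \<oplus>\<^bsub>P\<^esub> m \<otimes>\<^bsub>P\<^esub> t \<in> L" if "i \<in> coeff_ideal I" "t \<in> carrier P" for i t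
    using that unfolding L_def by blast
  have LE: "\<exists>i t. x = i \<oplus>\<^bsub>P\<^esub> m \<otimes>\<^bsub>P\<^esub> t \<and> i \<in> coeff_ideal I \<and> t \<in> carrier P" if "x \<in> L" for x
    using that unfolding L_def by blast
  have Lc: "L \<subseteq> carrier P"
  proof
    fix x assume "x \<in> L"
    then obtain i t where "x = i \<oplus>\<^bsub>P\<^esub> m \<otimes>\<^bsub>P\<^esub> t" "i \<in> coeff_ideal I" "t \<in> carrier P" using LE by blast
    then show "x \<in> carrier P" using IXc m(1) by simp
  qed
  have Lmult: "x \<otimes>\<^bsub>P\<^esub> f \<in> L" if x: "x \<in> L" and f: "f \<in> carrier P" for x f
  proof -
    obtain i t where it: "x = i \<oplus>\<^bsub>P\<^esub> m \<otimes>\<^bsub>P\<^esub> t" "i \<in> coeff_ideal I" "t \<in> carrier P" using LE[OF x] by blast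
    have "x \<otimes>\<^bsub>P\<^esub> f = i \<otimes>\<^bsub>P\<^esub> f \<oplus>\<^bsub>P\<^esub> m \<otimes>\<^bsub>P\<^esub> (t \<otimes>\<^bsub>P\<^esub> f)"
      using it f m IXc by (simp add: P.l_distr P.m_assoc)
    then show ?thesis using LI it f IX.I_r_closed by auto
  qed
  have Ladd: "x \<oplus>\<^bsub>P\<^esub> y \<in> L" if x: "x \<in> L" and y: "y \<in> L" for x y
  proof -
    obtain i t where it: "x = i \<oplus>\<^bsub>P\<^esub> m \<otimes>\<^bsub>P\<^esub> t" "i \<in> coeff_ideal I" "t \<in> carrier P" using LE[OF x] by blast
    obtain i' t' where it': "y = i' \<oplus>\<^bsub>P\<^esub> m \<otimes>\<^bsub>P\<^esub> t'" "i' \<in> coeff_ideal I" "t' \<in> carrier P" using LE[OF y] by blast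
    have "x \<oplus>\<^bsub>P\<^esub> y = (i \<oplus>\<^bsub>P\<^esub> i') \<oplus>\<^bsub>P\<^esub> m \<otimes>\<^bsub>P\<^esub> (t \<oplus>\<^bsub>P\<^esub> t')"
      using it it' m IXc by (simp add: P.r_distr P.a_ac)
    then show ?thesis using LI it it' IX.a_closed by auto
  qed
  have Lneg: "\<ominus>\<^bsub>P\<^esub> x \<in> L" if x: "x \<in> L" for x
  proof -
    have "\<ominus>\<^bsub>P\<^esub> x = x \<otimes>\<^bsub>P\<^esub> (\<ominus>\<^bsub>P\<^esub> \<one>\<^bsub>P\<^esub>)" using x Lc by (auto simp: P.r_minus)
    then show ?thesis using Lmult[OF x] by simp
  qed
  have L0: "\<zero>\<^bsub>P\<^esub> \<in> L" using LI[OF IX.zero_closed, of "\<zero>\<^bsub>P\<^esub>"] m by simp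
  have mL: "m \<in> L" using LI[OF IX.zero_closed, of "\<one>\<^bsub>P\<^esub>"] m by simp
  have IL: "i \<in> L" if "i \<in> coeff_ideal I" for i using LI[OF that, of "\<zero>\<^bsub>P\<^esub>"] m IXc[OF that] by simp
  have JI: "ideal J S"
  proof (rule idealI)
    show "ring S" by (rule S.ring_axioms)
    show "subgroup J (add_monoid S)"
    proof (rule S.add.subgroupI)
      show "J \<subseteq> carrier S" using Lc by (auto simp: J_def)
      show "J \<noteq> {}" using L0 by (auto simp: J_def)
      show "\<ominus>\<^bsub>S\<^esub> a \<in> J" if aJ: "a \<in> J" for a
      proof -
        obtain x where "x \<in> L" "a = Eval x" using aJ by (auto simp: J_def)
        then show ?thesis unfolding J_def using Lneg Lc[THEN subsetD] by (intro image_eqI[of _ _ "\<ominus>\<^bsub>P\<^esub> x"]) auto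
      qed
      show "a \<oplus>\<^bsub>S\<^esub> b \<in> J" if ab: "a \<in> J" "b \<in> J" for a b
      proof -
        obtain x y where "x \<in> L" "a = Eval x" "y \<in> L" "b = Eval y" using ab by (auto simp: J_def)
        then show ?thesis unfolding J_def using Ladd Lc[THEN subsetD] by (intro image_eqI[of _ _ "x \<oplus>\<^bsub>P\<^esub> y"]) auto
      qed
    qed
    have "a \<otimes>\<^bsub>S\<^esub> x \<in> J" if a: "a \<in> J" "x \<in> carrier S" for a x
    proof -
      obtain y where y: "y \<in> L" "a = Eval y" using a(1) by (auto simp: J_def)
      obtain f where "f \<in> carrier P" "x = Eval f" using a(2) Eval_surj by (metis imageE)
      with y show ?thesis unfolding J_def using Lmult Lc[THEN subsetD] by (intro image_eqI[of _ _ "y \<otimes>\<^bsub>P\<^esub> f"]) auto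
    qed
    moreover have "J \<subseteq> carrier S" using Lc by (auto simp: J_def)
    ultimately show "a \<otimes>\<^bsub>S\<^esub> x \<in> J" "x \<otimes>\<^bsub>S\<^esub> a \<in> J" if "a \<in> J" "x \<in> carrier S" for a x
      using that S.m_comm by (metis subsetD)+
  qed
  interpret J: ideal J S by (rule JI)
  interpret \<kappa>: ring_hom_cring S "S Quot J" "(+>\<^bsub>S\<^esub>) J" by (rule J.rcos_ring_hom_cring) (rule S.is_cring)
  let ?Q = "S Quot J" and ?\<kappa> = "(+>\<^bsub>S\<^esub>) J"
  note \<kappa>0 = S.coset_eq_zero_iff[OF JI]
  have hE: "Eval (up_ring.monom P a 0) = h a" if "a \<in> carrier R" for a
    using Eval_monom[OF that, of 0] that by simp
  have hI: "h ` I \<subseteq> J"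
  proof
    fix x assume "x \<in> h ` I"
    then obtain a where a: "a \<in> I" "x = h a" by blast
    then have ac: "a \<in> carrier R" using I.Icarr by blast
    have "up_ring.monom P a 0 \<in> coeff_ideal I" unfolding coeff_ideal_def using a ac by auto
    then show "x \<in> J" using IL hE[OF ac] a by (auto simp: J_def intro!: image_eqI[of _ _ "up_ring.monom P a 0"])
  qed
  obtain u where u: "u \<in> carrier R" "?l \<otimes> u \<ominus> \<one> \<in> I" using m(3) by (auto simp: unit_mod_def)
  have lc: "?l \<in> carrier R" using m(1) by simp
  have one: "\<one>\<^bsub>S\<^esub> \<notin> J"
  proof
    assume "\<one>\<^bsub>S\<^esub> \<in> J"
    then obtain i t where it: "\<one>\<^bsub>S\<^esub> = Eval (i \<oplus>\<^bsub>P\<^esub> m \<otimes>\<^bsub>P\<^esub> t)" "i \<in> coeff_ideal I" "t \<in> carrier P"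
      using LE unfolding J_def by (metis imageE)
    let ?p = "i \<oplus>\<^bsub>P\<^esub> m \<otimes>\<^bsub>P\<^esub> t"
    have pc: "?p \<in> carrier P" using it IXc m by simp
    let ?k = "\<one>\<^bsub>P\<^esub> \<ominus>\<^bsub>P\<^esub> ?p"
    have kc: "?k \<in> carrier P" using pc by simp
    have "Eval (x \<ominus>\<^bsub>P\<^esub> y) = Eval x \<ominus>\<^bsub>S\<^esub> Eval y" if "x \<in> carrier P" "y \<in> carrier P" for x y
      using that by (simp add: a_minus_def)
    then have "Eval ?k = Eval \<one>\<^bsub>P\<^esub> \<ominus>\<^bsub>S\<^esub> Eval ?p" using pc UP_one_closed by blast
    also have "\<dots> = \<zero>\<^bsub>S\<^esub>" using it(1) pc by (metis S.r_right_minus_eq hom_closed hom_one)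
    finally obtain n t' where t': "t' \<in> carrier P" "(?l [^] (n::nat)) \<odot>\<^bsub>P\<^esub> ?k = m \<otimes>\<^bsub>P\<^esub> t'"
      using ker[OF kc] by blast
    let ?L = "?l [^] n"
    have Lc: "?L \<in> carrier R" using lc by simp
    have pk: "?p \<oplus>\<^bsub>P\<^esub> ?k = \<one>\<^bsub>P\<^esub>"
    proof -
      have "?p \<oplus>\<^bsub>P\<^esub> (\<one>\<^bsub>P\<^esub> \<oplus>\<^bsub>P\<^esub> \<ominus>\<^bsub>P\<^esub> ?p) = \<one>\<^bsub>P\<^esub> \<oplus>\<^bsub>P\<^esub> (?p \<oplus>\<^bsub>P\<^esub> \<ominus>\<^bsub>P\<^esub> ?p)"
        using pc by (intro P.a_lcomm) simp_all
      then show ?thesis using pc by (simp only: a_minus_def P.r_neg P.r_zero UP_one_closed)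
    qed
    have "up_ring.monom P ?L 0 = ?L \<odot>\<^bsub>P\<^esub> \<one>\<^bsub>P\<^esub>"
      using Lc by (metis UP_one_closed UP_r_one monom_closed monom_mult_is_smult)
    also have "\<dots> = ?L \<odot>\<^bsub>P\<^esub> ?p \<oplus>\<^bsub>P\<^esub> ?L \<odot>\<^bsub>P\<^esub> ?k"
      using UP_smult_r_distr[OF Lc pc kc] pk by simp
    also have "?L \<odot>\<^bsub>P\<^esub> ?p = (?L \<odot>\<^bsub>P\<^esub> i) \<oplus>\<^bsub>P\<^esub> m \<otimes>\<^bsub>P\<^esub> (?L \<odot>\<^bsub>P\<^esub> t)"
    proof -
      have "?L \<odot>\<^bsub>P\<^esub> (m \<otimes>\<^bsub>P\<^esub> t) = m \<otimes>\<^bsub>P\<^esub> (?L \<odot>\<^bsub>P\<^esub> t)"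
        using Lc m it by (metis UP_m_comm UP_mult_closed UP_smult_assoc2 UP_smult_closed)
      then show ?thesis using Lc m it IXc by (simp add: UP_smult_r_distr)
    qed
    finally have "up_ring.monom P ?L 0 = (?L \<odot>\<^bsub>P\<^esub> i) \<oplus>\<^bsub>P\<^esub> m \<otimes>\<^bsub>P\<^esub> (?L \<odot>\<^bsub>P\<^esub> t \<oplus>\<^bsub>P\<^esub> t')"
      unfolding t'(2) using Lc m it IXc t' by (simp add: P.r_distr P.a_assoc)
    moreover have "?L \<odot>\<^bsub>P\<^esub> i \<in> coeff_ideal I"
      using it(2) Lc I.I_l_closed unfolding coeff_ideal_def by auto
    ultimately have "?L \<in> I"
      using const_in_ideal_sum[OF I(1) m, of "?L \<odot>\<^bsub>P\<^esub> i" "?L \<odot>\<^bsub>P\<^esub> t \<oplus>\<^bsub>P\<^esub> t'" ?L] Lc it t' by simp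
    then have "?L \<otimes> u [^] n \<in> I" using u I.I_r_closed by simp
    moreover have "?L \<otimes> u [^] n \<ominus> \<one> \<in> I" using R.unit_mod_pow[OF I(1) lc u] .
    ultimately have "?L \<otimes> u [^] n \<ominus> (?L \<otimes> u [^] n \<ominus> \<one>) \<in> I"
      by (simp add: a_minus_def)
    moreover have "?L \<otimes> u [^] n \<ominus> (?L \<otimes> u [^] n \<ominus> \<one>) = \<one>"
    proof -
      have c: "?L \<otimes> u [^] n \<in> carrier R" using lc u by simp
      have "x \<ominus> (x \<ominus> \<one>) = \<one>" if "x \<in> carrier R" for x
        using that by (simp add: a_minus_def R.minus_add R.a_assoc[symmetric] R.r_neg)
      then show ?thesis using c by blast
    qed
    ultimately show False using I(3) by simp
  qed
  define \<phi> where "\<phi> a = J +>\<^bsub>S\<^esub> h a" for a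
  have \<phi>c: "\<phi> a \<in> carrier ?Q" if "a \<in> carrier R" for a using that by (simp add: \<phi>_def)
  have \<phi>eq: "\<phi> a = \<phi> b" if "I +> a = I +> b" "a \<in> carrier R" "b \<in> carrier R" for a b
  proof -
    have "a \<ominus> b \<in> I" using R.quotient_eq_iff_same_a_r_cos[OF I(1)] that by blast
    then have "h (a \<ominus> b) \<in> J" using hI by blast
    then have "h a \<ominus>\<^bsub>S\<^esub> h b \<in> J" using that by (simp add: a_minus_def)
    then show ?thesis unfolding \<phi>_def using S.quotient_eq_iff_same_a_r_cos[OF JI] that by simp
  qed
  have fin\<phi>: "finite (\<phi> ` carrier R)"
  proof -
    obtain Y where Y: "Y \<subseteq> carrier R" "finite Y" "(+>) I ` carrier R = (+>) I ` Y"
    proof -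
      have "finite ((+>) I ` carrier R)" using I(2) by (rule finite_subset[rotated]) auto
      then show ?thesis using finite_subset_image[of "(+>) I ` carrier R" "(+>) I" "carrier R"] that by blast
    qed
    have "\<phi> ` carrier R \<subseteq> \<phi> ` Y"
    proof
      fix x assume "x \<in> \<phi> ` carrier R"
      then obtain a where a: "a \<in> carrier R" "x = \<phi> a" by blast
      then obtain y where "y \<in> Y" "I +> a = I +> y" using Y(3) by (metis image_iff)
      then show "x \<in> \<phi> ` Y" using \<phi>eq[of a y] a Y(1) by blast
    qed
    then show ?thesis using Y(2) finite_surj by blast
  qed
  have \<phi>u: "\<phi> ?l \<otimes>\<^bsub>?Q\<^esub> \<phi> u = \<one>\<^bsub>?Q\<^esub>"
  proof -
    have "\<phi> (?l \<otimes> u) = \<phi> \<one>" using \<phi>eq[of "?l \<otimes> u" \<one>] R.quotient_eq_iff_same_a_r_cos[OF I(1)] u lc by simp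
    then show ?thesis using lc u by (simp add: \<phi>_def)
  qed
  define E where "E f = J +>\<^bsub>S\<^esub> Eval f" for f
  have Esm: "E (a \<odot>\<^bsub>P\<^esub> f) = \<phi> a \<otimes>\<^bsub>?Q\<^esub> E f" if "a \<in> carrier R" "f \<in> carrier P" for a f
    using that by (simp add: E_def \<phi>_def Eval_smult)
  define T where "T = (\<lambda>c. \<Oplus>\<^bsub>?Q\<^esub>i\<in>{..<deg R m}. c i \<otimes>\<^bsub>?Q\<^esub> (J +>\<^bsub>S\<^esub> s [^]\<^bsub>S\<^esub> i)) ` ({..<deg R m} \<rightarrow>\<^sub>E \<phi> ` carrier R)"
  have Elow: "E r \<in> T" if r: "r \<in> carrier P" "deg R r < deg R m" for r
  proof -
    let ?c = "\<lambda>i\<in>{..<deg R m}. \<phi> (up_ring.coeff P r i)"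
    have "Eval r = (\<Oplus>\<^bsub>S\<^esub>i\<in>{..deg R r}. h (up_ring.coeff P r i) \<otimes>\<^bsub>S\<^esub> s [^]\<^bsub>S\<^esub> i)"
      unfolding Eval_def by (rule eval_on_carrier[OF r(1)])
    also have "\<dots> = (\<Oplus>\<^bsub>S\<^esub>i\<in>{..<deg R m}. h (up_ring.coeff P r i) \<otimes>\<^bsub>S\<^esub> s [^]\<^bsub>S\<^esub> i)"
      using r deg_aboveD[OF _ r(1)] by (intro S.add.finprod_mono_neutral_cong_left) auto
    finally have "E r = (\<Oplus>\<^bsub>?Q\<^esub>i\<in>{..<deg R m}. J +>\<^bsub>S\<^esub> (h (up_ring.coeff P r i) \<otimes>\<^bsub>S\<^esub> s [^]\<^bsub>S\<^esub> i))"
      unfolding E_def using r by (simp add: \<kappa>.ring.hom_finsum Pi_def o_def)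
    also have "\<dots> = (\<Oplus>\<^bsub>?Q\<^esub>i\<in>{..<deg R m}. ?c i \<otimes>\<^bsub>?Q\<^esub> (J +>\<^bsub>S\<^esub> s [^]\<^bsub>S\<^esub> i))"
      using r \<phi>c by (intro \<kappa>.S.finsum_cong') (auto simp: \<phi>_def)
    finally show ?thesis unfolding T_def using r by (intro image_eqI[of _ _ ?c]) auto
  qed
  have "carrier ?Q \<subseteq> T"
  proof
    fix x assume "x \<in> carrier ?Q"
    then obtain y where "y \<in> carrier S" "x = J +>\<^bsub>S\<^esub> y" using quot_carrierE by metis
    then obtain f where f: "f \<in> carrier P" "x = E f" unfolding E_def using Eval_surj by (metis imageE)
    have m0: "m \<noteq> \<zero>\<^bsub>P\<^esub>" using m(2) by auto
    obtain t r n where t: "t \<in> carrier P" "r \<in> carrier P" "?l [^] (n::nat) \<odot>\<^bsub>P\<^esub> f = m \<otimes>\<^bsub>P\<^esub> t \<oplus>\<^bsub>P\<^esub> r"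
       "r = \<zero>\<^bsub>P\<^esub> \<or> deg R r < deg R m"
      using long_div_theorem[OF m(1) f(1) m0] by blast
    have rd: "deg R r < deg R m" using t(4) m(2) by auto
    have Em: "E m = \<zero>\<^bsub>?Q\<^esub>" unfolding E_def using mL \<kappa>0[of "Eval m"] m(1) by (simp add: J_def)
    have "E (?l [^] n \<odot>\<^bsub>P\<^esub> f) = E m \<otimes>\<^bsub>?Q\<^esub> E t \<oplus>\<^bsub>?Q\<^esub> E r" unfolding t(3) using t m by (simp add: E_def)
    also have "\<dots> = E r" using Em t m by (simp add: E_def)
    finally have *: "\<phi> (?l [^] n) \<otimes>\<^bsub>?Q\<^esub> E f = E r" using Esm lc f by simp
    have pw: "\<phi> (u [^] n) \<otimes>\<^bsub>?Q\<^esub> \<phi> (?l [^] n) = \<one>\<^bsub>?Q\<^esub>"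
    proof -
      have "\<phi> (u [^] n) \<otimes>\<^bsub>?Q\<^esub> \<phi> (?l [^] n) = (\<phi> ?l \<otimes>\<^bsub>?Q\<^esub> \<phi> u) [^]\<^bsub>?Q\<^esub> n"
        using lc u by (simp add: \<phi>_def \<kappa>.S.nat_pow_distrib \<kappa>.S.m_comm)
      then show ?thesis by (simp add: \<phi>u)
    qed
    have "E (u [^] n \<odot>\<^bsub>P\<^esub> r) = \<phi> (u [^] n) \<otimes>\<^bsub>?Q\<^esub> (\<phi> (?l [^] n) \<otimes>\<^bsub>?Q\<^esub> E f)" using Esm u t * by simp
    also have "\<dots> = (\<phi> (u [^] n) \<otimes>\<^bsub>?Q\<^esub> \<phi> (?l [^] n)) \<otimes>\<^bsub>?Q\<^esub> E f"
      using \<phi>c u lc f by (intro \<kappa>.S.m_assoc[symmetric]) (auto simp: E_def)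
    also have "\<dots> = E f" using pw f by (simp add: E_def)
    finally have "x = E (u [^] n \<odot>\<^bsub>P\<^esub> r)" using f by simp
    moreover have "deg R (u [^] n \<odot>\<^bsub>P\<^esub> r) < deg R m" using rd deg_smult_decr[of "u [^] n" r] u t by simp
    ultimately show "x \<in> T" using Elow[of "u [^] n \<odot>\<^bsub>P\<^esub> r"] u t by simp
  qed
  moreover have "finite T" unfolding T_def by (intro finite_imageI finite_PiE finite_lessThan fin\<phi>)
  ultimately have "finite (carrier ?Q)" by (rule finite_subset)
  moreover have "Eval m \<in> J" using mL by (simp add: J_def)
  ultimately show ?thesis using JI one hI by blast
qed

text \<open>
  If \<open>s\<close> is transcendental and \<open>b = g(s)\<close>, take \<open>m = Xg - 1\<close>: in the quotient \<open>s\<close> becomes an inverse of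
  \<open>b\<close>, and the leading coefficient of \<open>m\<close> is that of \<open>g\<close>. If \<open>s\<close> is algebraic, take for \<open>m\<close> a polynomial
  \<open>f\<close> of least degree with root \<open>s\<close>; then \<open>b\<close> divides some nonzero \<open>a\<close> of \<open>R\<close>, and it suffices that
  \<open>a\<close> and the leading coefficient of \<open>f\<close> become units.
\<close>

lemma res_finite_step:
  assumes "res_finite R" shows "res_finite S"
  unfolding res_finite_def
proof (intro ballI impI)
  fix b assume b: "b \<in> carrier S" "b \<noteq> \<zero>\<^bsub>S\<^esub>"
  obtain g where g: "g \<in> carrier P" "Eval g = b" using b Eval_surj by (metis imageE)
  have h0: "a = \<zero>" if "a \<in> carrier R" "h a = \<zero>\<^bsub>S\<^esub>" for a
    using that inj_onD[OF h_inj, of a \<zero>] by simp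
  have hE: "Eval (up_ring.monom P a 0) = h a" if "a \<in> carrier R" for a
    using Eval_monom[OF that, of 0] that by simp
  show "\<exists>J. ideal J S \<and> finite (carrier (S Quot J)) \<and> \<one>\<^bsub>S\<^esub> \<notin> J \<and> unit_mod S J b"
  proof (cases "\<forall>k\<in>carrier P. Eval k = \<zero>\<^bsub>S\<^esub> \<longrightarrow> k = \<zero>\<^bsub>P\<^esub>")
    case True
    have g0: "g \<noteq> \<zero>\<^bsub>P\<^esub>" using g b by auto
    let ?\<beta> = "up_ring.coeff P g (deg R g)"
    have \<beta>: "?\<beta> \<in> carrier R" "?\<beta> \<noteq> \<zero>" using g g0 lcoeff_nonzero by auto
    obtain I where I: "ideal I R" "finite (carrier (R Quot I))" "\<one> \<notin> I" "unit_mod R I ?\<beta>"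
      using assms \<beta> unfolding res_finite_def by blast
    define V where "V = up_ring.monom P \<one> 1"
    have V: "V \<in> carrier P" "Eval V = s" using Eval_monom[of \<one> 1] by (simp_all add: V_def)
    \<comment> \<open>Modulo \<open>m\<close> the product of the variable and \<open>g\<close> is 1.\<close>
    define m where "m = V \<otimes>\<^bsub>P\<^esub> g \<ominus>\<^bsub>P\<^esub> \<one>\<^bsub>P\<^esub>"
    have m: "m \<in> carrier P" using V g by (simp add: m_def)
    have cm: "up_ring.coeff P m (Suc k) = up_ring.coeff P g k" for k
      using coeff_monom_mult[OF R.one_closed g(1), of 1 k] g V
      by (simp add: m_def V_def a_minus_def del: coeff_mult)
    have dm: "deg R m = Suc (deg R g)"
    proof (rule le_antisym)
      show "deg R m \<le> Suc (deg R g)"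
      proof (rule deg_aboveI[OF _ m])
        fix k assume "Suc (deg R g) < k"
        then obtain k' where "k = Suc k'" "deg R g < k'" by (metis Suc_lessE)
        then show "up_ring.coeff P m k = \<zero>" using cm deg_aboveD[OF _ g(1)] by simp
      qed
      show "Suc (deg R g) \<le> deg R m" by (rule deg_belowI[OF _ m]) (use cm \<beta> in simp)
    qed
    have ker: "\<exists>n t. t \<in> carrier P \<and> (up_ring.coeff P m (deg R m) [^] (n::nat)) \<odot>\<^bsub>P\<^esub> k = m \<otimes>\<^bsub>P\<^esub> t"
      if "k \<in> carrier P" "Eval k = \<zero>\<^bsub>S\<^esub>" for k
    proof -
      have "k = \<zero>\<^bsub>P\<^esub>" using True that by blast
      then show ?thesis using m by (intro exI[of _ 0] exI[of _ "\<zero>\<^bsub>P\<^esub>"]) simp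
    qed
    have pos: "deg R m > 0" by (simp only: dm)
    have um: "unit_mod R I (up_ring.coeff P m (deg R m))" unfolding dm cm by (rule I(4))
    obtain J where J: "ideal J S" "finite (carrier (S Quot J))" "\<one>\<^bsub>S\<^esub> \<notin> J" "Eval m \<in> J"
      using extend_ideal[OF I(1-3) m pos um ker] by blast
    have "Eval m = s \<otimes>\<^bsub>S\<^esub> b \<ominus>\<^bsub>S\<^esub> \<one>\<^bsub>S\<^esub>" using V g by (simp add: m_def a_minus_def)
    also have "s \<otimes>\<^bsub>S\<^esub> b = b \<otimes>\<^bsub>S\<^esub> s" using b by (simp add: S.m_comm)
    finally have "unit_mod S J b" using J(4) b unfolding unit_mod_def by auto
    then show ?thesis using J by blast
  next
    case False
    obtain f where f: "f \<in> carrier P" "Eval f = \<zero>\<^bsub>S\<^esub>" "f \<noteq> \<zero>\<^bsub>P\<^esub>"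
      and fmin: "\<And>k. k \<in> carrier P \<Longrightarrow> Eval k = \<zero>\<^bsub>S\<^esub> \<Longrightarrow> k \<noteq> \<zero>\<^bsub>P\<^esub> \<Longrightarrow> deg R f \<le> deg R k"
    proof -
      from False obtain k where "k \<in> carrier P \<and> Eval k = \<zero>\<^bsub>S\<^esub> \<and> k \<noteq> \<zero>\<^bsub>P\<^esub>" by blast
      from ex_has_least_nat[of "\<lambda>k. k \<in> carrier P \<and> Eval k = \<zero>\<^bsub>S\<^esub> \<and> k \<noteq> \<zero>\<^bsub>P\<^esub>", OF this, of "deg R"]
      show ?thesis using that by (elim exE conjE) metis
    qed
    let ?l = "up_ring.coeff P f (deg R f)"
    have l: "?l \<in> carrier R" "?l \<noteq> \<zero>" using f lcoeff_nonzero by auto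
    have df: "deg R f > 0"
    proof (rule ccontr)
      assume "\<not> deg R f > 0"
      then have fm: "f = up_ring.monom P (up_ring.coeff P f 0) 0" using deg_zero_impl_monom[OF f(1)] by simp
      then have "h (up_ring.coeff P f 0) = \<zero>\<^bsub>S\<^esub>" using f(1,2) hE coeff_closed by metis
      then have "up_ring.coeff P f 0 = \<zero>" using h0 f(1) by simp
      then show False using fm f(3) by simp
    qed
    have pnz: "a [^] n \<noteq> \<zero>" if "a \<in> carrier R" "a \<noteq> \<zero>" for a and n :: nat
      using that R.integral_iff by (induction n) auto
    have div: "\<exists>t r n. t \<in> carrier P \<and> r \<in> carrier P \<and>
        (up_ring.coeff P p (deg R p) [^] (n::nat)) \<odot>\<^bsub>P\<^esub> k = p \<otimes>\<^bsub>P\<^esub> t \<oplus>\<^bsub>P\<^esub> r \<and>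
        h (up_ring.coeff P p (deg R p) [^] n) \<otimes>\<^bsub>S\<^esub> Eval k = Eval p \<otimes>\<^bsub>S\<^esub> Eval t \<oplus>\<^bsub>S\<^esub> Eval r \<and>
        h (up_ring.coeff P p (deg R p) [^] n) \<noteq> \<zero>\<^bsub>S\<^esub> \<and> h (up_ring.coeff P p (deg R p) [^] n) \<in> carrier S \<and>
        (r = \<zero>\<^bsub>P\<^esub> \<or> deg R r < deg R p)"
      if p: "p \<in> carrier P" "p \<noteq> \<zero>\<^bsub>P\<^esub>" and k: "k \<in> carrier P" for p k
    proof -
      obtain t r n where *: "t \<in> carrier P" "r \<in> carrier P" 
        "(up_ring.coeff P p (deg R p) [^] (n::nat)) \<odot>\<^bsub>P\<^esub> k = p \<otimes>\<^bsub>P\<^esub> t \<oplus>\<^bsub>P\<^esub> r" "r = \<zero>\<^bsub>P\<^esub> \<or> deg R r < deg R p"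
        using long_div_theorem[OF p(1) k p(2)] by blast
      have c: "up_ring.coeff P p (deg R p) [^] n \<in> carrier R" using p by simp
      have "up_ring.coeff P p (deg R p) [^] n \<noteq> \<zero>" using pnz[of "up_ring.coeff P p (deg R p)" n] p lcoeff_nonzero by simp
      then have "h (up_ring.coeff P p (deg R p) [^] n) \<noteq> \<zero>\<^bsub>S\<^esub>" using h0 c by blast
      moreover have "h (up_ring.coeff P p (deg R p) [^] n) \<otimes>\<^bsub>S\<^esub> Eval k = Eval p \<otimes>\<^bsub>S\<^esub> Eval t \<oplus>\<^bsub>S\<^esub> Eval r"
        using Eval_smult[OF c k] *(3) * p k by simp
      ultimately show ?thesis using * c by (intro exI[of _ t] exI[of _ r] exI[of _ n]) simp
    qed
    have kerdiv: "\<exists>n t. t \<in> carrier P \<and> (?l [^] (n::nat)) \<odot>\<^bsub>P\<^esub> k = f \<otimes>\<^bsub>P\<^esub> t"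
      if k: "k \<in> carrier P" "Eval k = \<zero>\<^bsub>S\<^esub>" for k
    proof -
      obtain t r n where *: "t \<in> carrier P" "r \<in> carrier P" "(?l [^] (n::nat)) \<odot>\<^bsub>P\<^esub> k = f \<otimes>\<^bsub>P\<^esub> t \<oplus>\<^bsub>P\<^esub> r" 
        "h (?l [^] n) \<otimes>\<^bsub>S\<^esub> Eval k = Eval f \<otimes>\<^bsub>S\<^esub> Eval t \<oplus>\<^bsub>S\<^esub> Eval r" "h (?l [^] n) \<in> carrier S"
        "r = \<zero>\<^bsub>P\<^esub> \<or> deg R r < deg R f"
        using div[OF f(1,3) k(1)] by blast
      have "Eval r = \<zero>\<^bsub>S\<^esub>" using *(4) *(1,2,5) k f(1,2) by simp
      then have "r = \<zero>\<^bsub>P\<^esub>" using fmin[OF *(2)] *(6) by (metis not_le)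
      then show ?thesis using * f(1) by (intro exI[of _ n] exI[of _ t]) simp
    qed
    \<comment> \<open>A polynomial \<open>q\<close> of least degree among those whose value is a nonzero multiple of \<open>b\<close> is constant:
      otherwise the remainder of \<open>f\<close> on division by \<open>q\<close> contradicts the minimality of \<open>q\<close> or of \<open>f\<close>.\<close>
    define Q where "Q = {q \<in> carrier P. Eval q \<noteq> \<zero>\<^bsub>S\<^esub> \<and> (\<exists>v\<in>carrier S. Eval q = b \<otimes>\<^bsub>S\<^esub> v)}"
    have QI: "q \<in> Q" if "q \<in> carrier P" "Eval q \<noteq> \<zero>\<^bsub>S\<^esub>" "v \<in> carrier S" "Eval q = b \<otimes>\<^bsub>S\<^esub> v" for q v
      using that unfolding Q_def by blast
    have gQ: "g \<in> Q" using QI[OF g(1), of "\<one>\<^bsub>S\<^esub>"] g b by simp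
    then obtain q where qQ: "q \<in> Q" and qmin: "\<And>k. k \<in> Q \<Longrightarrow> deg R q \<le> deg R k"
      using ex_has_least_nat[of "\<lambda>k. k \<in> Q" g "deg R"] by blast
    obtain v where q: "q \<in> carrier P" "Eval q \<noteq> \<zero>\<^bsub>S\<^esub>" "v \<in> carrier S" "Eval q = b \<otimes>\<^bsub>S\<^esub> v"
      using qQ unfolding Q_def by blast
    have q0: "q \<noteq> \<zero>\<^bsub>P\<^esub>" using q(2) by auto
    have qf: "deg R q < deg R f"
    proof -
      obtain t r n where *: "t \<in> carrier P" "r \<in> carrier P"
        "h (?l [^] (n::nat)) \<otimes>\<^bsub>S\<^esub> Eval g = Eval f \<otimes>\<^bsub>S\<^esub> Eval t \<oplus>\<^bsub>S\<^esub> Eval r" "h (?l [^] n) \<in> carrier S"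
        "h (?l [^] n) \<noteq> \<zero>\<^bsub>S\<^esub>" "r = \<zero>\<^bsub>P\<^esub> \<or> deg R r < deg R f"
        using div[OF f(1,3) g(1)] by blast
      have er: "Eval r = b \<otimes>\<^bsub>S\<^esub> h (?l [^] n)" using * g b f(1,2) by (simp add: S.m_comm)
      have "Eval r \<noteq> \<zero>\<^bsub>S\<^esub>" unfolding er using SD.integral_iff[OF b(1) *(4)] b(2) *(5) by simp
      then have "r \<in> Q" "r \<noteq> \<zero>\<^bsub>P\<^esub>" using QI[OF *(2) _ *(4) er] by auto
      then show ?thesis using qmin[of r] *(6) by simp
    qed
    have dq: "deg R q = 0"
    proof (rule ccontr)
      assume dq: "deg R q \<noteq> 0"
      let ?L = "\<lambda>n. up_ring.coeff P q (deg R q) [^] (n::nat)"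
      obtain t r n where *: "t \<in> carrier P" "r \<in> carrier P" "?L n \<odot>\<^bsub>P\<^esub> f = q \<otimes>\<^bsub>P\<^esub> t \<oplus>\<^bsub>P\<^esub> r"
        "h (?L n) \<otimes>\<^bsub>S\<^esub> Eval f = Eval q \<otimes>\<^bsub>S\<^esub> Eval t \<oplus>\<^bsub>S\<^esub> Eval r" "h (?L n) \<in> carrier S"
        "h (?L n) \<noteq> \<zero>\<^bsub>S\<^esub>" "r = \<zero>\<^bsub>P\<^esub> \<or> deg R r < deg R q"
        using div[OF q(1) q0 f(1)] by blast
      have Lc: "?L n \<in> carrier R" using q by simp
      have L0: "?L n \<noteq> \<zero>" using *(6) by auto
      have s0: "Eval q \<otimes>\<^bsub>S\<^esub> Eval t \<oplus>\<^bsub>S\<^esub> Eval r = \<zero>\<^bsub>S\<^esub>" using *(4,5) f(2) by simp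
      then have er: "Eval r = b \<otimes>\<^bsub>S\<^esub> (\<ominus>\<^bsub>S\<^esub> (v \<otimes>\<^bsub>S\<^esub> Eval t))"
      proof -
        have "Eval r = \<ominus>\<^bsub>S\<^esub> (Eval q \<otimes>\<^bsub>S\<^esub> Eval t)"
          using s0 * q by (metis S.a_comm S.m_closed S.minus_equality hom_closed)
        then show ?thesis using q b * by (simp add: S.r_minus S.m_assoc)
      qed
      have "Eval r = \<zero>\<^bsub>S\<^esub>"
      proof (rule ccontr)
        assume "Eval r \<noteq> \<zero>\<^bsub>S\<^esub>"
        then have "r \<in> Q" "r \<noteq> \<zero>\<^bsub>P\<^esub>" using QI[OF *(2) _ _ er] q * by auto
        then show False using qmin[of r] *(7) by simp
      qed
      then have r0: "r = \<zero>\<^bsub>P\<^esub>" using fmin[OF *(2)] *(7) qf by (metis le_less_trans not_less_iff_gr_or_eq)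
      then have "Eval q \<otimes>\<^bsub>S\<^esub> Eval t = \<zero>\<^bsub>S\<^esub>" using s0 *(1) q(1) by (metis S.m_closed S.r_zero hom_closed hom_zero)
      then have "Eval t = \<zero>\<^bsub>S\<^esub>"
        using SD.integral[OF _ hom_closed[OF q(1)] hom_closed[OF *(1)]] q(2) by blast
      have fe: "?L n \<odot>\<^bsub>P\<^esub> f = q \<otimes>\<^bsub>P\<^esub> t" using *(3) r0 q * by simp
      have dL: "deg R (?L n \<odot>\<^bsub>P\<^esub> f) = deg R f" using deg_smult[OF Lc f(1)] L0 by simp
      have t0: "t \<noteq> \<zero>\<^bsub>P\<^esub>" 
      proof
        assume "t = \<zero>\<^bsub>P\<^esub>"
        then have "deg R f = 0" using dL fe q by simp
        then show False using df by simp
      qed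
      have "deg R f = deg R q + deg R t" using dL fe deg_mult[OF q0 t0 q(1) *(1)] by simp
      moreover have "deg R f \<le> deg R t" using fmin[OF *(1)] \<open>Eval t = \<zero>\<^bsub>S\<^esub>\<close> t0 by blast
      ultimately show False using dq by simp
    qed
    define a where "a = up_ring.coeff P q 0"
    have ac: "a \<in> carrier R" using q by (simp add: a_def)
    have ha: "h a = b \<otimes>\<^bsub>S\<^esub> v" using deg_zero_impl_monom[OF q(1) dq] hE[OF ac] q(4) by (simp add: a_def)
    have a0: "a \<noteq> \<zero>" using ha q(2,4) by auto
    have "?l \<otimes> a \<noteq> \<zero>" using l ac a0 R.integral by blast
    then obtain I where I: "ideal I R" "finite (carrier (R Quot I))" "\<one> \<notin> I" "unit_mod R I (?l \<otimes> a)"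
      using assms l ac unfolding res_finite_def by blast
    have ul: "unit_mod R I ?l" by (rule R.unit_mod_mult[OF I(1) l(1) ac I(4)])
    have "unit_mod R I a" using R.unit_mod_mult[OF I(1) ac l(1)] I(4) l ac by (simp add: R.m_comm)
    then obtain a' where a': "a' \<in> carrier R" "a \<otimes> a' \<ominus> \<one> \<in> I" by (auto simp: unit_mod_def)
    obtain J where J: "ideal J S" "finite (carrier (S Quot J))" "\<one>\<^bsub>S\<^esub> \<notin> J" "h ` I \<subseteq> J"
      using extend_ideal[OF I(1-3) f(1) df ul kerdiv] by blast
    have "h (a \<otimes> a' \<ominus> \<one>) \<in> J" using J(4) a' by blast
    moreover have "h (a \<otimes> a' \<ominus> \<one>) = b \<otimes>\<^bsub>S\<^esub> (v \<otimes>\<^bsub>S\<^esub> h a') \<ominus>\<^bsub>S\<^esub> \<one>\<^bsub>S\<^esub>"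
      using ac a' ha b q by (simp add: a_minus_def S.m_assoc)
    ultimately have "unit_mod S J b" unfolding unit_mod_def using b q a' by auto
    then show ?thesis using J by blast
  qed
qed

end

lemma (in ring) int_embed_hom: "(\<lambda>k::int. [k] \<cdot> \<one>) \<in> ring_hom \<Z> R"
proof (rule ring_hom_memI)
  fix k l :: int
  show "[(k \<otimes>\<^bsub>\<Z>\<^esub> l)] \<cdot> \<one> = ([k] \<cdot> \<one>) \<otimes> ([l] \<cdot> \<one>)"
  proof -
    have c: "[l] \<cdot> \<one> \<in> carrier R" using add.int_pow_closed[of \<one> l] by (simp add: add_pow_def)
    have "([k] \<cdot> \<one>) \<otimes> ([l] \<cdot> \<one>) = [k] \<cdot> ([l] \<cdot> \<one>)" using add_pow_ldistr_int[OF one_closed c] c by simp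
    also have "\<dots> = [(k * l)] \<cdot> \<one>" using add.int_pow_pow[of \<one> k l] by (simp add: add_pow_def mult.commute)
    finally show ?thesis by simp
  qed
  show "[(k \<oplus>\<^bsub>\<Z>\<^esub> l)] \<cdot> \<one> = ([k] \<cdot> \<one>) \<oplus> ([l] \<cdot> \<one>)"
    using add.int_pow_mult[of \<one> k l] by (simp add: add_pow_def)
  show "[\<one>\<^bsub>\<Z>\<^esub>] \<cdot> \<one> = \<one>" using add.int_pow_1[of \<one>] by (simp add: add_pow_def)
qed simp

text \<open>
  In positive characteristic \<open>q\<close> is the characteristic; in characteristic zero any prime larger than
  the absolute value of \<open>n\<close> will do.
\<close>

lemma int_hom_prime_avoiding:
  assumes D: "domain R" and h: "h \<in> ring_hom \<Z> R" and n: "h n \<noteq> \<zero>\<^bsub>R\<^esub>"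
  obtains q :: nat where "Factorial_Ring.prime q" "\<not> int q dvd n" "\<And>k. h k = \<zero>\<^bsub>R\<^esub> \<Longrightarrow> int q dvd k"
proof -
  interpret R: "domain" R by fact
  interpret h: ring_hom_ring \<Z> R h by (intro ring_hom_ringI2 int.ring_axioms R.ring_axioms h)
  have hm: "h (k * l) = h k \<otimes>\<^bsub>R\<^esub> h l" for k l using h.hom_mult[of k l] by simp
  have ha: "h (k + l) = h k \<oplus>\<^bsub>R\<^esub> h l" for k l using h.hom_add[of k l] by simp
  have h0: "h 0 = \<zero>\<^bsub>R\<^esub>" and h1: "h 1 = \<one>\<^bsub>R\<^esub>" using h.hom_zero h.hom_one by simp_all
  have hc: "h k \<in> carrier R" for k using h.hom_closed[of k] by simp
  have dv: "h k = \<zero>\<^bsub>R\<^esub>" if "h j = \<zero>\<^bsub>R\<^esub>" "j dvd k" for j k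
    using that hc by (auto simp: dvd_def hm)
  show ?thesis
  proof (cases "\<exists>k. k \<noteq> 0 \<and> h k = \<zero>\<^bsub>R\<^esub>")
    case True
    then obtain k where k: "k \<noteq> 0" "h k = \<zero>\<^bsub>R\<^esub>" by blast
    have kq: "0 < nat \<bar>k\<bar> \<and> h (int (nat \<bar>k\<bar>)) = \<zero>\<^bsub>R\<^esub>" using k dv[of k "\<bar>k\<bar>"] by simp
    obtain q :: nat where q: "0 < q" "h (int q) = \<zero>\<^bsub>R\<^esub>"
      and qmin: "\<And>j. 0 < j \<Longrightarrow> h (int j) = \<zero>\<^bsub>R\<^esub> \<Longrightarrow> q \<le> j"
    proof -
      from ex_has_least_nat[of "\<lambda>q. 0 < q \<and> h (int q) = \<zero>\<^bsub>R\<^esub>", OF kq, of "\<lambda>q. q"]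
      show ?thesis using that by (elim exE conjE) metis
    qed
    have qd: "int q dvd k" if k: "h k = \<zero>\<^bsub>R\<^esub>" for k
    proof (rule ccontr)
      assume nd: "\<not> int q dvd k"
      have "k mod int q \<noteq> 0" using nd by (simp add: dvd_eq_mod_eq_0)
      moreover have "0 \<le> k mod int q" "k mod int q < int q" using q(1) by simp_all
      ultimately have r: "0 < k mod int q" "k mod int q < int q" by linarith+
      have "h k = h (int q) \<otimes>\<^bsub>R\<^esub> h (k div int q) \<oplus>\<^bsub>R\<^esub> h (k mod int q)"
        unfolding hm[symmetric] ha[symmetric] by simp
      then have "h (k mod int q) = \<zero>\<^bsub>R\<^esub>" using k q hc by simp
      moreover have "int (nat (k mod int q)) = k mod int q" using r(1) by linarith
      ultimately have "q \<le> nat (k mod int q)" using r(1) qmin[of "nat (k mod int q)"] by simp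
      then show False using r by linarith
    qed
    have q1: "q \<noteq> 1" using q h1 by (intro notI) simp
    have "Factorial_Ring.prime q"
    proof (rule prime_natI)
      show "2 \<le> q" using q q1 by simp
      fix a b assume ab: "q dvd a * b"
      then have "h (int a) \<otimes>\<^bsub>R\<^esub> h (int b) = \<zero>\<^bsub>R\<^esub>"
        using dv[OF q(2), of "int a * int b"] by (simp add: hm flip: int_dvd_int_iff)
      then have "h (int a) = \<zero>\<^bsub>R\<^esub> \<or> h (int b) = \<zero>\<^bsub>R\<^esub>" using R.integral hc by blast
      then show "q dvd a \<or> q dvd b" using qd by (metis int_dvd_int_iff)
    qed
    moreover have "\<not> int q dvd n" using dv[OF q(2)] n by blast
    ultimately show ?thesis using that qd by blast
  next
    case False
    obtain q where q: "Factorial_Ring.prime q" "nat \<bar>n\<bar> < q" using bigger_prime by blast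
    have "n \<noteq> 0" using n h0 by auto
    then have "\<not> int q dvd n" using q(2) zdvd_imp_le[of "int q" "\<bar>n\<bar>"] by auto
    moreover have "int q dvd k" if "h k = \<zero>\<^bsub>R\<^esub>" for k using False that by (cases "k = 0") auto
    ultimately show ?thesis by (rule that[OF q(1)])
  qed
qed

lemma res_finite_prime_ring:
  assumes D: "domain F"
  defines "h \<equiv> (\<lambda>k::int. [k] \<cdot>\<^bsub>F\<^esub> \<one>\<^bsub>F\<^esub>)"
  shows "subring (range h) F" "res_finite (F\<lparr>carrier := range h\<rparr>)"
proof -
  interpret F: "domain" F by fact
  have hF: "h \<in> ring_hom \<Z> F" unfolding h_def by (rule F.int_embed_hom)
  interpret hF: ring_hom_ring \<Z> F h by (intro ring_hom_ringI2 int.ring_axioms F.ring_axioms hF)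
  show sr: "subring (range h) F" using hF.img_is_subring[OF ring.carrier_is_subring[OF int.ring_axioms]] by simp
  let ?R = "F\<lparr>carrier := range h\<rparr>"
  have dR: "domain ?R" by (rule F.subring_is_domain[OF sr])
  interpret R: "domain" ?R by (rule dR)
  have hR: "h \<in> ring_hom \<Z> ?R" using hF by (auto simp: ring_hom_def)
  interpret h: ring_hom_ring \<Z> ?R h by (intro ring_hom_ringI2 int.ring_axioms R.ring_axioms hR)
  have hm: "h (k * l) = h k \<otimes>\<^bsub>F\<^esub> h l" for k l using h.hom_mult[of k l] by simp
  have ha: "h (k + l) = h k \<oplus>\<^bsub>F\<^esub> h l" for k l using h.hom_add[of k l] by simp
  have hs: "h (k - l) = h k \<ominus>\<^bsub>?R\<^esub> h l" for k l
  proof -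
    have "h (- l) = \<ominus>\<^bsub>?R\<^esub> h l" using h.hom_a_inv[of l] by (simp add: int_a_inv_eq)
    then show ?thesis using ha[of k "- l"] by (simp add: a_minus_def)
  qed
  have h1: "h 1 = \<one>\<^bsub>F\<^esub>" using h.hom_one by simp
  show "res_finite ?R" unfolding res_finite_def
  proof (intro ballI impI)
    fix a assume a: "a \<in> carrier ?R" "a \<noteq> \<zero>\<^bsub>?R\<^esub>"
    then obtain n where n: "a = h n" by auto
    obtain q :: nat where q: "Factorial_Ring.prime q" "\<not> int q dvd n" "\<And>k. h k = \<zero>\<^bsub>?R\<^esub> \<Longrightarrow> int q dvd k"
      using int_hom_prime_avoiding[OF dR hR, of n] a n by blast
    define I where "I = PIdl\<^bsub>?R\<^esub> (h (int q))"
    have II: "ideal I ?R" unfolding I_def by (rule R.cgenideal_ideal) simp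
    have memI: "h j \<in> I \<longleftrightarrow> int q dvd j" for j
    proof
      assume "h j \<in> I"
      then obtain k where "h j = h k \<otimes>\<^bsub>F\<^esub> h (int q)" by (auto simp: I_def cgenideal_def)
      then have hj: "h j = h (k * int q)" by (simp only: hm)
      have "h (j - k * int q) = h j \<ominus>\<^bsub>?R\<^esub> h j" using hs[of j "k * int q"] hj by metis
      then have "h (j - k * int q) = \<zero>\<^bsub>?R\<^esub>" using R.r_right_minus_eq[of "h j" "h j"] by simp
      then have "int q dvd j - k * int q" by (rule q(3))
      then have "int q dvd (j - k * int q) + k * int q" by (intro dvd_add) simp_all
      then show "int q dvd j" by simp
    next
      assume "int q dvd j"
      then obtain k where "j = k * int q" by (metis dvd_def mult.commute)
      then show "h j \<in> I" by (auto simp: I_def cgenideal_def hm)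
    qed
    have "carrier (?R Quot I) \<subseteq> (\<lambda>j. I +>\<^bsub>?R\<^esub> h j) ` {0..<int q}"
    proof
      fix x assume "x \<in> carrier (?R Quot I)"
      then obtain y where "y \<in> carrier ?R" "x = I +>\<^bsub>?R\<^esub> y" using quot_carrierE by metis
      then obtain j where j: "x = I +>\<^bsub>?R\<^esub> h j" by auto
      have "h j \<ominus>\<^bsub>?R\<^esub> h (j mod int q) \<in> I" unfolding hs[symmetric] memI by (simp add: minus_mod_eq_mult_div)
      then have "x = I +>\<^bsub>?R\<^esub> h (j mod int q)"
        unfolding j using R.quotient_eq_iff_same_a_r_cos[OF II, of "h j" "h (j mod int q)"] by simp
      moreover have "j mod int q \<in> {0..<int q}" using prime_gt_0_nat[OF q(1)] by simp
      ultimately show "x \<in> (\<lambda>j. I +>\<^bsub>?R\<^esub> h j) ` {0..<int q}" by blast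
    qed
    then have "finite (carrier (?R Quot I))" by (rule finite_subset) simp
    moreover have "\<one>\<^bsub>?R\<^esub> \<notin> I" using memI[of 1] q(1) h1 by (auto simp: prime_nat_iff)
    moreover have "unit_mod ?R I a"
    proof -
      have "coprime (int q) n" using q(1,2) by (intro prime_imp_coprime) auto
      then obtain u v where uv: "u * int q + v * n = 1" using bezout_int[of "int q" n] by auto
      have "int q dvd n * v - 1" using uv by (intro dvdI[of _ _ "- u"]) (simp add: algebra_simps)
      then have "h n \<otimes>\<^bsub>?R\<^esub> h v \<ominus>\<^bsub>?R\<^esub> \<one>\<^bsub>?R\<^esub> \<in> I" using memI[of "n * v - 1"] by (simp add: hs hm h1)
      then show ?thesis unfolding unit_mod_def n by auto
    qed
    ultimately show "\<exists>I. ideal I ?R \<and> finite (carrier (?R Quot I)) \<and> \<one>\<^bsub>?R\<^esub> \<notin> I \<and> unit_mod ?R I a"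
      using II by blast
  qed
qed

text \<open>
  Adjoin the elements of \<open>C\<close> one after the other to the image of the integers.
\<close>

theorem res_finite_finitely_generated:
  assumes D: "domain F" and C: "finite C" "C \<subseteq> carrier F"
  shows "\<exists>A. subring A F \<and> C \<subseteq> A \<and> res_finite (F\<lparr>carrier := A\<rparr>)"
  using C
proof (induction C rule: finite_induct)
  case empty
  show ?case using res_finite_prime_ring[OF D] by blast
next
  case (insert c C)
  interpret F: "domain" F by fact
  obtain A where A: "subring A F" "C \<subseteq> A" "res_finite (F\<lparr>carrier := A\<rparr>)" using insert by auto
  have c: "c \<in> carrier F" and AF: "A \<subseteq> carrier F" using insert subringE(1)[OF A(1)] by auto
  define B where "B = generate_ring F (insert c A)"
  have icA: "insert c A \<subseteq> carrier F" using c AF by blast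
  have B: "subring B F" "insert c A \<subseteq> B" "\<And>K. subring K F \<Longrightarrow> insert c A \<subseteq> K \<Longrightarrow> B \<subseteq> K"
    using F.generate_ringE[OF icA B_def] by blast+
  let ?R = "F\<lparr>carrier := A\<rparr>" and ?S = "F\<lparr>carrier := B\<rparr>"
  interpret R: "domain" ?R by (rule F.subring_is_domain[OF A(1)])
  interpret S: "domain" ?S by (rule F.subring_is_domain[OF B(1)])
  have idh: "(\<lambda>x. x) \<in> ring_hom ?R ?S" using B(2) by (auto simp: ring_hom_def)
  interpret U: UP_pre_univ_prop ?R ?S "\<lambda>x. x" "UP ?R"
    by (intro UP_pre_univ_propI R.is_cring S.is_cring idh)
  let ?E = "eval ?R ?S (\<lambda>x. x) c"
  have cS: "c \<in> carrier ?S" using B(2) by simp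
  have E: "?E \<in> ring_hom (UP ?R) ?S" by (rule U.eval_ring_hom[OF cS])
  interpret E: ring_hom_ring "UP ?R" ?S ?E
    by (intro ring_hom_ringI2 U.UP_ring S.ring_axioms E)
  let ?K = "?E ` carrier (UP ?R)"
  have KS: "?K \<subseteq> carrier ?S" using E.hom_closed by blast
  have "subring ?K ?S" by (rule E.img_is_subring) (rule U.P.carrier_is_subring)
  then have "ring (?S\<lparr>carrier := ?K\<rparr>)" by (rule S.subring_is_ring)
  then have K: "subring ?K F" using F.subring_iff[of ?K] KS subringE(1)[OF B(1)] by simp
  have "insert c A \<subseteq> ?K"
  proof
    fix x assume x: "x \<in> insert c A"
    show "x \<in> ?K"
    proof (cases "x = c")
      case True
      have "?E (up_ring.monom (UP ?R) \<one>\<^bsub>?R\<^esub> 1) = c" by (rule U.eval_monom1[OF cS])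
      then show ?thesis using True U.monom_closed[OF R.one_closed, of 1] by (metis imageI)
    next
      case False
      then have xA: "x \<in> carrier ?R" using x by simp
      have "?E (up_ring.monom (UP ?R) x 0) = x" by (rule U.eval_const[OF cS xA])
      then show ?thesis using U.monom_closed[OF xA, of 0] by (metis imageI)
    qed
  qed
  then have surj: "?E ` carrier (UP ?R) = carrier ?S" using B(3)[OF K] KS by simp
  interpret simple_ext ?R ?S "\<lambda>x. x" "UP ?R" c ?E
    by unfold_locales (use cS surj in \<open>auto\<close>)
  have "res_finite ?S" by (rule res_finite_step[OF A(3)])
  then show ?case using B A(2) by blast
qed

section \<open>From Hopfian wreath products to direct finiteness\<close>

lemma (in ring) finite_fin_gen_add:
  assumes "finite (carrier R)" shows "fin_gen_group (add_monoid R)" "comm_group (add_monoid R)"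
proof -
  show "comm_group (add_monoid R)" by (rule a_comm_group)
  have "generate (add_monoid R) (carrier R) = carrier R"
    using add.generate_incl[of "carrier R"] by (auto intro: generate.incl)
  then show "fin_gen_group (add_monoid R)"
    using add.is_group assms unfolding fin_gen_group_def by (intro conjI exI[of _ "carrier R"]) simp_all
qed

lemma (in cring) unit_mod_notin:
  assumes I: "ideal I R" "\<one> \<notin> I" and a: "unit_mod R I a" shows "a \<notin> I"
proof
  assume aI: "a \<in> I"
  interpret I: ideal I R by fact
  obtain b where b: "a \<in> carrier R" "b \<in> carrier R" "a \<otimes> b \<ominus> \<one> \<in> I" using a by (auto simp: unit_mod_def)
  have "a \<otimes> b \<in> I" using aI b I.I_r_closed by simp
  moreover have "I +> (a \<otimes> b) = I +> \<one>" using quotient_eq_iff_same_a_r_cos[OF I(1)] b by simp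
  ultimately have "I +> \<one> = \<zero>\<^bsub>R Quot I\<^esub>" using coset_eq_zero_iff[OF I(1), of "a \<otimes> b"] b by simp
  then show False using coset_eq_zero_iff[OF I(1), of \<one>] I(2) by simp
qed

text \<open>
  Take for \<open>G\<close> the subgroup generated by the supports of \<open>x\<close> and \<open>y\<close>, and for \<open>R\<close> a suitable subring
  that contains their coefficients.
\<close>

lemma not_directly_finite_descend:
  fixes \<Gamma> :: "'c monoid" and F :: "'d ring"
  assumes gr: "group \<Gamma>" and fld: "field F"
    and x: "x \<in> carrier (group_ring F \<Gamma>)" and y: "y \<in> carrier (group_ring F \<Gamma>)"
    and xy: "x \<otimes>\<^bsub>group_ring F \<Gamma>\<^esub> y = \<one>\<^bsub>group_ring F \<Gamma>\<^esub>" and yx: "y \<otimes>\<^bsub>group_ring F \<Gamma>\<^esub> x \<noteq> \<one>\<^bsub>group_ring F \<Gamma>\<^esub>"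
  obtains G :: "'c monoid" and R :: "'d ring" and x0 y0 g
  where "fin_gen_group G" "domain R" "res_finite R"
    "x0 \<in> carrier (group_ring R G)" "y0 \<in> carrier (group_ring R G)"
    "x0 \<otimes>\<^bsub>group_ring R G\<^esub> y0 = \<one>\<^bsub>group_ring R G\<^esub>"
    "g \<in> carrier G" "(y0 \<otimes>\<^bsub>group_ring R G\<^esub> x0) g \<noteq> \<one>\<^bsub>group_ring R G\<^esub> g"
proof -
  interpret F: field F by fact
  interpret \<Gamma>: group \<Gamma> by fact
  interpret FG: grp_ring F \<Gamma> by unfold_locales
  define C where "C = x ` FG.supp x \<union> y ` FG.supp y"
  have C: "finite C" "C \<subseteq> carrier F" using x y FG.GR_closed by (auto simp: C_def FG.GR_carrier)
  obtain A where A: "subring A F" "C \<subseteq> A" "res_finite (F\<lparr>carrier := A\<rparr>)"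
    using res_finite_finitely_generated[OF F.domain_axioms C] by blast
  let ?R = "F\<lparr>carrier := A\<rparr>"
  interpret R: "domain" ?R by (rule F.subring_is_domain[OF A(1)])
  define S where "S = FG.supp x \<union> FG.supp y"
  have S: "finite S" "S \<subseteq> carrier \<Gamma>" using x y by (auto simp: S_def FG.GR_carrier)
  define G where "G = subgroup_generated \<Gamma> S"
  interpret G: group G by (simp add: G_def)
  have cG: "carrier G = generate \<Gamma> S" using S by (simp add: G_def carrier_subgroup_generated Int_absorb1)
  have SG: "S \<subseteq> carrier G" by (auto simp: cG intro: generate.incl)
  have GG: "carrier G \<subseteq> carrier \<Gamma>" unfolding cG using S(2) by (rule \<Gamma>.generate_incl)
  have fgG: "fin_gen_group G"
  proof -
    have "subgroup_generated G S = G" by (simp add: G_def)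
    then have "generate G S = carrier G"
      using carrier_subgroup_generated[of G S] SG by (simp add: Int_absorb1)
    then show ?thesis using S SG G.is_group by (auto simp: fin_gen_group_def)
  qed
  have P: "gr_push ?R G F \<Gamma> (\<lambda>u. u) (\<lambda>u. u)"
  proof (intro gr_push.intro gr_push_axioms.intro grp_ring.intro)
    show "ring ?R" "group G" "ring F" "group \<Gamma>"
      by (rule R.ring_axioms G.is_group F.ring_axioms \<Gamma>.is_group)+
    show "inj_on (\<lambda>u. u) (carrier G)" by simp
    show "(\<lambda>u. u) \<in> ring_hom ?R F" using subringE(1)[OF A(1)] by (auto simp: ring_hom_def)
    show "(\<lambda>u. u) \<in> hom G \<Gamma>" using GG by (auto simp: hom_def G_def)
  qed
  define pu where "pu = gr_push.push G F \<Gamma> (\<lambda>u::'d. u) (\<lambda>u. u)"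
  have RG: "grp_ring ?R G" using P by (simp add: gr_push_def)
  define rs where "rs f = restrict f (carrier G)" for f :: "'c \<Rightarrow> 'd"
  have rs: "rs f \<in> carrier (group_ring ?R G)" "pu (rs f) = f"
    if f: "f \<in> carrier (group_ring F \<Gamma>)" "FG.supp f \<subseteq> S" "f ` FG.supp f \<subseteq> A" for f
  proof -
    have z: "\<zero>\<^bsub>F\<^esub> \<in> A" by (rule subringE(2)[OF A(1)])
    have fA: "f u \<in> A" if "u \<in> carrier \<Gamma>" for u using that f(3) z by (cases "f u = \<zero>\<^bsub>F\<^esub>") auto
    have "finite (FG.supp f)" using f(1) by (simp add: FG.GR_carrier)
    then have "finite {u \<in> carrier G. rs f u \<noteq> \<zero>\<^bsub>F\<^esub>}"
      by (rule finite_subset[rotated]) (use GG in \<open>auto simp: rs_def\<close>)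
    then show r: "rs f \<in> carrier (group_ring ?R G)"
      using fA GG by (auto simp: grp_ring.GR_carrier[OF RG] rs_def)
    show "pu (rs f) = f"
    proof (rule FG.GR_eqI[OF gr_push.push_closed[OF P r, folded pu_def] f(1)])
      fix u assume u: "u \<in> carrier \<Gamma>"
      show "pu (rs f) u = f u"
      proof (cases "u \<in> carrier G")
        case True then show ?thesis using gr_push.push_image[OF P True, of "rs f", folded pu_def] by (simp add: rs_def)
      next
        case False
        then have "f u = \<zero>\<^bsub>F\<^esub>" using f(2) SG u by blast
        then show ?thesis using gr_push.push_off[OF P u, of "rs f", folded pu_def] False by simp
      qed
    qed
  qed
  define x0 where "x0 = rs x" define y0 where "y0 = rs y"
  have x0: "x0 \<in> carrier (group_ring ?R G)" "pu x0 = x"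
    unfolding x0_def using A(2) by (intro rs[OF x]; auto simp: S_def C_def)+
  have y0: "y0 \<in> carrier (group_ring ?R G)" "pu y0 = y"
    unfolding y0_def using A(2) by (intro rs[OF y]; auto simp: S_def C_def)+
  note xy0 = grp_ring.GR_mult_closed[OF RG x0(1) y0(1)] and yx0 = grp_ring.GR_mult_closed[OF RG y0(1) x0(1)]
  have "pu (x0 \<otimes>\<^bsub>group_ring ?R G\<^esub> y0) = \<one>\<^bsub>group_ring F \<Gamma>\<^esub>"
    using gr_push.push_mult[OF P x0(1) y0(1), folded pu_def] x0(2) y0(2) xy by simp
  then have one: "(x0 \<otimes>\<^bsub>group_ring ?R G\<^esub> y0) u = \<one>\<^bsub>group_ring ?R G\<^esub> u" if "u \<in> carrier G" for u
    using gr_push.push_eq_one_iff[OF P xy0, folded pu_def] that by blast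
  have "pu (y0 \<otimes>\<^bsub>group_ring ?R G\<^esub> x0) \<noteq> \<one>\<^bsub>group_ring F \<Gamma>\<^esub>"
    using gr_push.push_mult[OF P y0(1) x0(1), folded pu_def] x0(2) y0(2) yx by simp
  then obtain g where g: "g \<in> carrier G" "(y0 \<otimes>\<^bsub>group_ring ?R G\<^esub> x0) g \<noteq> \<one>\<^bsub>group_ring ?R G\<^esub> g"
    using gr_push.push_eq_one_iff[OF P yx0, folded pu_def] by blast
  have "x0 \<otimes>\<^bsub>group_ring ?R G\<^esub> y0 = \<one>\<^bsub>group_ring ?R G\<^esub>"
    using grp_ring.GR_eqI[OF RG xy0 grp_ring.GR_one_closed[OF RG]] one by blast
  then show ?thesis using that[OF fgG R.domain_axioms A(3) x0(1) y0(1) _ g] by blast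
qed

text \<open>
  The finite quotient ring and the Hopfian overgroup live in types of their own. Being countable, they
  have copies in the two given infinite types.
\<close>

theorem directly_finite_if_all_wreath_hopfian:
  fixes \<Gamma> :: "'c monoid" and F :: "'d ring"
  assumes inf: "infinite (UNIV :: 'a set)" "infinite (UNIV :: 'b set)"
    and hop: "\<And>(A :: 'a monoid) (\<Delta> :: 'b monoid).
            comm_group A \<Longrightarrow> fin_gen_group A \<Longrightarrow> fin_gen_group \<Delta> \<Longrightarrow> hopfian \<Delta> \<Longrightarrow>
            hopfian (wreath_product A \<Delta>)"
    and gr: "group \<Gamma>" and fld: "field F"
  shows "directly_finite (group_ring F \<Gamma>)"
  unfolding directly_finite_def
proof (intro ballI impI, rule ccontr)
  fix x y assume "x \<in> carrier (group_ring F \<Gamma>)" "y \<in> carrier (group_ring F \<Gamma>)"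
    "x \<otimes>\<^bsub>group_ring F \<Gamma>\<^esub> y = \<one>\<^bsub>group_ring F \<Gamma>\<^esub>" "y \<otimes>\<^bsub>group_ring F \<Gamma>\<^esub> x \<noteq> \<one>\<^bsub>group_ring F \<Gamma>\<^esub>"
  then obtain G :: "'c monoid" and R :: "'d ring" and x0 y0 g
  where fgG: "fin_gen_group G" and dR: "domain R" and rR: "res_finite R"
    and x0: "x0 \<in> carrier (group_ring R G)" and y0: "y0 \<in> carrier (group_ring R G)"
    and one: "x0 \<otimes>\<^bsub>group_ring R G\<^esub> y0 = \<one>\<^bsub>group_ring R G\<^esub>"
    and g: "g \<in> carrier G" "(y0 \<otimes>\<^bsub>group_ring R G\<^esub> x0) g \<noteq> \<one>\<^bsub>group_ring R G\<^esub> g"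
    using not_directly_finite_descend[OF gr fld] by blast
  interpret R: "domain" R by (rule dR)
  interpret G: group G using fgG by (simp add: fin_gen_group_def)
  have RG: "grp_ring R G" by (intro grp_ring.intro R.ring_axioms G.is_group)
  note GR_closed = grp_ring.GR_closed[OF RG grp_ring.GR_mult_closed[OF RG y0 x0] g(1)]
     grp_ring.GR_closed[OF RG grp_ring.GR_one_closed[OF RG] g(1)]
  let ?u = "(y0 \<otimes>\<^bsub>group_ring R G\<^esub> x0) g" and ?v = "\<one>\<^bsub>group_ring R G\<^esub> g"
  have uv: "?u \<in> carrier R" "?v \<in> carrier R"
    using GR_closed by auto
  have "?u \<ominus>\<^bsub>R\<^esub> ?v \<noteq> \<zero>\<^bsub>R\<^esub>" using R.r_right_minus_eq[OF uv] g(2) by blast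
  then obtain I where I: "ideal I R" "finite (carrier (R Quot I))" "\<one>\<^bsub>R\<^esub> \<notin> I" "unit_mod R I (?u \<ominus>\<^bsub>R\<^esub> ?v)"
    using rR R.minus_closed[OF uv] unfolding res_finite_def by blast
  interpret I: ideal I R by (rule I(1))
  interpret q: ring_hom_cring R "R Quot I" "(+>\<^bsub>R\<^esub>) I" by (rule I.rcos_ring_hom_cring) (rule R.is_cring)
  have ne: "I +>\<^bsub>R\<^esub> ?u \<noteq> I +>\<^bsub>R\<^esub> ?v"
    using R.unit_mod_notin[OF I(1,3,4)] R.quotient_eq_iff_same_a_r_cos[OF I(1) uv] by blast
  obtain f :: "'d set \<Rightarrow> 'a" where f: "inj_on f (carrier (R Quot I))"
    using countable_inj_into_infinite[OF countable_finite[OF I(2)] inf(1)] by blast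
  define K where "K = image_ring f (R Quot I)"
  have fK: "f \<in> ring_iso (R Quot I) K" unfolding K_def by (rule inj_imp_image_ring_iso[OF f])
  interpret K: ring K unfolding K_def by (rule q.S.inj_imp_image_ring_is_ring[OF f])
  have finK: "finite (carrier K)" using I(2) by (simp add: K_def image_ring_carrier)
  obtain Q :: "('c point \<Rightarrow> 'c point) set monoid" and j
    where Q: "fin_gen_group Q" "hopfian Q" "j \<in> hom G Q" "inj_on j (carrier G)"
    using embeds_in_hopfian[OF fgG] by blast
  interpret Q: group Q using Q(1) by (simp add: fin_gen_group_def)
  obtain e :: "('c point \<Rightarrow> 'c point) set \<Rightarrow> 'b" where e: "inj_on e (carrier Q)"
    using countable_inj_into_infinite[OF fin_gen_group_countable[OF Q(1)] inf(2)] by blast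
  define \<Delta> where "\<Delta> = image_group e Q"
  have e\<Delta>: "e \<in> iso Q \<Delta>" unfolding \<Delta>_def by (rule inj_imp_image_group_iso[OF e])
  interpret \<Delta>: group \<Delta> unfolding \<Delta>_def by (rule Q.inj_imp_image_group_is_group[OF e])
  have "hopfian (wreath_product (add_monoid K) \<Delta>)"
    using K.finite_fin_gen_add[OF finK] fin_gen_group_iso[OF Q(1) \<Delta>.is_group e\<Delta>] hopfian_iso[OF Q(2) \<Delta>.is_group e\<Delta>]
    by (intro hop)
  have KD: "grp_ring K \<Delta>" by (intro grp_ring.intro K.ring_axioms \<Delta>.is_group)
  \<comment> \<open>The assumption is applied to copies of the finite quotient ring and of the Hopfian overgroup.\<close>
  have df: "directly_finite (group_ring K \<Delta>)"
    by (rule grp_ring.directly_finite_if_hopfian_wreath[OF KD]) fact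
  let ?\<theta> = "\<lambda>u. f (I +>\<^bsub>R\<^esub> u)"
  have T: "gr_push R G K \<Delta> ?\<theta> (\<lambda>u. e (j u))"
  proof (intro gr_push.intro gr_push_axioms.intro RG KD)
    show "?\<theta> \<in> ring_hom R K"
      using ring_hom_trans[OF I.rcos_ring_hom, of f K] fK by (simp add: ring_iso_def o_def)
    show "(\<lambda>u. e (j u)) \<in> hom G \<Delta>" using hom_compose[OF Q(3), of e \<Delta>] e\<Delta> by (simp add: iso_def o_def)
    have "inj_on (e \<circ> j) (carrier G)"
      using Q(3) by (intro comp_inj_on[OF Q(4)] inj_on_subset[OF e]) (auto simp: hom_def)
    then show "inj_on (\<lambda>u. e (j u)) (carrier G)" by (simp add: o_def)
  qed
  have "?\<theta> ?u = ?\<theta> ?v"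
    using gr_push.directly_finite_pull[OF T df x0 y0 _ g(1)] one by simp
  then show False using ne inj_onD[OF f] uv by simp
qed

section \<open>Integral group rings\<close>

text \<open>
  For the second direction it is convenient to compute with integer coefficients and congruences, and
  with total functions that vanish off the group: this is the group ring over the integers modulo \<open>p\<close>
  without the quotient.
\<close>

definition fin_supp :: "('g, 'm) monoid_scheme \<Rightarrow> ('g \<Rightarrow> int) \<Rightarrow> bool" where
  "fin_supp G f \<longleftrightarrow> finite {x. f x \<noteq> 0} \<and> {x. f x \<noteq> 0} \<subseteq> carrier G"

definition conv :: "('g, 'm) monoid_scheme \<Rightarrow> ('g \<Rightarrow> int) \<Rightarrow> ('g \<Rightarrow> int) \<Rightarrow> 'g \<Rightarrow> int" where
  "conv G f g x = (if x \<in> carrier G then \<Sum>y | f y \<noteq> 0. f y * g (inv\<^bsub>G\<^esub> y \<otimes>\<^bsub>G\<^esub> x) else 0)"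

definition unit_mass :: "('g, 'm) monoid_scheme \<Rightarrow> 'g \<Rightarrow> int" where
  "unit_mass G x = (if x = \<one>\<^bsub>G\<^esub> then 1 else 0)"

definition direct_finite_mod :: "int \<Rightarrow> ('g, 'm) monoid_scheme \<Rightarrow> bool" where
  "direct_finite_mod p G \<longleftrightarrow> (\<forall>f g. fin_supp G f \<longrightarrow> fin_supp G g \<longrightarrow>
     (\<forall>x\<in>carrier G. [conv G f g x = unit_mass G x] (mod p)) \<longrightarrow>
     (\<forall>x\<in>carrier G. [conv G g f x = unit_mass G x] (mod p)))"

lemma fin_supp_finite: "fin_supp G f \<Longrightarrow> finite {x. f x \<noteq> 0}"
  by (simp add: fin_supp_def)

lemma fin_supp_off: "fin_supp G f \<Longrightarrow> x \<notin> carrier G \<Longrightarrow> f x = 0"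
  by (auto simp: fin_supp_def)

lemma fin_suppI:
  assumes "finite U" "U \<subseteq> carrier G" "\<And>x. x \<notin> U \<Longrightarrow> f x = 0" shows "fin_supp G f"
proof -
  have "{x. f x \<noteq> 0} \<subseteq> U" using assms(3) by blast
  then show ?thesis using assms(1,2) finite_subset unfolding fin_supp_def by blast
qed

lemma fin_supp_zero: "fin_supp G (\<lambda>_. 0)"
  by (simp add: fin_supp_def)

lemma fin_supp_add:
  assumes "fin_supp G f" "fin_supp G g" shows "fin_supp G (\<lambda>x. f x + g x)"
  by (rule fin_suppI[of "{x. f x \<noteq> 0} \<union> {x. g x \<noteq> 0}"]) (use assms in \<open>auto simp: fin_supp_def\<close>)

lemma fin_supp_scale:
  assumes "fin_supp G f" shows "fin_supp G (\<lambda>x. k * f x)"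
  by (rule fin_suppI[of "{x. f x \<noteq> 0}"]) (use assms in \<open>auto simp: fin_supp_def\<close>)

lemma fin_supp_diff:
  assumes "fin_supp G f" "fin_supp G g" shows "fin_supp G (\<lambda>x. f x - g x)"
  using fin_supp_add[OF assms(1) fin_supp_scale[OF assms(2), of "-1"]] by simp

lemma fin_supp_sum:
  assumes "\<And>a. a \<in> A \<Longrightarrow> fin_supp G (f a)" shows "fin_supp G (\<lambda>x. \<Sum>a\<in>A. f a x)"
  using assms by (induction A rule: infinite_finite_induct) (auto intro: fin_supp_add fin_supp_zero)

lemma fin_supp_unit_mass: "\<one>\<^bsub>G\<^esub> \<in> carrier G \<Longrightarrow> fin_supp G (unit_mass G)"
  by (rule fin_suppI[of "{\<one>\<^bsub>G\<^esub>}"]) (auto simp: unit_mass_def)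

context group begin

lemma conv_superset:
  assumes "fin_supp G f" "finite U" "{y. f y \<noteq> 0} \<subseteq> U" "x \<in> carrier G"
  shows "conv G f g x = (\<Sum>y\<in>U. f y * g (inv y \<otimes> x))"
  using assms by (auto simp: conv_def intro!: sum.mono_neutral_left)

lemma conv_off: "x \<notin> carrier G \<Longrightarrow> conv G f g x = 0"
  by (simp add: conv_def)

lemma fin_supp_conv:
  assumes f: "fin_supp G f" and g: "fin_supp G g" shows "fin_supp G (conv G f g)"
proof (rule fin_suppI)
  let ?U = "(\<lambda>(u, v). u \<otimes> v) ` ({x. f x \<noteq> 0} \<times> {x. g x \<noteq> 0})"
  show "finite ?U" using f g by (auto simp: fin_supp_def)
  show "?U \<subseteq> carrier G" using f g by (auto simp: fin_supp_def)
  fix x assume x: "x \<notin> ?U"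
  show "conv G f g x = 0"
  proof (cases "x \<in> carrier G")
    case True
    have "f y * g (inv y \<otimes> x) = 0" if "f y \<noteq> 0" for y
    proof (rule ccontr)
      assume ne: "f y * g (inv y \<otimes> x) \<noteq> 0"
      have y: "y \<in> carrier G" using that f by (auto simp: fin_supp_def)
      have "x = y \<otimes> (inv y \<otimes> x)" using y True by (simp add: m_assoc[symmetric])
      then show False using x ne that by (auto simp: image_iff)
    qed
    then show ?thesis by (simp add: conv_def)
  qed (simp add: conv_off)
qed

lemma conv_add_left:
  assumes f: "fin_supp G f" and f': "fin_supp G f'"
  shows "conv G (\<lambda>x. f x + f' x) g x = conv G f g x + conv G f' g x"
proof (cases "x \<in> carrier G")
  case True
  let ?U = "{y. f y \<noteq> 0} \<union> {y. f' y \<noteq> 0}"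
  have U: "finite ?U" using f f' by (auto simp: fin_supp_def)
  have "conv G (\<lambda>x. f x + f' x) g x = (\<Sum>y\<in>?U. (f y + f' y) * g (inv y \<otimes> x))"
    by (rule conv_superset[OF fin_supp_add[OF f f'] U _ True]) auto
  moreover have "conv G f g x = (\<Sum>y\<in>?U. f y * g (inv y \<otimes> x))" by (rule conv_superset[OF f U _ True]) auto
  moreover have "conv G f' g x = (\<Sum>y\<in>?U. f' y * g (inv y \<otimes> x))" by (rule conv_superset[OF f' U _ True]) auto
  ultimately show ?thesis by (simp add: sum.distrib distrib_right)
qed (simp add: conv_off)

lemma conv_add_right: "conv G f (\<lambda>x. g x + g' x) x = conv G f g x + conv G f g' x"
  by (simp add: conv_def sum.distrib distrib_left)

lemma conv_zero_left: "conv G (\<lambda>_. 0) g x = 0"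
  by (simp add: conv_def)

lemma conv_zero_right: "conv G f (\<lambda>_. 0) x = 0"
  by (simp add: conv_def)

lemma conv_scale_left:
  assumes f: "fin_supp G f" shows "conv G (\<lambda>x. k * f x) g x = k * conv G f g x"
proof (cases "x \<in> carrier G")
  case True
  show ?thesis
    using conv_superset[OF fin_supp_scale[OF f, of k] fin_supp_finite[OF f] _ True, of g]
      conv_superset[OF f fin_supp_finite[OF f] _ True, of g]
    by (simp add: sum_distrib_left mult_ac Collect_mono)
qed (simp add: conv_off)

lemma conv_diff_left:
  assumes f: "fin_supp G f" and f': "fin_supp G f'"
  shows "conv G (\<lambda>x. f x - f' x) g x = conv G f g x - conv G f' g x"
  using conv_add_left[OF f fin_supp_scale[OF f', of "-1"], of g x] conv_scale_left[OF f', of "-1" g x] by simp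

lemma conv_diff_right: "conv G f (\<lambda>x. g x - g' x) x = conv G f g x - conv G f g' x"
  by (simp add: conv_def sum_subtractf right_diff_distrib)

lemma conv_sum_left:
  assumes "\<And>a. a \<in> A \<Longrightarrow> fin_supp G (f a)"
  shows "conv G (\<lambda>x. \<Sum>a\<in>A. f a x) g x = (\<Sum>a\<in>A. conv G (f a) g x)"
  using assms
proof (induction A rule: infinite_finite_induct)
  case (insert a A)
  then have "conv G (\<lambda>x. f a x + (\<Sum>a\<in>A. f a x)) g x = conv G (f a) g x + conv G (\<lambda>x. \<Sum>a\<in>A. f a x) g x"
    by (intro conv_add_left fin_supp_sum) auto
  then show ?case using insert by simp
qed (simp_all add: conv_zero_left)

lemma conv_sum_right: "conv G f (\<lambda>x. \<Sum>a\<in>A. g a x) x = (\<Sum>a\<in>A. conv G f (g a) x)"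
  by (induction A rule: infinite_finite_induct) (simp_all add: conv_zero_right conv_add_right)

lemma conv_unit_left:
  assumes "x \<in> carrier G" shows "conv G (unit_mass G) g x = g x"
  using conv_superset[OF fin_supp_unit_mass, of "{\<one>}" x g] assms by (auto simp: unit_mass_def)

lemma conv_unit_right:
  assumes f: "fin_supp G f" and x: "x \<in> carrier G" shows "conv G f (unit_mass G) x = f x"
proof -
  let ?U = "insert x {y. f y \<noteq> 0}"
  have U: "finite ?U" using f by (simp add: fin_supp_def)
  have *: "inv y \<otimes> x = \<one> \<longleftrightarrow> y = x" if "y \<in> carrier G" for y
    using that x by (metis inv_solve_left one_closed r_one)
  have "conv G f (unit_mass G) x = (\<Sum>y\<in>?U. f y * unit_mass G (inv y \<otimes> x))"
    by (rule conv_superset[OF f U _ x]) auto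
  also have "\<dots> = (\<Sum>y\<in>?U. if y = x then f y else 0)"
  proof (rule sum.cong)
    fix y assume "y \<in> ?U"
    then have "y \<in> carrier G" using x f by (auto simp: fin_supp_def)
    then show "f y * unit_mass G (inv y \<otimes> x) = (if y = x then f y else 0)" by (simp add: unit_mass_def *)
  qed simp
  also have "\<dots> = f x" using U by simp
  finally show ?thesis .
qed

lemma conv_assoc:
  assumes f: "fin_supp G f" and g: "fin_supp G g"
  shows "conv G (conv G f g) h x = conv G f (conv G g h) x"
proof (cases "x \<in> carrier G")
  case x: True
  let ?F = "{x. f x \<noteq> 0}" and ?G = "{x. g x \<noteq> 0}"
  define U where "U = (\<lambda>(u, v). u \<otimes> v) ` (?F \<times> ?G)"
  have fin: "finite ?F" "finite ?G" "finite U" using f g by (auto simp: fin_supp_def U_def)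
  have Fc: "u \<in> carrier G" if "f u \<noteq> 0" for u using that f by (auto simp: fin_supp_def)
  have Gc: "u \<in> carrier G" if "g u \<noteq> 0" for u using that g by (auto simp: fin_supp_def)
  have Uc: "U \<subseteq> carrier G" using Fc Gc by (auto simp: U_def)
  have sup: "{y. conv G f g y \<noteq> 0} \<subseteq> U"
  proof
    fix y assume "y \<in> {y. conv G f g y \<noteq> 0}"
    then have y: "conv G f g y \<noteq> 0" "y \<in> carrier G" using conv_off by auto
    then obtain u where u: "f u \<noteq> 0" "g (inv u \<otimes> y) \<noteq> 0"
      unfolding conv_def by (metis (mono_tags, lifting) mem_Collect_eq mult_zero_right sum.neutral)
    have "y = u \<otimes> (inv u \<otimes> y)" using Fc[OF u(1)] y(2) by (simp add: m_assoc[symmetric])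
    then show "y \<in> U" unfolding U_def using u by (intro image_eqI[of _ _ "(u, inv u \<otimes> y)"]) auto
  qed
  have "conv G (conv G f g) h x = (\<Sum>y\<in>U. conv G f g y * h (inv y \<otimes> x))"
    by (rule conv_superset[OF fin_supp_conv[OF f g] fin(3) sup x])
  also have "\<dots> = (\<Sum>y\<in>U. \<Sum>u\<in>?F. f u * (g (inv u \<otimes> y) * h (inv y \<otimes> x)))"
    using Uc by (intro sum.cong) (auto simp: conv_def sum_distrib_right mult.assoc subset_iff)
  also have "\<dots> = (\<Sum>u\<in>?F. \<Sum>y\<in>U. f u * (g (inv u \<otimes> y) * h (inv y \<otimes> x)))" by (rule sum.swap)
  also have "\<dots> = (\<Sum>u\<in>?F. f u * conv G g h (inv u \<otimes> x))"
  proof (rule sum.cong)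
    fix u assume u: "u \<in> ?F"
    then have uc: "u \<in> carrier G" using Fc by simp
    have "(\<Sum>y\<in>U. g (inv u \<otimes> y) * h (inv y \<otimes> x)) = (\<Sum>y\<in>(\<lambda>v. u \<otimes> v) ` ?G. g (inv u \<otimes> y) * h (inv y \<otimes> x))"
    proof (rule sum.mono_neutral_right[OF fin(3)])
      show "(\<lambda>v. u \<otimes> v) ` ?G \<subseteq> U" using u by (auto simp: U_def)
      show "\<forall>i\<in>U - (\<lambda>v. u \<otimes> v) ` ?G. g (inv u \<otimes> i) * h (inv i \<otimes> x) = 0"
      proof
        fix i assume i: "i \<in> U - (\<lambda>v. u \<otimes> v) ` ?G"
        then have "i = u \<otimes> (inv u \<otimes> i)" using uc Uc by (auto simp: m_assoc[symmetric])
        then show "g (inv u \<otimes> i) * h (inv i \<otimes> x) = 0" using i by force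
      qed
    qed
    also have "\<dots> = (\<Sum>v\<in>?G. g v * h (inv v \<otimes> (inv u \<otimes> x)))"
      using uc x Gc by (subst sum.reindex) (auto simp: inj_on_def m_assoc[symmetric] inv_mult_group intro!: sum.cong)
    also have "\<dots> = conv G g h (inv u \<otimes> x)" using uc x by (simp add: conv_def)
    finally show "(\<Sum>y\<in>U. f u * (g (inv u \<otimes> y) * h (inv y \<otimes> x))) = f u * conv G g h (inv u \<otimes> x)"
      by (simp only: sum_distrib_left[symmetric])
  qed simp
  also have "\<dots> = conv G f (conv G g h) x" using x by (simp add: conv_def)
  finally show ?thesis .
qed (simp add: conv_off)

lemma conv_cong_mod:
  assumes f: "fin_supp G f" "fin_supp G f'"
    and fc: "\<And>y. y \<in> carrier G \<Longrightarrow> [f y = f' y] (mod p)" and gc: "\<And>y. y \<in> carrier G \<Longrightarrow> [g y = g' y] (mod p)"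
  shows "[conv G f g x = conv G f' g' x] (mod p)"
proof (cases "x \<in> carrier G")
  case True
  let ?U = "{y. f y \<noteq> 0} \<union> {y. f' y \<noteq> 0}"
  have U: "finite ?U" "?U \<subseteq> carrier G" using f by (auto simp: fin_supp_def)
  have "conv G f g x = (\<Sum>y\<in>?U. f y * g (inv y \<otimes> x))" by (rule conv_superset[OF f(1) U(1) _ True]) auto
  moreover have "conv G f' g' x = (\<Sum>y\<in>?U. f' y * g' (inv y \<otimes> x))" by (rule conv_superset[OF f(2) U(1) _ True]) auto
  moreover have "[(\<Sum>y\<in>?U. f y * g (inv y \<otimes> x)) = (\<Sum>y\<in>?U. f' y * g' (inv y \<otimes> x))] (mod p)"
    using U(2) True by (intro cong_sum cong_mult fc gc) (auto simp: subset_iff)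
  ultimately show ?thesis by simp
qed (simp add: conv_off)

end

lemma conv_DirProd:
  assumes G: "group G" and H: "group H" and f: "fin_supp G f" and e: "fin_supp H e"
  shows "conv (G \<times>\<times> H) (\<lambda>(x, h). f x * e h) (\<lambda>(x, h). f' x * e' h) (x, h) = conv G f f' x * conv H e e' h"
proof (cases "x \<in> carrier G \<and> h \<in> carrier H")
  case True
  interpret G: group G by fact
  interpret H: group H by fact
  interpret GH: group "G \<times>\<times> H" by (rule DirProd_group[OF G H])
  let ?U = "{x. f x \<noteq> 0} \<times> {h. e h \<noteq> 0}"
  have U: "finite ?U" "?U \<subseteq> carrier (G \<times>\<times> H)" using f e by (auto simp: fin_supp_def)
  have fs: "fin_supp (G \<times>\<times> H) (\<lambda>(x, h). f x * e h)" by (rule fin_suppI[OF U]) auto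
  have "conv (G \<times>\<times> H) (\<lambda>(x, h). f x * e h) (\<lambda>(x, h). f' x * e' h) (x, h)
     = (\<Sum>y\<in>?U. (\<lambda>(x, h). f x * e h) y * (\<lambda>(x, h). f' x * e' h) (inv\<^bsub>G \<times>\<times> H\<^esub> y \<otimes>\<^bsub>G \<times>\<times> H\<^esub> (x, h)))"
    using True by (intro GH.conv_superset[OF fs U(1)]) auto
  also have "\<dots> = (\<Sum>y\<in>?U. (f (fst y) * f' (inv\<^bsub>G\<^esub> (fst y) \<otimes>\<^bsub>G\<^esub> x)) * (e (snd y) * e' (inv\<^bsub>H\<^esub> (snd y) \<otimes>\<^bsub>H\<^esub> h)))"
    using U(2) by (intro sum.cong) (auto simp: inv_DirProd[OF G H] subset_iff)
  also have "\<dots> = conv G f f' x * conv H e e' h"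
    using True by (simp add: conv_def sum_product sum.cartesian_product case_prod_beta)
  finally show ?thesis .
next
  case False
  then show ?thesis by (auto simp: conv_def)
qed

section \<open>Matrix units in the group ring of a finite Heisenberg group\<close>

text \<open>
  The Heisenberg group over the integers modulo \<open>l\<close>. If \<open>l\<close> is congruent to 1 modulo \<open>p\<close>, its group ring
  modulo \<open>p\<close> contains matrix units of every size less than the smallest prime factor of \<open>l\<close>, without
  any need for roots of unity in the coefficients.
\<close>

definition heis :: "int \<Rightarrow> (int \<times> int \<times> int) monoid" where
  "heis l = \<lparr>carrier = {0..<l} \<times> {0..<l} \<times> {0..<l},
     monoid.mult = (\<lambda>(t, x, y) (t', x', y'). ((t + t') mod l, (x + x') mod l, (y + y' + x * t') mod l)),
     one = (0, 0, 0)\<rparr>"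

lemma heis_simps:
  "carrier (heis l) = {0..<l} \<times> {0..<l} \<times> {0..<l}"
  "(t, x, y) \<otimes>\<^bsub>heis l\<^esub> (t', x', y') = ((t + t') mod l, (x + x') mod l, (y + y' + x * t') mod l)"
  "\<one>\<^bsub>heis l\<^esub> = (0, 0, 0)"
  by (simp_all add: heis_def)

lemma mod_add_mult_left: "(a mod l + b + (c mod l) * d) mod l = (a + b + c * d) mod (l :: int)"
  by (intro mod_add_cong mod_mult_cong) simp_all

lemma mod_add_mult_right: "(b + a mod l + d * (c mod l)) mod l = (b + a + d * c) mod (l :: int)"
  by (intro mod_add_cong mod_mult_cong) simp_all

lemma heis_left_inverse:
  "((- t) mod l, (- x) mod l, (x * t - y) mod l) \<otimes>\<^bsub>heis l\<^esub> (t, x, y) = \<one>\<^bsub>heis l\<^esub>"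
  unfolding heis_simps mod_add_mult_left by (simp add: mod_simps)

lemma heis_group:
  assumes l: "l > 0" shows "group (heis l)"
proof (rule groupI)
  fix g h k assume "g \<in> carrier (heis l)" "h \<in> carrier (heis l)" "k \<in> carrier (heis l)"
  obtain t x y t' x' y' t'' x'' y'' where e: "g = (t, x, y)" "h = (t', x', y')" "k = (t'', x'', y'')"
    by (metis prod_cases3)
  show "g \<otimes>\<^bsub>heis l\<^esub> h \<otimes>\<^bsub>heis l\<^esub> k = g \<otimes>\<^bsub>heis l\<^esub> (h \<otimes>\<^bsub>heis l\<^esub> k)"
    unfolding e heis_simps mod_add_mult_left mod_add_mult_right by (simp add: mod_simps algebra_simps)
next
  fix g assume "g \<in> carrier (heis l)"
  moreover obtain t x y where e: "g = (t, x, y)" by (metis prod_cases3)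
  ultimately show "\<exists>h\<in>carrier (heis l). h \<otimes>\<^bsub>heis l\<^esub> g = \<one>\<^bsub>heis l\<^esub>"
    using l heis_left_inverse[where t=t and l=l and x=x and y=y]
    by (intro bexI[of _ "((- t) mod l, (- x) mod l, (x * t - y) mod l)"]) (auto simp: heis_simps(1))
qed (use l in \<open>auto simp: heis_simps\<close>)

lemma heis_inv:
  assumes "l > 0" "(t, x, y) \<in> carrier (heis l)"
  shows "inv\<^bsub>heis l\<^esub> (t, x, y) = ((- t) mod l, (- x) mod l, (x * t - y) mod l)"
  using assms by (intro group.inv_equality[OF heis_group heis_left_inverse]) (auto simp: heis_simps(1))

definition multiple :: "int \<Rightarrow> int \<Rightarrow> int" where
  "multiple l u = (if l dvd u then 1 else 0)"

lemma multiple_cong: "[u = v] (mod l) \<Longrightarrow> multiple l u = multiple l v"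
  by (simp add: multiple_def cong_dvd_iff)

lemma sum_multiple:
  assumes l: "l > 0" shows "(\<Sum>b\<in>{0..<l}. multiple l (b + u) * f b) = f ((- u) mod l)"
proof -
  have *: "multiple l (b + u) * f b = (if b = (- u) mod l then f b else 0)" if "b \<in> {0..<l}" for b
  proof -
    have "l dvd b + u \<longleftrightarrow> b = (- u) mod l"
      using that l by (metis add.inverse_inverse atLeastLessThan_iff diff_minus_eq_add mod_eq_dvd_iff mod_pos_pos_trivial)
    then show ?thesis by (simp add: multiple_def)
  qed
  have "(\<Sum>b\<in>{0..<l}. multiple l (b + u) * f b) = (\<Sum>b\<in>{0..<l}. if b = (- u) mod l then f b else 0)"
    using * by (intro sum.cong) auto
  also have "\<dots> = f ((- u) mod l)" using l by simp
  finally show ?thesis .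
qed

lemma sum_multiple_product:
  assumes l: "l > 0"
  shows "(\<Sum>b\<in>{0..<l}. (multiple l (b + u) - 1) * (multiple l (v - b) - 1)) = multiple l (u + v) - 2 + l"
proof -
  have s1: "(\<Sum>b\<in>{0..<l}. multiple l (b + u)) = 1" for u using sum_multiple[OF l, of u "\<lambda>_. 1"] by simp
  have "multiple l (v - b) = multiple l (b + (- v))" for b
    unfolding multiple_def by (metis add.commute diff_conv_add_uminus dvd_minus_iff minus_diff_eq)
  then have s2: "(\<Sum>b\<in>{0..<l}. multiple l (v - b)) = 1" using s1[of "- v"] by simp
  have s3: "(\<Sum>b\<in>{0..<l}. multiple l (b + u) * multiple l (v - b)) = multiple l (u + v)"
    unfolding sum_multiple[OF l] by (rule multiple_cong) (simp add: cong_def mod_simps algebra_simps)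
  have "(\<Sum>b\<in>{0..<l}. (multiple l (b + u) - 1) * (multiple l (v - b) - 1))
      = (\<Sum>b\<in>{0..<l}. multiple l (b + u) * multiple l (v - b) - multiple l (b + u) - multiple l (v - b) + 1)"
    by (intro sum.cong) (auto simp: algebra_simps)
  also have "\<dots> = multiple l (u + v) - 1 - 1 + l"
    using l by (simp add: sum.distrib sum_subtractf s1 s2 s3)
  finally show ?thesis by simp
qed

lemma sum_multiple_coprime:
  assumes l: "l > 0" and d: "coprime d l"
  shows "(\<Sum>a\<in>{0..<l}. multiple l (a * d + z)) = 1"
proof -
  obtain d' where d': "[d * d' = 1] (mod l)" using cong_solve_coprime_int[OF d] by blast
  have "multiple l (a * d + z) = multiple l (a + z * d')" for a
  proof -
    have "l dvd a * d + z \<longleftrightarrow> l dvd d * (a + z * d')"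
    proof (rule cong_dvd_iff)
      have "l dvd d * d' - 1" using d' by (simp add: cong_iff_dvd_diff)
      then have "l dvd (d * d' - 1) * (- z)" by (rule dvd_mult2)
      moreover have "a * d + z - d * (a + z * d') = (d * d' - 1) * (- z)" by (simp add: algebra_simps)
      ultimately show "[a * d + z = d * (a + z * d')] (mod l)" by (simp only: cong_iff_dvd_diff)
    qed
    also have "\<dots> \<longleftrightarrow> l dvd a + z * d'" using d by (simp add: coprime_commute coprime_dvd_mult_right_iff)
    finally show ?thesis by (simp add: multiple_def)
  qed
  then show ?thesis using sum_multiple[OF l, of "z * d'" "\<lambda>_. 1"] by simp
qed

text \<open>
  The matrix unit in position \<open>(i, j)\<close>. The element is supported on \<open>t = i - j\<close>; for \<open>i = j\<close> it is
  the difference of the averages over the subgroup \<open>{y + xj = 0}\<close> and over all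
  \<open>(x, y)\<close>. The averages need no denominators because \<open>l\<close> is congruent to 1. Conjugation by \<open>t\<close>
  permutes these subgroups.
\<close>

definition heis_unit :: "int \<Rightarrow> int \<Rightarrow> int \<Rightarrow> int \<times> int \<times> int \<Rightarrow> int" where
  "heis_unit l i j = (\<lambda>(t, x, y).
     if (t, x, y) \<in> carrier (heis l) \<and> [t = i - j] (mod l) then multiple l (y + x * j) - 1 else 0)"

lemma fin_supp_heis: "(\<And>h. h \<notin> carrier (heis l) \<Longrightarrow> f h = 0) \<Longrightarrow> fin_supp (heis l) f"
  by (rule fin_suppI[of "carrier (heis l)"]) (auto simp: heis_simps(1))

lemma fin_supp_heis_unit: "fin_supp (heis l) (heis_unit l i j)"
  by (rule fin_supp_heis) (auto simp: heis_unit_def)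

lemma conv_heis_unit:
  assumes l: "l > 0" and h: "(T, x, y) \<in> carrier (heis l)"
  shows "conv (heis l) (heis_unit l i j) (heis_unit l k m) (T, x, y) =
    (if [T = i - j + k - m] (mod l)
     then (\<Sum>a\<in>{0..<l}. multiple l (a * (j - k) + (y + x * m))) - 2 * l + l * l else 0)"
proof -
  interpret H: group "heis l" by (rule heis_group[OF l])
  define t where "t = (i - j) mod l"
  have t: "t \<in> {0..<l}" "[t = i - j] (mod l)" using l by (auto simp: t_def)
  have E1: "heis_unit l i j (t', a, b) = (if t' = t then multiple l (b + a * j) - 1 else 0)"
    if "t' \<in> {0..<l}" "a \<in> {0..<l}" "b \<in> {0..<l}" for t' a b
  proof -
    have "[t' = i - j] (mod l) \<longleftrightarrow> t' = t" using that(1) by (auto simp: t_def cong_def)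
    then show ?thesis using that by (simp add: heis_unit_def heis_simps(1))
  qed
  have E2: "heis_unit l k m (inv\<^bsub>heis l\<^esub> (t, a, b) \<otimes>\<^bsub>heis l\<^esub> (T, x, y)) =
      (if [T = i - j + k - m] (mod l) then multiple l (y + x * m - a * k - b) - 1 else 0)"
    if ab: "a \<in> {0..<l}" "b \<in> {0..<l}" for a b
  proof -
    have c: "(t, a, b) \<in> carrier (heis l)" using ab t by (simp add: heis_simps(1))
    let ?t = "(- t + T) mod l" and ?x = "(- a + x) mod l" and ?y = "(a * t - b + y - a * T) mod l"
    have "inv\<^bsub>heis l\<^esub> (t, a, b) \<otimes>\<^bsub>heis l\<^esub> (T, x, y) = (?t, ?x, ?y)"
      unfolding heis_inv[OF l c] heis_simps mod_add_mult_left by (simp add: mod_simps)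
    moreover have "(?t, ?x, ?y) \<in> carrier (heis l)" using l by (simp add: heis_simps(1))
    moreover have tT: "[?t = k - m] (mod l) \<longleftrightarrow> [T = i - j + k - m] (mod l)"
    proof -
      have "[?t = k - m] (mod l) \<longleftrightarrow> [T - t = k - m] (mod l)" by (simp add: cong_def)
      also have "\<dots> \<longleftrightarrow> [T = k - m + t] (mod l)" by (metis cong_add_rcancel diff_add_cancel)
      also have "\<dots> \<longleftrightarrow> [T = k - m + (i - j)] (mod l)"
        using t(2) by (metis cong_add_lcancel cong_sym cong_trans)
      finally show ?thesis by (simp add: algebra_simps)
    qed
    moreover have "multiple l (?y + ?x * m) = multiple l (y + x * m - a * k - b)"
      if T: "[T = i - j + k - m] (mod l)"
    proof (rule multiple_cong)
      have "[?y + ?x * m = (a * t - b + y - a * T) + (- a + x) * m] (mod l)"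
        by (intro cong_add cong_mult) (auto simp: cong_def)
      also have "(a * t - b + y - a * T) + (- a + x) * m = y + x * m - b - a * m - a * (T - t)"
        by (simp add: algebra_simps)
      also have "[\<dots> = y + x * m - b - a * m - a * (k - m)] (mod l)"
      proof -
        have "[T - t = k - m] (mod l)" using T tT by (simp add: cong_def)
        then show ?thesis by (rule cong_diff[OF cong_refl cong_scalar_left])
      qed
      also have "y + x * m - b - a * m - a * (k - m) = y + x * m - a * k - b" by (simp add: algebra_simps)
      finally show "[?y + ?x * m = y + x * m - a * k - b] (mod l)" .
    qed
    ultimately show ?thesis by (simp add: heis_unit_def)
  qed
  have "conv (heis l) (heis_unit l i j) (heis_unit l k m) (T, x, y) =
    (\<Sum>(t', a, b)\<in>{0..<l} \<times> {0..<l} \<times> {0..<l}. heis_unit l i j (t', a, b) *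
       heis_unit l k m (inv\<^bsub>heis l\<^esub> (t', a, b) \<otimes>\<^bsub>heis l\<^esub> (T, x, y)))"
    unfolding case_prod_unfold prod.collapse using h
    by (intro H.conv_superset[OF fin_supp_heis_unit]) (auto simp: heis_unit_def heis_simps(1))
  also have "\<dots> = (\<Sum>t'\<in>{0..<l}. \<Sum>a\<in>{0..<l}. \<Sum>b\<in>{0..<l}. heis_unit l i j (t', a, b) *
       heis_unit l k m (inv\<^bsub>heis l\<^esub> (t', a, b) \<otimes>\<^bsub>heis l\<^esub> (T, x, y)))"
    by (simp add: sum.cartesian_product case_prod_unfold)
  also have "\<dots> = (\<Sum>t'\<in>{0..<l}. if t' = t then (\<Sum>a\<in>{0..<l}. \<Sum>b\<in>{0..<l}. (multiple l (b + a * j) - 1) *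
       heis_unit l k m (inv\<^bsub>heis l\<^esub> (t, a, b) \<otimes>\<^bsub>heis l\<^esub> (T, x, y))) else 0)"
    by (intro sum.cong) (auto simp: E1)
  also have "\<dots> = (\<Sum>a\<in>{0..<l}. \<Sum>b\<in>{0..<l}. (multiple l (b + a * j) - 1) *
       heis_unit l k m (inv\<^bsub>heis l\<^esub> (t, a, b) \<otimes>\<^bsub>heis l\<^esub> (T, x, y)))"
    using t by simp
  also have "\<dots> = (if [T = i - j + k - m] (mod l) 
     then \<Sum>a\<in>{0..<l}. \<Sum>b\<in>{0..<l}. (multiple l (b + a * j) - 1) * (multiple l (y + x * m - a * k - b) - 1) else 0)"
    by (simp add: E2)
  also have "(\<Sum>a\<in>{0..<l}. \<Sum>b\<in>{0..<l}. (multiple l (b + a * j) - 1) * (multiple l (y + x * m - a * k - b) - 1))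
     = (\<Sum>a\<in>{0..<l}. multiple l (a * (j - k) + (y + x * m)) - 2 + l)"
    unfolding sum_multiple_product[OF l] by (intro sum.cong) (auto simp: algebra_simps)
  also have "\<dots> = (\<Sum>a\<in>{0..<l}. multiple l (a * (j - k) + (y + x * m))) - 2 * l + l * l"
    using l by (simp add: sum.distrib sum_subtractf)
  finally show ?thesis .
qed

text \<open>
  The subgroups \<open>{y + xj = 0}\<close> and \<open>{y + xk = 0}\<close> generate all pairs \<open>(x, y)\<close> if \<open>j - k\<close> is prime to \<open>l\<close>,
  so the product of the two averages is the average over everything, which the definition subtracts.
\<close>

lemma heis_matrix_units:
  assumes l: "l > 0" "[l = 1] (mod p)" and jk: "j \<noteq> k \<Longrightarrow> coprime (j - k) l"
  shows "[conv (heis l) (heis_unit l i j) (heis_unit l k m) h = (if j = k then heis_unit l i m h else 0)] (mod p)"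
proof (cases "h \<in> carrier (heis l)")
  case True
  obtain T x y where h: "h = (T, x, y)" by (metis prod_cases3)
  let ?z = "multiple l (y + x * m)"
  have ll: "[l * l = 1] (mod p)" "[2 * l = 2] (mod p)" "[l * ?z = ?z] (mod p)"
    using cong_mult[OF l(2) l(2)] cong_mult[OF _ l(2), of 2 2] cong_mult[OF l(2) cong_refl[of ?z]] by simp_all
  show ?thesis
  proof (cases "j = k")
    case jk: True
    have "[l * ?z - 2 * l + l * l = ?z - 2 + 1] (mod p)" by (intro cong_add cong_diff ll)
    then have "[l * ?z - 2 * l + l * l = ?z - 1] (mod p)" by simp
    then show ?thesis using True jk l(1) unfolding h conv_heis_unit[OF l(1) True[unfolded h]]
      by (simp add: heis_unit_def)
  next
    case False
    have "[1 - 2 * l + l * l = 1 - 2 + 1] (mod p)" by (intro cong_add cong_diff ll cong_refl)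
    then have "[1 - 2 * l + l * l = 0] (mod p)" by simp
    then show ?thesis using False unfolding h conv_heis_unit[OF l(1) True[unfolded h]]
      by (simp add: sum_multiple_coprime[OF l(1) jk[OF False]])
  qed
next
  case False
  then show ?thesis by (cases h) (auto simp: conv_def heis_unit_def)
qed

section \<open>Stable finiteness\<close>

lemma sum_pairs_diag:
  fixes f :: "'s \<Rightarrow> 's \<Rightarrow> int"
  assumes "finite S"
  shows "(\<Sum>i\<in>S. \<Sum>j\<in>S. if i = j then f i j else 0) = (\<Sum>i\<in>S. f i i)"
  using assms by (intro sum.cong) auto

text \<open>
  The index set \<open>S\<close> of the matrices is numbered by \<open>e\<close>. All differences of numbers being prime to \<open>l\<close>
  makes the matrix units orthogonal; that at least one residue is not a number makes them independent.
\<close>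

locale matrix_units =
  fixes \<Gamma> :: "('g, 'm) monoid_scheme" and l p :: int and S :: "'s set" and e :: "'s \<Rightarrow> int"
  assumes \<Gamma>: "group \<Gamma>" and l: "l > 0" "[l = 1] (mod p)" and S: "finite S"
    and e: "\<And>i. i \<in> S \<Longrightarrow> 0 \<le> e i" "\<And>i. i \<in> S \<Longrightarrow> e i < int (card S)" "inj_on e S" and lS: "int (card S) < l"
    and cop: "\<And>i j. i \<in> S \<Longrightarrow> j \<in> S \<Longrightarrow> i \<noteq> j \<Longrightarrow> coprime (e i - e j) l"
begin

abbreviation "H \<equiv> heis l"
abbreviation "W \<equiv> \<Gamma> \<times>\<times> H"
abbreviation "E i j \<equiv> heis_unit l (e i) (e j)"

text \<open>
  The idempotent complementary to the sum of the diagonal matrix units. Adding it to an embedded matrix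
  makes the embedding unital.
\<close>

definition D :: "int \<times> int \<times> int \<Rightarrow> int" where "D h = unit_mass H h - (\<Sum>i\<in>S. E i i h)"

definition tens :: "('g \<Rightarrow> int) \<Rightarrow> (int \<times> int \<times> int \<Rightarrow> int) \<Rightarrow> 'g \<times> int \<times> int \<times> int \<Rightarrow> int" where
  "tens f u = (\<lambda>(x, h). f x * u h)"

definition embed :: "('s \<Rightarrow> 's \<Rightarrow> 'g \<Rightarrow> int) \<Rightarrow> 'g \<times> int \<times> int \<times> int \<Rightarrow> int" where
  "embed t x = (\<Sum>(i, j)\<in>S \<times> S. tens (t i j) (E i j) x) + tens (unit_mass \<Gamma>) D x"

definition mmult :: "('s \<Rightarrow> 's \<Rightarrow> 'g \<Rightarrow> int) \<Rightarrow> ('s \<Rightarrow> 's \<Rightarrow> 'g \<Rightarrow> int) \<Rightarrow> 's \<Rightarrow> 's \<Rightarrow> 'g \<Rightarrow> int" where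
  "mmult t r i k x = (\<Sum>j\<in>S. conv \<Gamma> (t i j) (r j k) x)"

definition mone :: "'s \<Rightarrow> 's \<Rightarrow> 'g \<Rightarrow> int" where
  "mone i j x = (if i = j then unit_mass \<Gamma> x else 0)"

lemma H_group: "group H" by (rule heis_group[OF l(1)])
lemma W_group: "group W" by (rule DirProd_group[OF \<Gamma> H_group])

lemma fin_supp_D: "fin_supp H D"
  unfolding D_def[abs_def] using H_group
  by (intro fin_supp_diff fin_supp_sum fin_supp_heis_unit fin_supp_unit_mass) (simp add: group.is_monoid)

lemma fin_supp_tens:
  assumes "fin_supp \<Gamma> f" "fin_supp H u" shows "fin_supp W (tens f u)"
  by (rule fin_suppI[of "{x. f x \<noteq> 0} \<times> {h. u h \<noteq> 0}"]) (use assms in \<open>auto simp: fin_supp_def tens_def\<close>)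

lemma fin_supp_one: "fin_supp \<Gamma> (unit_mass \<Gamma>)"
  using \<Gamma> by (intro fin_supp_unit_mass) (simp add: group.is_monoid)

lemma fin_supp_embed_sum:
  assumes "\<And>i j. i \<in> S \<Longrightarrow> j \<in> S \<Longrightarrow> fin_supp \<Gamma> (t i j)"
  shows "fin_supp W (\<lambda>x. \<Sum>(i, j)\<in>S \<times> S. tens (t i j) (E i j) x)"
  unfolding case_prod_unfold using assms
  by (intro fin_supp_sum fin_supp_tens fin_supp_heis_unit) auto

lemma fin_supp_embed:
  assumes "\<And>i j. i \<in> S \<Longrightarrow> j \<in> S \<Longrightarrow> fin_supp \<Gamma> (t i j)"
  shows "fin_supp W (embed t)"
  unfolding embed_def[abs_def] using assms
  by (intro fin_supp_add fin_supp_embed_sum fin_supp_tens fin_supp_D fin_supp_one)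

lemma conv_tens:
  assumes "fin_supp \<Gamma> f" "fin_supp H u"
  shows "conv W (tens f u) (tens f' u') (x, h) = conv \<Gamma> f f' x * conv H u u' h"
  unfolding tens_def by (rule conv_DirProd[OF \<Gamma> H_group assms])

lemma EE:
  assumes "j \<in> S" "k \<in> S"
  shows "[conv H (E i j) (E k m) h = (if j = k then E i m h else 0)] (mod p)"
proof -
  have "e j = e k \<longleftrightarrow> j = k" using e(3) assms by (auto dest: inj_onD)
  then show ?thesis using heis_matrix_units[OF l, of "e j" "e k" "e i" "e m" h] cop[OF assms] by auto
qed

lemma ED:
  assumes "j \<in> S" shows "[conv H (E i j) D h = 0] (mod p)"
proof (cases "h \<in> carrier H")
  case True
  have "conv H (E i j) D h = E i j h - (\<Sum>k\<in>S. conv H (E i j) (E k k) h)"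
    unfolding D_def[abs_def] group.conv_diff_right[OF H_group] group.conv_sum_right[OF H_group]
      group.conv_unit_right[OF H_group fin_supp_heis_unit True] ..
  also have "[\<dots> = E i j h - (\<Sum>k\<in>S. if j = k then E i k h else 0)] (mod p)"
    using assms by (intro cong_diff cong_sum cong_refl EE)
  also have "E i j h - (\<Sum>k\<in>S. if j = k then E i k h else 0) = 0" using S assms by simp
  finally show ?thesis .
qed (simp add: conv_def)

lemma DE:
  assumes "k \<in> S" shows "[conv H D (E k m) h = 0] (mod p)"
proof (cases "h \<in> carrier H")
  case True
  have u: "fin_supp H (unit_mass H)" using H_group by (intro fin_supp_unit_mass) (simp add: group.is_monoid)
  have "conv H D (E k m) h = E k m h - (\<Sum>i\<in>S. conv H (E i i) (E k m) h)"
    unfolding D_def[abs_def] 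
    by (simp add: group.conv_diff_left[OF H_group u fin_supp_sum] fin_supp_heis_unit
      group.conv_sum_left[OF H_group] group.conv_unit_left[OF H_group True])
  also have "[\<dots> = E k m h - (\<Sum>i\<in>S. if i = k then E i m h else 0)] (mod p)"
    using assms by (intro cong_diff cong_sum cong_refl EE)
  also have "E k m h - (\<Sum>i\<in>S. if i = k then E i m h else 0) = 0" using S assms by simp
  finally show ?thesis .
qed (simp add: conv_def)

lemma DD: "[conv H D D h = D h] (mod p)"
proof (cases "h \<in> carrier H")
  case True
  have u: "fin_supp H (unit_mass H)" using H_group by (intro fin_supp_unit_mass) (simp add: group.is_monoid)
  have "conv H D D h = conv H (\<lambda>h. unit_mass H h - (\<Sum>i\<in>S. E i i h)) D h"
    by (simp add: D_def[abs_def])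
  also have "\<dots> = D h - (\<Sum>i\<in>S. conv H (E i i) D h)"
    by (simp add: group.conv_diff_left[OF H_group u fin_supp_sum] fin_supp_heis_unit
      group.conv_sum_left[OF H_group] group.conv_unit_left[OF H_group True])
  also have "[\<dots> = D h - (\<Sum>i\<in>S. 0)] (mod p)"
    by (intro cong_diff cong_sum cong_refl ED)
  finally show ?thesis by simp
next
  case False
  then have "D h = 0" using fin_supp_off[OF fin_supp_D] by blast
  then show ?thesis using False by (simp add: conv_def)
qed

lemma embed_mult:
  assumes t: "\<And>i j. i \<in> S \<Longrightarrow> j \<in> S \<Longrightarrow> fin_supp \<Gamma> (t i j)" 
    and r: "\<And>i j. i \<in> S \<Longrightarrow> j \<in> S \<Longrightarrow> fin_supp \<Gamma> (r i j)"
  shows "[conv W (embed t) (embed r) (x, h) = embed (mmult t r) (x, h)] (mod p)"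
proof (cases "(x, h) \<in> carrier W")
  case True
  then have xh: "x \<in> carrier \<Gamma>" "h \<in> carrier H" by auto
  interpret W: group W by (rule W_group)
  let ?P = "S \<times> S"
  let ?T = "\<lambda>t x. \<Sum>a\<in>?P. tens (t (fst a) (snd a)) (E (fst a) (snd a)) x"
  let ?d = "tens (unit_mass \<Gamma>) D"
  have em: "embed t = (\<lambda>x. ?T t x + ?d x)" for t
    by (simp add: embed_def fun_eq_iff case_prod_unfold)
  have fsT: "fin_supp W (?T t)" using fin_supp_embed_sum[OF t] by (simp add: case_prod_unfold)
  have fsd: "fin_supp W ?d" by (intro fin_supp_tens fin_supp_D fin_supp_one)
  have fsa: "fin_supp W (tens (t (fst a) (snd a)) (E (fst a) (snd a)))" if "a \<in> ?P" for a
    using that t by (intro fin_supp_tens fin_supp_heis_unit) auto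
  have ct: "conv W (tens (t (fst a) (snd a)) (E (fst a) (snd a))) (tens f u) (x, h)
      = conv \<Gamma> (t (fst a) (snd a)) f x * conv H (E (fst a) (snd a)) u h" if "a \<in> ?P" for a f u
    using that t by (intro conv_tens fin_supp_heis_unit) auto
  have cd: "conv W ?d (tens f u) (x, h) = conv \<Gamma> (unit_mass \<Gamma>) f x * conv H D u h" for f u
    by (intro conv_tens fin_supp_D fin_supp_one)
  let ?c = "\<lambda>a b. conv \<Gamma> (t (fst a) (snd a)) (r (fst b) (snd b)) x"
  let ?E = "\<lambda>a. E (fst a) (snd a)"
  have e0: "conv W (embed t) (embed r) (x, h) =
    conv W (?T t) (?T r) (x, h) + conv W (?T t) ?d (x, h) + (conv W ?d (?T r) (x, h) + conv W ?d ?d (x, h))"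
    unfolding em by (simp only: W.conv_add_left[OF fsT fsd] W.conv_add_right)
  have e1: "conv W (?T t) (?T r) (x, h) = (\<Sum>a\<in>?P. \<Sum>b\<in>?P. ?c a b * conv H (?E a) (?E b) h)"
    using fsa by (simp add: W.conv_sum_left W.conv_sum_right ct) (rule sum.swap)
  have e2: "conv W (?T t) ?d (x, h) = (\<Sum>a\<in>?P. conv \<Gamma> (t (fst a) (snd a)) (unit_mass \<Gamma>) x * conv H (?E a) D h)"
    using fsa by (simp add: W.conv_sum_left ct)
  have e3: "conv W ?d (?T r) (x, h) = (\<Sum>b\<in>?P. conv \<Gamma> (unit_mass \<Gamma>) (r (fst b) (snd b)) x * conv H D (?E b) h)"
    by (simp add: W.conv_sum_right cd)
  have e4: "conv W ?d ?d (x, h) = unit_mass \<Gamma> x * conv H D D h"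
    by (simp add: cd group.conv_unit_left[OF \<Gamma> xh(1)])
  have "[conv W (embed t) (embed r) (x, h) =
      (\<Sum>a\<in>?P. \<Sum>b\<in>?P. ?c a b * (if snd a = fst b then E (fst a) (snd b) h else 0))
     + (\<Sum>a\<in>?P. conv \<Gamma> (t (fst a) (snd a)) (unit_mass \<Gamma>) x * 0)
     + ((\<Sum>b\<in>?P. conv \<Gamma> (unit_mass \<Gamma>) (r (fst b) (snd b)) x * 0) + unit_mass \<Gamma> x * D h)] (mod p)"
    unfolding e0 e1 e2 e3 e4 by (intro cong_add cong_sum cong_mult cong_refl EE ED DE DD) auto
  moreover have "(\<Sum>a\<in>?P. \<Sum>b\<in>?P. ?c a b * (if snd a = fst b then E (fst a) (snd b) h else 0)) = ?T (mmult t r) (x, h)"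
  proof -
    have pr: "(\<Sum>i\<in>S. \<Sum>j\<in>S. g i j) = (\<Sum>a\<in>?P. g (fst a) (snd a))" for g :: "'s \<Rightarrow> 's \<Rightarrow> int"
      by (simp add: sum.cartesian_product case_prod_unfold)
    have sw: "(\<Sum>k\<in>S. \<Sum>m\<in>S. c k m * (if j = k then w m else 0)) =
        (\<Sum>m\<in>S. \<Sum>k\<in>S. if j = k then c k m * w m else 0)" for c :: "'s \<Rightarrow> 's \<Rightarrow> int" and w j
      by (rule trans[OF sum.swap]) (auto intro!: sum.cong)
    have "(\<Sum>a\<in>?P. \<Sum>b\<in>?P. ?c a b * (if snd a = fst b then E (fst a) (snd b) h else 0))
    = (\<Sum>i\<in>S. \<Sum>j\<in>S. \<Sum>k\<in>S. \<Sum>m\<in>S. conv \<Gamma> (t i j) (r k m) x * (if j = k then E i m h else 0))"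
      by (simp only: pr)
  also have "\<dots> = (\<Sum>i\<in>S. \<Sum>j\<in>S. \<Sum>m\<in>S. \<Sum>k\<in>S. if j = k then conv \<Gamma> (t i j) (r k m) x * E i m h else 0)"
    by (simp only: sw)
  also have "\<dots> = (\<Sum>i\<in>S. \<Sum>j\<in>S. \<Sum>m\<in>S. conv \<Gamma> (t i j) (r j m) x * E i m h)"
    using S by (intro sum.cong) auto
  also have "\<dots> = (\<Sum>i\<in>S. \<Sum>m\<in>S. mmult t r i m x * E i m h)"
    unfolding mmult_def sum_distrib_right by (intro sum.cong refl sum.swap)
  also have "\<dots> = ?T (mmult t r) (x, h)"
    by (simp add: sum.cartesian_product case_prod_unfold tens_def)
    finally show ?thesis .
  qed
  ultimately show ?thesis by (simp add: em tens_def)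
next
  case False
  have 1: "conv W (embed t) (embed r) (x, h) = 0" using False unfolding conv_def by (rule if_not_P)
  have "mmult t r i j x * E i j h = 0" for i j
  proof (cases "x \<in> carrier \<Gamma>")
    case True
    then show ?thesis using False fin_supp_off[OF fin_supp_heis_unit, of h l] by auto
  qed (simp add: mmult_def conv_def)
  moreover have "unit_mass \<Gamma> x * D h = 0"
    using False fin_supp_off[OF fin_supp_one, of x] fin_supp_off[OF fin_supp_D, of h] by auto
  ultimately have "embed (mmult t r) (x, h) = 0"
    unfolding embed_def tens_def case_prod_unfold fst_conv snd_conv by (simp only: sum.neutral_const add_0)
  then show ?thesis using 1 by simp
qed

lemma embed_one: "embed mone x = unit_mass W x"
proof -
  obtain g h where x: "x = (g, h)" by (cases x)
  have "(\<Sum>(i, j)\<in>S \<times> S. tens (mone i j) (E i j) (g, h)) = (\<Sum>i\<in>S. \<Sum>j\<in>S. if i = j then unit_mass \<Gamma> g * E i j h else 0)"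
    unfolding sum.cartesian_product by (intro sum.cong) (auto simp: tens_def mone_def)
  also have "\<dots> = unit_mass \<Gamma> g * (\<Sum>i\<in>S. E i i h)" using S by (simp add: sum_pairs_diag sum_distrib_left)
  finally show ?thesis by (simp add: x embed_def tens_def D_def algebra_simps unit_mass_def)
qed

lemma embed_cong:
  assumes "\<And>i j x. i \<in> S \<Longrightarrow> j \<in> S \<Longrightarrow> x \<in> carrier \<Gamma> \<Longrightarrow> [t i j x = t' i j x] (mod p)" and x: "x \<in> carrier W"
  shows "[embed t x = embed t' x] (mod p)"
  unfolding embed_def tens_def case_prod_unfold
  using x by (intro cong_add cong_sum cong_mult cong_refl assms) auto

text \<open>
  The matrix unit in position \<open>(i, j)\<close> takes the value 0 at \<open>(e i - e j, 1, - e j)\<close>, the others with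
  the same difference of indices take the value -1 there. Since all of them take the value -1 at
  \<open>(e i - e j, 1, - card S)\<close>, subtracting the two relations isolates one coefficient.
\<close>

lemma units_independent:
  assumes v: "\<And>h. h \<in> carrier H \<Longrightarrow> [(\<Sum>i\<in>S. \<Sum>j\<in>S. v i j * E i j h) = 0] (mod p)"
    and i0: "i0 \<in> S" and j0: "j0 \<in> S"
  shows "[v i0 j0 = 0] (mod p)"
proof -
  define t where "t = (e i0 - e j0) mod l"
  define w where "w = (\<Sum>i\<in>S. \<Sum>j\<in>S. if [t = e i - e j] (mod l) then v i j else 0)"
  have ev: "(\<Sum>i\<in>S. \<Sum>j\<in>S. v i j * E i j (t, 1 mod l, (- y) mod l)) =
     (\<Sum>i\<in>S. \<Sum>j\<in>S. if [t = e i - e j] (mod l) \<and> e j = y then v i j else 0) - w"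
    if y: "0 \<le> y" "y < l" for y
  proof -
    have "v i j * E i j (t, 1 mod l, (- y) mod l) =
       (if [t = e i - e j] (mod l) \<and> e j = y then v i j else 0) - (if [t = e i - e j] (mod l) then v i j else 0)"
      if ij: "i \<in> S" "j \<in> S" for i j
    proof -
      have "multiple l ((- y) mod l + (1 mod l) * e j) = multiple l (e j - y)"
      proof (rule multiple_cong)
        have "[(- y) mod l + (1 mod l) * e j = - y + 1 * e j] (mod l)"
          by (intro cong_add cong_mult) (simp_all add: cong_def)
        then show "[(- y) mod l + (1 mod l) * e j = e j - y] (mod l)" by simp
      qed
      also have "\<dots> = (if e j = y then 1 else 0)"
      proof -
        have "l dvd e j - y \<longleftrightarrow> e j = y"
        proof
          assume "l dvd e j - y"
          then have "e j mod l = y mod l" by (simp add: mod_eq_dvd_iff)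
          then show "e j = y" using y e(1,2)[OF ij(2)] lS by simp
        qed simp
        then show ?thesis by (simp add: multiple_def)
      qed
      finally show ?thesis using l(1) by (simp add: heis_unit_def heis_simps(1) t_def)
    qed
    then show ?thesis unfolding w_def sum_subtractf[symmetric] by (intro sum.cong) auto
  qed
  have inH: "(t, 1 mod l, (- y) mod l) \<in> carrier H" for y using l(1) by (simp add: heis_simps(1) t_def)
  have n0: "e j \<noteq> int (card S)" if "j \<in> S" for j using e(2)[OF that] by simp
  have "[(\<Sum>i\<in>S. \<Sum>j\<in>S. if [t = e i - e j] (mod l) \<and> e j = int (card S) then v i j else 0) - w = 0] (mod p)"
    unfolding ev[OF of_nat_0_le_iff lS, symmetric] by (rule v[OF inH])
  moreover have "(\<Sum>i\<in>S. \<Sum>j\<in>S. if [t = e i - e j] (mod l) \<and> e j = int (card S) then v i j else 0) = 0"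
    using n0 by (intro sum.neutral) auto
  ultimately have w: "[- w = 0] (mod p)" by simp
  have y0: "0 \<le> e j0" "e j0 < l" using e(1,2)[OF j0] lS by auto
  have "[(\<Sum>i\<in>S. \<Sum>j\<in>S. if [t = e i - e j] (mod l) \<and> e j = e j0 then v i j else 0) - w = 0] (mod p)"
    unfolding ev[OF y0, symmetric] by (rule v[OF inH])
  also have "(\<Sum>i\<in>S. \<Sum>j\<in>S. if [t = e i - e j] (mod l) \<and> e j = e j0 then v i j else 0)
     = (\<Sum>i\<in>S. \<Sum>j\<in>S. if i = i0 \<and> j = j0 then v i j else 0)"
  proof (intro sum.cong refl)
    fix i j assume ij: "i \<in> S" "j \<in> S"
    have "[t = e i - e j] (mod l) \<and> e j = e j0 \<longleftrightarrow> i = i0 \<and> j = j0"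
    proof
      assume a: "[t = e i - e j] (mod l) \<and> e j = e j0"
      then have "[e i0 - e j0 = e i - e j0] (mod l)" by (simp add: t_def cong_def)
      then have "[e i0 = e i] (mod l)" by (metis cong_add_rcancel diff_add_cancel)
      then have "e i0 = e i" using e(1,2)[OF i0] e(1,2)[OF ij(1)] lS by (simp add: cong_def)
      then show "i = i0 \<and> j = j0" using a e(3) i0 j0 ij by (auto dest: inj_onD)
    qed (simp add: t_def cong_def)
    then show "(if [t = e i - e j] (mod l) \<and> e j = e j0 then v i j else 0) = (if i = i0 \<and> j = j0 then v i j else 0)" by simp
  qed
  also have "\<dots> = (\<Sum>i\<in>S. if i = i0 then (\<Sum>j\<in>S. if j = j0 then v i j else 0) else 0)"
    by (intro sum.cong) auto
  also have "\<dots> = v i0 j0" using S i0 j0 by simp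
  finally have "[v i0 j0 - w = 0] (mod p)" .
  then have "[(v i0 j0 - w) - (- w) = 0 - 0] (mod p)" using w by (intro cong_diff)
  then have "[(v i0 j0 - w) - (- w) + (- w) = 0 - 0 + 0] (mod p)" using w by (intro cong_add)
  moreover have "[w = 0] (mod p)" using w by (simp add: cong_0_iff)
  ultimately show ?thesis using \<open>[v i0 j0 - w = 0] (mod p)\<close> cong_add[of "v i0 j0 - w" 0 p w 0] by simp
qed

text \<open>
  Embed both matrices in the group ring of \<open>\<Gamma> \<times> H\<close>, swap the factors there by direct finiteness, and read
  off the entries.
\<close>

theorem stable_from_direct:
  assumes df: "direct_finite_mod p W"
    and t: "\<And>i j. i \<in> S \<Longrightarrow> j \<in> S \<Longrightarrow> fin_supp \<Gamma> (t i j)" 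
    and r: "\<And>i j. i \<in> S \<Longrightarrow> j \<in> S \<Longrightarrow> fin_supp \<Gamma> (r i j)"
    and tr: "\<And>i k x. i \<in> S \<Longrightarrow> k \<in> S \<Longrightarrow> x \<in> carrier \<Gamma> \<Longrightarrow> [mmult t r i k x = mone i k x] (mod p)"
    and ik: "i \<in> S" "k \<in> S" and x: "x \<in> carrier \<Gamma>"
  shows "[mmult r t i k x = mone i k x] (mod p)"
proof -
  have *: "[conv W (embed t) (embed r) z = unit_mass W z] (mod p)" if z: "z \<in> carrier W" for z
  proof -
    obtain y h where zz: "z = (y, h)" by (cases z)
    have "[conv W (embed t) (embed r) z = embed (mmult t r) z] (mod p)"
      unfolding zz by (rule embed_mult[OF t r])
    moreover have "[embed (mmult t r) z = embed mone z] (mod p)" by (rule embed_cong[OF tr z])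
    ultimately show ?thesis unfolding embed_one by (rule cong_trans)
  qed
  have rt: "[conv W (embed r) (embed t) z = unit_mass W z] (mod p)" if "z \<in> carrier W" for z
  proof -
    have "fin_supp W (embed t)" "fin_supp W (embed r)" using t r by (auto intro: fin_supp_embed)
    then show ?thesis using df that * unfolding direct_finite_mod_def by blast
  qed
  have "[(\<Sum>i\<in>S. \<Sum>j\<in>S. (mmult r t i j x - mone i j x) * E i j h) = 0] (mod p)" if h: "h \<in> carrier H" for h
  proof -
    have z: "(x, h) \<in> carrier W" using x h by simp
    have "[embed (mmult r t) (x, h) = conv W (embed r) (embed t) (x, h)] (mod p)"
      by (rule cong_sym[OF embed_mult[OF r t]])
    moreover have "[conv W (embed r) (embed t) (x, h) = embed mone (x, h)] (mod p)"
      unfolding embed_one by (rule rt[OF z])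
    ultimately have "[embed (mmult r t) (x, h) = embed mone (x, h)] (mod p)" by (rule cong_trans)
    then have "[embed (mmult r t) (x, h) - embed mone (x, h) = 0] (mod p)" by (simp add: cong_diff_iff_cong_0)
    moreover have "embed (mmult r t) (x, h) - embed mone (x, h) = (\<Sum>i\<in>S. \<Sum>j\<in>S. (mmult r t i j x - mone i j x) * E i j h)"
      by (simp add: embed_def tens_def sum.cartesian_product case_prod_unfold sum_subtractf left_diff_distrib)
    ultimately show ?thesis by simp
  qed
  from units_independent[OF this ik] show ?thesis by (simp add: cong_diff_iff_cong_0)
qed

end

text \<open>
  It remains to choose the parameter of the Heisenberg group in terms of the size of the matrices.
\<close>

theorem stable_finite_mod:
  fixes \<Gamma> :: "('g, 'm) monoid_scheme" and S :: "'s set"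
  assumes \<Gamma>: "group \<Gamma>" and p: "p > 0" and S: "finite S"
    and df: "\<And>l. l > 0 \<Longrightarrow> direct_finite_mod p (\<Gamma> \<times>\<times> heis l)"
    and t: "\<And>i j. i \<in> S \<Longrightarrow> j \<in> S \<Longrightarrow> fin_supp \<Gamma> (t i j)" 
    and r: "\<And>i j. i \<in> S \<Longrightarrow> j \<in> S \<Longrightarrow> fin_supp \<Gamma> (r i j)"
    and tr: "\<And>i k x. i \<in> S \<Longrightarrow> k \<in> S \<Longrightarrow> x \<in> carrier \<Gamma> \<Longrightarrow>
       [(\<Sum>j\<in>S. conv \<Gamma> (t i j) (r j k) x) = (if i = k then unit_mass \<Gamma> x else 0)] (mod p)"
    and ik: "i \<in> S" "k \<in> S" and x: "x \<in> carrier \<Gamma>"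
  shows "[(\<Sum>j\<in>S. conv \<Gamma> (r i j) (t j k) x) = (if i = k then unit_mass \<Gamma> x else 0)] (mod p)"
proof -
  define n where "n = card S"
  \<comment> \<open>Then \<open>l\<close> is congruent to 1 modulo \<open>p\<close>, exceeds \<open>n\<close>, and is prime to all nonzero integers of absolute
    value at most \<open>n\<close>.\<close>
  define l where "l = 1 + p * fact n * (int n + 1)"
  have l: "l > 0" "[l = 1] (mod p)" using p by (auto simp: l_def cong_iff_dvd_diff intro!: add_pos_nonneg)
  obtain f where f: "bij_betw f S {0..<n}" using ex_bij_betw_finite_nat[OF S] unfolding n_def by blast
  define e where "e i = int (f i)" for i
  have ef: "f i < n" if "i \<in> S" for i using f that by (auto simp: bij_betw_def)
  have einj: "inj_on e S" using f by (auto simp: e_def bij_betw_def inj_on_def)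
  interpret matrix_units \<Gamma> l p S e
  proof (rule matrix_units.intro)
    show "group \<Gamma>" "l > 0" "[l = 1] (mod p)" "finite S" "inj_on e S" by fact+
    show "0 \<le> e i" for i by (simp add: e_def)
    show "e i < int (card S)" if "i \<in> S" for i using ef[OF that] by (simp add: e_def n_def)
    have "(1::int) \<le> p * fact n" using p by (simp add: int_one_le_iff_zero_less)
    then have "1 * (int n + 1) \<le> p * fact n * (int n + 1)" by (intro mult_right_mono) simp_all
    then show "int (card S) < l" by (simp only: l_def n_def[symmetric] mult_1)
    fix i j assume ij: "i \<in> S" "j \<in> S" "i \<noteq> j"
    have d0: "e i - e j \<noteq> 0" using inj_onD[OF einj, of i j] ij by auto
    have "\<bar>e i - e j\<bar> \<le> int n" using ef[OF ij(1)] ef[OF ij(2)] by (auto simp: e_def)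
    then have "nat \<bar>e i - e j\<bar> dvd fact n" using d0 by (intro dvd_fact) auto
    then have "int (nat \<bar>e i - e j\<bar>) dvd int (fact n)" by (simp only: int_dvd_int_iff)
    then have "e i - e j dvd fact n" by simp
    then have d: "e i - e j dvd p * fact n * (int n + 1)" by (intro dvd_mult2 dvd_mult)
    show "coprime (e i - e j) l"
    proof (rule coprimeI)
      fix c assume c: "c dvd e i - e j" "c dvd l"
      then have "c dvd l - p * fact n * (int n + 1)" using d dvd_trans by (intro dvd_diff) blast+
      then show "c dvd 1" by (simp add: l_def)
    qed
  qed
  have "[mmult r t i k x = mone i k x] (mod p)"
  proof (rule stable_from_direct[OF df[OF l(1)] t r _ ik x])
    show "[mmult t r i k x = mone i k x] (mod p)" if "i \<in> S" "k \<in> S" "x \<in> carrier \<Gamma>" for i k x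
      unfolding mmult_def mone_def by (rule tr[OF that])
  qed
  then show ?thesis unfolding mmult_def mone_def .
qed

section \<open>Direct finiteness modulo a prime\<close>

text \<open>
  Both the prime field and the countable group \<open>G\<close> have copies in the given infinite types.
\<close>

lemma direct_finite_mod_from_fields:
  fixes p :: nat and G :: "'x monoid"
  assumes inf: "infinite (UNIV :: 'c set)" "infinite (UNIV :: 'd set)"
    and df: "\<And>(\<Gamma> :: 'c monoid) (F :: 'd ring). group \<Gamma> \<Longrightarrow> field F \<Longrightarrow> directly_finite (group_ring F \<Gamma>)"
    and p: "Factorial_Ring.prime p" and G: "group G" and cG: "countable (carrier G)"
  shows "direct_finite_mod (int p) G"
proof -
  let ?I = "Idl\<^bsub>\<Z>\<^esub> {int p}" and ?F = "ZFact (int p)"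
  have pp: "Factorial_Ring.prime (int p)" using p by simp
  have I: "ideal ?I \<Z>" by (intro int.genideal_ideal) simp
  have memI: "a \<in> ?I \<longleftrightarrow> int p dvd a" for a by (auto simp: int_Idl dvd_def mult.commute)
  define q where "q a = ?I +>\<^bsub>\<Z>\<^esub> a" for a :: int
  have qhom: "q \<in> ring_hom \<Z> ?F" unfolding q_def[abs_def] ZFact_def by (rule ideal.rcos_ring_hom[OF I])
  have qeq: "q a = q b \<longleftrightarrow> int p dvd a - b" for a b
    using ring.quotient_eq_iff_same_a_r_cos[OF int.ring_axioms I, of a b] memI[of "a - b"]
    by (simp add: q_def a_minus_def int_a_inv_eq)
  have cF: "carrier ?F = range q" by (auto simp: ZFact_def FactRing_def A_RCOSETS_def' q_def)
  interpret F: "domain" ?F by (rule ZFact_prime_is_domain[OF pp])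
  interpret q: ring_hom_ring \<Z> ?F q by (intro ring_hom_ringI2 int.ring_axioms F.ring_axioms qhom)
  have q0: "q 0 = \<zero>\<^bsub>?F\<^esub>" and q1: "q 1 = \<one>\<^bsub>?F\<^esub>" using q.hom_zero q.hom_one by simp_all
  have qm: "q (a * b) = q a \<otimes>\<^bsub>?F\<^esub> q b" for a b using q.hom_mult[of a b] by simp
  have "Units ?F = carrier ?F - {\<zero>\<^bsub>?F\<^esub>}"
  proof
    show "Units ?F \<subseteq> carrier ?F - {\<zero>\<^bsub>?F\<^esub>}"
      using F.zero_not_one by (auto simp: Units_def)
    show "carrier ?F - {\<zero>\<^bsub>?F\<^esub>} \<subseteq> Units ?F"
    proof
      fix x assume x: "x \<in> carrier ?F - {\<zero>\<^bsub>?F\<^esub>}"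
      then obtain a where a: "x = q a" using cF by blast
      then have "\<not> int p dvd a" using x qeq[of a 0] q0 by auto
      then have "coprime (int p) a" using pp prime_imp_coprime by blast
      then obtain u v where "u * int p + v * a = 1" using bezout_int[of "int p" a] by auto
      then have "q (a * v) = q 1" unfolding qeq by (intro dvdI[of _ _ "- u"]) (simp add: algebra_simps)
      then have "q a \<otimes>\<^bsub>?F\<^esub> q v = \<one>\<^bsub>?F\<^esub>" by (simp only: qm q1)
      then show "x \<in> Units ?F" using a cF F.m_comm[of "q a" "q v"] by (auto simp: Units_def)
    qed
  qed
  then have fF: "field ?F" by (rule F.cring_fieldI)
  have "countable (carrier ?F)" unfolding cF by simp
  then obtain f :: "int set \<Rightarrow> 'd" where f: "inj_on f (carrier ?F)"
    using countable_inj_into_infinite[OF _ inf(2)] by blast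
  obtain e :: "'x \<Rightarrow> 'c" where e: "inj_on e (carrier G)"
    using countable_inj_into_infinite[OF cG inf(1)] by blast
  define K where "K = image_ring f ?F"
  define \<Delta> where "\<Delta> = image_group e G"
  have fK: "field K" unfolding K_def by (rule field.inj_imp_image_ring_is_field[OF fF f])
  have rK: "ring K" using fK by (simp add: field_def domain_def cring_def)
  have gD: "group \<Delta>" unfolding \<Delta>_def by (rule group.inj_imp_image_group_is_group[OF G e])
  have fh: "f \<in> ring_hom ?F K" using inj_imp_image_ring_iso[OF f] by (simp add: K_def ring_iso_def)
  have eh: "e \<in> hom G \<Delta>" using inj_imp_image_group_iso[OF e] by (simp add: \<Delta>_def iso_def)
  have ZG: "grp_ring \<Z> G" by (intro grp_ring.intro int.ring_axioms G)
  have T: "gr_push \<Z> G K \<Delta> (\<lambda>a. f (q a)) e"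
    using ring_hom_trans[OF qhom fh]
    by (intro gr_push.intro gr_push_axioms.intro ZG grp_ring.intro rK gD eh e) (simp add: o_def)
  have feq: "f (q a) = f (q b) \<longleftrightarrow> [a = b] (mod int p)" for a b
    using inj_on_eq_iff[OF f, of "q a" "q b"] qeq[of a b] by (simp add: cF cong_iff_dvd_diff)
  define rs where "rs u = restrict u (carrier G)" for u :: "'x \<Rightarrow> int"
  have rs: "rs u \<in> carrier (group_ring \<Z> G)" if "fin_supp G u" for u
  proof -
    have "finite {x \<in> carrier G. rs u x \<noteq> 0}"
      using fin_supp_finite[OF that] by (rule finite_subset[rotated]) (auto simp: rs_def)
    then show ?thesis by (simp add: grp_ring.GR_carrier[OF ZG] rs_def)
  qed
  have rsm: "(rs u \<otimes>\<^bsub>group_ring \<Z> G\<^esub> rs v) x = conv G u v x"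
    if "fin_supp G u" "fin_supp G v" "x \<in> carrier G" for u v x
  proof -
    have s: "{y \<in> carrier G. rs u y \<noteq> 0} = {y. u y \<noteq> 0}" using that(1) by (auto simp: rs_def fin_supp_def)
    have "(rs u \<otimes>\<^bsub>group_ring \<Z> G\<^esub> rs v) x =
       (\<Sum>y | u y \<noteq> 0. rs u y * rs v (inv\<^bsub>G\<^esub> y \<otimes>\<^bsub>G\<^esub> x))"
      using grp_ring.GR_mult_eq[OF ZG rs rs that(3)] that s by (simp add: int_finsum_eq)
    also have "\<dots> = (\<Sum>y | u y \<noteq> 0. u y * v (inv\<^bsub>G\<^esub> y \<otimes>\<^bsub>G\<^esub> x))"
    proof (rule sum.cong)
      fix y assume "y \<in> {y. u y \<noteq> 0}"
      then have "y \<in> carrier G" using that(1) by (auto simp: fin_supp_def)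
      then show "rs u y * rs v (inv\<^bsub>G\<^esub> y \<otimes>\<^bsub>G\<^esub> x) = u y * v (inv\<^bsub>G\<^esub> y \<otimes>\<^bsub>G\<^esub> x)"
        using that(3) G by (simp add: rs_def group.inv_closed group.is_monoid monoid.m_closed)
    qed simp
    finally show ?thesis using that(3) by (simp add: conv_def)
  qed
  have one: "\<one>\<^bsub>group_ring \<Z> G\<^esub> x = unit_mass G x" if "x \<in> carrier G" for x
    using grp_ring.GR_one_eq[OF ZG that] by (simp add: unit_mass_def)
  have dfK: "directly_finite (group_ring K \<Delta>)" by (rule df[OF gD fK])
  show ?thesis unfolding direct_finite_mod_def
  proof (intro allI impI ballI)
    fix u v x assume u: "fin_supp G u" and v: "fin_supp G v"
      and uv: "\<forall>x\<in>carrier G. [conv G u v x = unit_mass G x] (mod int p)" and x: "x \<in> carrier G"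
    have "f (q ((rs v \<otimes>\<^bsub>group_ring \<Z> G\<^esub> rs u) x)) = f (q (\<one>\<^bsub>group_ring \<Z> G\<^esub> x))"
    proof (rule gr_push.directly_finite_pull[OF T dfK rs[OF u] rs[OF v] _ x])
      fix y assume y: "y \<in> carrier G"
      then show "f (q ((rs u \<otimes>\<^bsub>group_ring \<Z> G\<^esub> rs v) y)) = f (q (\<one>\<^bsub>group_ring \<Z> G\<^esub> y))"
        unfolding feq rsm[OF u v y] one[OF y] using uv by blast
    qed
    then show "[conv G v u x = unit_mass G x] (mod int p)" unfolding feq rsm[OF v u x] one[OF x] .
  qed
qed

section \<open>Finitely generated abelian groups\<close>

lemma (in comm_group) normal_iff_subgroup: "N \<lhd> G \<longleftrightarrow> subgroup N G"
  using subgroup_imp_normal normal_imp_subgroup by blast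

text \<open>
  By maximality \<open>a\<close> lies in the subgroup generated by \<open>N\<close> and \<open>x\<close>.
\<close>

lemma (in comm_group) max_subgroup_avoiding:
  assumes a: "a \<in> carrier G" "a \<noteq> \<one>"
  obtains N where "subgroup N G" "a \<notin> N"
    "\<And>x. x \<in> carrier G \<Longrightarrow> x \<notin> N \<Longrightarrow> \<exists>s\<in>N. \<exists>k::int. a = s \<otimes> x [^] k"
proof -
  obtain N where N: "N \<lhd> G" "a \<notin> N" "\<And>M. M \<lhd> G \<Longrightarrow> N \<subseteq> M \<Longrightarrow> M \<noteq> N \<Longrightarrow> a \<in> M"
    using max_normal_avoiding[OF is_group a] by blast
  interpret N: subgroup N G using N(1) normal_imp_subgroup by blast
  have "\<exists>s\<in>N. \<exists>k::int. a = s \<otimes> x [^] k" if x: "x \<in> carrier G" "x \<notin> N" for x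
  proof -
    define M where "M = {s \<otimes> x [^] k | s k. s \<in> N \<and> (k::int) \<in> UNIV}"
    have MI: "s \<otimes> x [^] (k::int) \<in> M" if "s \<in> N" for s k using that by (auto simp: M_def)
    have ME: "\<exists>s k. m = s \<otimes> x [^] (k::int) \<and> s \<in> N" if "m \<in> M" for m using that by (auto simp: M_def)
    have "subgroup M G"
    proof (rule subgroupI)
      show "M \<subseteq> carrier G" using x N.subset by (auto simp: M_def)
      show "M \<noteq> {}" using MI[OF N.one_closed, of 0] by blast
      show "inv m \<in> M" if mM: "m \<in> M" for m
      proof -
        obtain s and k :: int where m: "m = s \<otimes> x [^] k" "s \<in> N" using ME[OF mM] by blast
        have "inv m = inv s \<otimes> x [^] (- k)" using m x N.mem_carrier by (simp add: inv_mult int_pow_neg)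
        then show ?thesis using MI[of "inv s" "- k"] m by simp
      qed
      show "m \<otimes> m' \<in> M" if mm: "m \<in> M" "m' \<in> M" for m m'
      proof -
        obtain s and k :: int where m: "m = s \<otimes> x [^] k" "s \<in> N" using ME[OF mm(1)] by blast
        obtain s' and k' :: int where m': "m' = s' \<otimes> x [^] k'" "s' \<in> N" using ME[OF mm(2)] by blast
        have "m \<otimes> m' = (s \<otimes> s') \<otimes> x [^] (k + k')"
          using m m' x N.mem_carrier by (simp add: int_pow_mult m_ac)
        then show ?thesis using MI[of "s \<otimes> s'" "k + k'"] m m' by simp
      qed
    qed
    then have MN: "M \<lhd> G" by (simp add: normal_iff_subgroup)
    have "N \<subseteq> M"
    proof
      fix s assume s: "s \<in> N"
      have "s \<otimes> x [^] (0::int) = s" using N.mem_carrier[OF s] by simp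
      then show "s \<in> M" using MI[OF s, of 0] by simp
    qed
    moreover have "x \<in> M" using MI[OF N.one_closed, of 1] x by simp
    ultimately have "a \<in> M" using N(3)[OF MN] x by blast
    then show ?thesis using ME by blast
  qed
  then show ?thesis using that[of N] N N.subgroup_axioms by blast
qed

text \<open>
  Let \<open>N\<close> be a maximal subgroup without \<open>a\<close>. Modulo \<open>N\<close>, every element other than
  the identity has a power equal to \<open>a\<close>. So the square of \<open>a\<close> is trivial or has \<open>a\<close> as a power; in both
  cases \<open>a\<close> has finite order modulo \<open>N\<close>, and hence every element has. By finite generation some \<open>e > 0\<close> kills the quotient, while \<open>a\<close> is not in \<open>N\<close>.
\<close>

lemma (in comm_group) fin_gen_not_divisible:
  assumes fg: "fin_gen_group G" and a: "a \<in> carrier G" "a \<noteq> \<one>"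
  obtains e :: nat where "e > 0" "\<And>x. x \<in> carrier G \<Longrightarrow> a \<noteq> x [^] int e"
proof -
  obtain N where N: "subgroup N G" "a \<notin> N"
    and mono: "\<And>x. x \<in> carrier G \<Longrightarrow> x \<notin> N \<Longrightarrow> \<exists>s\<in>N. \<exists>k::int. a = s \<otimes> x [^] k"
    using max_subgroup_avoiding[OF a] by blast
  interpret N: subgroup N G by (rule N(1))
  have cancel: "y \<in> N" if "s \<otimes> y \<in> N" "s \<in> N" "y \<in> carrier G" for s y
  proof -
    have "y = inv s \<otimes> (s \<otimes> y)" using that N.mem_carrier by (simp add: m_assoc[symmetric])
    then show ?thesis using that by (metis N.m_closed N.m_inv_closed)
  qed
  have pow_in: "y [^] (k::int) \<in> N" if "y \<in> N" for y k
    by (rule subgroup_int_pow_closed[OF N(1) that])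
  have oa: "\<exists>o'::int. o' \<noteq> 0 \<and> a [^] o' \<in> N"
  proof (cases "a [^] (2::int) \<in> N")
    case False
    then obtain s and k :: int where s: "s \<in> N" "a = s \<otimes> (a [^] (2::int)) [^] k" using mono a by blast
    have "a = s \<otimes> a [^] (2 * k)" using s a by (simp add: int_pow_pow)
    then have "a \<otimes> a [^] (- (2 * k)) = s"
      using a s N.mem_carrier[OF s(1)] by (metis int_pow_closed int_pow_neg inv_solve_right)
    then have "a [^] (1 - 2 * k) = s" using a int_pow_mult[of a 1 "- (2 * k)"] by simp
    moreover have "1 - 2 * k \<noteq> 0" by presburger
    ultimately show ?thesis using s by blast
  next
    case True then show ?thesis by (intro exI[of _ 2]) simp
  qed
  then obtain o' :: int where o': "o' \<noteq> 0" "a [^] o' \<in> N" by blast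
  have tors: "\<exists>n::nat. n > 0 \<and> x [^] int n \<in> N" if x: "x \<in> carrier G" for x
  proof -
    have "\<exists>n::int. n \<noteq> 0 \<and> x [^] n \<in> N"
    proof (cases "x \<in> N")
      case True then show ?thesis using x by (intro exI[of _ 1]) simp
    next
      case False
      then obtain s and k :: int where s: "s \<in> N" "a = s \<otimes> x [^] k" using mono x by blast
      have k: "k \<noteq> 0" using s N(2) N.mem_carrier by (intro notI) auto
      have "a [^] o' = s [^] o' \<otimes> x [^] (k * o')"
        using s x N.mem_carrier[OF s(1)] by (simp add: int_pow_distrib int_pow_pow)
      then have "x [^] (k * o') \<in> N" using cancel[of "s [^] o'" "x [^] (k * o')"] o' pow_in[OF s(1)] x by simp
      then show ?thesis using k o' by (intro exI[of _ "k * o'"]) simp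
    qed
    then obtain n :: int where n: "n \<noteq> 0" "x [^] n \<in> N" by blast
    have "x [^] int (nat \<bar>n\<bar>) \<in> N"
    proof (cases "n \<ge> 0")
      case False
      then have "x [^] \<bar>n\<bar> = inv (x [^] n)" using x by (simp add: int_pow_neg)
      then show ?thesis using n by simp
    qed (use n in simp)
    then show ?thesis using n by (intro exI[of _ "nat \<bar>n\<bar>"]) auto
  qed
  obtain S where S: "S \<subseteq> carrier G" "finite S" "generate G S = carrier G"
    using fg by (auto simp: fin_gen_group_def)
  obtain n :: "'a \<Rightarrow> nat" where n: "\<And>x. x \<in> carrier G \<Longrightarrow> n x > 0 \<and> x [^] int (n x) \<in> N" using tors by metis
  define e where "e = (\<Prod>s\<in>S. n s)"
  have e0: "e > 0" unfolding e_def using n S by (intro prod_pos) auto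
  have gen: "s [^] int e \<in> N" if "s \<in> S" for s
  proof -
    have "n s dvd e" unfolding e_def using S(2) that by (rule dvd_prodI)
    then obtain d where "e = n s * d" by blast
    then have "s [^] int e = (s [^] int (n s)) [^] int d" using S that by (simp add: int_pow_pow subset_iff)
    then show ?thesis using n pow_in S that by (simp add: subset_iff)
  qed
  have "x [^] int e \<in> N" if "x \<in> carrier G" for x
  proof -
    have "x \<in> generate G S" using that S by simp
    then show ?thesis
    proof (induction rule: generate.induct)
      case (inv h)
      then have "(inv h) [^] int e = inv (h [^] int e)" using S by (simp add: int_pow_inv subset_iff)
      then show ?case using gen[OF inv] by simp
    next
      case (eng h1 h2)
      then show ?case using generate_in_carrier[OF S(1)] by (simp add: int_pow_distrib)
    qed (use gen in auto)
  qed
  then show ?thesis using that[OF e0] N(2) by metis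
qed

section \<open>Equivariant surjections of finitely supported functions\<close>

text \<open>
  The elements of \<open>B\<close> are the finitely supported configurations of lamps with states in \<open>A\<close>, placed at
  the elements of \<open>\<Gamma>\<close>.
\<close>

locale lamps = A: comm_group A + \<Gamma>: group \<Gamma> for A :: "'a monoid" and \<Gamma> :: "'g monoid"
begin

abbreviation "B \<equiv> sum_group (carrier \<Gamma>) (\<lambda>_. A)"

lemma B_carrier: "b \<in> carrier B \<longleftrightarrow> b \<in> carrier \<Gamma> \<rightarrow>\<^sub>E carrier A \<and> finite {x \<in> carrier \<Gamma>. b x \<noteq> \<one>\<^bsub>A\<^esub>}"
  by (simp add: carrier_sum_group)

lemma B_closed: "b \<in> carrier B \<Longrightarrow> x \<in> carrier \<Gamma> \<Longrightarrow> b x \<in> carrier A"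
  by (auto simp: B_carrier)

lemma B_group: "group B" by simp

lemma B_mult: "x \<in> carrier \<Gamma> \<Longrightarrow> (b \<otimes>\<^bsub>B\<^esub> b') x = b x \<otimes>\<^bsub>A\<^esub> b' x"
  by simp

lemma B_one: "x \<in> carrier \<Gamma> \<Longrightarrow> \<one>\<^bsub>B\<^esub> x = \<one>\<^bsub>A\<^esub>"
  by simp

lemma B_eqI: "b \<in> carrier B \<Longrightarrow> b' \<in> carrier B \<Longrightarrow> (\<And>x. x \<in> carrier \<Gamma> \<Longrightarrow> b x = b' x) \<Longrightarrow> b = b'"
  unfolding B_carrier by (elim conjE, rule PiE_ext)

lemma B_eval_hom: "x \<in> carrier \<Gamma> \<Longrightarrow> (\<lambda>b. b x) \<in> hom B A"
  by (intro homI) (auto simp: B_closed)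

lemma B_pow: "b \<in> carrier B \<Longrightarrow> x \<in> carrier \<Gamma> \<Longrightarrow> (b [^]\<^bsub>B\<^esub> (k::int)) x = b x [^]\<^bsub>A\<^esub> k"
  using hom_int_pow[OF B_eval_hom, of x b k] by simp

lemma B_I:
  assumes "\<And>x. x \<in> carrier \<Gamma> \<Longrightarrow> f x \<in> carrier A" "finite {x \<in> carrier \<Gamma>. f x \<noteq> \<one>\<^bsub>A\<^esub>}"
  shows "(\<lambda>x\<in>carrier \<Gamma>. f x) \<in> carrier B"
proof -
  have "{x \<in> carrier \<Gamma>. (\<lambda>x\<in>carrier \<Gamma>. f x) x \<noteq> \<one>\<^bsub>A\<^esub>} = {x \<in> carrier \<Gamma>. f x \<noteq> \<one>\<^bsub>A\<^esub>}" by auto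
  then show ?thesis using assms by (auto simp: B_carrier)
qed

lemma shift_B:
  assumes g: "g \<in> carrier \<Gamma>" and b: "b \<in> carrier B" shows "shift \<Gamma> g b \<in> carrier B"
  unfolding shift_def
proof (rule B_I)
  show "b (inv\<^bsub>\<Gamma>\<^esub> g \<otimes>\<^bsub>\<Gamma>\<^esub> x) \<in> carrier A" if "x \<in> carrier \<Gamma>" for x using that g b by (simp add: B_closed)
  have "{x \<in> carrier \<Gamma>. b (inv\<^bsub>\<Gamma>\<^esub> g \<otimes>\<^bsub>\<Gamma>\<^esub> x) \<noteq> \<one>\<^bsub>A\<^esub>} \<subseteq> (\<lambda>x. g \<otimes>\<^bsub>\<Gamma>\<^esub> x) ` {x \<in> carrier \<Gamma>. b x \<noteq> \<one>\<^bsub>A\<^esub>}"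
  proof
    fix x assume "x \<in> {x \<in> carrier \<Gamma>. b (inv\<^bsub>\<Gamma>\<^esub> g \<otimes>\<^bsub>\<Gamma>\<^esub> x) \<noteq> \<one>\<^bsub>A\<^esub>}"
    then show "x \<in> (\<lambda>x. g \<otimes>\<^bsub>\<Gamma>\<^esub> x) ` {x \<in> carrier \<Gamma>. b x \<noteq> \<one>\<^bsub>A\<^esub>}"
      using g by (intro image_eqI[of _ _ "inv\<^bsub>\<Gamma>\<^esub> g \<otimes>\<^bsub>\<Gamma>\<^esub> x"]) (auto simp: \<Gamma>.m_assoc[symmetric])
  qed
  then show "finite {x \<in> carrier \<Gamma>. b (inv\<^bsub>\<Gamma>\<^esub> g \<otimes>\<^bsub>\<Gamma>\<^esub> x) \<noteq> \<one>\<^bsub>A\<^esub>}"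
    by (rule finite_subset) (use b in \<open>auto simp: B_carrier\<close>)
qed

lemma shift_apply: "x \<in> carrier \<Gamma> \<Longrightarrow> shift \<Gamma> g b x = b (inv\<^bsub>\<Gamma>\<^esub> g \<otimes>\<^bsub>\<Gamma>\<^esub> x)"
  by (simp add: shift_def)

definition lamp :: "'g \<Rightarrow> 'a \<Rightarrow> 'g \<Rightarrow> 'a" where
  "lamp u a = (\<lambda>x\<in>carrier \<Gamma>. if x = u then a else \<one>\<^bsub>A\<^esub>)"

lemma lamp_B: "a \<in> carrier A \<Longrightarrow> lamp u a \<in> carrier B"
  unfolding lamp_def by (rule B_I) (auto intro: finite_subset[of _ "{u}"] split: if_splits)

lemma lamp_apply: "x \<in> carrier \<Gamma> \<Longrightarrow> lamp u a x = (if x = u then a else \<one>\<^bsub>A\<^esub>)"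
  by (simp add: lamp_def)

abbreviation "point \<equiv> lamp \<one>\<^bsub>\<Gamma>\<^esub>"

text \<open>
  Integer linear combinations of elements of \<open>S\<close>, written multiplicatively. Pointwise, they describe
  elements of \<open>B\<close> by families of elements of the integral group ring, one for each element of \<open>S\<close>.
\<close>

definition comb :: "'a set \<Rightarrow> ('a \<Rightarrow> int) \<Rightarrow> 'a" where
  "comb S u = finprod A (\<lambda>s. s [^]\<^bsub>A\<^esub> u s) S"

definition ev :: "'a set \<Rightarrow> ('a \<Rightarrow> 'g \<Rightarrow> int) \<Rightarrow> 'g \<Rightarrow> 'a" where
  "ev S U = (\<lambda>x\<in>carrier \<Gamma>. comb S (\<lambda>s. U s x))"

lemma comb_closed: "S \<subseteq> carrier A \<Longrightarrow> comb S u \<in> carrier A"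
  unfolding comb_def by (rule A.finprod_closed) auto

lemma comb_add: "S \<subseteq> carrier A \<Longrightarrow> comb S (\<lambda>s. u s + v s) = comb S u \<otimes>\<^bsub>A\<^esub> comb S v"
  unfolding comb_def
  by (subst A.finprod_multf[symmetric]) (auto simp: A.int_pow_mult intro!: A.finprod_cong' A.int_pow_closed)

lemma comb_cong: "S \<subseteq> carrier A \<Longrightarrow> (\<And>s. s \<in> S \<Longrightarrow> u s = v s) \<Longrightarrow> comb S u = comb S v"
  unfolding comb_def by (intro A.finprod_cong') auto

lemma comb_zero: "S \<subseteq> carrier A \<Longrightarrow> comb S (\<lambda>_. 0) = \<one>\<^bsub>A\<^esub>"
  unfolding comb_def by (simp add: A.finprod_one_eqI)

lemma comb_neg: 
  assumes S: "S \<subseteq> carrier A" shows "comb S (\<lambda>s. - u s) = inv\<^bsub>A\<^esub> comb S u"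
proof -
  have "comb S (\<lambda>s. - u s) \<otimes>\<^bsub>A\<^esub> comb S u = \<one>\<^bsub>A\<^esub>"
    using comb_add[OF S, of "\<lambda>s. - u s" u] comb_zero[OF S] by simp
  then show ?thesis using comb_closed[OF S] A.inv_equality by simp
qed

lemma comb_scale:
  assumes S: "finite S" "S \<subseteq> carrier A" shows "comb S (\<lambda>s. k * u s) = comb S u [^]\<^bsub>A\<^esub> k"
  using S unfolding comb_def
proof (induction S rule: finite_induct)
  case (insert s S)
  have sc: "s \<in> carrier A" "S \<subseteq> carrier A" using insert.prems by auto
  have "finprod A (\<lambda>s. s [^]\<^bsub>A\<^esub> (k * u s)) (insert s S) = s [^]\<^bsub>A\<^esub> (k * u s) \<otimes>\<^bsub>A\<^esub> finprod A (\<lambda>s. s [^]\<^bsub>A\<^esub> (k * u s)) S"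
    using insert.hyps sc by (intro A.finprod_insert) auto
  also have "\<dots> = (s [^]\<^bsub>A\<^esub> u s) [^]\<^bsub>A\<^esub> k \<otimes>\<^bsub>A\<^esub> (finprod A (\<lambda>s. s [^]\<^bsub>A\<^esub> u s) S) [^]\<^bsub>A\<^esub> k"
    using insert.IH sc by (simp add: A.int_pow_pow mult.commute)
  also have "\<dots> = (s [^]\<^bsub>A\<^esub> u s \<otimes>\<^bsub>A\<^esub> finprod A (\<lambda>s. s [^]\<^bsub>A\<^esub> u s) S) [^]\<^bsub>A\<^esub> k"
    using sc by (intro A.int_pow_distrib[symmetric] A.finprod_closed A.int_pow_closed) auto
  also have "s [^]\<^bsub>A\<^esub> u s \<otimes>\<^bsub>A\<^esub> finprod A (\<lambda>s. s [^]\<^bsub>A\<^esub> u s) S = finprod A (\<lambda>s. s [^]\<^bsub>A\<^esub> u s) (insert s S)"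
    using insert.hyps sc by (intro A.finprod_insert[symmetric]) auto
  finally show ?case .
qed simp

lemma comb_single:
  assumes S: "finite S" "S \<subseteq> carrier A" "s \<in> S"
  shows "comb S (\<lambda>j. if j = s then k else 0) = s [^]\<^bsub>A\<^esub> k"
proof -
  have "comb S (\<lambda>j. if j = s then k else 0) = finprod A (\<lambda>j. if s = j then j [^]\<^bsub>A\<^esub> k else \<one>\<^bsub>A\<^esub>) S"
    unfolding comb_def using S by (intro A.finprod_cong') auto
  also have "\<dots> = s [^]\<^bsub>A\<^esub> k" using S by (intro A.finprod_singleton) auto
  finally show ?thesis .
qed

definition fs :: "'a set \<Rightarrow> ('a \<Rightarrow> 'g \<Rightarrow> int) \<Rightarrow> bool" where
  "fs S U \<longleftrightarrow> (\<forall>s\<in>S. fin_supp \<Gamma> (U s))"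

lemma ev_B:
  assumes S: "finite S" "S \<subseteq> carrier A" and U: "fs S U" shows "ev S U \<in> carrier B"
  unfolding ev_def
proof (rule B_I)
  show "comb S (\<lambda>s. U s x) \<in> carrier A" for x by (rule comb_closed[OF S(2)])
  have "{x \<in> carrier \<Gamma>. comb S (\<lambda>s. U s x) \<noteq> \<one>\<^bsub>A\<^esub>} \<subseteq> (\<Union>s\<in>S. {x. U s x \<noteq> 0})"
  proof
    fix x assume "x \<in> {x \<in> carrier \<Gamma>. comb S (\<lambda>s. U s x) \<noteq> \<one>\<^bsub>A\<^esub>}"
    then show "x \<in> (\<Union>s\<in>S. {x. U s x \<noteq> 0})"
      using comb_zero[OF S(2)] comb_cong[OF S(2), of "\<lambda>s. U s x" "\<lambda>_. 0"] by auto
  qed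
  moreover have "finite (\<Union>s\<in>S. {x. U s x \<noteq> 0})" using S U by (auto simp: fs_def fin_supp_def)
  ultimately show "finite {x \<in> carrier \<Gamma>. comb S (\<lambda>s. U s x) \<noteq> \<one>\<^bsub>A\<^esub>}" by (rule finite_subset)
qed

text \<open>
  Congruence modulo the subgroup of \<open>p\<close>-th powers of \<open>B\<close>.
\<close>

definition pcong :: "int \<Rightarrow> ('g \<Rightarrow> 'a) \<Rightarrow> ('g \<Rightarrow> 'a) \<Rightarrow> bool" where
  "pcong p b b' \<longleftrightarrow> (\<exists>z\<in>carrier B. b = b' \<otimes>\<^bsub>B\<^esub> z [^]\<^bsub>B\<^esub> p)"

text \<open>
  A \<open>p\<close>-th power can be extracted pointwise because the supports are finite.
\<close>

lemma pcongI:
  assumes b: "b \<in> carrier B" "b' \<in> carrier B"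
    and e: "\<And>x. x \<in> carrier \<Gamma> \<Longrightarrow> \<exists>a\<in>carrier A. b x = b' x \<otimes>\<^bsub>A\<^esub> a [^]\<^bsub>A\<^esub> p"
  shows "pcong p b b'"
proof -
  interpret B: group B by (rule B_group)
  obtain f where f: "\<And>x. x \<in> carrier \<Gamma> \<Longrightarrow> f x \<in> carrier A \<and> b x = b' x \<otimes>\<^bsub>A\<^esub> f x [^]\<^bsub>A\<^esub> p" using e by metis
  define z where "z = (\<lambda>x\<in>carrier \<Gamma>. if b x = \<one>\<^bsub>A\<^esub> \<and> b' x = \<one>\<^bsub>A\<^esub> then \<one>\<^bsub>A\<^esub> else f x)"
  have z: "z \<in> carrier B" unfolding z_def
  proof (rule B_I)
    have "{x \<in> carrier \<Gamma>. (if b x = \<one>\<^bsub>A\<^esub> \<and> b' x = \<one>\<^bsub>A\<^esub> then \<one>\<^bsub>A\<^esub> else f x) \<noteq> \<one>\<^bsub>A\<^esub>} \<subseteq>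
       {x \<in> carrier \<Gamma>. b x \<noteq> \<one>\<^bsub>A\<^esub>} \<union> {x \<in> carrier \<Gamma>. b' x \<noteq> \<one>\<^bsub>A\<^esub>}" by auto
    then show "finite {x \<in> carrier \<Gamma>. (if b x = \<one>\<^bsub>A\<^esub> \<and> b' x = \<one>\<^bsub>A\<^esub> then \<one>\<^bsub>A\<^esub> else f x) \<noteq> \<one>\<^bsub>A\<^esub>}"
      by (rule finite_subset) (use b in \<open>auto simp: B_carrier\<close>)
  qed (use f in auto)
  have "b = b' \<otimes>\<^bsub>B\<^esub> z [^]\<^bsub>B\<^esub> p"
  proof (rule B_eqI[OF b(1)])
    show "b' \<otimes>\<^bsub>B\<^esub> z [^]\<^bsub>B\<^esub> p \<in> carrier B" using b z by (intro B.m_closed B.int_pow_closed)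
    fix x assume x: "x \<in> carrier \<Gamma>"
    have "(b' \<otimes>\<^bsub>B\<^esub> z [^]\<^bsub>B\<^esub> p) x = b' x \<otimes>\<^bsub>A\<^esub> z x [^]\<^bsub>A\<^esub> p" unfolding B_mult[OF x] B_pow[OF z x] ..
    then show "b x = (b' \<otimes>\<^bsub>B\<^esub> z [^]\<^bsub>B\<^esub> p) x" using f[OF x] x by (auto simp: z_def)
  qed
  then show ?thesis using z by (auto simp: pcong_def)
qed

lemma pcongD:
  assumes "pcong p b b'" "x \<in> carrier \<Gamma>" shows "\<exists>a\<in>carrier A. b x = b' x \<otimes>\<^bsub>A\<^esub> a [^]\<^bsub>A\<^esub> p"
proof -
  obtain z where z: "z \<in> carrier B" "b = b' \<otimes>\<^bsub>B\<^esub> z [^]\<^bsub>B\<^esub> p" using assms(1) by (auto simp: pcong_def)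
  have "b x = b' x \<otimes>\<^bsub>A\<^esub> z x [^]\<^bsub>A\<^esub> p" unfolding z(2) B_mult[OF assms(2)] B_pow[OF z(1) assms(2)] ..
  then show ?thesis using B_closed[OF z(1) assms(2)] by blast
qed

lemma pcong_trans:
  assumes c: "b \<in> carrier B" "b' \<in> carrier B" "b'' \<in> carrier B" and "pcong p b b'" "pcong p b' b''"
  shows "pcong p b b''"
proof (rule pcongI[OF c(1,3)])
  fix x assume x: "x \<in> carrier \<Gamma>"
  obtain a a' where a: "a \<in> carrier A" "b x = b' x \<otimes>\<^bsub>A\<^esub> a [^]\<^bsub>A\<^esub> p" "a' \<in> carrier A" "b' x = b'' x \<otimes>\<^bsub>A\<^esub> a' [^]\<^bsub>A\<^esub> p"
    using pcongD[OF assms(4) x] pcongD[OF assms(5) x] by blast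
  have "b x = b'' x \<otimes>\<^bsub>A\<^esub> (a' \<otimes>\<^bsub>A\<^esub> a) [^]\<^bsub>A\<^esub> p"
    using a B_closed[OF c(3) x] by (simp add: A.int_pow_distrib A.m_assoc)
  then show "\<exists>a\<in>carrier A. b x = b'' x \<otimes>\<^bsub>A\<^esub> a [^]\<^bsub>A\<^esub> p" using a by blast
qed

lemma pcong_mult:
  assumes c: "b \<in> carrier B" "b' \<in> carrier B" "d \<in> carrier B" "d' \<in> carrier B"
    and "pcong p b b'" "pcong p d d'"
  shows "pcong p (b \<otimes>\<^bsub>B\<^esub> d) (b' \<otimes>\<^bsub>B\<^esub> d')"
proof (rule pcongI)
  interpret B: group B by (rule B_group)
  show "b \<otimes>\<^bsub>B\<^esub> d \<in> carrier B" "b' \<otimes>\<^bsub>B\<^esub> d' \<in> carrier B" using c by (simp_all only: B.m_closed)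
  fix x assume x: "x \<in> carrier \<Gamma>"
  obtain a a' where a: "a \<in> carrier A" "b x = b' x \<otimes>\<^bsub>A\<^esub> a [^]\<^bsub>A\<^esub> p" "a' \<in> carrier A" "d x = d' x \<otimes>\<^bsub>A\<^esub> a' [^]\<^bsub>A\<^esub> p"
    using pcongD[OF assms(5) x] pcongD[OF assms(6) x] by blast
  have "b x \<otimes>\<^bsub>A\<^esub> d x = (b' x \<otimes>\<^bsub>A\<^esub> d' x) \<otimes>\<^bsub>A\<^esub> (a \<otimes>\<^bsub>A\<^esub> a') [^]\<^bsub>A\<^esub> p"
    using a B_closed[OF c(2) x] B_closed[OF c(4) x] by (simp add: A.int_pow_distrib A.m_ac)
  then show "\<exists>a\<in>carrier A. (b \<otimes>\<^bsub>B\<^esub> d) x = (b' \<otimes>\<^bsub>B\<^esub> d') x \<otimes>\<^bsub>A\<^esub> a [^]\<^bsub>A\<^esub> p"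
    unfolding B_mult[OF x] using a by blast
qed

lemma pcong_pow:
  assumes c: "b \<in> carrier B" "b' \<in> carrier B" and "pcong p b b'"
  shows "pcong p (b [^]\<^bsub>B\<^esub> (k::int)) (b' [^]\<^bsub>B\<^esub> k)"
proof (rule pcongI)
  interpret B: group B by (rule B_group)
  show "b [^]\<^bsub>B\<^esub> k \<in> carrier B" "b' [^]\<^bsub>B\<^esub> k \<in> carrier B" using c by (simp_all only: B.int_pow_closed)
  fix x assume x: "x \<in> carrier \<Gamma>"
  obtain a where a: "a \<in> carrier A" "b x = b' x \<otimes>\<^bsub>A\<^esub> a [^]\<^bsub>A\<^esub> p" using pcongD[OF assms(3) x] by blast
  have "b x [^]\<^bsub>A\<^esub> k = b' x [^]\<^bsub>A\<^esub> k \<otimes>\<^bsub>A\<^esub> (a [^]\<^bsub>A\<^esub> k) [^]\<^bsub>A\<^esub> p"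
    using a B_closed[OF c(2) x] by (simp add: A.int_pow_distrib A.int_pow_pow mult.commute)
  then show "\<exists>a\<in>carrier A. (b [^]\<^bsub>B\<^esub> k) x = (b' [^]\<^bsub>B\<^esub> k) x \<otimes>\<^bsub>A\<^esub> a [^]\<^bsub>A\<^esub> p"
    unfolding B_pow[OF c(1) x] B_pow[OF c(2) x] using a by blast
qed

lemma pcong_shift:
  assumes g: "g \<in> carrier \<Gamma>" and c: "b \<in> carrier B" "b' \<in> carrier B" and "pcong p b b'"
  shows "pcong p (shift \<Gamma> g b) (shift \<Gamma> g b')"
proof (rule pcongI[OF shift_B[OF g c(1)] shift_B[OF g c(2)]])
  fix x assume x: "x \<in> carrier \<Gamma>"
  then have "inv\<^bsub>\<Gamma>\<^esub> g \<otimes>\<^bsub>\<Gamma>\<^esub> x \<in> carrier \<Gamma>" using g by simp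
  from pcongD[OF assms(4) this]
  show "\<exists>a\<in>carrier A. shift \<Gamma> g b x = shift \<Gamma> g b' x \<otimes>\<^bsub>A\<^esub> a [^]\<^bsub>A\<^esub> p" unfolding shift_apply[OF x] .
qed

lemma pcong_hom:
  assumes T: "T \<in> hom B B" and c: "b \<in> carrier B" "b' \<in> carrier B" and "pcong p b b'"
  shows "pcong p (T b) (T b')"
proof -
  interpret B: group B by (rule B_group)
  obtain z where z: "z \<in> carrier B" "b = b' \<otimes>\<^bsub>B\<^esub> z [^]\<^bsub>B\<^esub> p" using assms(4) by (auto simp: pcong_def)
  have "T b = T b' \<otimes>\<^bsub>B\<^esub> T z [^]\<^bsub>B\<^esub> p"
    using hom_mult[OF T c(2) B.int_pow_closed[OF z(1)]] hom_int_pow[OF T z(1) B_group B_group] z(2) by simp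
  moreover have "T z \<in> carrier B" using T z(1) by (auto simp: hom_def)
  ultimately show ?thesis by (auto simp: pcong_def)
qed

definition generates_mod :: "int \<Rightarrow> 'a set \<Rightarrow> bool" where
  "generates_mod p S \<longleftrightarrow> finite S \<and> S \<subseteq> carrier A \<and>
     (\<forall>x\<in>carrier A. \<exists>u. \<exists>z\<in>carrier A. x = comb S u \<otimes>\<^bsub>A\<^esub> z [^]\<^bsub>A\<^esub> p)"

lemma generates_mod_exists:
  assumes "fin_gen_group A" shows "\<exists>S. generates_mod p S"
proof -
  obtain S where S: "S \<subseteq> carrier A" "finite S" "generate A S = carrier A"
    using assms by (auto simp: fin_gen_group_def)
  have "\<exists>u. x = comb S u" if "x \<in> carrier A" for x
  proof -
    have "x \<in> generate A S" using that S by simp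
    then show ?thesis
    proof (induction rule: generate.induct)
      case one show ?case using comb_zero[OF S(1)] by metis
    next
      case (incl h) 
      then have "comb S (\<lambda>j. if j = h then 1 else 0) = h" using comb_single[OF S(2,1) incl, of 1] S by auto
      then show ?case by metis
    next
      case (inv h)
      have "comb S (\<lambda>j. if j = h then -1 else 0) = inv\<^bsub>A\<^esub> h"
        using comb_single[OF S(2,1) inv, of "-1"] S inv by (auto simp: A.int_pow_neg)
      then show ?case by metis
    next
      case (eng h1 h2) then show ?case using comb_add[OF S(1)] by metis
    qed
  qed
  then have "\<exists>u. \<exists>z\<in>carrier A. x = comb S u \<otimes>\<^bsub>A\<^esub> z [^]\<^bsub>A\<^esub> p" if "x \<in> carrier A" for x
    using that comb_closed[OF S(1)] by (metis A.int_pow_one A.one_closed A.r_one)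
  then show ?thesis using S unfolding generates_mod_def by blast
qed

text \<open>
  Generating sets modulo \<open>p\<close>-th powers behave like those of a vector space: if the exponent of \<open>j\<close> in a
  relation is not divisible by \<open>p\<close>, then \<open>j\<close> is redundant.
\<close>

lemma minimal_independent:
  fixes p :: int
  assumes S: "generates_mod p S" and min: "\<And>S'. generates_mod p S' \<Longrightarrow> card S \<le> card S'"
    and p: "Factorial_Ring.prime p" and z: "z \<in> carrier A" "comb S u = z [^]\<^bsub>A\<^esub> p" and j: "j \<in> S"
  shows "p dvd u j"
proof (rule ccontr)
  assume nd: "\<not> p dvd u j"
  have Sf: "finite S" "S \<subseteq> carrier A" using S by (auto simp: generates_mod_def)
  have jA: "j \<in> carrier A" using j Sf by blast
  have "coprime p (u j)" using p nd prime_imp_coprime by blast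
  then obtain w v where wv: "w * p + v * u j = 1" using bezout_int[of p "u j"] by auto
  let ?S = "S - {j}"
  have S': "finite ?S" "?S \<subseteq> carrier A" using Sf by auto
  have split: "comb S f = comb ?S f \<otimes>\<^bsub>A\<^esub> j [^]\<^bsub>A\<^esub> f j" for f
  proof -
    have "comb (insert j ?S) f = j [^]\<^bsub>A\<^esub> f j \<otimes>\<^bsub>A\<^esub> comb ?S f"
      unfolding comb_def using S' jA by (intro A.finprod_insert) auto
    moreover have "insert j ?S = S" using j by blast
    ultimately show ?thesis using comb_closed[OF S'(2)] jA by (simp add: A.m_comm)
  qed
  let ?c = "comb ?S"
  have cc: "?c f \<in> carrier A" for f by (rule comb_closed[OF S'(2)])
  have ju: "j [^]\<^bsub>A\<^esub> u j = z [^]\<^bsub>A\<^esub> p \<otimes>\<^bsub>A\<^esub> ?c (\<lambda>s. - u s)"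
    unfolding comb_neg[OF S'(2)]
    using split[of u] z cc[of u] jA by (metis A.int_pow_closed A.inv_solve_right A.m_comm)
  have jj: "j = ?c (\<lambda>s. v * - u s) \<otimes>\<^bsub>A\<^esub> (z [^]\<^bsub>A\<^esub> v \<otimes>\<^bsub>A\<^esub> j [^]\<^bsub>A\<^esub> w) [^]\<^bsub>A\<^esub> p"
  proof -
    have "j = j [^]\<^bsub>A\<^esub> (u j * v + w * p)" using wv jA by (simp add: mult.commute add.commute)
    also have "\<dots> = (j [^]\<^bsub>A\<^esub> u j) [^]\<^bsub>A\<^esub> v \<otimes>\<^bsub>A\<^esub> (j [^]\<^bsub>A\<^esub> w) [^]\<^bsub>A\<^esub> p"
      using jA by (simp add: A.int_pow_mult A.int_pow_pow)
    also have "(j [^]\<^bsub>A\<^esub> u j) [^]\<^bsub>A\<^esub> v = (z [^]\<^bsub>A\<^esub> v) [^]\<^bsub>A\<^esub> p \<otimes>\<^bsub>A\<^esub> ?c (\<lambda>s. v * - u s)"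
      unfolding ju comb_scale[OF S'] using z cc by (simp add: A.int_pow_distrib A.int_pow_pow mult.commute)
    finally show ?thesis using z cc jA by (simp add: A.int_pow_distrib A.m_ac)
  qed
  let ?y = "z [^]\<^bsub>A\<^esub> v \<otimes>\<^bsub>A\<^esub> j [^]\<^bsub>A\<^esub> w"
  have yA: "?y \<in> carrier A" using z jA by simp
  have "generates_mod p ?S"
    unfolding generates_mod_def
  proof (intro conjI ballI S')
    fix x assume "x \<in> carrier A"
    then obtain f y where f: "y \<in> carrier A" "x = comb S f \<otimes>\<^bsub>A\<^esub> y [^]\<^bsub>A\<^esub> p" using S by (auto simp: generates_mod_def)
    have "j [^]\<^bsub>A\<^esub> f j = (?c (\<lambda>s. v * - u s) \<otimes>\<^bsub>A\<^esub> ?y [^]\<^bsub>A\<^esub> p) [^]\<^bsub>A\<^esub> f j" using jj by metis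
    also have "\<dots> = ?c (\<lambda>s. f j * (v * - u s)) \<otimes>\<^bsub>A\<^esub> (?y [^]\<^bsub>A\<^esub> f j) [^]\<^bsub>A\<^esub> p"
      unfolding comb_scale[OF S', of "f j"] using cc yA by (simp add: A.int_pow_distrib A.int_pow_pow mult.commute)
    finally have jf: "j [^]\<^bsub>A\<^esub> f j = ?c (\<lambda>s. f j * (v * - u s)) \<otimes>\<^bsub>A\<^esub> (?y [^]\<^bsub>A\<^esub> f j) [^]\<^bsub>A\<^esub> p" .
    have "x = ?c f \<otimes>\<^bsub>A\<^esub> (?c (\<lambda>s. f j * (v * - u s)) \<otimes>\<^bsub>A\<^esub> (?y [^]\<^bsub>A\<^esub> f j) [^]\<^bsub>A\<^esub> p) \<otimes>\<^bsub>A\<^esub> y [^]\<^bsub>A\<^esub> p"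
      unfolding f(2) split[of f] jf ..
    also have "\<dots> = (?c f \<otimes>\<^bsub>A\<^esub> ?c (\<lambda>s. f j * (v * - u s))) \<otimes>\<^bsub>A\<^esub> (?y [^]\<^bsub>A\<^esub> f j \<otimes>\<^bsub>A\<^esub> y) [^]\<^bsub>A\<^esub> p"
    proof -
      have d: "(?y [^]\<^bsub>A\<^esub> f j \<otimes>\<^bsub>A\<^esub> y) [^]\<^bsub>A\<^esub> p = (?y [^]\<^bsub>A\<^esub> f j) [^]\<^bsub>A\<^esub> p \<otimes>\<^bsub>A\<^esub> y [^]\<^bsub>A\<^esub> p"
        by (rule A.int_pow_distrib[OF A.int_pow_closed[OF yA] f(1)])
      have "(?y [^]\<^bsub>A\<^esub> f j) [^]\<^bsub>A\<^esub> p \<in> carrier A" by (rule A.int_pow_closed[OF A.int_pow_closed[OF yA]])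
      moreover have "y [^]\<^bsub>A\<^esub> p \<in> carrier A" by (rule A.int_pow_closed[OF f(1)])
      ultimately show ?thesis unfolding d using cc by (simp add: A.m_assoc)
    qed
    finally have "x = ?c (\<lambda>s. f s + f j * (v * - u s)) \<otimes>\<^bsub>A\<^esub> (?y [^]\<^bsub>A\<^esub> f j \<otimes>\<^bsub>A\<^esub> y) [^]\<^bsub>A\<^esub> p"
      unfolding comb_add[OF S'(2)] .
    moreover have "?y [^]\<^bsub>A\<^esub> f j \<otimes>\<^bsub>A\<^esub> y \<in> carrier A" by (rule A.m_closed[OF A.int_pow_closed[OF yA] f(1)])
    ultimately show "\<exists>u. \<exists>z\<in>carrier A. x = ?c u \<otimes>\<^bsub>A\<^esub> z [^]\<^bsub>A\<^esub> p" by blast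
  qed
  then have "card S \<le> card ?S" by (rule min)
  then show False using j Sf(1) by (metis card_Diff1_less linorder_not_less)
qed

text \<open>
  The row vector \<open>U\<close> times the matrix \<open>t\<close> over the integral group ring.
\<close>

definition act :: "'a set \<Rightarrow> ('a \<Rightarrow> 'g \<Rightarrow> int) \<Rightarrow> ('a \<Rightarrow> 'a \<Rightarrow> 'g \<Rightarrow> int) \<Rightarrow> 'a \<Rightarrow> 'g \<Rightarrow> int" where
  "act S U t k x = (\<Sum>s\<in>S. conv \<Gamma> (U s) (t s k) x)"

lemma fs_act: "fs S U \<Longrightarrow> (\<And>s. s \<in> S \<Longrightarrow> fs S (t s)) \<Longrightarrow> fs S (act S U t)"
  unfolding fs_def act_def[abs_def] by (intro ballI fin_supp_sum \<Gamma>.fin_supp_conv) auto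

lemma conv_single:
  assumes g: "g \<in> carrier \<Gamma>" and x: "x \<in> carrier \<Gamma>"
  shows "conv \<Gamma> (\<lambda>y. if y = g then k else 0) f x = k * f (inv\<^bsub>\<Gamma>\<^esub> g \<otimes>\<^bsub>\<Gamma>\<^esub> x)"
proof -
  have "fin_supp \<Gamma> (\<lambda>y. if y = g then k else 0)" by (rule fin_suppI[of "{g}"]) (use g in auto)
  moreover have "{y. (if y = g then k else 0) \<noteq> 0} \<subseteq> {g}" by auto
  ultimately show ?thesis using \<Gamma>.conv_superset[of _ "{g}" x f] x by simp
qed

text \<open>
  An equivariant homomorphism is determined by its values at the lamps at the identity, and these are
  the rows of the matrix \<open>t\<close>. The proof removes the points of the support of \<open>U\<close> one at a time.
\<close>

lemma hom_ev:
  assumes S: "finite S" "S \<subseteq> carrier A"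
    and T: "T \<in> hom B B" and eq: "\<And>g b. g \<in> carrier \<Gamma> \<Longrightarrow> b \<in> carrier B \<Longrightarrow> T (shift \<Gamma> g b) = shift \<Gamma> g (T b)"
    and t: "\<And>s. s \<in> S \<Longrightarrow> fs S (t s)" "\<And>s. s \<in> S \<Longrightarrow> pcong p (T (point s)) (ev S (t s))"
    and F: "finite F" "{(s, x). s \<in> S \<and> U s x \<noteq> 0} \<subseteq> F" and U: "fs S U"
  shows "pcong p (T (ev S U)) (ev S (act S U t))"
  using F U
proof (induction F arbitrary: U rule: finite_induct)
  case empty
  interpret B: group B by (rule B_group)
  have U0: "U s x = 0" if "s \<in> S" for s x using empty that by auto
  have e1: "ev S U = \<one>\<^bsub>B\<^esub>"
  proof (rule B_eqI[OF ev_B[OF S empty(2)] B.one_closed])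
    fix x assume x: "x \<in> carrier \<Gamma>"
    then show "ev S U x = \<one>\<^bsub>B\<^esub> x"
      using comb_cong[OF S(2), of "\<lambda>s. U s x" "\<lambda>_. 0"] comb_zero[OF S(2)] U0 by (simp add: ev_def)
  qed
  have a0: "act S U t k x = 0" for k x
  proof -
    have "U s = (\<lambda>_. 0)" if "s \<in> S" for s using U0[OF that] by auto
    then show ?thesis by (simp add: act_def \<Gamma>.conv_zero_left)
  qed
  have fa: "fs S (act S U t)" by (rule fs_act[OF empty(2) t(1)])
  have e2: "ev S (act S U t) = \<one>\<^bsub>B\<^esub>"
  proof (rule B_eqI[OF ev_B[OF S fa] B.one_closed])
    fix x assume x: "x \<in> carrier \<Gamma>"
    then show "ev S (act S U t) x = \<one>\<^bsub>B\<^esub> x"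
      using comb_zero[OF S(2)] by (simp add: ev_def a0)
  qed
  have "T \<one>\<^bsub>B\<^esub> = \<one>\<^bsub>B\<^esub>" by (rule hom_one[OF T B_group B_group])
  moreover have "pcong p \<one>\<^bsub>B\<^esub> \<one>\<^bsub>B\<^esub>"
  proof (rule pcongI[OF B.one_closed B.one_closed])
    fix x assume x: "x \<in> carrier \<Gamma>"
    show "\<exists>a\<in>carrier A. \<one>\<^bsub>B\<^esub> x = \<one>\<^bsub>B\<^esub> x \<otimes>\<^bsub>A\<^esub> a [^]\<^bsub>A\<^esub> p"
      unfolding B_one[OF x] by (intro bexI[of _ "\<one>\<^bsub>A\<^esub>"]) simp_all
  qed
  ultimately show ?case unfolding e1 e2 by (simp only:)
next
  case (insert a F)
  interpret B: group B by (rule B_group)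
  obtain s0 g0 where a: "a = (s0, g0)" by (cases a)
  show ?case
  proof (cases "s0 \<in> S \<and> U s0 g0 \<noteq> 0")
    case False
    then have "{(s, x). s \<in> S \<and> U s x \<noteq> 0} \<subseteq> F" using insert.prems(1) a by auto
    then show ?thesis by (rule insert.IH) (rule insert.prems(2))
  next
    case True
    then have s0: "s0 \<in> S" by blast
    have g0: "g0 \<in> carrier \<Gamma>" using insert.prems(2) True by (auto simp: fs_def fin_supp_def)
    have s0A: "s0 \<in> carrier A" using s0 S by blast
    define k where "k = U s0 g0"
    define U' where "U' = U(s0 := (U s0)(g0 := 0))"
    have supp': "{(s, x). s \<in> S \<and> U' s x \<noteq> 0} \<subseteq> F"
      using insert.prems(1) a by (auto simp: U'_def split: if_splits)
    have fs': "fs S U'"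
      unfolding fs_def
    proof
      fix s assume "s \<in> S"
      then have f: "fin_supp \<Gamma> (U s)" using insert.prems(2) by (simp add: fs_def)
      show "fin_supp \<Gamma> (U' s)"
        by (rule fin_suppI[of "{x. U s x \<noteq> 0}"]) (use f in \<open>auto simp: U'_def fin_supp_def\<close>)
    qed
    have Ue: "U s x = U' s x + (if s = s0 then (if x = g0 then k else 0) else 0)" for s x
      by (auto simp: U'_def k_def)
    have IH: "pcong p (T (ev S U')) (ev S (act S U' t))" by (rule insert.IH[OF supp' fs'])
    let ?d = "shift \<Gamma> g0 (point s0)"
    have pB: "point s0 \<in> carrier B" by (rule lamp_B[OF s0A])
    have dB: "?d \<in> carrier B" by (rule shift_B[OF g0 pB])
    have evU': "ev S U' \<in> carrier B" by (rule ev_B[OF S fs'])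
    have evt: "ev S (t s0) \<in> carrier B" by (rule ev_B[OF S t(1)[OF s0]])
    have Tc: "T b \<in> carrier B" if "b \<in> carrier B" for b using T that by (auto simp: hom_def)
    have inv_g0: "inv\<^bsub>\<Gamma>\<^esub> g0 \<otimes>\<^bsub>\<Gamma>\<^esub> x = \<one>\<^bsub>\<Gamma>\<^esub> \<longleftrightarrow> x = g0" if "x \<in> carrier \<Gamma>" for x
      using that g0 by (metis \<Gamma>.inv_closed \<Gamma>.inv_equality \<Gamma>.inv_inv \<Gamma>.l_inv)
    have e1: "ev S U = ev S U' \<otimes>\<^bsub>B\<^esub> ?d [^]\<^bsub>B\<^esub> k"
    proof (rule B_eqI[OF ev_B[OF S insert.prems(2)] B.m_closed[OF evU' B.int_pow_closed[OF dB]]])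
      fix x assume x: "x \<in> carrier \<Gamma>"
      have d: "?d x = (if x = g0 then s0 else \<one>\<^bsub>A\<^esub>)"
        unfolding shift_apply[OF x] using x g0 inv_g0[OF x] by (simp add: lamp_def)
      have "ev S U x = comb S (\<lambda>s. U' s x + (if s = s0 then (if x = g0 then k else 0) else 0))"
        using x by (simp add: ev_def Ue)
      also have "\<dots> = comb S (\<lambda>s. U' s x) \<otimes>\<^bsub>A\<^esub> s0 [^]\<^bsub>A\<^esub> (if x = g0 then k else 0 :: int)"
        unfolding comb_add[OF S(2)] comb_single[OF S s0] ..
      also have "\<dots> = (ev S U' \<otimes>\<^bsub>B\<^esub> ?d [^]\<^bsub>B\<^esub> k) x"
        unfolding B_mult[OF x] B_pow[OF dB x] d using x by (simp add: ev_def)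
      finally show "ev S U x = (ev S U' \<otimes>\<^bsub>B\<^esub> ?d [^]\<^bsub>B\<^esub> k) x" .
    qed
    have e2: "T (ev S U) = T (ev S U') \<otimes>\<^bsub>B\<^esub> (shift \<Gamma> g0 (T (point s0))) [^]\<^bsub>B\<^esub> k"
      unfolding e1 hom_mult[OF T evU' B.int_pow_closed[OF dB]] hom_int_pow[OF T dB B_group B_group] eq[OF g0 pB] ..
    have fa: "fs S (act S U t)" "fs S (act S U' t)" by (intro fs_act insert.prems(2) fs' t(1); assumption)+
    have e3: "ev S (act S U t) = ev S (act S U' t) \<otimes>\<^bsub>B\<^esub> (shift \<Gamma> g0 (ev S (t s0))) [^]\<^bsub>B\<^esub> k"
    proof (rule B_eqI[OF ev_B[OF S fa(1)]])
      show "ev S (act S U' t) \<otimes>\<^bsub>B\<^esub> (shift \<Gamma> g0 (ev S (t s0))) [^]\<^bsub>B\<^esub> k \<in> carrier B"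
        by (intro B.m_closed B.int_pow_closed ev_B[OF S fa(2)] shift_B[OF g0] evt)
      fix x assume x: "x \<in> carrier \<Gamma>"
      let ?gx = "inv\<^bsub>\<Gamma>\<^esub> g0 \<otimes>\<^bsub>\<Gamma>\<^esub> x"
      have gx: "?gx \<in> carrier \<Gamma>" using g0 x by simp
      have ac: "act S U t j x = act S U' t j x + k * t s0 j ?gx" for j
      proof -
        have "conv \<Gamma> (U s) (t s j) x = conv \<Gamma> (U' s) (t s j) x + (if s = s0 then k * t s0 j ?gx else 0)"
          if s: "s \<in> S" for s
        proof (cases "s = s0")
          case True
          have f1: "fin_supp \<Gamma> (U' s)" using fs' s by (simp add: fs_def)
          have f2: "fin_supp \<Gamma> (\<lambda>y. if y = g0 then k else 0)" by (rule fin_suppI[of "{g0}"]) (use g0 in auto)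
          have "U s = (\<lambda>y. U' s y + (if y = g0 then k else 0))" using Ue[of s] True by auto
          then show ?thesis
            using \<Gamma>.conv_add_left[OF f1 f2, of "t s j" x] conv_single[OF g0 x] True by simp
        next
          case False
          then show ?thesis by (simp add: U'_def)
        qed
        then have "act S U t j x = (\<Sum>s\<in>S. conv \<Gamma> (U' s) (t s j) x + (if s = s0 then k * t s0 j ?gx else 0))"
          unfolding act_def by (intro sum.cong) auto
        then show ?thesis using S s0 by (simp add: sum.distrib act_def)
      qed
      have "ev S (act S U t) x = comb S (\<lambda>j. act S U' t j x + k * t s0 j ?gx)"
        using x by (simp add: ev_def ac)
      also have "\<dots> = comb S (\<lambda>j. act S U' t j x) \<otimes>\<^bsub>A\<^esub> comb S (\<lambda>j. t s0 j ?gx) [^]\<^bsub>A\<^esub> k"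
        unfolding comb_add[OF S(2)] comb_scale[OF S] ..
      also have "\<dots> = (ev S (act S U' t) \<otimes>\<^bsub>B\<^esub> (shift \<Gamma> g0 (ev S (t s0))) [^]\<^bsub>B\<^esub> k) x"
        unfolding B_mult[OF x] B_pow[OF shift_B[OF g0 evt] x] shift_apply[OF x] using x gx by (simp add: ev_def)
      finally show "ev S (act S U t) x = (ev S (act S U' t) \<otimes>\<^bsub>B\<^esub> (shift \<Gamma> g0 (ev S (t s0))) [^]\<^bsub>B\<^esub> k) x" .
    qed
    show ?thesis unfolding e2 e3
      by (intro pcong_mult pcong_pow pcong_shift[OF g0] IH t(2)[OF s0] Tc evU' pB B.int_pow_closed
          shift_B[OF g0] evt ev_B[OF S fa(2)])
  qed
qed

text \<open>
  Choose a generating set \<open>S\<close> modulo \<open>p\<close>-th powers of least cardinality. Coordinates with respect to \<open>S\<close>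
  are then unique modulo \<open>p\<close>, and \<open>T\<close> acts on them by a matrix \<open>t\<close>. Surjectivity gives a left inverse
  \<open>r\<close> of \<open>t\<close>; by stable finiteness it is a right inverse too. So \<open>T b = 1\<close> makes the coordinates of \<open>b\<close>
  vanish modulo \<open>p\<close>.
\<close>

lemma pth_power_kernel:
  assumes fg: "fin_gen_group A" and p: "Factorial_Ring.prime (p :: int)"
    and stab: "\<And>l. l > 0 \<Longrightarrow> direct_finite_mod p (\<Gamma> \<times>\<times> heis l)"
    and T: "T \<in> hom B B" and surj: "T ` carrier B = carrier B"
    and eq: "\<And>g b. g \<in> carrier \<Gamma> \<Longrightarrow> b \<in> carrier B \<Longrightarrow> T (shift \<Gamma> g b) = shift \<Gamma> g (T b)"
    and b: "b \<in> carrier B" "T b = \<one>\<^bsub>B\<^esub>" and x: "x \<in> carrier \<Gamma>"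
  shows "\<exists>a\<in>carrier A. b x = a [^]\<^bsub>A\<^esub> p"
proof -
  interpret B: group B by (rule B_group)
  obtain S where S: "generates_mod p S" and min: "\<And>S'. generates_mod p S' \<Longrightarrow> card S \<le> card S'"
  proof -
    obtain S0 where "generates_mod p S0" using generates_mod_exists[OF fg] by blast
    from ex_has_least_nat[of "generates_mod p", OF this, of card] show ?thesis using that by blast
  qed
  have Sf: "finite S" "S \<subseteq> carrier A" using S by (auto simp: generates_mod_def)
  have Tc: "T b \<in> carrier B" if "b \<in> carrier B" for b using T that by (auto simp: hom_def)
  have rep: "\<exists>U. fs S U \<and> pcong p d (ev S U)" if d: "d \<in> carrier B" for d
  proof -
    have "\<exists>u. \<exists>z\<in>carrier A. d x = comb S u \<otimes>\<^bsub>A\<^esub> z [^]\<^bsub>A\<^esub> p" if "x \<in> carrier \<Gamma>" for x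
      using S B_closed[OF d that] unfolding generates_mod_def by blast
    then obtain u where u: "\<And>x. x \<in> carrier \<Gamma> \<Longrightarrow> \<exists>z\<in>carrier A. d x = comb S (u x) \<otimes>\<^bsub>A\<^esub> z [^]\<^bsub>A\<^esub> p" by metis
    define U where "U s x = (if x \<in> carrier \<Gamma> \<and> d x \<noteq> \<one>\<^bsub>A\<^esub> then u x s else 0)" for s x
    have fU: "fs S U" unfolding fs_def
    proof
      fix s show "fin_supp \<Gamma> (U s)"
        by (rule fin_suppI[of "{x \<in> carrier \<Gamma>. d x \<noteq> \<one>\<^bsub>A\<^esub>}"]) (use d in \<open>auto simp: U_def B_carrier\<close>)
    qed
    have "pcong p d (ev S U)"
    proof (rule pcongI[OF d ev_B[OF Sf fU]])
      fix x assume x: "x \<in> carrier \<Gamma>"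
      show "\<exists>a\<in>carrier A. d x = ev S U x \<otimes>\<^bsub>A\<^esub> a [^]\<^bsub>A\<^esub> p"
      proof (cases "d x = \<one>\<^bsub>A\<^esub>")
        case True
        then have "ev S U x = \<one>\<^bsub>A\<^esub>" using x comb_zero[OF Sf(2)] by (simp add: ev_def U_def)
        then show ?thesis using True by (intro bexI[of _ "\<one>\<^bsub>A\<^esub>"]) auto
      next
        case False
        then have "ev S U x = comb S (u x)" using x by (simp add: ev_def U_def)
        then show ?thesis using u[OF x] by simp
      qed
    qed
    then show ?thesis using fU by blast
  qed
  have indep: "[U s x = V s x] (mod p)"
    if U: "fs S U" and V: "fs S V" and c: "pcong p (ev S U) (ev S V)" and s: "s \<in> S" and x: "x \<in> carrier \<Gamma>" for U V s x
  proof -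
    obtain a where a: "a \<in> carrier A" "comb S (\<lambda>s. U s x) = comb S (\<lambda>s. V s x) \<otimes>\<^bsub>A\<^esub> a [^]\<^bsub>A\<^esub> p"
      using pcongD[OF c x] x by (auto simp: ev_def)
    have "comb S (\<lambda>s. U s x + - V s x) = comb S (\<lambda>s. U s x) \<otimes>\<^bsub>A\<^esub> inv\<^bsub>A\<^esub> comb S (\<lambda>s. V s x)"
      unfolding comb_add[OF Sf(2)] comb_neg[OF Sf(2)] ..
    also have "\<dots> = (a [^]\<^bsub>A\<^esub> p \<otimes>\<^bsub>A\<^esub> comb S (\<lambda>s. V s x)) \<otimes>\<^bsub>A\<^esub> inv\<^bsub>A\<^esub> comb S (\<lambda>s. V s x)"
      unfolding a(2) using a(1) comb_closed[OF Sf(2)] by (simp add: A.m_comm)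
    also have "\<dots> = a [^]\<^bsub>A\<^esub> p" using a(1) comb_closed[OF Sf(2)] by (simp add: A.m_assoc)
    finally have "comb S (\<lambda>s. U s x + - V s x) = a [^]\<^bsub>A\<^esub> p" .
    then have "p dvd U s x + - V s x"
      using minimal_independent[OF S min p a(1), of "\<lambda>s. U s x + - V s x" s] s by blast
    then show ?thesis by (simp add: cong_iff_dvd_diff)
  qed
  have "\<exists>t. \<forall>s\<in>S. fs S (t s) \<and> pcong p (T (point s)) (ev S (t s))"
    using rep[OF Tc[OF lamp_B]] Sf(2) by (intro bchoice) auto
  then obtain t where t: "\<And>s. s \<in> S \<Longrightarrow> fs S (t s)" "\<And>s. s \<in> S \<Longrightarrow> pcong p (T (point s)) (ev S (t s))" by blast
  have Tev: "pcong p (T (ev S U)) (ev S (act S U t))" if U: "fs S U" for U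
  proof (rule hom_ev[OF Sf T eq t _ subset_refl U])
    have "{(s, x). s \<in> S \<and> U s x \<noteq> 0} \<subseteq> (\<Union>s\<in>S. {s} \<times> {x. U s x \<noteq> 0})" by auto
    moreover have "finite (\<Union>s\<in>S. {s} \<times> {x. U s x \<noteq> 0})" using Sf U by (auto simp: fs_def fin_supp_def)
    ultimately show "finite {(s, x). s \<in> S \<and> U s x \<noteq> 0}" by (rule finite_subset)
  qed
  define one where "one i k y = (if i = k then unit_mass \<Gamma> y else 0)" for i k :: 'a and y
  have fone: "fs S (one s)" for s unfolding fs_def
  proof
    fix k show "fin_supp \<Gamma> (one s k)" unfolding one_def[abs_def]
      using fin_supp_unit_mass[of \<Gamma>] fin_supp_zero[of \<Gamma>] by (cases "s = k") simp_all
  qed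
  have pone: "point s = ev S (one s)" if s: "s \<in> S" for s
  proof (rule B_eqI[OF lamp_B ev_B[OF Sf fone]])
    show "s \<in> carrier A" using s Sf by blast
    fix y assume y: "y \<in> carrier \<Gamma>"
    have "comb S (\<lambda>k. one s k y) = comb S (\<lambda>k. if k = s then unit_mass \<Gamma> y else 0)"
      by (intro comb_cong[OF Sf(2)]) (auto simp: one_def)
    also have "\<dots> = s [^]\<^bsub>A\<^esub> unit_mass \<Gamma> y" by (rule comb_single[OF Sf s])
    finally show "point s y = ev S (one s) y" using y \<open>s \<in> carrier A\<close> by (simp add: lamp_def ev_def unit_mass_def)
  qed
  have "\<exists>r. \<forall>s\<in>S. fs S (r s) \<and> pcong p (point s) (ev S (act S (r s) t))"
  proof (intro bchoice ballI)
    fix s assume s: "s \<in> S"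
    then have sA: "s \<in> carrier A" using Sf by blast
    have "point s \<in> T ` carrier B" unfolding surj by (rule lamp_B[OF sA])
    then obtain d where d: "d \<in> carrier B" "T d = point s" by (elim imageE) simp
    obtain r where r: "fs S r" "pcong p d (ev S r)" using rep[OF d(1)] by blast
    have "pcong p (T d) (ev S (act S r t))"
      by (rule pcong_trans[OF Tc[OF d(1)] Tc[OF ev_B[OF Sf r(1)]] ev_B[OF Sf fs_act[OF r(1) t(1)]]
          pcong_hom[OF T d(1) ev_B[OF Sf r(1)] r(2)] Tev[OF r(1)]])
    then show "\<exists>r. fs S r \<and> pcong p (point s) (ev S (act S r t))" using r d by auto
  qed
  then obtain r where r: "\<And>s. s \<in> S \<Longrightarrow> fs S (r s)" "\<And>s. s \<in> S \<Longrightarrow> pcong p (point s) (ev S (act S (r s) t))" by blast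
  have rt: "[(\<Sum>j\<in>S. conv \<Gamma> (r i j) (t j k) y) = (if i = k then unit_mass \<Gamma> y else 0)] (mod p)"
    if "i \<in> S" "k \<in> S" "y \<in> carrier \<Gamma>" for i k y
  proof -
    have fa: "fs S (act S (r i) t)" by (rule fs_act[OF r(1)[OF that(1)] t(1)])
    have "pcong p (ev S (one i)) (ev S (act S (r i) t))" using r(2)[OF that(1)] pone[OF that(1)] by simp
    then have "[one i k y = act S (r i) t k y] (mod p)"
      by (rule indep[OF fone fa _ that(2,3)])
    then show ?thesis unfolding act_def one_def by (rule cong_sym)
  qed
  have frt: "fin_supp \<Gamma> (r i j)" "fin_supp \<Gamma> (t i j)" if "i \<in> S" "j \<in> S" for i j
    using r(1)[OF that(1)] t(1)[OF that(1)] that(2) by (auto simp: fs_def)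
  \<comment> \<open>Stable finiteness turns the left inverse into a right inverse.\<close>
  have tr: "[(\<Sum>j\<in>S. conv \<Gamma> (t i j) (r j k) y) = one i k y] (mod p)"
    if "i \<in> S" "k \<in> S" "y \<in> carrier \<Gamma>" for i k y
    unfolding one_def
    by (rule stable_finite_mod[where t = r and r = t and S = S and p = p and i = i and k = k and x = y,
        OF \<Gamma>.is_group prime_gt_0_int[OF p] Sf(1)])
      (assumption | rule stab frt rt that)+
  obtain U where U: "fs S U" "pcong p b (ev S U)" using rep[OF b(1)] by blast
  have fU: "fin_supp \<Gamma> (U s)" if "s \<in> S" for s using U(1) that by (simp add: fs_def)
  have fz: "fs S (\<lambda>_ _. 0)" by (simp add: fs_def fin_supp_zero)
  have ez: "ev S (\<lambda>_ _. 0) = \<one>\<^bsub>B\<^esub>"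
    by (rule B_eqI[OF ev_B[OF Sf fz] B.one_closed]) (use comb_zero[OF Sf(2)] in \<open>simp add: ev_def\<close>)
  have fA: "fs S (act S U t)" by (rule fs_act[OF U(1) t(1)])
  have "pcong p (T b) (ev S (act S U t))"
    by (rule pcong_trans[OF Tc[OF b(1)] Tc[OF ev_B[OF Sf U(1)]] ev_B[OF Sf fA]
          pcong_hom[OF T b(1) ev_B[OF Sf U(1)] U(2)] Tev[OF U(1)]])
  then have "pcong p (ev S (\<lambda>_ _. 0)) (ev S (act S U t))" unfolding b(2) ez .
  then have act0: "[act S U t j y = 0] (mod p)" if "j \<in> S" "y \<in> carrier \<Gamma>" for j y
    using indep[OF fz fA _ that] by (metis cong_sym)
  have U0: "[U k y = 0] (mod p)" if k: "k \<in> S" and y: "y \<in> carrier \<Gamma>" for k y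
  proof -
    have "U k y = (\<Sum>s\<in>S. conv \<Gamma> (U s) (one s k) y)"
    proof -
      have "conv \<Gamma> (U s) (one s k) y = (if s = k then U k y else 0)" if s: "s \<in> S" for s
      proof (cases "s = k")
        case True
        then have "one s k = unit_mass \<Gamma>" by (simp add: one_def fun_eq_iff)
        then show ?thesis using True \<Gamma>.conv_unit_right[OF fU[OF s] y] by simp
      next
        case False
        then have "one s k = (\<lambda>_. 0)" by (simp add: one_def fun_eq_iff)
        then show ?thesis using False \<Gamma>.conv_zero_right by simp
      qed
      then have "(\<Sum>s\<in>S. conv \<Gamma> (U s) (one s k) y) = (\<Sum>s\<in>S. if s = k then U k y else 0)"
        by (intro sum.cong) auto
      then show ?thesis using Sf k by simp
    qed
    also have "[(\<Sum>s\<in>S. conv \<Gamma> (U s) (one s k) y) =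
       (\<Sum>s\<in>S. conv \<Gamma> (U s) (\<lambda>y. \<Sum>j\<in>S. conv \<Gamma> (t s j) (r j k) y) y)] (mod p)"
      using k by (intro cong_sum \<Gamma>.conv_cong_mod fU cong_refl cong_sym[OF tr]) auto
    also have "(\<Sum>s\<in>S. conv \<Gamma> (U s) (\<lambda>y. \<Sum>j\<in>S. conv \<Gamma> (t s j) (r j k) y) y) =
       (\<Sum>s\<in>S. \<Sum>j\<in>S. conv \<Gamma> (conv \<Gamma> (U s) (t s j)) (r j k) y)"
      unfolding \<Gamma>.conv_sum_right
    proof (intro sum.cong refl)
      fix s j assume sj: "s \<in> S" "j \<in> S"
      have "conv \<Gamma> (U s) (\<lambda>y. conv \<Gamma> (t s j) (r j k) y) y = conv \<Gamma> (U s) (conv \<Gamma> (t s j) (r j k)) y" by simp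
      then show "conv \<Gamma> (U s) (conv \<Gamma> (t s j) (r j k)) y = conv \<Gamma> (conv \<Gamma> (U s) (t s j)) (r j k) y"
        using \<Gamma>.conv_assoc[OF fU[OF sj(1)] frt(2)[OF sj]] by simp
    qed
    also have "\<dots> = (\<Sum>j\<in>S. \<Sum>s\<in>S. conv \<Gamma> (conv \<Gamma> (U s) (t s j)) (r j k) y)" by (rule sum.swap)
    also have "\<dots> = (\<Sum>j\<in>S. conv \<Gamma> (act S U t j) (r j k) y)"
    proof (intro sum.cong refl)
      fix j assume j: "j \<in> S"
      have "act S U t j = (\<lambda>y. \<Sum>s\<in>S. conv \<Gamma> (U s) (t s j) y)" by (simp add: act_def fun_eq_iff)
      then show "(\<Sum>s\<in>S. conv \<Gamma> (conv \<Gamma> (U s) (t s j)) (r j k) y) = conv \<Gamma> (act S U t j) (r j k) y"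
        using \<Gamma>.conv_sum_left[of S "\<lambda>s. conv \<Gamma> (U s) (t s j)" "r j k" y] \<Gamma>.fin_supp_conv fU frt(2) j by simp
    qed
    also have "[\<dots> = (\<Sum>j\<in>S. conv \<Gamma> (\<lambda>_. 0) (r j k) y)] (mod p)"
    proof (intro cong_sum \<Gamma>.conv_cong_mod fin_supp_zero cong_refl act0)
      fix j assume "j \<in> S" then show "fin_supp \<Gamma> (act S U t j)" using fA by (simp add: fs_def)
    qed
    finally show ?thesis by (simp add: \<Gamma>.conv_zero_left)
  qed
  obtain a where a: "a \<in> carrier A" "b x = ev S U x \<otimes>\<^bsub>A\<^esub> a [^]\<^bsub>A\<^esub> p" using pcongD[OF U(2) x] by blast
  have "comb S (\<lambda>s. U s x) = comb S (\<lambda>s. p * (U s x div p))"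
    using U0[OF _ x] by (intro comb_cong[OF Sf(2)]) (simp add: cong_0_iff)
  also have "\<dots> = comb S (\<lambda>s. U s x div p) [^]\<^bsub>A\<^esub> p" by (rule comb_scale[OF Sf])
  finally have "b x = (comb S (\<lambda>s. U s x div p) \<otimes>\<^bsub>A\<^esub> a) [^]\<^bsub>A\<^esub> p"
    using a x comb_closed[OF Sf(2)] by (simp add: ev_def A.int_pow_distrib)
  then show ?thesis using a(1) comb_closed[OF Sf(2)] by (metis A.m_closed)
qed

abbreviation "power_image M \<equiv> (\<lambda>x. x [^]\<^bsub>A\<^esub> int M) ` carrier A"
abbreviation "power_group M \<equiv> A\<lparr>carrier := power_image M\<rparr>"

lemma power_hom: "(\<lambda>x. x [^]\<^bsub>A\<^esub> int M) \<in> hom A A"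
  by (intro homI) (auto simp: A.int_pow_distrib)

lemma power_subgroup: "subgroup (power_image M) A"
proof -
  interpret f: group_hom A A "\<lambda>x. x [^]\<^bsub>A\<^esub> int M" by (unfold_locales) (rule power_hom)
  show ?thesis by (rule f.img_is_subgroup)
qed

lemma power_group_comm: "comm_group (power_group M)"
proof -
  have g: "group (power_group M)" by (rule subgroup.subgroup_is_group[OF power_subgroup A.is_group])
  show ?thesis
    by (rule group.group_comm_groupI[OF g]) (auto simp: A.m_comm)
qed

lemma power_group_fin_gen:
  assumes "fin_gen_group A" shows "fin_gen_group (power_group M)"
proof -
  obtain S where S: "S \<subseteq> carrier A" "finite S" "generate A S = carrier A"
    using assms by (auto simp: fin_gen_group_def)
  let ?f = "\<lambda>x. x [^]\<^bsub>A\<^esub> int M"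
  have g: "group (power_group M)" by (rule subgroup.subgroup_is_group[OF power_subgroup A.is_group])
  have "?f \<in> hom A (power_group M)" by (intro homI) (auto simp: A.int_pow_distrib)
  then interpret f: group_hom A "power_group M" ?f
    using g by (simp add: group_hom_def group_hom_axioms_def)
  have "generate (power_group M) (?f ` S) = carrier (power_group M)"
    using f.generate_img[OF S(1)] S(3) by simp
  moreover have "finite (?f ` S)" "?f ` S \<subseteq> carrier (power_group M)" using S by auto
  ultimately show ?thesis using g unfolding fin_gen_group_def by blast
qed

lemma power_lamps: "lamps (power_group M) \<Gamma>"
  by (intro lamps.intro power_group_comm \<Gamma>.is_group)

lemma power_B:
  "b \<in> carrier (sum_group (carrier \<Gamma>) (\<lambda>_. power_group M)) \<longleftrightarrow>
    b \<in> carrier B \<and> (\<forall>x\<in>carrier \<Gamma>. b x \<in> power_image M)"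
proof -
  have H: "power_image M \<subseteq> carrier A" using power_subgroup subgroup.subset by blast
  show ?thesis unfolding lamps.B_carrier[OF power_lamps] B_carrier using H by (auto simp: PiE_iff)
qed

lemma power_B_root:
  assumes "b \<in> carrier (sum_group (carrier \<Gamma>) (\<lambda>_. power_group M))"
  obtains z where "z \<in> carrier B" "b = z [^]\<^bsub>B\<^esub> int M"
proof -
  interpret B: group B by (rule B_group)
  have b: "b \<in> carrier B" "\<And>x. x \<in> carrier \<Gamma> \<Longrightarrow> b x \<in> power_image M" using assms power_B by blast+
  have "pcong (int M) b \<one>\<^bsub>B\<^esub>"
  proof (rule pcongI[OF b(1) B.one_closed])
    fix x assume x: "x \<in> carrier \<Gamma>"
    show "\<exists>a\<in>carrier A. b x = \<one>\<^bsub>B\<^esub> x \<otimes>\<^bsub>A\<^esub> a [^]\<^bsub>A\<^esub> int M"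
      unfolding B_one[OF x] using b(2)[OF x] by auto
  qed
  then obtain z where z: "z \<in> carrier B" "b = \<one>\<^bsub>B\<^esub> \<otimes>\<^bsub>B\<^esub> z [^]\<^bsub>B\<^esub> int M" by (auto simp only: pcong_def)
  then have "b = z [^]\<^bsub>B\<^esub> int M" using B.l_one[OF B.int_pow_closed[OF z(1)]] by (simp only:)
  then show ?thesis using that z(1) by blast
qed

lemma power_B_pow:
  assumes "z \<in> carrier B" shows "z [^]\<^bsub>B\<^esub> int M \<in> carrier (sum_group (carrier \<Gamma>) (\<lambda>_. power_group M))"
  unfolding power_B
proof (intro conjI ballI)
  show "z [^]\<^bsub>B\<^esub> int M \<in> carrier B" by (rule group.int_pow_closed[OF B_group assms])
  fix x assume x: "x \<in> carrier \<Gamma>"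
  show "(z [^]\<^bsub>B\<^esub> int M) x \<in> power_image M" unfolding B_pow[OF assms x] using B_closed[OF assms x] by blast
qed

text \<open>
  The kernel is shown to have values in the \<open>N\<close>-th powers by induction on \<open>N = Mp\<close>: \<open>T\<close> restricts to an
  equivariant surjection of the configurations with values in the subgroup of \<open>M\<close>-th powers, which is
  again a finitely generated abelian group.
\<close>

theorem equivariant_surjection_injective:
  assumes fg: "fin_gen_group A"
    and stab: "\<And>p l. Factorial_Ring.prime (p :: int) \<Longrightarrow> l > 0 \<Longrightarrow> direct_finite_mod p (\<Gamma> \<times>\<times> heis l)"
    and T: "T \<in> hom B B" and surj: "T ` carrier B = carrier B"
    and eq: "\<And>g b. g \<in> carrier \<Gamma> \<Longrightarrow> b \<in> carrier B \<Longrightarrow> T (shift \<Gamma> g b) = shift \<Gamma> g (T b)"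
    and b: "b \<in> carrier B" "T b = \<one>\<^bsub>B\<^esub>"
  shows "b = \<one>\<^bsub>B\<^esub>"
proof -
  interpret B: group B by (rule B_group)
  have Tc: "T b \<in> carrier B" if "b \<in> carrier B" for b using T that by (auto simp: hom_def)
  have pow: "\<exists>a\<in>carrier A. b x = a [^]\<^bsub>A\<^esub> int N" if "N > 0" "x \<in> carrier \<Gamma>" for N x
    using that
  proof (induction N arbitrary: x rule: less_induct)
    case (less N)
    show ?case
    proof (cases "N = 1")
      case True
      then show ?thesis using B_closed[OF b(1) less.prems(2)] by (intro bexI[of _ "b x"]) simp_all
    next
      case False
      then obtain p where p: "Factorial_Ring.prime p" "p dvd N" using prime_factor_nat by blast
      then obtain M where M: "N = M * p" by (metis dvd_def mult.commute)
      have M0: "M > 0" "M < N" using M less.prems(1) prime_gt_1_nat[OF p(1)] by auto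
      \<comment> \<open>Apply the result for one prime to the configurations with values in the \<open>M\<close>-th powers, where the
        induction hypothesis puts \<open>b\<close>.\<close>
      let ?A = "power_group M" and ?B = "sum_group (carrier \<Gamma>) (\<lambda>_. power_group M)"
      interpret L: lamps ?A \<Gamma> by (rule power_lamps)
      have mult: "(\<otimes>\<^bsub>?B\<^esub>) = (\<otimes>\<^bsub>B\<^esub>)" by simp
      have one: "\<one>\<^bsub>?B\<^esub> = \<one>\<^bsub>B\<^esub>" by simp
      have sub: "c \<in> carrier B" if "c \<in> carrier ?B" for c using that power_B by blast
      have TB: "T c \<in> carrier ?B" if c: "c \<in> carrier ?B" for c
      proof -
        obtain z where z: "z \<in> carrier B" "c = z [^]\<^bsub>B\<^esub> int M" using power_B_root[OF c] by blast
        have "T c = T z [^]\<^bsub>B\<^esub> int M" unfolding z(2) by (rule hom_int_pow[OF T z(1) B_group B_group])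
        then show ?thesis using power_B_pow[OF Tc[OF z(1)], of M] by (simp only:)
      qed
      have T': "T \<in> hom ?B ?B"
      proof (rule homI)
        show "T c \<in> carrier ?B" if "c \<in> carrier ?B" for c by (rule TB[OF that])
        show "T (c \<otimes>\<^bsub>?B\<^esub> d) = T c \<otimes>\<^bsub>?B\<^esub> T d" if "c \<in> carrier ?B" "d \<in> carrier ?B" for c d
          unfolding mult by (rule hom_mult[OF T sub[OF that(1)] sub[OF that(2)]])
      qed
      have surj': "T ` carrier ?B = carrier ?B"
      proof
        show "T ` carrier ?B \<subseteq> carrier ?B" using TB by blast
        show "carrier ?B \<subseteq> T ` carrier ?B"
        proof
          fix c assume c: "c \<in> carrier ?B"
          obtain z where z: "z \<in> carrier B" "c = z [^]\<^bsub>B\<^esub> int M" using power_B_root[OF c] by blast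
          have "z \<in> T ` carrier B" unfolding surj by (rule z(1))
          then obtain d where d: "d \<in> carrier B" "T d = z" by (elim imageE) simp
          have "T (d [^]\<^bsub>B\<^esub> int M) = c" using hom_int_pow[OF T d(1) B_group B_group, of "int M"] z(2) d(2) by (simp only:)
          then show "c \<in> T ` carrier ?B" using power_B_pow[OF d(1), of M] by (intro image_eqI[of c T]) (rule sym)
        qed
      qed
      have bB: "b \<in> carrier ?B" unfolding power_B using b(1) less.IH[OF M0(2,1)] by blast
      have b1: "T b = \<one>\<^bsub>?B\<^esub>" using b(2) one by (simp only:)
      have pp: "Factorial_Ring.prime (int p)" using p(1) by simp
      obtain a where a: "a \<in> carrier ?A" "b x = a [^]\<^bsub>?A\<^esub> int p"
      proof -
        have eq': "T (shift \<Gamma> g c) = shift \<Gamma> g (T c)" if "g \<in> carrier \<Gamma>" "c \<in> carrier ?B" for g c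
          by (rule eq[OF that(1) sub[OF that(2)]])
        have "\<exists>a\<in>carrier ?A. b x = a [^]\<^bsub>?A\<^esub> int p"
          by (rule L.pth_power_kernel[OF power_group_fin_gen[OF fg] pp stab[OF pp] T' surj' eq' bB b1 less.prems(2)])
        then show thesis using that by (elim bexE)
      qed
      have "b x = a [^]\<^bsub>A\<^esub> int p" using A.int_pow_consistent[OF power_subgroup, of a M "int p"] a by simp
      moreover obtain c where c: "c \<in> carrier A" "a = c [^]\<^bsub>A\<^esub> int M" using a(1) by auto
      ultimately have "b x = c [^]\<^bsub>A\<^esub> int N" by (simp add: M A.int_pow_pow)
      then show ?thesis using c by blast
    qed
  qed
  show ?thesis
  proof (rule B_eqI[OF b(1) B.one_closed], unfold B_one)
    fix x assume x: "x \<in> carrier \<Gamma>"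
    show "b x = \<one>\<^bsub>A\<^esub>"
    proof (rule ccontr)
      assume "b x \<noteq> \<one>\<^bsub>A\<^esub>"
      then obtain e :: nat where "e > 0" "\<And>y. y \<in> carrier A \<Longrightarrow> b x \<noteq> y [^]\<^bsub>A\<^esub> int e"
        using A.fin_gen_not_divisible[OF fg B_closed[OF b(1) x]] by blast
      then show False using pow[of e x] x by blast
    qed
  qed
qed

end

section \<open>Endomorphisms of a wreath product\<close>

lemma even_card_involution:
  assumes "finite P" "\<And>x. x \<in> P \<Longrightarrow> h x \<in> P \<and> h x \<noteq> x \<and> h (h x) = x"
  shows "even (card P)"
  using assms
proof (induction P rule: finite_psubset_induct)
  case (psubset P)
  show ?case
  proof (cases "P = {}")
    case False
    then obtain x where x: "x \<in> P" by blast
    let ?Q = "P - {x, h x}"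
    have hx: "h x \<in> P" "h x \<noteq> x" "h (h x) = x" using psubset.prems x by blast+
    have "even (card ?Q)"
    proof (rule psubset.IH)
      show "?Q \<subset> P" using x by blast
      fix y assume "y \<in> ?Q"
      then have y: "y \<in> P" "y \<noteq> x" "y \<noteq> h x" by auto
      then have "h y \<in> P \<and> h y \<noteq> y \<and> h (h y) = y" using psubset.prems by blast
      then show "h y \<in> ?Q \<and> h y \<noteq> y \<and> h (h y) = y" using y hx by auto
    qed
    moreover have "card P = card ?Q + 2"
    proof -
      have "card {x, h x} = 2" using hx by simp
      moreover have "card {x, h x} \<le> card P" using psubset.hyps x hx by (intro card_mono) auto
      moreover have "card ?Q = card P - card {x, h x}" using x hx by (intro card_Diff_subset) auto
      ultimately show ?thesis by linarith
    qed
    ultimately show ?thesis by simp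
  qed simp
qed

lemma even_card_sym_diff:
  assumes "finite P" "finite Q"
  shows "even (card (P - Q \<union> (Q - P))) \<longleftrightarrow> (even (card P) \<longleftrightarrow> even (card Q))"
proof -
  have "card P = card (P \<inter> Q) + card (P - Q)" "card Q = card (P \<inter> Q) + card (Q - P)"
    using card_Int_Diff[OF assms(1), of Q] card_Int_Diff[OF assms(2), of P] by (simp_all add: Int_commute)
  moreover have "card (P - Q \<union> (Q - P)) = card (P - Q) + card (Q - P)"
    using assms by (intro card_Un_disjoint) auto
  ultimately show ?thesis by presburger
qed

context lamps
begin

abbreviation "W \<equiv> wreath_product A \<Gamma>"

lemma W_carrier: "w \<in> carrier W \<longleftrightarrow> fst w \<in> carrier B \<and> snd w \<in> carrier \<Gamma>"
  by (cases w) (simp add: wreath_product_def semidirect_product_def)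

lemma W_mult: "(f, g) \<otimes>\<^bsub>W\<^esub> (f', g') = (f \<otimes>\<^bsub>B\<^esub> shift \<Gamma> g f', g \<otimes>\<^bsub>\<Gamma>\<^esub> g')"
  by (simp add: wreath_product_def semidirect_product_def)

lemma W_one: "\<one>\<^bsub>W\<^esub> = (\<one>\<^bsub>B\<^esub>, \<one>\<^bsub>\<Gamma>\<^esub>)"
  by (simp add: wreath_product_def semidirect_product_def)

lemma B_comm_group: "comm_group B"
  by (rule group.group_comm_groupI[OF B_group])
    (auto intro!: ext simp: A.m_comm PiE_iff carrier_sum_group)

lemma shift_mult:
  assumes "g \<in> carrier \<Gamma>"
  shows "shift \<Gamma> g (b \<otimes>\<^bsub>B\<^esub> b') = shift \<Gamma> g b \<otimes>\<^bsub>B\<^esub> shift \<Gamma> g b'"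
  using assms by (auto simp: shift_def)

lemma shift_one:
  assumes "g \<in> carrier \<Gamma>" shows "shift \<Gamma> g \<one>\<^bsub>B\<^esub> = \<one>\<^bsub>B\<^esub>"
  using assms by (auto simp: shift_def)

lemma shift_shift:
  assumes "g \<in> carrier \<Gamma>" "h \<in> carrier \<Gamma>"
  shows "shift \<Gamma> g (shift \<Gamma> h b) = shift \<Gamma> (g \<otimes>\<^bsub>\<Gamma>\<^esub> h) b"
  using assms by (auto simp: shift_def \<Gamma>.inv_mult_group \<Gamma>.m_assoc)

lemma shift_unit:
  assumes "b \<in> carrier B" shows "shift \<Gamma> \<one>\<^bsub>\<Gamma>\<^esub> b = b"
  by (rule B_eqI[OF shift_B[OF \<Gamma>.one_closed assms] assms]) (simp add: shift_apply)

lemma W_group: "group W"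
proof -
  interpret B: comm_group B by (rule B_comm_group)
  show ?thesis
  proof (rule groupI)
    show "\<one>\<^bsub>W\<^esub> \<in> carrier W" unfolding W_carrier W_one using B.one_closed by simp
    fix w assume w: "w \<in> carrier W"
    obtain f g where fg: "w = (f, g)" "f \<in> carrier B" "g \<in> carrier \<Gamma>" using w unfolding W_carrier by (cases w) auto
    show "\<one>\<^bsub>W\<^esub> \<otimes>\<^bsub>W\<^esub> w = w" unfolding fg(1) W_one W_mult shift_unit[OF fg(2)] B.l_one[OF fg(2)] \<Gamma>.l_one[OF fg(3)] ..
    let ?v = "(shift \<Gamma> (inv\<^bsub>\<Gamma>\<^esub> g) (inv\<^bsub>B\<^esub> f), inv\<^bsub>\<Gamma>\<^esub> g)"
    have "?v \<otimes>\<^bsub>W\<^esub> w = \<one>\<^bsub>W\<^esub>"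
      unfolding fg(1) W_mult W_one shift_mult[OF \<Gamma>.inv_closed[OF fg(3)], symmetric] B.l_inv[OF fg(2)]
        shift_one[OF \<Gamma>.inv_closed[OF fg(3)]] \<Gamma>.l_inv[OF fg(3)] ..
    moreover have "?v \<in> carrier W"
      unfolding W_carrier using shift_B[OF \<Gamma>.inv_closed[OF fg(3)] B.inv_closed[OF fg(2)]] fg(3) by (simp only: fst_conv snd_conv \<Gamma>.inv_closed)
    ultimately show "\<exists>v\<in>carrier W. v \<otimes>\<^bsub>W\<^esub> w = \<one>\<^bsub>W\<^esub>" by blast
    fix w' assume w': "w' \<in> carrier W"
    obtain f' g' where fg': "w' = (f', g')" "f' \<in> carrier B" "g' \<in> carrier \<Gamma>" using w' unfolding W_carrier by (cases w') auto
    show "w \<otimes>\<^bsub>W\<^esub> w' \<in> carrier W"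
      unfolding fg fg' W_mult W_carrier fst_conv snd_conv
      by (intro conjI B.m_closed \<Gamma>.m_closed shift_B fg fg')
    fix w'' assume w'': "w'' \<in> carrier W"
    obtain f'' g'' where fg'': "w'' = (f'', g'')" "f'' \<in> carrier B" "g'' \<in> carrier \<Gamma>" using w'' unfolding W_carrier by (cases w'') auto
    show "w \<otimes>\<^bsub>W\<^esub> w' \<otimes>\<^bsub>W\<^esub> w'' = w \<otimes>\<^bsub>W\<^esub> (w' \<otimes>\<^bsub>W\<^esub> w'')"
      unfolding fg(1) fg'(1) fg''(1) W_mult shift_mult[OF fg(3)] shift_shift[OF fg(3) fg'(3)]
        \<Gamma>.m_assoc[OF fg(3) fg'(3) fg''(3)]
      by (simp only: B.m_assoc[OF fg(2) shift_B[OF fg(3) fg'(2)] shift_B[OF \<Gamma>.m_closed[OF fg(3) fg'(3)] fg''(2)]])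
  qed
qed

text \<open>
  In a combination of finitely many generators only the parities of the exponents matter.
\<close>

lemma involutive_finite:
  assumes fg: "fin_gen_group A" and two: "\<And>a. a \<in> carrier A \<Longrightarrow> a \<otimes>\<^bsub>A\<^esub> a = \<one>\<^bsub>A\<^esub>"
  shows "finite (carrier A)"
proof -
  obtain S where "generates_mod 2 S" using generates_mod_exists[OF fg] by blast
  then have S: "finite S" "S \<subseteq> carrier A"
    "\<And>x. x \<in> carrier A \<Longrightarrow> \<exists>u. \<exists>z\<in>carrier A. x = comb S u \<otimes>\<^bsub>A\<^esub> z [^]\<^bsub>A\<^esub> (2::int)"
    by (auto simp: generates_mod_def)
  have sq: "z [^]\<^bsub>A\<^esub> (2::int) = \<one>\<^bsub>A\<^esub>" if "z \<in> carrier A" for z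
  proof -
    have "z [^]\<^bsub>A\<^esub> (1 + 1 :: int) = z \<otimes>\<^bsub>A\<^esub> z" using that A.int_pow_mult[OF that, of 1 1] by simp
    then show ?thesis using two[OF that] by simp
  qed
  have "carrier A \<subseteq> comb S ` (S \<rightarrow>\<^sub>E {0, 1})"
  proof
    fix x assume "x \<in> carrier A"
    then obtain u z where z: "z \<in> carrier A" "x = comb S u \<otimes>\<^bsub>A\<^esub> z [^]\<^bsub>A\<^esub> (2::int)" using S(3) by blast
    have "s [^]\<^bsub>A\<^esub> u s = s [^]\<^bsub>A\<^esub> restrict (\<lambda>s. u s mod 2) S s" if s: "s \<in> S" for s
    proof -
      have sA: "s \<in> carrier A" using s S by blast
      have "s [^]\<^bsub>A\<^esub> u s = s [^]\<^bsub>A\<^esub> (2 * (u s div 2) + u s mod 2)" by simp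
      also have "\<dots> = (s [^]\<^bsub>A\<^esub> (2::int)) [^]\<^bsub>A\<^esub> (u s div 2) \<otimes>\<^bsub>A\<^esub> s [^]\<^bsub>A\<^esub> (u s mod 2)"
        using sA by (simp only: A.int_pow_mult A.int_pow_pow)
      finally show ?thesis using sA s by (simp add: sq)
    qed
    then have "comb S u = comb S (restrict (\<lambda>s. u s mod 2) S)"
      unfolding comb_def using S by (intro A.finprod_cong') auto
    moreover have "x = comb S u" using z comb_closed[OF S(2)] by (simp add: sq)
    ultimately show "x \<in> comb S ` (S \<rightarrow>\<^sub>E {0, 1})" by (intro image_eqI) auto
  qed
  then show ?thesis using S(1) by (meson finite_PiE finite.emptyI finite.insertI finite_imageI finite_subset)
qed

lemma W_finite:
  assumes "finite (carrier A)" "finite (carrier \<Gamma>)" shows "finite (carrier W)"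
proof -
  have "carrier W \<subseteq> (carrier \<Gamma> \<rightarrow>\<^sub>E carrier A) \<times> carrier \<Gamma>"
    unfolding subset_iff W_carrier B_carrier mem_Times_iff by blast
  moreover have "finite ((carrier \<Gamma> \<rightarrow>\<^sub>E carrier A) \<times> carrier \<Gamma>)" using assms by (intro finite_cartesian_product finite_PiE)
  ultimately show ?thesis by (rule finite_subset)
qed

end

section \<open>Surjective endomorphisms that preserve the base\<close>

locale wreath_epi = lamps A \<Gamma> for A :: "'a monoid" and \<Gamma> :: "'g monoid" +
  fixes \<phi>
  assumes fg: "fin_gen_group A" and hop: "hopfian \<Gamma>" and epi: "\<phi> \<in> epi W W"
begin

lemma \<phi>_closed: "w \<in> carrier W \<Longrightarrow> \<phi> w \<in> carrier W"
  using epi by (auto simp: epi_def hom_def)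

lemma \<phi>_mult: "w \<in> carrier W \<Longrightarrow> w' \<in> carrier W \<Longrightarrow> \<phi> (w \<otimes>\<^bsub>W\<^esub> w') = \<phi> w \<otimes>\<^bsub>W\<^esub> \<phi> w'"
  using epi by (auto simp: epi_def hom_def)

lemma \<phi>_surj: "w \<in> carrier W \<Longrightarrow> \<exists>v\<in>carrier W. w = \<phi> v"
  using epi by (auto simp: epi_def)

lemma base_W: "b \<in> carrier B \<Longrightarrow> (b, \<one>\<^bsub>\<Gamma>\<^esub>) \<in> carrier W"
  by (simp only: W_carrier fst_conv snd_conv \<Gamma>.one_closed)

lemma top_W: "g \<in> carrier \<Gamma> \<Longrightarrow> (\<one>\<^bsub>B\<^esub>, g) \<in> carrier W"
  by (simp only: W_carrier fst_conv snd_conv group.is_monoid[OF B_group] monoid.one_closed)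

lemma base_mult: "b \<in> carrier B \<Longrightarrow> b' \<in> carrier B \<Longrightarrow> (b, \<one>\<^bsub>\<Gamma>\<^esub>) \<otimes>\<^bsub>W\<^esub> (b', \<one>\<^bsub>\<Gamma>\<^esub>) = (b \<otimes>\<^bsub>B\<^esub> b', \<one>\<^bsub>\<Gamma>\<^esub>)"
  unfolding W_mult using shift_unit by simp

lemma top_mult: "g \<in> carrier \<Gamma> \<Longrightarrow> (\<one>\<^bsub>B\<^esub>, g) \<otimes>\<^bsub>W\<^esub> (\<one>\<^bsub>B\<^esub>, g') = (\<one>\<^bsub>B\<^esub>, g \<otimes>\<^bsub>\<Gamma>\<^esub> g')"
  unfolding W_mult using shift_one monoid.l_one[OF group.is_monoid[OF B_group] monoid.one_closed[OF group.is_monoid[OF B_group]]] by simp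

lemma base_top: "b \<in> carrier B \<Longrightarrow> g \<in> carrier \<Gamma> \<Longrightarrow> (b, \<one>\<^bsub>\<Gamma>\<^esub>) \<otimes>\<^bsub>W\<^esub> (\<one>\<^bsub>B\<^esub>, g) = (b, g)"
  unfolding W_mult using shift_unit[OF monoid.one_closed[OF group.is_monoid[OF B_group]]] monoid.r_one[OF group.is_monoid[OF B_group]] by simp

lemma top_base: "b \<in> carrier B \<Longrightarrow> g \<in> carrier \<Gamma> \<Longrightarrow> (\<one>\<^bsub>B\<^esub>, g) \<otimes>\<^bsub>W\<^esub> (b, \<one>\<^bsub>\<Gamma>\<^esub>) = (shift \<Gamma> g b, g)"
  unfolding W_mult using monoid.l_one[OF group.is_monoid[OF B_group] shift_B] by simp

lemma \<phi>_split:
  assumes "w \<in> carrier W"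
  shows "\<exists>b\<in>carrier B. \<exists>g\<in>carrier \<Gamma>. w = \<phi> (b, \<one>\<^bsub>\<Gamma>\<^esub>) \<otimes>\<^bsub>W\<^esub> \<phi> (\<one>\<^bsub>B\<^esub>, g)"
proof -
  obtain v where v: "v \<in> carrier W" "w = \<phi> v" using \<phi>_surj[OF assms] by blast
  have bg: "fst v \<in> carrier B" "snd v \<in> carrier \<Gamma>" using v(1) by (simp_all only: W_carrier)
  have "w = \<phi> (fst v, \<one>\<^bsub>\<Gamma>\<^esub>) \<otimes>\<^bsub>W\<^esub> \<phi> (\<one>\<^bsub>B\<^esub>, snd v)"
    unfolding v(2) \<phi>_mult[OF base_W[OF bg(1)] top_W[OF bg(2)], symmetric] base_top[OF bg] by simp
  then show ?thesis using bg by blast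
qed

definition \<psi> :: "'g \<Rightarrow> 'g" where "\<psi> g = snd (\<phi> (\<one>\<^bsub>B\<^esub>, g))"

lemma snd_mult: "snd (w \<otimes>\<^bsub>W\<^esub> w') = snd w \<otimes>\<^bsub>\<Gamma>\<^esub> snd w'"
  by (cases w; cases w') (simp only: W_mult snd_conv)

lemma fst_mult: "fst (w \<otimes>\<^bsub>W\<^esub> w') = fst w \<otimes>\<^bsub>B\<^esub> shift \<Gamma> (snd w) (fst w')"
  by (cases w; cases w') (simp only: W_mult fst_conv snd_conv)

lemma \<psi>_hom: "\<psi> \<in> hom \<Gamma> \<Gamma>"
proof (rule homI)
  show "\<psi> g \<in> carrier \<Gamma>" if "g \<in> carrier \<Gamma>" for g
    using \<phi>_closed[OF top_W[OF that]] unfolding \<psi>_def W_carrier by blast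
  show "\<psi> (g \<otimes>\<^bsub>\<Gamma>\<^esub> h) = \<psi> g \<otimes>\<^bsub>\<Gamma>\<^esub> \<psi> h" if "g \<in> carrier \<Gamma>" "h \<in> carrier \<Gamma>" for g h
    unfolding \<psi>_def top_mult[OF that(1), symmetric] \<phi>_mult[OF top_W[OF that(1)] top_W[OF that(2)]] snd_mult ..
qed

lemma hopfian_inj: "h \<in> hom \<Gamma> \<Gamma> \<Longrightarrow> carrier \<Gamma> \<subseteq> h ` carrier \<Gamma> \<Longrightarrow> inj_on h (carrier \<Gamma>)"
  using hop by (auto simp: hopfian_def iso_def bij_betw_def epi_iff_subset)

text \<open>
  Here \<open>\<psi>\<close> is onto, hence bijective. Therefore \<open>\<phi>\<close> maps \<open>B\<close> onto \<open>B\<close>, and \<open>\<tau>\<close>, its restriction, satisfies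
  \<open>\<tau> (g b) = \<psi> g (\<tau> b)\<close>. Composition with \<open>\<psi>\<close> turns this into equivariance.
\<close>

theorem injective_if_base_preserved:
  assumes stab: "\<And>p l. Factorial_Ring.prime (p :: int) \<Longrightarrow> l > 0 \<Longrightarrow> direct_finite_mod p (\<Gamma> \<times>\<times> heis l)"
    and base: "\<And>b. b \<in> carrier B \<Longrightarrow> snd (\<phi> (b, \<one>\<^bsub>\<Gamma>\<^esub>)) = \<one>\<^bsub>\<Gamma>\<^esub>"
  shows "inj_on \<phi> (carrier W)"
proof -
  interpret B: comm_group B by (rule B_comm_group)
  interpret WG: group W by (rule W_group)
  interpret \<phi>: group_hom W W \<phi> using epi by (simp add: group_hom_def group_hom_axioms_def epi_def W_group)
  interpret \<psi>: group_hom \<Gamma> \<Gamma> \<psi> using \<psi>_hom by (simp add: group_hom_def group_hom_axioms_def)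
  define \<tau> where "\<tau> b = fst (\<phi> (b, \<one>\<^bsub>\<Gamma>\<^esub>))" for b
  have \<tau>B: "\<tau> b \<in> carrier B" if "b \<in> carrier B" for b
    using \<phi>_closed[OF base_W[OF that]] unfolding \<tau>_def W_carrier by blast
  have \<phi>b: "\<phi> (b, \<one>\<^bsub>\<Gamma>\<^esub>) = (\<tau> b, \<one>\<^bsub>\<Gamma>\<^esub>)" if "b \<in> carrier B" for b
    using base[OF that] by (simp add: \<tau>_def prod_eq_iff)
  have onto: "carrier \<Gamma> \<subseteq> \<psi> ` carrier \<Gamma>"
  proof
    fix d assume d: "d \<in> carrier \<Gamma>"
    obtain b g where bg: "b \<in> carrier B" "g \<in> carrier \<Gamma>" "(\<one>\<^bsub>B\<^esub>, d) = \<phi> (b, \<one>\<^bsub>\<Gamma>\<^esub>) \<otimes>\<^bsub>W\<^esub> \<phi> (\<one>\<^bsub>B\<^esub>, g)"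
      using \<phi>_split[OF top_W[OF d]] by blast
    have "d = \<one>\<^bsub>\<Gamma>\<^esub> \<otimes>\<^bsub>\<Gamma>\<^esub> \<psi> g" using arg_cong[OF bg(3), of snd] unfolding snd_mult base[OF bg(1)] snd_conv \<psi>_def .
    then show "d \<in> \<psi> ` carrier \<Gamma>" using bg(2) \<psi>.hom_closed by auto
  qed
  have inj: "inj_on \<psi> (carrier \<Gamma>)" by (rule hopfian_inj[OF \<psi>_hom onto])
  have \<psi>1: "g = \<one>\<^bsub>\<Gamma>\<^esub>" if "g \<in> carrier \<Gamma>" "\<psi> g = \<one>\<^bsub>\<Gamma>\<^esub>" for g
    using inj_onD[OF inj, of g "\<one>\<^bsub>\<Gamma>\<^esub>"] that \<psi>.hom_one by simp
  have \<tau>m: "\<tau> (b \<otimes>\<^bsub>B\<^esub> b') = \<tau> b \<otimes>\<^bsub>B\<^esub> \<tau> b'" if "b \<in> carrier B" "b' \<in> carrier B" for b b'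
    using \<phi>_mult[OF base_W[OF that(1)] base_W[OF that(2)]]
    unfolding base_mult[OF that] \<phi>b[OF that(1)] \<phi>b[OF that(2)] \<phi>b[OF B.m_closed[OF that]] base_mult[OF \<tau>B[OF that(1)] \<tau>B[OF that(2)]]
    by (simp only: prod.inject)
  have \<tau>s: "\<exists>f\<in>carrier B. \<tau> f = b" if b: "b \<in> carrier B" for b
  proof -
    obtain f g where fg: "f \<in> carrier B" "g \<in> carrier \<Gamma>" "(b, \<one>\<^bsub>\<Gamma>\<^esub>) = \<phi> (f, \<one>\<^bsub>\<Gamma>\<^esub>) \<otimes>\<^bsub>W\<^esub> \<phi> (\<one>\<^bsub>B\<^esub>, g)"
      using \<phi>_split[OF base_W[OF b]] by blast
    have "\<one>\<^bsub>\<Gamma>\<^esub> = \<one>\<^bsub>\<Gamma>\<^esub> \<otimes>\<^bsub>\<Gamma>\<^esub> \<psi> g" using arg_cong[OF fg(3), of snd] unfolding snd_mult base[OF fg(1)] snd_conv \<psi>_def .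
    then have "g = \<one>\<^bsub>\<Gamma>\<^esub>" using \<psi>1[OF fg(2)] \<psi>.hom_closed[OF fg(2)] by simp
    then have "\<phi> (\<one>\<^bsub>B\<^esub>, g) = \<one>\<^bsub>W\<^esub>" using \<phi>.hom_one unfolding W_one by (simp only:)
    then have "(b, \<one>\<^bsub>\<Gamma>\<^esub>) = \<phi> (f, \<one>\<^bsub>\<Gamma>\<^esub>)" using fg(3) WG.r_one[OF \<phi>_closed[OF base_W[OF fg(1)]]] by (simp only:)
    then have "\<tau> f = b" unfolding \<phi>b[OF fg(1)] by simp
    then show ?thesis using fg(1) by blast
  qed
  \<comment> \<open>Apply \<open>\<phi>\<close> to \<open>(1, g) (b, 1) = (g b, 1) (1, g)\<close>.\<close>
  have \<tau>eq: "\<tau> (shift \<Gamma> g b) = shift \<Gamma> (\<psi> g) (\<tau> b)" if g: "g \<in> carrier \<Gamma>" and b: "b \<in> carrier B" for g b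
  proof -
    have sb: "shift \<Gamma> g b \<in> carrier B" by (rule shift_B[OF g b])
    define h where "h = fst (\<phi> (\<one>\<^bsub>B\<^esub>, g))"
    have h: "h \<in> carrier B" using \<phi>_closed[OF top_W[OF g]] unfolding h_def W_carrier by blast
    have \<phi>g: "\<phi> (\<one>\<^bsub>B\<^esub>, g) = (h, \<psi> g)" by (simp add: h_def \<psi>_def)
    have "(\<one>\<^bsub>B\<^esub>, g) \<otimes>\<^bsub>W\<^esub> (b, \<one>\<^bsub>\<Gamma>\<^esub>) = (shift \<Gamma> g b, \<one>\<^bsub>\<Gamma>\<^esub>) \<otimes>\<^bsub>W\<^esub> (\<one>\<^bsub>B\<^esub>, g)"
      unfolding top_base[OF b g] base_top[OF sb g] ..
    then have "\<phi> (\<one>\<^bsub>B\<^esub>, g) \<otimes>\<^bsub>W\<^esub> \<phi> (b, \<one>\<^bsub>\<Gamma>\<^esub>) = \<phi> (shift \<Gamma> g b, \<one>\<^bsub>\<Gamma>\<^esub>) \<otimes>\<^bsub>W\<^esub> \<phi> (\<one>\<^bsub>B\<^esub>, g)"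
      unfolding \<phi>_mult[OF top_W[OF g] base_W[OF b], symmetric] \<phi>_mult[OF base_W[OF sb] top_W[OF g], symmetric] by (simp only:)
    then have "h \<otimes>\<^bsub>B\<^esub> shift \<Gamma> (\<psi> g) (\<tau> b) = \<tau> (shift \<Gamma> g b) \<otimes>\<^bsub>B\<^esub> shift \<Gamma> \<one>\<^bsub>\<Gamma>\<^esub> h"
      unfolding \<phi>g \<phi>b[OF b] \<phi>b[OF sb] W_mult by (simp only: prod.inject)
    then have "h \<otimes>\<^bsub>B\<^esub> shift \<Gamma> (\<psi> g) (\<tau> b) = h \<otimes>\<^bsub>B\<^esub> \<tau> (shift \<Gamma> g b)"
      unfolding shift_unit[OF h] B.m_comm[OF \<tau>B[OF sb] h] .
    from B.l_cancel[OF this shift_B[OF \<psi>.hom_closed[OF g] \<tau>B[OF b]] \<tau>B[OF sb] h]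
    show ?thesis by (rule sym)
  qed
  define T where "T b = (\<lambda>x\<in>carrier \<Gamma>. \<tau> b (\<psi> x))" for b
  have Tx: "T b x = \<tau> b (\<psi> x)" if "x \<in> carrier \<Gamma>" for b x using that by (simp add: T_def)
  have TB: "T b \<in> carrier B" if b: "b \<in> carrier B" for b
    unfolding T_def
  proof (rule B_I)
    show "\<tau> b (\<psi> x) \<in> carrier A" if "x \<in> carrier \<Gamma>" for x
      by (rule B_closed[OF \<tau>B[OF b] \<psi>.hom_closed[OF that]])
    have "finite {x \<in> carrier \<Gamma>. \<tau> b x \<noteq> \<one>\<^bsub>A\<^esub>}" using \<tau>B[OF b] unfolding B_carrier by blast
    from finite_inverse_image_gen[OF this, of \<psi> "carrier \<Gamma>"]
    have "finite {x \<in> carrier \<Gamma>. \<psi> x \<in> {x \<in> carrier \<Gamma>. \<tau> b x \<noteq> \<one>\<^bsub>A\<^esub>}}" using inj by (auto simp: Int_def vimage_def conj_commute)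
    then show "finite {x \<in> carrier \<Gamma>. \<tau> b (\<psi> x) \<noteq> \<one>\<^bsub>A\<^esub>}" by (rule finite_subset[rotated]) (use \<psi>.hom_closed in blast)
  qed
  have Thom: "T \<in> hom B B"
  proof (rule homI)
    show "T b \<in> carrier B" if "b \<in> carrier B" for b by (rule TB[OF that])
    show "T (b \<otimes>\<^bsub>B\<^esub> b') = T b \<otimes>\<^bsub>B\<^esub> T b'" if bb: "b \<in> carrier B" "b' \<in> carrier B" for b b'
    proof (rule B_eqI[OF TB[OF B.m_closed[OF bb]] B.m_closed[OF TB[OF bb(1)] TB[OF bb(2)]]])
      fix x assume x: "x \<in> carrier \<Gamma>"
      show "T (b \<otimes>\<^bsub>B\<^esub> b') x = (T b \<otimes>\<^bsub>B\<^esub> T b') x"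
        unfolding Tx[OF x] B_mult[OF x] \<tau>m[OF bb] by (rule B_mult[OF \<psi>.hom_closed[OF x]])
    qed
  qed
  have Tsurj: "T ` carrier B = carrier B"
  proof
    show "T ` carrier B \<subseteq> carrier B" using TB by blast
    show "carrier B \<subseteq> T ` carrier B"
    proof
      fix b assume b: "b \<in> carrier B"
      let ?\<kappa> = "inv_into (carrier \<Gamma>) \<psi>"
      have \<kappa>: "?\<kappa> y \<in> carrier \<Gamma>" "\<psi> (?\<kappa> y) = y" if "y \<in> carrier \<Gamma>" for y
        using onto that by (auto intro: inv_into_into f_inv_into_f)
      define b' where "b' = (\<lambda>y\<in>carrier \<Gamma>. b (?\<kappa> y))"
      have b': "b' \<in> carrier B"
        unfolding b'_def
      proof (rule B_I)
        show "b (?\<kappa> y) \<in> carrier A" if "y \<in> carrier \<Gamma>" for y by (rule B_closed[OF b \<kappa>(1)[OF that]])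
        have fin: "finite {x \<in> carrier \<Gamma>. b x \<noteq> \<one>\<^bsub>A\<^esub>}" using b unfolding B_carrier by blast
        have "{y \<in> carrier \<Gamma>. b (?\<kappa> y) \<noteq> \<one>\<^bsub>A\<^esub>} \<subseteq> \<psi> ` {x \<in> carrier \<Gamma>. b x \<noteq> \<one>\<^bsub>A\<^esub>}"
        proof
          fix y assume "y \<in> {y \<in> carrier \<Gamma>. b (?\<kappa> y) \<noteq> \<one>\<^bsub>A\<^esub>}"
          then show "y \<in> \<psi> ` {x \<in> carrier \<Gamma>. b x \<noteq> \<one>\<^bsub>A\<^esub>}"
            using \<kappa> by (intro image_eqI[of y \<psi> "?\<kappa> y"]) auto
        qed
        then show "finite {y \<in> carrier \<Gamma>. b (?\<kappa> y) \<noteq> \<one>\<^bsub>A\<^esub>}" using fin by (blast intro: finite_subset)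
      qed
      obtain f where f: "f \<in> carrier B" "\<tau> f = b'" using \<tau>s[OF b'] by blast
      have "T f = b"
      proof (rule B_eqI[OF TB[OF f(1)] b])
        fix x assume x: "x \<in> carrier \<Gamma>"
        have "?\<kappa> (\<psi> x) = x" by (rule inv_into_f_f[OF inj x])
        then show "T f x = b x" unfolding Tx[OF x] f(2) b'_def using \<psi>.hom_closed[OF x] by simp
      qed
      then show "b \<in> T ` carrier B" using f(1) by (intro image_eqI[of b T f]) simp_all
    qed
  qed
  have Teq: "T (shift \<Gamma> g b) = shift \<Gamma> g (T b)" if g: "g \<in> carrier \<Gamma>" and b: "b \<in> carrier B" for g b
  proof (rule B_eqI[OF TB[OF shift_B[OF g b]] shift_B[OF g TB[OF b]]])
    fix x assume x: "x \<in> carrier \<Gamma>"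
    have gx: "inv\<^bsub>\<Gamma>\<^esub> g \<otimes>\<^bsub>\<Gamma>\<^esub> x \<in> carrier \<Gamma>" using g x by simp
    show "T (shift \<Gamma> g b) x = shift \<Gamma> g (T b) x"
      unfolding Tx[OF x] shift_apply[OF x] Tx[OF gx] \<tau>eq[OF g b] shift_apply[OF \<psi>.hom_closed[OF x]]
      using g x by simp
  qed
  have "w = \<one>\<^bsub>W\<^esub>" if w: "w \<in> carrier W" "\<phi> w = \<one>\<^bsub>W\<^esub>" for w
  proof -
    obtain b g where bg: "w = (b, g)" "b \<in> carrier B" "g \<in> carrier \<Gamma>" using w(1) unfolding W_carrier by (cases w) auto
    have e: "\<phi> w = (\<tau> b, \<one>\<^bsub>\<Gamma>\<^esub>) \<otimes>\<^bsub>W\<^esub> \<phi> (\<one>\<^bsub>B\<^esub>, g)"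
      unfolding bg(1) base_top[OF bg(2,3), symmetric] \<phi>_mult[OF base_W[OF bg(2)] top_W[OF bg(3)]] \<phi>b[OF bg(2)] ..
    have "\<one>\<^bsub>\<Gamma>\<^esub> = \<one>\<^bsub>\<Gamma>\<^esub> \<otimes>\<^bsub>\<Gamma>\<^esub> \<psi> g" using arg_cong[OF e, of snd] unfolding w(2) snd_mult W_one snd_conv \<psi>_def .
    then have g1: "g = \<one>\<^bsub>\<Gamma>\<^esub>" using \<psi>1[OF bg(3)] \<psi>.hom_closed[OF bg(3)] by simp
    then have "\<phi> (b, \<one>\<^bsub>\<Gamma>\<^esub>) = \<one>\<^bsub>W\<^esub>" using w(2) bg(1) by (simp only:)
    then have \<tau>1: "\<tau> b = \<one>\<^bsub>B\<^esub>" unfolding \<phi>b[OF bg(2)] W_one by (simp only: prod.inject)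
    have "T b = \<one>\<^bsub>B\<^esub>"
      by (rule B_eqI[OF TB[OF bg(2)] B.one_closed]) (simp only: Tx \<tau>1 B_one \<psi>.hom_closed)
    then have "b = \<one>\<^bsub>B\<^esub>"
      by (intro equivariant_surjection_injective[OF fg _ Thom Tsurj Teq bg(2)] stab)
    then show ?thesis using bg(1) g1 W_one by (simp only:)
  qed
  then show ?thesis by (intro iffD2[OF \<phi>.inj_on_one_iff]) blast
qed

definition base_fst :: "('g \<Rightarrow> 'a) \<Rightarrow> 'g \<Rightarrow> 'a" where "base_fst b = fst (\<phi> (b, \<one>\<^bsub>\<Gamma>\<^esub>))"
definition base_snd :: "('g \<Rightarrow> 'a) \<Rightarrow> 'g" where "base_snd b = snd (\<phi> (b, \<one>\<^bsub>\<Gamma>\<^esub>))"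

lemma \<phi>_base: "\<phi> (b, \<one>\<^bsub>\<Gamma>\<^esub>) = (base_fst b, base_snd b)"
  by (simp add: base_fst_def base_snd_def)

lemma base_fst_B: "b \<in> carrier B \<Longrightarrow> base_fst b \<in> carrier B"
  using \<phi>_closed[OF base_W] unfolding base_fst_def W_carrier by blast

lemma base_snd_closed: "b \<in> carrier B \<Longrightarrow> base_snd b \<in> carrier \<Gamma>"
  using \<phi>_closed[OF base_W] unfolding base_snd_def W_carrier by blast

lemma base_snd_mult: "b \<in> carrier B \<Longrightarrow> b' \<in> carrier B \<Longrightarrow> base_snd (b \<otimes>\<^bsub>B\<^esub> b') = base_snd b \<otimes>\<^bsub>\<Gamma>\<^esub> base_snd b'"
  unfolding base_snd_def snd_mult[symmetric] base_mult[symmetric] by (simp only: \<phi>_mult base_W)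

text \<open>
  The image of \<open>B\<close> is normal because \<open>\<phi>\<close> is onto.
\<close>

lemma image_normal:
  assumes b: "b \<in> carrier B" and w: "w \<in> carrier W"
  shows "\<exists>b'\<in>carrier B. \<phi> (b', \<one>\<^bsub>\<Gamma>\<^esub>) \<otimes>\<^bsub>W\<^esub> w = w \<otimes>\<^bsub>W\<^esub> \<phi> (b, \<one>\<^bsub>\<Gamma>\<^esub>)"
proof -
  interpret B: comm_group B by (rule B_comm_group)
  obtain v where v: "v \<in> carrier W" "w = \<phi> v" using \<phi>_surj[OF w] by blast
  obtain f g where fg: "v = (f, g)" "f \<in> carrier B" "g \<in> carrier \<Gamma>" using v(1) unfolding W_carrier by (cases v) auto
  have sb: "shift \<Gamma> g b \<in> carrier B" by (rule shift_B[OF fg(3) b])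
  have "(shift \<Gamma> g b, \<one>\<^bsub>\<Gamma>\<^esub>) \<otimes>\<^bsub>W\<^esub> v = v \<otimes>\<^bsub>W\<^esub> (b, \<one>\<^bsub>\<Gamma>\<^esub>)"
    unfolding fg(1) W_mult shift_unit[OF fg(2)] B.m_comm[OF sb fg(2)] \<Gamma>.l_one[OF fg(3)] \<Gamma>.r_one[OF fg(3)] ..
  then have "\<phi> (shift \<Gamma> g b, \<one>\<^bsub>\<Gamma>\<^esub>) \<otimes>\<^bsub>W\<^esub> w = w \<otimes>\<^bsub>W\<^esub> \<phi> (b, \<one>\<^bsub>\<Gamma>\<^esub>)"
    unfolding v(2) \<phi>_mult[OF base_W[OF sb] v(1), symmetric] \<phi>_mult[OF v(1) base_W[OF b], symmetric] by (rule arg_cong)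
  then show ?thesis using sb by blast
qed

text \<open>
  Elements of the image of \<open>B\<close> commute; compare the base components of the two products.
\<close>

lemma image_fixed:
  assumes b: "b \<in> carrier B" "base_snd b = \<one>\<^bsub>\<Gamma>\<^esub>" and b': "b' \<in> carrier B"
  shows "shift \<Gamma> (base_snd b') (base_fst b) = base_fst b"
proof -
  interpret B: comm_group B by (rule B_comm_group)
  have s: "shift \<Gamma> (base_snd b') (base_fst b) \<in> carrier B" by (intro shift_B base_snd_closed base_fst_B b b')
  have "\<phi> (b', \<one>\<^bsub>\<Gamma>\<^esub>) \<otimes>\<^bsub>W\<^esub> \<phi> (b, \<one>\<^bsub>\<Gamma>\<^esub>) = \<phi> (b, \<one>\<^bsub>\<Gamma>\<^esub>) \<otimes>\<^bsub>W\<^esub> \<phi> (b', \<one>\<^bsub>\<Gamma>\<^esub>)"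
    unfolding \<phi>_mult[OF base_W[OF b'] base_W[OF b(1)], symmetric] \<phi>_mult[OF base_W[OF b(1)] base_W[OF b'], symmetric]
      base_mult[OF b' b(1)] base_mult[OF b(1) b'] B.m_comm[OF b' b(1)] ..
  then have "base_fst b' \<otimes>\<^bsub>B\<^esub> shift \<Gamma> (base_snd b') (base_fst b) = base_fst b \<otimes>\<^bsub>B\<^esub> base_fst b'"
    unfolding \<phi>_base W_mult b(2) shift_unit[OF base_fst_B[OF b']] by (simp only: prod.inject)
  then have "base_fst b' \<otimes>\<^bsub>B\<^esub> shift \<Gamma> (base_snd b') (base_fst b) = base_fst b' \<otimes>\<^bsub>B\<^esub> base_fst b"
    unfolding B.m_comm[OF base_fst_B[OF b(1)] base_fst_B[OF b']] .
  then show ?thesis by (rule B.l_cancel[OF _ s base_fst_B[OF b(1)] base_fst_B[OF b']])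
qed

text \<open>
  The commutator of a lamp configuration \<open>l\<close> with \<open>\<phi> (b, 1)\<close> lies in the image of \<open>B\<close> by normality, and
  in \<open>B\<close>.
\<close>

lemma image_commutator:
  assumes b: "b \<in> carrier B" and l: "l \<in> carrier B"
  shows "\<exists>d\<in>carrier B. base_snd d = \<one>\<^bsub>\<Gamma>\<^esub> \<and> base_fst d \<otimes>\<^bsub>B\<^esub> shift \<Gamma> (base_snd b) l = l"
proof -
  interpret B: comm_group B by (rule B_comm_group)
  note c = base_snd_closed and f = base_fst_B
  obtain b1 where b1: "b1 \<in> carrier B" "\<phi> (b1, \<one>\<^bsub>\<Gamma>\<^esub>) \<otimes>\<^bsub>W\<^esub> (l, \<one>\<^bsub>\<Gamma>\<^esub>) = (l, \<one>\<^bsub>\<Gamma>\<^esub>) \<otimes>\<^bsub>W\<^esub> \<phi> (b, \<one>\<^bsub>\<Gamma>\<^esub>)"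
    using image_normal[OF b base_W[OF l]] by blast
  then have "base_fst b1 \<otimes>\<^bsub>B\<^esub> shift \<Gamma> (base_snd b1) l = l \<otimes>\<^bsub>B\<^esub> base_fst b \<and> base_snd b1 \<otimes>\<^bsub>\<Gamma>\<^esub> \<one>\<^bsub>\<Gamma>\<^esub> = \<one>\<^bsub>\<Gamma>\<^esub> \<otimes>\<^bsub>\<Gamma>\<^esub> base_snd b"
    unfolding \<phi>_base W_mult shift_unit[OF f[OF b]] by (simp only: prod.inject)
  then have e: "base_snd b1 = base_snd b" "base_fst b1 \<otimes>\<^bsub>B\<^esub> shift \<Gamma> (base_snd b1) l = l \<otimes>\<^bsub>B\<^esub> base_fst b"
    unfolding \<Gamma>.r_one[OF c[OF b1(1)]] \<Gamma>.l_one[OF c[OF b]] by blast+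
  \<comment> \<open>\<open>b1\<close> corresponds to a conjugate of \<open>\<phi> (b, 1)\<close>, so \<open>d\<close> corresponds to the commutator.\<close>
  define d where "d = b1 \<otimes>\<^bsub>B\<^esub> inv\<^bsub>B\<^esub> b"
  have d: "d \<in> carrier B" unfolding d_def by (intro B.m_closed B.inv_closed b b1)
  have db: "d \<otimes>\<^bsub>B\<^esub> b = b1"
    unfolding d_def B.m_assoc[OF b1(1) B.inv_closed[OF b] b] B.l_inv[OF b] by (rule B.r_one[OF b1(1)])
  have "\<phi> (d, \<one>\<^bsub>\<Gamma>\<^esub>) \<otimes>\<^bsub>W\<^esub> \<phi> (b, \<one>\<^bsub>\<Gamma>\<^esub>) = \<phi> (b1, \<one>\<^bsub>\<Gamma>\<^esub>)"
    unfolding \<phi>_mult[OF base_W[OF d] base_W[OF b], symmetric] base_mult[OF d b] db ..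
  then have m: "base_fst d \<otimes>\<^bsub>B\<^esub> shift \<Gamma> (base_snd d) (base_fst b) = base_fst b1" "base_snd d \<otimes>\<^bsub>\<Gamma>\<^esub> base_snd b = base_snd b1"
    unfolding \<phi>_base W_mult by (simp_all only: prod.inject)
  then have d1: "base_snd d = \<one>\<^bsub>\<Gamma>\<^esub>"
    using c[OF d] c[OF b] \<Gamma>.r_cancel_one[OF c[OF b] c[OF d]] unfolding e(1) by blast
  have m1: "base_fst d \<otimes>\<^bsub>B\<^esub> base_fst b = base_fst b1" using m(1) unfolding d1 shift_unit[OF f[OF b]] .
  have sl: "shift \<Gamma> (base_snd b) l \<in> carrier B" by (intro shift_B c b l)
  have "(base_fst d \<otimes>\<^bsub>B\<^esub> shift \<Gamma> (base_snd b) l) \<otimes>\<^bsub>B\<^esub> base_fst b = l \<otimes>\<^bsub>B\<^esub> base_fst b"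
    unfolding B.m_assoc[OF f[OF d] sl f[OF b]] B.m_comm[OF sl f[OF b]] B.m_assoc[OF f[OF d] f[OF b] sl, symmetric]
      m1 e(2)[unfolded e(1)] ..
  then have "base_fst d \<otimes>\<^bsub>B\<^esub> shift \<Gamma> (base_snd b) l = l"
    by (rule B.r_cancel[OF _ B.m_closed[OF f[OF d] sl] l f[OF b]])
  then show ?thesis using d d1 by blast
qed

lemma image_of_top_meets_cosets:
  assumes "w \<in> carrier B"
  shows "\<exists>g\<in>carrier \<Gamma>. \<exists>b\<in>carrier B. \<phi> (\<one>\<^bsub>B\<^esub>, g) = \<phi> (b, \<one>\<^bsub>\<Gamma>\<^esub>) \<otimes>\<^bsub>W\<^esub> (w, \<one>\<^bsub>\<Gamma>\<^esub>)"
proof -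
  interpret B: comm_group B by (rule B_comm_group)
  interpret WG: group W by (rule W_group)
  interpret \<phi>: group_hom W W \<phi> using epi by (simp add: group_hom_def group_hom_axioms_def epi_def W_group)
  obtain b g where bg: "b \<in> carrier B" "g \<in> carrier \<Gamma>" "(w, \<one>\<^bsub>\<Gamma>\<^esub>) = \<phi> (b, \<one>\<^bsub>\<Gamma>\<^esub>) \<otimes>\<^bsub>W\<^esub> \<phi> (\<one>\<^bsub>B\<^esub>, g)"
    using \<phi>_split[OF base_W[OF assms]] by blast
  note i = B.inv_closed[OF bg(1)]
  have "\<phi> (inv\<^bsub>B\<^esub> b, \<one>\<^bsub>\<Gamma>\<^esub>) \<otimes>\<^bsub>W\<^esub> \<phi> (b, \<one>\<^bsub>\<Gamma>\<^esub>) = \<one>\<^bsub>W\<^esub>"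
    unfolding \<phi>_mult[OF base_W[OF i] base_W[OF bg(1)], symmetric] base_mult[OF i bg(1)] B.l_inv[OF bg(1)]
    using \<phi>.hom_one unfolding W_one .
  then have "\<phi> (inv\<^bsub>B\<^esub> b, \<one>\<^bsub>\<Gamma>\<^esub>) \<otimes>\<^bsub>W\<^esub> (w, \<one>\<^bsub>\<Gamma>\<^esub>) = \<phi> (\<one>\<^bsub>B\<^esub>, g)"
    unfolding bg(3) using WG.m_assoc[OF \<phi>_closed[OF base_W[OF i]] \<phi>_closed[OF base_W[OF bg(1)]] \<phi>_closed[OF top_W[OF bg(2)]]]
      WG.l_one[OF \<phi>_closed[OF top_W[OF bg(2)]]] by (simp only:)
  then show ?thesis using bg i by (intro bexI[of _ g] bexI[of _ "inv\<^bsub>B\<^esub> b"]) simp_all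
qed

end

section \<open>Surjective endomorphisms that do not preserve the base\<close>

locale off_base = wreath_epi +
  fixes b\<^sub>0 m
  assumes b\<^sub>0: "b\<^sub>0 \<in> carrier B" and m: "base_snd b\<^sub>0 = m" "m \<noteq> \<one>\<^bsub>\<Gamma>\<^esub>"
begin

lemma m_closed: "m \<in> carrier \<Gamma>"
  using base_snd_closed[OF b\<^sub>0] m by simp

lemma base_snd_one: "base_snd \<one>\<^bsub>B\<^esub> = \<one>\<^bsub>\<Gamma>\<^esub>"
proof -
  interpret \<phi>: group_hom W W \<phi> using epi by (simp add: group_hom_def group_hom_axioms_def epi_def W_group)
  show ?thesis using \<phi>.hom_one unfolding W_one base_snd_def by (simp only: snd_conv)
qed

lemma nontrivial: "\<exists>a\<in>carrier A. a \<noteq> \<one>\<^bsub>A\<^esub>"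
proof (rule ccontr)
  assume "\<not> ?thesis"
  then have "a = \<one>\<^bsub>A\<^esub>" if "a \<in> carrier A" for a using that by blast
  then have "b\<^sub>0 = \<one>\<^bsub>B\<^esub>"
    by (intro B_eqI[OF b\<^sub>0 monoid.one_closed[OF group.is_monoid[OF B_group]]])
      (simp only: B_closed[OF b\<^sub>0] B_one)
  then show False using m base_snd_one by simp
qed

text \<open>
  Let \<open>d\<close> be the commutator of \<open>\<phi> (b\<^sub>0, 1)\<close> with a single lamp at the identity in state \<open>a\<close>: it is \<open>a\<close> at
  the identity, the inverse of \<open>a\<close> at \<open>m\<close>, and trivial elsewhere. It lies in the image of \<open>B\<close> and is thus
  invariant under \<open>base_snd b\<close>, which leaves only one possibility for this element and for \<open>a\<close>.
\<close>

lemma involution_dichotomy: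
  assumes a: "a \<in> carrier A" "a \<noteq> \<one>\<^bsub>A\<^esub>" and b: "b \<in> carrier B" "base_snd b \<noteq> \<one>\<^bsub>\<Gamma>\<^esub>"
  shows "base_snd b = m \<and> a \<otimes>\<^bsub>A\<^esub> a = \<one>\<^bsub>A\<^esub>"
proof -
  let ?l = "lamp \<one>\<^bsub>\<Gamma>\<^esub> a" and ?n = "base_snd b"
  have n: "?n \<in> carrier \<Gamma>" by (rule base_snd_closed[OF b(1)])
  obtain d where d: "d \<in> carrier B" "base_snd d = \<one>\<^bsub>\<Gamma>\<^esub>" "base_fst d \<otimes>\<^bsub>B\<^esub> shift \<Gamma> m ?l = ?l"
    using image_commutator[OF b\<^sub>0 lamp_B[OF a(1)]] m by blast
  note f = B_closed[OF base_fst_B[OF d(1)]]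
  have dx: "base_fst d x \<otimes>\<^bsub>A\<^esub> ?l (inv\<^bsub>\<Gamma>\<^esub> m \<otimes>\<^bsub>\<Gamma>\<^esub> x) = ?l x" if x: "x \<in> carrier \<Gamma>" for x
    using fun_cong[OF d(3), of x] unfolding B_mult[OF x] shift_apply[OF x] .
  have "inv\<^bsub>\<Gamma>\<^esub> m \<noteq> \<one>\<^bsub>\<Gamma>\<^esub>" using m(2) m_closed by (metis \<Gamma>.inv_inv \<Gamma>.inv_one)
  then have d1: "base_fst d \<one>\<^bsub>\<Gamma>\<^esub> = a"
    using dx[OF \<Gamma>.one_closed] m_closed f[OF \<Gamma>.one_closed] by (simp add: lamp_apply)
  have "base_fst d ?n = base_fst d (inv\<^bsub>\<Gamma>\<^esub> ?n \<otimes>\<^bsub>\<Gamma>\<^esub> ?n)"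
    using fun_cong[OF image_fixed[OF d(1,2) b(1)], of ?n] unfolding shift_apply[OF n] by (rule sym)
  then have dn: "base_fst d ?n = a" using n d1 by simp
  have e: "a \<otimes>\<^bsub>A\<^esub> ?l (inv\<^bsub>\<Gamma>\<^esub> m \<otimes>\<^bsub>\<Gamma>\<^esub> ?n) = \<one>\<^bsub>A\<^esub>"
    using dx[OF n] b(2) n unfolding dn by (simp add: lamp_apply)
  have mn: "inv\<^bsub>\<Gamma>\<^esub> m \<otimes>\<^bsub>\<Gamma>\<^esub> ?n = \<one>\<^bsub>\<Gamma>\<^esub>"
    using e a n m_closed by (simp add: lamp_apply split: if_splits)
  then have "?n = m" using n m_closed by (metis \<Gamma>.inv_closed \<Gamma>.inv_equality \<Gamma>.inv_inv)
  moreover have "a \<otimes>\<^bsub>A\<^esub> a = \<one>\<^bsub>A\<^esub>" using e unfolding mn by (simp add: lamp_apply)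
  ultimately show ?thesis by blast
qed

lemma base_snd_cases: "b \<in> carrier B \<Longrightarrow> base_snd b = \<one>\<^bsub>\<Gamma>\<^esub> \<or> base_snd b = m"
  using nontrivial involution_dichotomy by blast

lemma A_square: "a \<in> carrier A \<Longrightarrow> a \<otimes>\<^bsub>A\<^esub> a = \<one>\<^bsub>A\<^esub>"
proof (cases "a = \<one>\<^bsub>A\<^esub>")
  case False
  have "base_snd b\<^sub>0 \<noteq> \<one>\<^bsub>\<Gamma>\<^esub>" using m by simp
  then show "a \<in> carrier A \<Longrightarrow> ?thesis" using involution_dichotomy[OF _ False b\<^sub>0] by blast
qed simp

lemma m_square: "m \<otimes>\<^bsub>\<Gamma>\<^esub> m = \<one>\<^bsub>\<Gamma>\<^esub>"
proof -
  have "base_snd (b\<^sub>0 \<otimes>\<^bsub>B\<^esub> b\<^sub>0) = m \<otimes>\<^bsub>\<Gamma>\<^esub> m" using base_snd_mult[OF b\<^sub>0 b\<^sub>0] m by simp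
  moreover have "b\<^sub>0 \<otimes>\<^bsub>B\<^esub> b\<^sub>0 \<in> carrier B" by (rule monoid.m_closed[OF group.is_monoid[OF B_group] b\<^sub>0 b\<^sub>0])
  ultimately have "m \<otimes>\<^bsub>\<Gamma>\<^esub> m = \<one>\<^bsub>\<Gamma>\<^esub> \<or> m \<otimes>\<^bsub>\<Gamma>\<^esub> m = m" using base_snd_cases by metis
  then show ?thesis using m(2) m_closed \<Gamma>.r_cancel_one[OF m_closed m_closed] by blast
qed

lemma m_central:
  assumes g: "g \<in> carrier \<Gamma>" shows "m \<otimes>\<^bsub>\<Gamma>\<^esub> g = g \<otimes>\<^bsub>\<Gamma>\<^esub> m"
proof -
  obtain b where b: "b \<in> carrier B" "\<phi> (b, \<one>\<^bsub>\<Gamma>\<^esub>) \<otimes>\<^bsub>W\<^esub> (\<one>\<^bsub>B\<^esub>, g) = (\<one>\<^bsub>B\<^esub>, g) \<otimes>\<^bsub>W\<^esub> \<phi> (b\<^sub>0, \<one>\<^bsub>\<Gamma>\<^esub>)"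
    using image_normal[OF b\<^sub>0 top_W[OF g]] by blast
  have e: "base_snd b \<otimes>\<^bsub>\<Gamma>\<^esub> g = g \<otimes>\<^bsub>\<Gamma>\<^esub> m"
    using arg_cong[OF b(2), of snd] unfolding snd_mult base_snd_def[symmetric] m(1) by (simp only: snd_conv)
  have "base_snd b \<noteq> \<one>\<^bsub>\<Gamma>\<^esub>"
  proof
    assume "base_snd b = \<one>\<^bsub>\<Gamma>\<^esub>"
    then have "g \<otimes>\<^bsub>\<Gamma>\<^esub> m = g" using e g by simp
    then show False using m(2) \<Gamma>.l_cancel_one[OF g m_closed] by blast
  qed
  then show ?thesis using base_snd_cases[OF b(1)] e by simp
qed

lemma m_invariant:
  assumes b: "b \<in> carrier B" "base_snd b = \<one>\<^bsub>\<Gamma>\<^esub>" and x: "x \<in> carrier \<Gamma>"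
  shows "base_fst b (m \<otimes>\<^bsub>\<Gamma>\<^esub> x) = base_fst b x"
proof -
  have mx: "m \<otimes>\<^bsub>\<Gamma>\<^esub> x \<in> carrier \<Gamma>" using m_closed x by simp
  have "base_fst b (inv\<^bsub>\<Gamma>\<^esub> m \<otimes>\<^bsub>\<Gamma>\<^esub> (m \<otimes>\<^bsub>\<Gamma>\<^esub> x)) = base_fst b (m \<otimes>\<^bsub>\<Gamma>\<^esub> x)"
    using fun_cong[OF image_fixed[OF b b\<^sub>0], of "m \<otimes>\<^bsub>\<Gamma>\<^esub> x"] unfolding shift_apply[OF mx] m(1) .
  then show ?thesis using m_closed x by (simp add: \<Gamma>.m_assoc[symmetric])
qed

lemma m_moves: "x \<in> carrier \<Gamma> \<Longrightarrow> m \<otimes>\<^bsub>\<Gamma>\<^esub> x \<noteq> x"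
  using \<Gamma>.r_cancel_one[OF _ m_closed] m(2) by blast

text \<open>
  The quotient of two configurations in the same coset of the image of \<open>B\<close> is invariant under \<open>m\<close>. If
  both are trivial at \<open>m x\<close>, then they agree at \<open>x\<close>.
\<close>

lemma image_coset_eq:
  assumes b: "b \<in> carrier B" and c: "c \<in> carrier B" and b': "b' \<in> carrier B" and c': "c' \<in> carrier B"
    and e: "\<phi> (b', \<one>\<^bsub>\<Gamma>\<^esub>) \<otimes>\<^bsub>W\<^esub> (b, \<one>\<^bsub>\<Gamma>\<^esub>) = \<phi> (c', \<one>\<^bsub>\<Gamma>\<^esub>) \<otimes>\<^bsub>W\<^esub> (c, \<one>\<^bsub>\<Gamma>\<^esub>)"
    and x: "x \<in> carrier \<Gamma>" "b (m \<otimes>\<^bsub>\<Gamma>\<^esub> x) = \<one>\<^bsub>A\<^esub>" "c (m \<otimes>\<^bsub>\<Gamma>\<^esub> x) = \<one>\<^bsub>A\<^esub>"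
  shows "b x = c x"
proof -
  interpret B: comm_group B by (rule B_comm_group)
  interpret WG: group W by (rule W_group)
  define k where "k = inv\<^bsub>B\<^esub> c' \<otimes>\<^bsub>B\<^esub> b'"
  note ic = B.inv_closed[OF c']
  have k: "k \<in> carrier B" unfolding k_def by (rule B.m_closed[OF ic b'])
  have "c' \<otimes>\<^bsub>B\<^esub> k = b'" unfolding k_def B.m_assoc[OF c' ic b', symmetric] B.r_inv[OF c'] by (rule B.l_one[OF b'])
  then have "\<phi> (c', \<one>\<^bsub>\<Gamma>\<^esub>) \<otimes>\<^bsub>W\<^esub> \<phi> (k, \<one>\<^bsub>\<Gamma>\<^esub>) = \<phi> (b', \<one>\<^bsub>\<Gamma>\<^esub>)"
    unfolding \<phi>_mult[OF base_W[OF c'] base_W[OF k], symmetric] base_mult[OF c' k] by (rule arg_cong)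
  then have "\<phi> (c', \<one>\<^bsub>\<Gamma>\<^esub>) \<otimes>\<^bsub>W\<^esub> (\<phi> (k, \<one>\<^bsub>\<Gamma>\<^esub>) \<otimes>\<^bsub>W\<^esub> (b, \<one>\<^bsub>\<Gamma>\<^esub>)) = \<phi> (c', \<one>\<^bsub>\<Gamma>\<^esub>) \<otimes>\<^bsub>W\<^esub> (c, \<one>\<^bsub>\<Gamma>\<^esub>)"
    using e WG.m_assoc[OF \<phi>_closed[OF base_W[OF c']] \<phi>_closed[OF base_W[OF k]] base_W[OF b]] by (simp only:)
  from WG.l_cancel[OF this WG.m_closed[OF \<phi>_closed[OF base_W[OF k]] base_W[OF b]] base_W[OF c] \<phi>_closed[OF base_W[OF c']]]
  have kb: "base_fst k \<otimes>\<^bsub>B\<^esub> shift \<Gamma> (base_snd k) b = c" "base_snd k \<otimes>\<^bsub>\<Gamma>\<^esub> \<one>\<^bsub>\<Gamma>\<^esub> = \<one>\<^bsub>\<Gamma>\<^esub>"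
    unfolding \<phi>_base W_mult by (simp_all only: prod.inject)
  have k1: "base_snd k = \<one>\<^bsub>\<Gamma>\<^esub>" using kb(2) unfolding \<Gamma>.r_one[OF base_snd_closed[OF k]] .
  have ky: "base_fst k y \<otimes>\<^bsub>A\<^esub> b y = c y" if "y \<in> carrier \<Gamma>" for y
    using fun_cong[OF kb(1), of y] unfolding k1 shift_unit[OF b] B_mult[OF that] .
  have mx: "m \<otimes>\<^bsub>\<Gamma>\<^esub> x \<in> carrier \<Gamma>" using m_closed x by simp
  have "base_fst k x = \<one>\<^bsub>A\<^esub>"
    using ky[OF mx] B_closed[OF base_fst_B[OF k] x(1)] unfolding m_invariant[OF k k1 x(1)] x(2,3) by simp
  then show ?thesis using ky[OF x(1)] B_closed[OF b x(1)] by simp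
qed

text \<open>
  If \<open>m\<close> were in the range of \<open>\<psi>\<close>, then \<open>\<psi>\<close> would be onto and hence injective. But the elements of \<open>\<Gamma>\<close>
  that \<open>\<phi>\<close> sends to the cosets of the trivial configuration, of the lamp at the identity and of the lamp
  at \<open>x\<close> are distinct, and \<open>\<psi>\<close> sends all three to \<open>1\<close> or \<open>m\<close>.
\<close>

lemma not_in_range:
  assumes x: "x \<in> carrier \<Gamma>" "x \<noteq> \<one>\<^bsub>\<Gamma>\<^esub>" "x \<noteq> m"
  shows "m \<notin> \<psi> ` carrier \<Gamma>"
proof
  assume mr: "m \<in> \<psi> ` carrier \<Gamma>"
  interpret B: comm_group B by (rule B_comm_group)
  interpret \<psi>: group_hom \<Gamma> \<Gamma> \<psi> using \<psi>_hom by (simp add: group_hom_def group_hom_axioms_def)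
  interpret im: subgroup "\<psi> ` carrier \<Gamma>" \<Gamma> by (rule \<psi>.img_is_subgroup)
  obtain a where a: "a \<in> carrier A" "a \<noteq> \<one>\<^bsub>A\<^esub>" using nontrivial by blast
  have "carrier \<Gamma> \<subseteq> \<psi> ` carrier \<Gamma>"
  proof
    fix d assume d: "d \<in> carrier \<Gamma>"
    obtain b g where bg: "b \<in> carrier B" "g \<in> carrier \<Gamma>" "(\<one>\<^bsub>B\<^esub>, d) = \<phi> (b, \<one>\<^bsub>\<Gamma>\<^esub>) \<otimes>\<^bsub>W\<^esub> \<phi> (\<one>\<^bsub>B\<^esub>, g)"
      using \<phi>_split[OF top_W[OF d]] by blast
    have "d = base_snd b \<otimes>\<^bsub>\<Gamma>\<^esub> \<psi> g" using arg_cong[OF bg(3), of snd] unfolding snd_mult base_snd_def[symmetric] \<psi>_def[symmetric] by (simp only: snd_conv)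
    moreover have "base_snd b \<in> \<psi> ` carrier \<Gamma>" using base_snd_cases[OF bg(1)] mr im.one_closed by auto
    ultimately show "d \<in> \<psi> ` carrier \<Gamma>" using bg(2) by (simp add: im.m_closed)
  qed
  then have inj: "inj_on \<psi> (carrier \<Gamma>)" by (rule hopfian_inj[OF \<psi>_hom])
  let ?b1 = "lamp \<one>\<^bsub>\<Gamma>\<^esub> a" and ?bx = "lamp x a"
  have Bs: "\<one>\<^bsub>B\<^esub> \<in> carrier B" "?b1 \<in> carrier B" "?bx \<in> carrier B" using lamp_B[OF a(1)] B.one_closed by blast+
  have "\<forall>w\<in>carrier B. \<exists>g. g \<in> carrier \<Gamma> \<and> (\<exists>b\<in>carrier B. \<phi> (\<one>\<^bsub>B\<^esub>, g) = \<phi> (b, \<one>\<^bsub>\<Gamma>\<^esub>) \<otimes>\<^bsub>W\<^esub> (w, \<one>\<^bsub>\<Gamma>\<^esub>))"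
    using image_of_top_meets_cosets by blast
  then obtain \<rho> where \<rho>: "\<And>w. w \<in> carrier B \<Longrightarrow> \<rho> w \<in> carrier \<Gamma>"
    "\<And>w. w \<in> carrier B \<Longrightarrow> \<exists>b\<in>carrier B. \<phi> (\<one>\<^bsub>B\<^esub>, \<rho> w) = \<phi> (b, \<one>\<^bsub>\<Gamma>\<^esub>) \<otimes>\<^bsub>W\<^esub> (w, \<one>\<^bsub>\<Gamma>\<^esub>)"
    by metis
  have \<psi>\<rho>: "\<psi> (\<rho> w) \<in> {\<one>\<^bsub>\<Gamma>\<^esub>, m}" if w: "w \<in> carrier B" for w
  proof -
    obtain b where b: "b \<in> carrier B" "\<phi> (\<one>\<^bsub>B\<^esub>, \<rho> w) = \<phi> (b, \<one>\<^bsub>\<Gamma>\<^esub>) \<otimes>\<^bsub>W\<^esub> (w, \<one>\<^bsub>\<Gamma>\<^esub>)" using \<rho>(2)[OF w] by blast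
    have "\<psi> (\<rho> w) = base_snd b \<otimes>\<^bsub>\<Gamma>\<^esub> \<one>\<^bsub>\<Gamma>\<^esub>" unfolding \<psi>_def b(2) snd_mult base_snd_def by (simp only: snd_conv)
    then show ?thesis using base_snd_cases[OF b(1)] m_closed by auto
  qed
  have ne: "\<psi> (\<rho> v) \<noteq> \<psi> (\<rho> w)"
    if v: "v \<in> carrier B" and w: "w \<in> carrier B" and y: "y \<in> carrier \<Gamma>"
      "v (m \<otimes>\<^bsub>\<Gamma>\<^esub> y) = \<one>\<^bsub>A\<^esub>" "w (m \<otimes>\<^bsub>\<Gamma>\<^esub> y) = \<one>\<^bsub>A\<^esub>" "v y \<noteq> w y" for v w y
  proof
    assume "\<psi> (\<rho> v) = \<psi> (\<rho> w)"
    then have r: "\<rho> v = \<rho> w" using inj_onD[OF inj] \<rho>(1) v w by blast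
    obtain b where b: "b \<in> carrier B" "\<phi> (\<one>\<^bsub>B\<^esub>, \<rho> v) = \<phi> (b, \<one>\<^bsub>\<Gamma>\<^esub>) \<otimes>\<^bsub>W\<^esub> (v, \<one>\<^bsub>\<Gamma>\<^esub>)" using \<rho>(2)[OF v] by blast
    obtain c where c: "c \<in> carrier B" "\<phi> (\<one>\<^bsub>B\<^esub>, \<rho> w) = \<phi> (c, \<one>\<^bsub>\<Gamma>\<^esub>) \<otimes>\<^bsub>W\<^esub> (w, \<one>\<^bsub>\<Gamma>\<^esub>)" using \<rho>(2)[OF w] by blast
    have "v y = w y"
      by (rule image_coset_eq[OF v w b(1) c(1) _ y(1-3)]) (use b(2) c(2) r in \<open>simp only:\<close>)
    then show False using y(4) by blast
  qed
  have v1: "?b1 \<one>\<^bsub>\<Gamma>\<^esub> = a" "?b1 (m \<otimes>\<^bsub>\<Gamma>\<^esub> \<one>\<^bsub>\<Gamma>\<^esub>) = \<one>\<^bsub>A\<^esub>" "?bx \<one>\<^bsub>\<Gamma>\<^esub> = \<one>\<^bsub>A\<^esub>" "?bx (m \<otimes>\<^bsub>\<Gamma>\<^esub> \<one>\<^bsub>\<Gamma>\<^esub>) = \<one>\<^bsub>A\<^esub>"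
    using m(2) m_closed x by (auto simp: lamp_apply)
  have vx: "?bx x = a" "?bx (m \<otimes>\<^bsub>\<Gamma>\<^esub> x) = \<one>\<^bsub>A\<^esub>" using m_moves[OF x(1)] m_closed x(1) by (auto simp: lamp_apply)
  have o: "\<one>\<^bsub>B\<^esub> \<one>\<^bsub>\<Gamma>\<^esub> = \<one>\<^bsub>A\<^esub>" "\<one>\<^bsub>B\<^esub> (m \<otimes>\<^bsub>\<Gamma>\<^esub> \<one>\<^bsub>\<Gamma>\<^esub>) = \<one>\<^bsub>A\<^esub>" "\<one>\<^bsub>B\<^esub> x = \<one>\<^bsub>A\<^esub>" "\<one>\<^bsub>B\<^esub> (m \<otimes>\<^bsub>\<Gamma>\<^esub> x) = \<one>\<^bsub>A\<^esub>"
    using m_closed x(1) by (simp_all add: B_one)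
  \<comment> \<open>Three distinct elements of \<open>{1, m}\<close>.\<close>
  have three: False if "u \<noteq> v" "u \<noteq> w" "v \<noteq> w" "u \<in> {y, z}" "v \<in> {y, z}" "w \<in> {y, z}" for u v w y z :: 'b
    using that by auto
  have n1: "\<psi> (\<rho> \<one>\<^bsub>B\<^esub>) \<noteq> \<psi> (\<rho> ?b1)" by (rule ne[OF Bs(1,2) \<Gamma>.one_closed o(2) v1(2)]) (use o(1) v1(1) a(2) in metis)
  have n2: "\<psi> (\<rho> \<one>\<^bsub>B\<^esub>) \<noteq> \<psi> (\<rho> ?bx)" by (rule ne[OF Bs(1,3) x(1) o(4) vx(2)]) (use o(3) vx(1) a(2) in metis)
  have n3: "\<psi> (\<rho> ?b1) \<noteq> \<psi> (\<rho> ?bx)" by (rule ne[OF Bs(2,3) \<Gamma>.one_closed v1(2) v1(4)]) (use v1 a(2) in metis)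
  show False by (rule three[OF n1 n2 n3 \<psi>\<rho>[OF Bs(1)] \<psi>\<rho>[OF Bs(2)] \<psi>\<rho>[OF Bs(3)]])
qed

text \<open>
  Now \<open>\<psi>\<close> misses \<open>m\<close>, and is corrected by a sign. For a subgroup \<open>S\<close> of index two without \<open>a\<close>, the
  parity of the number of lamps whose state is not in \<open>S\<close> is a shift-invariant homomorphism on \<open>B\<close>; it
  is even for configurations invariant under the fixed-point-free involution \<open>m\<close>. Multiplying \<open>\<psi> g\<close> by
  \<open>m\<close> when the parity for the base component of \<open>\<phi> (1, g)\<close> is odd gives a homomorphism \<open>\<chi>\<close> with \<open>m\<close> in
  its range. So \<open>\<chi>\<close> is onto, and injective since \<open>\<Gamma>\<close> is Hopfian. The configuration with two lamps, at
  the identity and at \<open>x\<close>, is even, so the corresponding element of \<open>\<Gamma>\<close> is in the kernel of \<open>\<chi>\<close>; then the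
  configuration lies in the image of \<open>B\<close> without being invariant under \<open>m\<close>.
\<close>

lemma no_large_top:
  assumes x: "x \<in> carrier \<Gamma>" "x \<noteq> \<one>\<^bsub>\<Gamma>\<^esub>" "x \<noteq> m"
  shows False
proof -
  have mr: "m \<notin> \<psi> ` carrier \<Gamma>" by (rule not_in_range[OF x])
  interpret B: comm_group B by (rule B_comm_group)
  interpret \<psi>: group_hom \<Gamma> \<Gamma> \<psi> using \<psi>_hom by (simp add: group_hom_def group_hom_axioms_def)
  obtain a where a: "a \<in> carrier A" "a \<noteq> \<one>\<^bsub>A\<^esub>" using nontrivial by blast
  obtain S where S: "subgroup S A" "a \<notin> S"
    and max: "\<And>y. y \<in> carrier A \<Longrightarrow> y \<notin> S \<Longrightarrow> \<exists>s\<in>S. \<exists>k::int. a = s \<otimes>\<^bsub>A\<^esub> y [^]\<^bsub>A\<^esub> k"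
    using A.max_subgroup_avoiding[OF a] by metis
  interpret S: subgroup S A by (rule S(1))
  have sq2: "y [^]\<^bsub>A\<^esub> (2 * k :: int) = \<one>\<^bsub>A\<^esub>" if y: "y \<in> carrier A" for y k
  proof -
    have "y [^]\<^bsub>A\<^esub> (2 :: int) = \<one>\<^bsub>A\<^esub>" using A.int_pow_mult[OF y, of 1 1] A_square[OF y] y by simp
    then show ?thesis using A.int_pow_pow[OF y, of 2 k] by simp
  qed
  \<comment> \<open>The exponent in the maximality property of \<open>S\<close> is odd, and may be taken to be 1 as squares vanish.\<close>
  have coset: "\<exists>s\<in>S. a = s \<otimes>\<^bsub>A\<^esub> y" if y: "y \<in> carrier A" "y \<notin> S" for y
  proof -
    obtain s and k :: int where s: "s \<in> S" "a = s \<otimes>\<^bsub>A\<^esub> y [^]\<^bsub>A\<^esub> k" using max[OF y] by blast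
    have "odd k"
    proof
      assume "even k"
      then have "a = s" using s sq2[OF y(1)] by auto
      then show False using s S(2) by simp
    qed
    then obtain j where "k = 2 * j + 1" by (elim oddE)
    then have "y [^]\<^bsub>A\<^esub> k = y" using A.int_pow_mult[OF y(1), of "2 * j" 1] sq2[OF y(1), of j] y(1) by simp
    then show ?thesis using s by auto
  qed
  \<comment> \<open>So \<open>S\<close> has index two.\<close>
  have S_iff: "y \<otimes>\<^bsub>A\<^esub> z \<in> S \<longleftrightarrow> (y \<in> S \<longleftrightarrow> z \<in> S)" if y: "y \<in> carrier A" and z: "z \<in> carrier A" for y z
  proof -
    have l: "z \<in> S" if "y \<in> S" "y \<otimes>\<^bsub>A\<^esub> z \<in> S"
    proof -
      have "inv\<^bsub>A\<^esub> y \<otimes>\<^bsub>A\<^esub> (y \<otimes>\<^bsub>A\<^esub> z) \<in> S" using that by simp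
      then show ?thesis using y z by (simp add: A.m_assoc[symmetric])
    qed
    have r: "y \<in> S" if "z \<in> S" "y \<otimes>\<^bsub>A\<^esub> z \<in> S"
    proof -
      have "(y \<otimes>\<^bsub>A\<^esub> z) \<otimes>\<^bsub>A\<^esub> inv\<^bsub>A\<^esub> z \<in> S" using that by simp
      then show ?thesis using y z by (simp add: A.m_assoc)
    qed
    have n: "y \<otimes>\<^bsub>A\<^esub> z \<in> S" if yz: "y \<notin> S" "z \<notin> S"
    proof -
      obtain s t where st: "s \<in> S" "t \<in> S" "a = s \<otimes>\<^bsub>A\<^esub> y" "a = t \<otimes>\<^bsub>A\<^esub> z" using coset y z yz by metis
      then have c: "s \<in> carrier A" "t \<in> carrier A" by simp_all
      have "(s \<otimes>\<^bsub>A\<^esub> t) \<otimes>\<^bsub>A\<^esub> (y \<otimes>\<^bsub>A\<^esub> z) = (s \<otimes>\<^bsub>A\<^esub> y) \<otimes>\<^bsub>A\<^esub> (t \<otimes>\<^bsub>A\<^esub> z)" using c y z by (simp add: A.m_ac)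
      also have "\<dots> = \<one>\<^bsub>A\<^esub>" using A_square[OF a(1)] unfolding st(3)[symmetric] st(4)[symmetric] .
      finally have e: "(s \<otimes>\<^bsub>A\<^esub> t) \<otimes>\<^bsub>A\<^esub> (y \<otimes>\<^bsub>A\<^esub> z) = \<one>\<^bsub>A\<^esub>" .
      have "y \<otimes>\<^bsub>A\<^esub> z = inv\<^bsub>A\<^esub> (s \<otimes>\<^bsub>A\<^esub> t)" 
        using A.inv_equality[of "y \<otimes>\<^bsub>A\<^esub> z" "s \<otimes>\<^bsub>A\<^esub> t"] e c y z A.m_comm[of "s \<otimes>\<^bsub>A\<^esub> t" "y \<otimes>\<^bsub>A\<^esub> z"] by simp
      then show ?thesis using st by simp
    qed
    show ?thesis using l r n S.m_closed by blast
  qed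
  define P where "P f = {y \<in> carrier \<Gamma>. f y \<notin> S}" for f :: "'b \<Rightarrow> 'a"
  have Pfin: "finite (P f)" if "f \<in> carrier B" for f
  proof (rule finite_subset)
    show "P f \<subseteq> {y \<in> carrier \<Gamma>. f y \<noteq> \<one>\<^bsub>A\<^esub>}" unfolding P_def using S.one_closed by auto
    show "finite {y \<in> carrier \<Gamma>. f y \<noteq> \<one>\<^bsub>A\<^esub>}" using that unfolding B_carrier by blast
  qed
  define ev where "ev f \<longleftrightarrow> even (card (P f))" for f
  have ev_mult: "ev (f \<otimes>\<^bsub>B\<^esub> f') \<longleftrightarrow> (ev f \<longleftrightarrow> ev f')" if f: "f \<in> carrier B" and f': "f' \<in> carrier B" for f f'
  proof -
    have "P (f \<otimes>\<^bsub>B\<^esub> f') = P f - P f' \<union> (P f' - P f)"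
    proof (rule Set.set_eqI)
      fix y
      show "y \<in> P (f \<otimes>\<^bsub>B\<^esub> f') \<longleftrightarrow> y \<in> P f - P f' \<union> (P f' - P f)"
      proof (cases "y \<in> carrier \<Gamma>")
        case True
        have "(f \<otimes>\<^bsub>B\<^esub> f') y \<in> S \<longleftrightarrow> (f y \<in> S \<longleftrightarrow> f' y \<in> S)"
          unfolding B_mult[OF True] by (rule S_iff[OF B_closed[OF f True] B_closed[OF f' True]])
        then show ?thesis unfolding P_def using True by blast
      qed (simp add: P_def)
    qed
    then show ?thesis unfolding ev_def using even_card_sym_diff[OF Pfin[OF f] Pfin[OF f']] by (simp only:)
  qed
  have ev_shift: "ev (shift \<Gamma> g f) \<longleftrightarrow> ev f" if g: "g \<in> carrier \<Gamma>" for g f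
  proof -
    have "P (shift \<Gamma> g f) = (\<lambda>y. g \<otimes>\<^bsub>\<Gamma>\<^esub> y) ` P f"
    proof
      show "(\<lambda>y. g \<otimes>\<^bsub>\<Gamma>\<^esub> y) ` P f \<subseteq> P (shift \<Gamma> g f)"
        using g by (auto simp: P_def shift_apply \<Gamma>.m_assoc[symmetric])
      show "P (shift \<Gamma> g f) \<subseteq> (\<lambda>y. g \<otimes>\<^bsub>\<Gamma>\<^esub> y) ` P f"
      proof
        fix y assume "y \<in> P (shift \<Gamma> g f)"
        then show "y \<in> (\<lambda>y. g \<otimes>\<^bsub>\<Gamma>\<^esub> y) ` P f"
          using g by (intro image_eqI[of _ _ "inv\<^bsub>\<Gamma>\<^esub> g \<otimes>\<^bsub>\<Gamma>\<^esub> y"]) (auto simp: P_def shift_apply \<Gamma>.m_assoc[symmetric])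
      qed
    qed
    moreover have "inj_on (\<lambda>y. g \<otimes>\<^bsub>\<Gamma>\<^esub> y) (P f)" using g by (intro inj_onI) (auto simp: P_def)
    ultimately show ?thesis unfolding ev_def by (simp add: card_image)
  qed
  have ev_image: "ev (base_fst d)" if d: "d \<in> carrier B" "base_snd d = \<one>\<^bsub>\<Gamma>\<^esub>" for d
    unfolding ev_def
  proof (rule even_card_involution[OF Pfin[OF base_fst_B[OF d(1)]]])
    fix y assume y: "y \<in> P (base_fst d)"
    then have yc: "y \<in> carrier \<Gamma>" by (simp add: P_def)
    show "m \<otimes>\<^bsub>\<Gamma>\<^esub> y \<in> P (base_fst d) \<and> m \<otimes>\<^bsub>\<Gamma>\<^esub> y \<noteq> y \<and> m \<otimes>\<^bsub>\<Gamma>\<^esub> (m \<otimes>\<^bsub>\<Gamma>\<^esub> y) = y"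
      using y m_invariant[OF d yc] m_moves[OF yc] m_closed yc m_square by (simp add: P_def \<Gamma>.m_assoc[symmetric])
  qed
  have ev_lamp: "\<not> ev (lamp u a)" if u: "u \<in> carrier \<Gamma>" for u
  proof -
    have "P (lamp u a) = {u}" unfolding P_def using u S(2) S.one_closed by (auto simp: lamp_apply split: if_splits)
    then show ?thesis by (simp add: ev_def)
  qed
  define t where "t f = (if ev f then \<one>\<^bsub>\<Gamma>\<^esub> else m)" for f
  have tc: "t f \<in> carrier \<Gamma>" for f using m_closed by (simp add: t_def)
  have t_central: "t f \<otimes>\<^bsub>\<Gamma>\<^esub> g = g \<otimes>\<^bsub>\<Gamma>\<^esub> t f" if "g \<in> carrier \<Gamma>" for f g
    using m_central[OF that] that by (simp add: t_def)
  have t_mult: "t (f \<otimes>\<^bsub>B\<^esub> f') = t f \<otimes>\<^bsub>\<Gamma>\<^esub> t f'" if "f \<in> carrier B" "f' \<in> carrier B" for f f'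
    using m_closed m_square unfolding t_def ev_mult[OF that] by auto
  define h where "h g = fst (\<phi> (\<one>\<^bsub>B\<^esub>, g))" for g
  have hB: "h g \<in> carrier B" if "g \<in> carrier \<Gamma>" for g using \<phi>_closed[OF top_W[OF that]] unfolding h_def W_carrier by blast
  define \<chi> where "\<chi> g = \<psi> g \<otimes>\<^bsub>\<Gamma>\<^esub> t (h g)" for g
  have \<chi>_hom: "\<chi> \<in> hom \<Gamma> \<Gamma>"
  proof (rule homI)
    show "\<chi> g \<in> carrier \<Gamma>" if "g \<in> carrier \<Gamma>" for g unfolding \<chi>_def by (intro \<Gamma>.m_closed \<psi>.hom_closed tc that)
    show "\<chi> (g \<otimes>\<^bsub>\<Gamma>\<^esub> g') = \<chi> g \<otimes>\<^bsub>\<Gamma>\<^esub> \<chi> g'" if g: "g \<in> carrier \<Gamma>" and g': "g' \<in> carrier \<Gamma>" for g g'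
    proof -
      note s = shift_B[OF \<psi>.hom_closed[OF g] hB[OF g']]
      have "h (g \<otimes>\<^bsub>\<Gamma>\<^esub> g') = h g \<otimes>\<^bsub>B\<^esub> shift \<Gamma> (\<psi> g) (h g')"
        unfolding h_def \<psi>_def top_mult[OF g, symmetric] \<phi>_mult[OF top_W[OF g] top_W[OF g']] fst_mult ..
      then have th: "t (h (g \<otimes>\<^bsub>\<Gamma>\<^esub> g')) = t (h g) \<otimes>\<^bsub>\<Gamma>\<^esub> t (h g')"
        using t_mult[OF hB[OF g] s] ev_shift[OF \<psi>.hom_closed[OF g], of "h g'"] by (simp only: t_def)
      have "\<psi> g \<otimes>\<^bsub>\<Gamma>\<^esub> \<psi> g' \<otimes>\<^bsub>\<Gamma>\<^esub> (t (h g) \<otimes>\<^bsub>\<Gamma>\<^esub> t (h g')) = \<psi> g \<otimes>\<^bsub>\<Gamma>\<^esub> (\<psi> g' \<otimes>\<^bsub>\<Gamma>\<^esub> t (h g)) \<otimes>\<^bsub>\<Gamma>\<^esub> t (h g')"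
        using g g' tc by (simp add: \<Gamma>.m_assoc)
      also have "\<dots> = \<psi> g \<otimes>\<^bsub>\<Gamma>\<^esub> t (h g) \<otimes>\<^bsub>\<Gamma>\<^esub> (\<psi> g' \<otimes>\<^bsub>\<Gamma>\<^esub> t (h g'))"
        unfolding t_central[OF \<psi>.hom_closed[OF g'], of "h g", symmetric] using g g' tc by (simp add: \<Gamma>.m_assoc)
      finally show ?thesis unfolding \<chi>_def th \<psi>.hom_mult[OF g g'] .
    qed
  qed
  interpret \<chi>: group_hom \<Gamma> \<Gamma> \<chi> using \<chi>_hom by (simp add: group_hom_def group_hom_axioms_def)
  interpret im: subgroup "\<chi> ` carrier \<Gamma>" \<Gamma> by (rule \<chi>.img_is_subgroup)
  \<comment> \<open>Because \<open>\<psi>\<close> misses \<open>m\<close>, an element of \<open>\<Gamma>\<close> mapped to the coset of \<open>w\<close> is mapped to \<open>w\<close> times an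
    element of \<open>B\<close> invariant under \<open>m\<close>, so that the sign is that of \<open>w\<close>.\<close>
  have root: "\<exists>g\<in>carrier \<Gamma>. \<exists>d\<in>carrier B. base_snd d = \<one>\<^bsub>\<Gamma>\<^esub> \<and> \<phi> (\<one>\<^bsub>B\<^esub>, g) = \<phi> (d, \<one>\<^bsub>\<Gamma>\<^esub>) \<otimes>\<^bsub>W\<^esub> (w, \<one>\<^bsub>\<Gamma>\<^esub>) \<and> \<chi> g = t w"
    if w: "w \<in> carrier B" for w
  proof -
    obtain g d where gd: "g \<in> carrier \<Gamma>" "d \<in> carrier B" "\<phi> (\<one>\<^bsub>B\<^esub>, g) = \<phi> (d, \<one>\<^bsub>\<Gamma>\<^esub>) \<otimes>\<^bsub>W\<^esub> (w, \<one>\<^bsub>\<Gamma>\<^esub>)"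
      using image_of_top_meets_cosets[OF w] by blast
    have "\<psi> g = base_snd d \<otimes>\<^bsub>\<Gamma>\<^esub> \<one>\<^bsub>\<Gamma>\<^esub>" unfolding \<psi>_def gd(3) snd_mult base_snd_def by (simp only: snd_conv)
    then have p: "\<psi> g = base_snd d" using base_snd_closed[OF gd(2)] by simp
    then have d1: "base_snd d = \<one>\<^bsub>\<Gamma>\<^esub>" using base_snd_cases[OF gd(2)] mr gd(1) by (metis imageI)
    have "h g = base_fst d \<otimes>\<^bsub>B\<^esub> w"
      unfolding h_def gd(3) \<phi>_base W_mult d1 shift_unit[OF w] by (simp only: fst_conv)
    then have "t (h g) = t w" using ev_mult[OF base_fst_B[OF gd(2)] w] ev_image[OF gd(2) d1] by (simp add: t_def)
    then have "\<chi> g = t w" unfolding \<chi>_def p d1 using tc by simp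
    then show ?thesis using gd d1 by blast
  qed
  have m_im: "m \<in> \<chi> ` carrier \<Gamma>"
    using root[OF lamp_B[OF a(1), of "\<one>\<^bsub>\<Gamma>\<^esub>"]] ev_lamp[OF \<Gamma>.one_closed] unfolding t_def by auto
  have "carrier \<Gamma> \<subseteq> \<chi> ` carrier \<Gamma>"
  proof
    fix d assume d: "d \<in> carrier \<Gamma>"
    obtain b g where bg: "b \<in> carrier B" "g \<in> carrier \<Gamma>" "(\<one>\<^bsub>B\<^esub>, d) = \<phi> (b, \<one>\<^bsub>\<Gamma>\<^esub>) \<otimes>\<^bsub>W\<^esub> \<phi> (\<one>\<^bsub>B\<^esub>, g)"
      using \<phi>_split[OF top_W[OF d]] by blast
    have e: "d = base_snd b \<otimes>\<^bsub>\<Gamma>\<^esub> \<psi> g" using arg_cong[OF bg(3), of snd] unfolding snd_mult base_snd_def[symmetric] \<psi>_def[symmetric] by (simp only: snd_conv)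
    have t_im: "t f \<in> \<chi> ` carrier \<Gamma>" for f unfolding t_def using m_im im.one_closed by simp
    have "\<psi> g = \<chi> g \<otimes>\<^bsub>\<Gamma>\<^esub> inv\<^bsub>\<Gamma>\<^esub> t (h g)" unfolding \<chi>_def using bg(2) tc by (simp add: \<Gamma>.m_assoc)
    then have "\<psi> g \<in> \<chi> ` carrier \<Gamma>" using bg(2) t_im by simp
    moreover have "base_snd b \<in> \<chi> ` carrier \<Gamma>" using base_snd_cases[OF bg(1)] m_im im.one_closed by auto
    ultimately show "d \<in> \<chi> ` carrier \<Gamma>" unfolding e by (intro im.m_closed)
  qed
  then have inj: "inj_on \<chi> (carrier \<Gamma>)" by (rule hopfian_inj[OF \<chi>_hom])
  let ?w = "lamp \<one>\<^bsub>\<Gamma>\<^esub> a \<otimes>\<^bsub>B\<^esub> lamp x a"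
  have wB: "?w \<in> carrier B" by (intro B.m_closed lamp_B a(1))
  obtain g d where gd: "g \<in> carrier \<Gamma>" "d \<in> carrier B" "base_snd d = \<one>\<^bsub>\<Gamma>\<^esub>"
    "\<phi> (\<one>\<^bsub>B\<^esub>, g) = \<phi> (d, \<one>\<^bsub>\<Gamma>\<^esub>) \<otimes>\<^bsub>W\<^esub> (?w, \<one>\<^bsub>\<Gamma>\<^esub>)" "\<chi> g = t ?w"
    using root[OF wB] by blast
  have "ev ?w" using ev_mult[OF lamp_B[OF a(1)] lamp_B[OF a(1)]] ev_lamp[OF x(1)] ev_lamp[OF \<Gamma>.one_closed] by blast
  then have "\<chi> g = \<chi> \<one>\<^bsub>\<Gamma>\<^esub>" unfolding gd(5) t_def \<chi>.hom_one by simp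
  then have "g = \<one>\<^bsub>\<Gamma>\<^esub>" using inj_onD[OF inj] gd(1) by blast
  then have "\<phi> (d, \<one>\<^bsub>\<Gamma>\<^esub>) \<otimes>\<^bsub>W\<^esub> (?w, \<one>\<^bsub>\<Gamma>\<^esub>) = \<phi> (\<one>\<^bsub>B\<^esub>, \<one>\<^bsub>\<Gamma>\<^esub>) \<otimes>\<^bsub>W\<^esub> (\<one>\<^bsub>B\<^esub>, \<one>\<^bsub>\<Gamma>\<^esub>)"
    using gd(4) monoid.r_one[OF group.is_monoid[OF W_group] \<phi>_closed[OF base_W[OF B.one_closed]]] unfolding W_one by (simp only:)
  then have "?w \<one>\<^bsub>\<Gamma>\<^esub> = \<one>\<^bsub>B\<^esub> \<one>\<^bsub>\<Gamma>\<^esub>"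
    by (rule image_coset_eq[OF wB B.one_closed gd(2) B.one_closed _ \<Gamma>.one_closed])
      (use m m_closed x in \<open>auto simp: B_mult B_one lamp_apply\<close>)
  then show False using a x by (simp add: B_mult B_one lamp_apply)
qed

lemma W_finite_off_base: "finite (carrier W)"
proof (rule W_finite)
  show "finite (carrier A)" by (rule involutive_finite[OF fg A_square])
  have "carrier \<Gamma> \<subseteq> {\<one>\<^bsub>\<Gamma>\<^esub>, m}" using no_large_top by blast
  then show "finite (carrier \<Gamma>)" by (rule finite_subset) simp
qed

end

section \<open>From direct finiteness to Hopfian wreath products\<close>

theorem hopfian_wreath:
  fixes A :: "'a monoid" and \<Gamma> :: "'g monoid"
  assumes "comm_group A" and fg: "fin_gen_group A" and hop: "hopfian \<Gamma>"
    and stab: "\<And>p l. Factorial_Ring.prime (p :: int) \<Longrightarrow> l > 0 \<Longrightarrow> direct_finite_mod p (\<Gamma> \<times>\<times> heis l)"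
  shows "hopfian (wreath_product A \<Gamma>)"
proof -
  interpret lamps A \<Gamma> using assms by (intro lamps.intro) (auto simp: hopfian_def)
  have "inj_on \<phi> (carrier W)" if \<phi>: "\<phi> \<in> epi W W" for \<phi>
  proof -
    interpret wreath_epi A \<Gamma> \<phi> using fg hop \<phi> by (unfold_locales) simp_all
    show ?thesis
    proof (cases "\<forall>b\<in>carrier B. base_snd b = \<one>\<^bsub>\<Gamma>\<^esub>")
      case True
      then show ?thesis using stab unfolding base_snd_def by (intro injective_if_base_preserved) blast+
    next
      case False
      then obtain b where "b \<in> carrier B" "base_snd b \<noteq> \<one>\<^bsub>\<Gamma>\<^esub>" by blast
      then interpret off_base A \<Gamma> \<phi> b "base_snd b" by unfold_locales simp_all
      have "carrier W \<subseteq> \<phi> ` carrier W" using \<phi> by (simp add: epi_iff_subset)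
      then show ?thesis by (rule finite_surj_inj[OF W_finite_off_base])
    qed
  qed
  then show ?thesis using W_group unfolding hopfian_def by (auto simp: iso_def epi_def bij_betw_def)
qed

theorem all_wreath_hopfian_if_directly_finite:
  fixes A :: "'a monoid" and \<Gamma> :: "'b monoid"
  assumes inf: "infinite (UNIV :: 'c set)" "infinite (UNIV :: 'd set)"
    and df: "\<And>(\<Gamma> :: 'c monoid) (F :: 'd ring). group \<Gamma> \<Longrightarrow> field F \<Longrightarrow> directly_finite (group_ring F \<Gamma>)"
    and A: "comm_group A" "fin_gen_group A" and \<Gamma>: "fin_gen_group \<Gamma>" "hopfian \<Gamma>"
  shows "hopfian (wreath_product A \<Gamma>)"
proof (rule hopfian_wreath[OF A \<Gamma>(2)])
  fix p l :: int assume p: "Factorial_Ring.prime p" and l: "l > 0"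
  have gr: "group \<Gamma>" using \<Gamma>(2) by (simp add: hopfian_def)
  have "countable (carrier (\<Gamma> \<times>\<times> heis l))"
    using fin_gen_group_countable[OF \<Gamma>(1)] by (auto simp: DirProd_def)
  then have "direct_finite_mod (int (nat p)) (\<Gamma> \<times>\<times> heis l)"
    using p by (intro direct_finite_mod_from_fields[OF inf df] DirProd_group[OF gr heis_group[OF l]]) auto
  then show "direct_finite_mod p (\<Gamma> \<times>\<times> heis l)" using prime_gt_0_int[OF p] by simp
qed

theorem theorem1p3:
  assumes "infinite (UNIV :: 'a set)" and "infinite (UNIV :: 'b set)"
    and "infinite (UNIV :: 'c set)" and "infinite (UNIV :: 'd set)"
  shows "(\<forall>(A :: 'a monoid) (\<Gamma> :: 'b monoid).
            comm_group A \<longrightarrow> fin_gen_group A \<longrightarrow> fin_gen_group \<Gamma> \<longrightarrow> hopfian \<Gamma> \<longrightarrow>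
            hopfian (wreath_product A \<Gamma>))
     \<longleftrightarrow> (\<forall>(\<Gamma> :: 'c monoid) (F :: 'd ring).
            group \<Gamma> \<longrightarrow> field F \<longrightarrow> directly_finite (group_ring F \<Gamma>))"
proof
  assume hop: "\<forall>(A :: 'a monoid) (\<Gamma> :: 'b monoid).
    comm_group A \<longrightarrow> fin_gen_group A \<longrightarrow> fin_gen_group \<Gamma> \<longrightarrow> hopfian \<Gamma> \<longrightarrow> hopfian (wreath_product A \<Gamma>)"
  show "\<forall>(\<Gamma> :: 'c monoid) (F :: 'd ring). group \<Gamma> \<longrightarrow> field F \<longrightarrow> directly_finite (group_ring F \<Gamma>)"
    using hop by (intro allI impI directly_finite_if_all_wreath_hopfian[OF assms(1,2)]) blast+
next
  assume df: "\<forall>(\<Gamma> :: 'c monoid) (F :: 'd ring). group \<Gamma> \<longrightarrow> field F \<longrightarrow> directly_finite (group_ring F \<Gamma>)"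
  show "\<forall>(A :: 'a monoid) (\<Gamma> :: 'b monoid).
    comm_group A \<longrightarrow> fin_gen_group A \<longrightarrow> fin_gen_group \<Gamma> \<longrightarrow> hopfian \<Gamma> \<longrightarrow> hopfian (wreath_product A \<Gamma>)"
    using df by (intro allI impI all_wreath_hopfian_if_directly_finite[OF assms(3,4)]) blast+
qed

end
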